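(* Let $d\ge2$, $\vec a\in[1,\infty)^d$, $\vec p=(p_1,\dots,p_d)\in(0,\infty)^d$, $0<q<\infty$ and $\beta\in\mathbb R$. Let $\mathcal W_{\vec p}$ be a re-scaled quasi-normalized version in $\dot F^\beta_{\vec p,q}(\vec a)$ of the brushlet system $\mathcal W$ associated with $\vec a$. Then $\mathcal W_{\vec p}$ is democratic in $\dot F^\beta_{\vec p,q}(\vec a)$ if and only if $p_1=p_2=\cdots=p_d$.
   Context: **Notation.** $\mathbb{N}_0=\{0,1,2,\dots\}$. For $t>0$, $b,x\in\mathbb{R}^d$: $t^bx:=(t^{b_1}x_1,\dots,t^{b_d}x_d)$. $\nu:=a_1+\dots+a_d$. The anisotropic quasi-norm is $|0|_{\vec a}:=0$ and, for $x\ne0$, $|x|_{\vec a}:=t_0$ where $t_0>0$ is the unique number with Euclidean norm $|t_0^{-\vec a}x|=1$. Fourier transform: $\hat f(\xi)=(2\pi)^{-d/2}\int f(x)e^{-ix\cdot\xi}dx$. Mixed norm: $\|f\|_{\vec p}:=\Big(\int_{\mathbb R}\cdots\Big(\int_{\mathbb R}\Big(\int_{\mathbb R}|f|^{p_1}dx_1\Big)^{p_2/p_1}dx_2\Big)^{p_3/p_2}\cdots dx_d\Big)^{1/p_d}$. **Triebel-Lizorkin space.** $\mathcal S'/\mathcal P$ denotes tempered distributions on $\mathbb R^d$ modulo polynomials. A function $\varphi\in\mathcal S(\mathbb{R}^d)$ is admissible if $\operatorname{supp}\hat\varphi\subseteq\{2^{-1}\le|\xi|_{\vec a}\le2\}$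 and $|\hat\varphi(\xi)|\ge c>0$ for $2^{-3/4}\le|\xi|_{\vec a}\le2^{3/4}$. Fix an admissible $\varphi$ and put $\varphi_j(x)=2^{j\nu}\varphi(2^{j\vec a}x)$, $j\in\mathbb Z$. $\dot F^\beta_{\vec p,q}(\vec a)$ is the set of $f\in\mathcal S'/\mathcal P$ with $\|f\|_{\dot F^\beta_{\vec p,q}(\vec a)}:=\big\|\big(\sum_{j\in\mathbb Z}(2^{\beta j}|\varphi_j*f|)^q\big)^{1/q}\big\|_{\vec p}<\infty$. **Brushlet system.** Fix a non-negative $\rho\in C^\infty(\mathbb R)$ with $\rho(\xi)=0$ for $\xi\le-1$, $\rho(\xi)=1$ for $\xi\ge1$ and $\rho(\xi)^2+\rho(-\xi)^2=1$ for all $\xi$. For an interval $I=[\alpha_I,\alpha_I')$ with cutoff radii $\varepsilon_I>0$ at $\alpha_I$ and $\varepsilon_I'>0$ at $\alpha_I'$, let $b_I(\xi)=\rho\big(\tfrac{\xi-\alpha_I}{\varepsilon_I}\big)\rho\big(\tfrac{\alpha_I'-\xi}{\varepsilon_I'}\big)$ and define $w_{n,I}$, $n\in\mathbb N_0$, by $\hat w_{n,I}(\xi)=\sqrt{2/|I|}\;b_I(\xi)\cos\!\big(\pi(n+\tfrac12)\tfrac{\xi-\alpha_I}{|I|}\big)$. For $j\in\mathbb Z$, $1\le i\le d$, put $I^i_{j,1}=[0,2^{(j-1)a_i})$, $I^i_{j,2}=[2^{(j-1)a_i},2^{ja_i})$, $I^i_{j,-1}=[-2^{(j-1)a_i},0)$,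 $I^i_{j,-2}=[-2^{ja_i},-2^{(j-1)a_i})$; for these level-$j$ intervals the cutoff radius is $2^{(j-2)a_i}$ at the endpoints $\pm2^{ja_i}$ and $2^{(j-3)a_i}$ at the endpoints $0,\pm2^{(j-1)a_i}$. Let $E:=\{\pm1,\pm2\}^d\setminus\{\pm1\}^d$, $R_{j,k}:=I^1_{j,k_1}\times\cdots\times I^d_{j,k_d}$, $\mathcal R:=\{R_{j,k}:j\in\mathbb Z,k\in E\}$, $w_{n,R_{j,k}}:=\bigotimes_{i=1}^dw_{n_i,I^i_{j,k_i}}$ for $n\in\mathbb N_0^d$, and $\mathcal W:=\{w_{n,R}:(n,R)\in\mathbb N_0^d\times\mathcal R\}$. **Quasi-normalization.** A re-scaled quasi-normalized version of $\mathcal W$ is a system $\mathcal W_{\vec p}=\{g_\lambda\}_\lambda$, $g_\lambda=c_\lambda w_\lambda$, $\lambda\in\mathbb N_0^d\times\mathcal R$, with nonzero scalars $c_\lambda$ such that for some $C\ge1$, $C^{-1}\le\|g_\lambda\|_{\dot F^\beta_{\vec p,q}(\vec a)}\le C$ for all $\lambda$. **Democratic.** $\mathcal W_{\vec p}$ is democratic in $\dot F^\beta_{\vec p,q}(\vec a)$ if there is $c\ge1$ such that for all finite index sets $\Gamma,\Gamma'$ with $\#\Gamma=\#\Gamma'$, $\ c^{-1}\big\|\sum_{\lambda\in\Gamma}g_\lambda\big\|_{\dot F^\beta_{\vec p,q}(\vec a)}\le\big\|\sum_{\lambda\in\Gamma'}g_\lambda\big\|_{\dot F^\beta_{\vec p,q}(\vec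 a)}\le c\big\|\sum_{\lambda\in\Gamma}g_\lambda\big\|_{\dot F^\beta_{\vec p,q}(\vec a)}$. *)

theory Defs
  imports "HOL-Analysis.Analysis"
begin

section \<open>Smooth and Schwartz functions\<close>

fun iterated_partial ::
  "'a list \<Rightarrow> ('a::euclidean_space \<Rightarrow> 'b::real_normed_vector) \<Rightarrow> 'a \<Rightarrow> 'b" where
  "iterated_partial [] f = f"
| "iterated_partial (b # bs) f = (\<lambda>x. frechet_derivative (iterated_partial bs f) (at x) b)"

definition smooth :: "('a::euclidean_space \<Rightarrow> 'b::real_normed_vector) \<Rightarrow> bool" where
  "smooth f \<longleftrightarrow> (\<forall>bs. set bs \<subseteq> Basis \<longrightarrow> iterated_partial bs f differentiable_on UNIV)"

definition schwartz :: "('a::euclidean_space \<Rightarrow> complex) set" where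
  "schwartz = {f. smooth f \<and>
     (\<forall>k bs. set bs \<subseteq> Basis \<longrightarrow>
        bounded (range (\<lambda>x. (1 + norm x) ^ k *\<^sub>R iterated_partial bs f x)))}"

text \<open>Convergence of sequences in the Frechet topology of the Schwartz space.\<close>

definition schwartz_tendsto ::
  "(nat \<Rightarrow> 'a::euclidean_space \<Rightarrow> complex) \<Rightarrow> ('a \<Rightarrow> complex) \<Rightarrow> bool" where
  "schwartz_tendsto F f \<longleftrightarrow>
     (\<forall>k bs. set bs \<subseteq> Basis \<longrightarrow>
        uniform_limit UNIV (\<lambda>n x. (1 + norm x) ^ k *\<^sub>R iterated_partial bs (F n) x)
          (\<lambda>x. (1 + norm x) ^ k *\<^sub>R iterated_partial bs f x) sequentially)"


section \<open>Fourier transform\<close>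

definition fourier :: "('a::euclidean_space \<Rightarrow> complex) \<Rightarrow> 'a \<Rightarrow> complex" where
  "fourier f \<xi> = complex_of_real ((2 * pi) powr (- real DIM('a) / 2)) *
     (LINT x|lborel. f x * exp (- (\<i> * complex_of_real (x \<bullet> \<xi>))))"

definition inverse_fourier :: "('a::euclidean_space \<Rightarrow> complex) \<Rightarrow> 'a \<Rightarrow> complex" where
  "inverse_fourier h x = complex_of_real ((2 * pi) powr (- real DIM('a) / 2)) *
     (LINT \<xi>|lborel. h \<xi> * exp (\<i> * complex_of_real (x \<bullet> \<xi>)))"


section \<open>Tempered distributions modulo polynomials\<close>

text \<open>A distribution is a functional on all functions, of which only the values on
  \<^const>\<open>schwartz\<close> matter.  Functionals that agree there are identified by
  \<open>poly_equiv\<close> below (take the zero polynomial).\<close>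

definition tempered :: "(('a::euclidean_space \<Rightarrow> complex) \<Rightarrow> complex) \<Rightarrow> bool" where
  "tempered T \<longleftrightarrow>
     (\<forall>f\<in>schwartz. \<forall>g\<in>schwartz. T (\<lambda>x. f x + g x) = T f + T g) \<and>
     (\<forall>c. \<forall>f\<in>schwartz. T (\<lambda>x. c * f x) = c * T f) \<and>
     (\<forall>F f. range F \<subseteq> schwartz \<longrightarrow> f \<in> schwartz \<longrightarrow> schwartz_tendsto F f \<longrightarrow>
        (\<lambda>n. T (F n)) \<longlonglongrightarrow> T f)"

definition dist_of :: "('a::euclidean_space \<Rightarrow> complex) \<Rightarrow> ('a \<Rightarrow> complex) \<Rightarrow> complex" where
  "dist_of g = (\<lambda>f. LINT x|lborel. g x * f x)"

definition poly_equiv ::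
  "((('a::euclidean_space \<Rightarrow> complex) \<Rightarrow> complex) \<times> (('a \<Rightarrow> complex) \<Rightarrow> complex)) set" where
  "poly_equiv = {(T, U). tempered T \<and> tempered U \<and>
     (\<exists>P. polynomial_function P \<and> (\<forall>f\<in>schwartz. T f - U f = dist_of P f))}"

definition tempered_mod_poly ::
  "(('a::euclidean_space \<Rightarrow> complex) \<Rightarrow> complex) set set" where
  "tempered_mod_poly = {T. tempered T} // poly_equiv"

text \<open>The class in \<^const>\<open>tempered_mod_poly\<close> of the distribution given by a function.\<close>

definition class_of ::
  "('a::euclidean_space \<Rightarrow> complex) \<Rightarrow> (('a \<Rightarrow> complex) \<Rightarrow> complex) set" where
  "class_of g = poly_equiv `` {dist_of g}"

definition convolve ::
  "('a::euclidean_space \<Rightarrow> complex) \<Rightarrow> (('a \<Rightarrow> complex) \<Rightarrow> complex) \<Rightarrow> 'a \<Rightarrow> complex" where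
  "convolve \<phi> T x = T (\<lambda>y. \<phi> (x - y))"


section \<open>Anisotropic dilations and quasi-norm\<close>

text \<open>The same type as \<open>real^'d\<close>, but without an implicit sort constraint on \<open>'d\<close>.\<close>

type_synonym 'd rvec = "(real, 'd) vec"

definition dilate :: "real \<Rightarrow> 'd::finite rvec \<Rightarrow> 'd rvec \<Rightarrow> 'd rvec" where
  "dilate t b x = (\<chi> i. t powr (b $ i) * x $ i)"

definition aniso_norm :: "'d::finite rvec \<Rightarrow> 'd rvec \<Rightarrow> real" where
  "aniso_norm a x = (if x = 0 then 0 else (THE t. t > 0 \<and> norm (dilate t (- a) x) = 1))"


section \<open>Mixed quasi-norms\<close>

definition ennpow :: "ennreal \<Rightarrow> real \<Rightarrow> ennreal" where
  "ennpow x r = (if x = \<infinity> then \<infinity> else ennreal (enn2real x powr r))"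
  \<comment> \<open>only meant for positive exponents\<close>

text \<open>The linear order on the index type determines the order of integration: the smallest
  index plays the role of the first coordinate and is integrated first.  After all coordinates
  have been integrated the function is constant, so it may be evaluated at any point.\<close>

definition coord_Lp ::
  "'d::finite rvec \<Rightarrow> 'd \<Rightarrow> ('d rvec \<Rightarrow> ennreal) \<Rightarrow> 'd rvec \<Rightarrow> ennreal" where
  "coord_Lp p i G x =
     ennpow (\<integral>\<^sup>+ t. ennpow (G (\<chi> k. if k = i then t else x $ k)) (p $ i) \<partial>lborel) (1 / p $ i)"

definition mixed_norm ::
  "'d::{finite,linorder} rvec \<Rightarrow> ('d rvec \<Rightarrow> ennreal) \<Rightarrow> ennreal" where
  "mixed_norm p F = fold (coord_Lp p) (sorted_list_of_set UNIV) F 0"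


section \<open>Homogeneous mixed-norm Triebel-Lizorkin spaces\<close>

definition admissible :: "'d::finite rvec \<Rightarrow> ('d rvec \<Rightarrow> complex) \<Rightarrow> bool" where
  "admissible a \<phi> \<longleftrightarrow> \<phi> \<in> schwartz \<and>
     closure {\<xi>. fourier \<phi> \<xi> \<noteq> 0} \<subseteq> {\<xi>. 1 / 2 \<le> aniso_norm a \<xi> \<and> aniso_norm a \<xi> \<le> 2} \<and>
     (\<exists>c>0. \<forall>\<xi>. 2 powr (- 3 / 4) \<le> aniso_norm a \<xi> \<and> aniso_norm a \<xi> \<le> 2 powr (3 / 4) \<longrightarrow>
        c \<le> norm (fourier \<phi> \<xi>))"

definition level_fun ::
  "'d::finite rvec \<Rightarrow> ('d rvec \<Rightarrow> complex) \<Rightarrow> int \<Rightarrow> 'd rvec \<Rightarrow> complex" where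
  "level_fun a \<phi> j x =
     complex_of_real (2 powr (real_of_int j * (\<Sum>i\<in>UNIV. a $ i))) *
       \<phi> (dilate 2 (real_of_int j *\<^sub>R a) x)"

definition TL_norm_rep ::
  "'d::{finite,linorder} rvec \<Rightarrow> 'd rvec \<Rightarrow> real \<Rightarrow> real \<Rightarrow> ('d rvec \<Rightarrow> complex) \<Rightarrow>
   (('d rvec \<Rightarrow> complex) \<Rightarrow> complex) \<Rightarrow> ennreal" where
  "TL_norm_rep a p q \<beta> \<phi> T = mixed_norm p (\<lambda>x.
     ennpow (\<Sum>\<^sub>\<infinity>j\<in>(UNIV :: int set).
        ennpow (ennreal (2 powr (\<beta> * real_of_int j) * norm (convolve (level_fun a \<phi> j) T x))) q)
      (1 / q))"

text \<open>For admissible \<open>\<phi>\<close> the functions \<open>level_fun a \<phi> j\<close> have vanishing moments, so all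
  representatives of a class have the same quasi-norm.\<close>

definition TL_norm ::
  "'d::{finite,linorder} rvec \<Rightarrow> 'd rvec \<Rightarrow> real \<Rightarrow> real \<Rightarrow> ('d rvec \<Rightarrow> complex) \<Rightarrow>
   (('d rvec \<Rightarrow> complex) \<Rightarrow> complex) set \<Rightarrow> ennreal" where
  "TL_norm a p q \<beta> \<phi> u = the_elem (TL_norm_rep a p q \<beta> \<phi> ` u)"

definition TL_space ::
  "'d::{finite,linorder} rvec \<Rightarrow> 'd rvec \<Rightarrow> real \<Rightarrow> real \<Rightarrow> ('d rvec \<Rightarrow> complex) \<Rightarrow>
   (('d rvec \<Rightarrow> complex) \<Rightarrow> complex) set set" where
  "TL_space a p q \<beta> \<phi> = {u \<in> tempered_mod_poly. TL_norm a p q \<beta> \<phi> u < \<infinity>}"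


section \<open>Brushlets\<close>

definition cutoff_function :: "(real \<Rightarrow> real) \<Rightarrow> bool" where
  "cutoff_function \<rho> \<longleftrightarrow> smooth \<rho> \<and> (\<forall>\<xi>. 0 \<le> \<rho> \<xi>) \<and> (\<forall>\<xi>\<le>-1. \<rho> \<xi> = 0) \<and> (\<forall>\<xi>\<ge>1. \<rho> \<xi> = 1) \<and>
     (\<forall>\<xi>. (\<rho> \<xi>)\<^sup>2 + (\<rho> (- \<xi>))\<^sup>2 = 1)"

text \<open>Below \<open>l\<close> and \<open>r\<close> are the endpoints of a half-open interval, \<open>e\<close> and \<open>e'\<close> the cutoff
  radii at \<open>l\<close> and \<open>r\<close>.\<close>

definition bell :: "(real \<Rightarrow> real) \<Rightarrow> real \<Rightarrow> real \<Rightarrow> real \<Rightarrow> real \<Rightarrow> real \<Rightarrow> real" where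
  "bell \<rho> l r e e' \<xi> = \<rho> ((\<xi> - l) / e) * \<rho> ((r - \<xi>) / e')"

definition brushlet_1d ::
  "(real \<Rightarrow> real) \<Rightarrow> real \<Rightarrow> real \<Rightarrow> real \<Rightarrow> real \<Rightarrow> nat \<Rightarrow> real \<Rightarrow> complex" where
  "brushlet_1d \<rho> l r e e' n = inverse_fourier (\<lambda>\<xi>. complex_of_real
     (sqrt (2 / (r - l)) * bell \<rho> l r e e' \<xi> * cos (pi * (real n + 1 / 2) * ((\<xi> - l) / (r - l)))))"

text \<open>Endpoints of the level-\<open>j\<close> interval with label \<open>m\<close> (one of 1, 2, -1, -2) in a direction
  with anisotropy exponent \<open>s\<close>, and the cutoff radius used at level \<open>j\<close> at an endpoint \<open>v\<close>.\<close>

definition left_end :: "real \<Rightarrow> int \<Rightarrow> int \<Rightarrow> real" where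
  "left_end s j m =
     (if m = 1 then 0
      else if m = 2 then 2 powr ((real_of_int j - 1) * s)
      else if m = -1 then - (2 powr ((real_of_int j - 1) * s))
      else - (2 powr (real_of_int j * s)))"

definition right_end :: "real \<Rightarrow> int \<Rightarrow> int \<Rightarrow> real" where
  "right_end s j m =
     (if m = 1 then 2 powr ((real_of_int j - 1) * s)
      else if m = 2 then 2 powr (real_of_int j * s)
      else if m = -1 then 0
      else - (2 powr ((real_of_int j - 1) * s)))"

definition cutoff_radius :: "real \<Rightarrow> int \<Rightarrow> real \<Rightarrow> real" where
  "cutoff_radius s j v =
     (if \<bar>v\<bar> = 2 powr (real_of_int j * s) then 2 powr ((real_of_int j - 2) * s)
      else 2 powr ((real_of_int j - 3) * s))"

definition level_brushlet ::
  "(real \<Rightarrow> real) \<Rightarrow> real \<Rightarrow> int \<Rightarrow> int \<Rightarrow> nat \<Rightarrow> real \<Rightarrow> complex" where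
  "level_brushlet \<rho> s j m =
     brushlet_1d \<rho> (left_end s j m) (right_end s j m)
       (cutoff_radius s j (left_end s j m)) (cutoff_radius s j (right_end s j m))"

text \<open>An index \<open>(n, j, k)\<close> stands for the pair of \<open>n\<close> and the rectangle with level \<open>j\<close> and
  label \<open>k\<close>.  A rectangle determines its level and label, because at least one of its sides
  carries a label 2 or -2.\<close>

type_synonym 'd brushlet_index = "(nat, 'd) vec \<times> int \<times> (int, 'd) vec"

definition brushlet_indices :: "'d::finite brushlet_index set" where
  "brushlet_indices = UNIV \<times> UNIV \<times>
     ({k. \<forall>i. k $ i \<in> {1, -1, 2, -2}} - {k. \<forall>i. k $ i \<in> {1, -1}})"

definition brushlet ::
  "(real \<Rightarrow> real) \<Rightarrow> 'd::finite rvec \<Rightarrow> 'd brushlet_index \<Rightarrow> 'd rvec \<Rightarrow> complex" where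
  "brushlet \<rho> a = (\<lambda>(n, j, k) x. \<Prod>i\<in>UNIV. level_brushlet \<rho> (a $ i) j (k $ i) (n $ i) (x $ i))"


section \<open>Quasi-normalized systems and democracy\<close>

definition quasi_normalized_brushlets ::
  "(real \<Rightarrow> real) \<Rightarrow> 'd::{finite,linorder} rvec \<Rightarrow> 'd rvec \<Rightarrow> real \<Rightarrow> real \<Rightarrow>
   ('d rvec \<Rightarrow> complex) \<Rightarrow> ('d brushlet_index \<Rightarrow> 'd rvec \<Rightarrow> complex) \<Rightarrow> bool" where
  "quasi_normalized_brushlets \<rho> a p q \<beta> \<phi> g \<longleftrightarrow>
     (\<exists>c. \<forall>\<mu>\<in>brushlet_indices. c \<mu> \<noteq> 0 \<and> g \<mu> = (\<lambda>x. c \<mu> * brushlet \<rho> a \<mu> x)) \<and>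
     (\<forall>\<mu>\<in>brushlet_indices. class_of (g \<mu>) \<in> TL_space a p q \<beta> \<phi>) \<and>
     (\<exists>C\<ge>1::real. \<forall>\<mu>\<in>brushlet_indices.
        ennreal (inverse C) \<le> TL_norm a p q \<beta> \<phi> (class_of (g \<mu>)) \<and>
        TL_norm a p q \<beta> \<phi> (class_of (g \<mu>)) \<le> ennreal C)"

definition democratic ::
  "'d::{finite,linorder} rvec \<Rightarrow> 'd rvec \<Rightarrow> real \<Rightarrow> real \<Rightarrow> ('d rvec \<Rightarrow> complex) \<Rightarrow>
   'l set \<Rightarrow> ('l \<Rightarrow> 'd rvec \<Rightarrow> complex) \<Rightarrow> bool" where
  "democratic a p q \<beta> \<phi> \<Lambda> g \<longleftrightarrow>
     (\<exists>c\<ge>1::real. \<forall>\<Gamma> \<Gamma>'. \<Gamma> \<subseteq> \<Lambda> \<longrightarrow> \<Gamma>' \<subseteq> \<Lambda> \<longrightarrow> finite \<Gamma> \<longrightarrow> finite \<Gamma>' \<longrightarrow> card \<Gamma> = card \<Gamma>' \<longrightarrow>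
        ennreal (inverse c) * TL_norm a p q \<beta> \<phi> (class_of (\<lambda>x. \<Sum>\<mu>\<in>\<Gamma>. g \<mu> x))
          \<le> TL_norm a p q \<beta> \<phi> (class_of (\<lambda>x. \<Sum>\<mu>\<in>\<Gamma>'. g \<mu> x)) \<and>
        TL_norm a p q \<beta> \<phi> (class_of (\<lambda>x. \<Sum>\<mu>\<in>\<Gamma>'. g \<mu> x))
          \<le> ennreal c * TL_norm a p q \<beta> \<phi> (class_of (\<lambda>x. \<Sum>\<mu>\<in>\<Gamma>. g \<mu> x)))"

end

theory Submission
  imports Defs "HOL-Probability.Probability"
begin

text \<open>Write \<open>E\<^sub>\<mu>\<close> for the tensor product of the weights \<open>(1 + |u|)\<^sup>-\<^sup>2\<close> adapted to the two centres per
  coordinate of the brushlet \<open>\<mu>\<close> of level \<open>j\<close>, and \<open>G\<close> for the square function of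
  \<open>f = \<Sum> c\<^sub>\<mu> w\<^sub>\<mu>\<close>. For small exponents \<open>t\<close> and \<open>r\<close> one has
  \<open>G\<^sup>t \<lesssim> \<Sum> |c\<^sub>\<mu>|\<^sup>t 2\<^bsup>jt(\<beta> + \<nu>/2)\<^esup> E\<^sub>\<mu>\<close> pointwise, because the spectra of brushlets and of Littlewood--Paley
  pieces overlap only for neighbouring levels, and conversely
  \<open>|c\<^sub>\<mu>|\<^sup>r \<lesssim> 2\<^bsup>j(\<nu>(1 - r/2) - \<beta>r)\<^esup> \<integral> G\<^sup>r E\<^sub>\<mu>\<close>, by orthonormality of the local cosine bases and a
  sub-mean-value property of band-limited functions. With Hoelder's inequality for mixed norms
  the norm of a sum over \<open>\<Gamma>\<close> is thus controlled from both sides by mixed norms of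
  \<open>\<Sum> 2\<^bsup>j \<Sum>a/s\<^esup> E\<^sub>\<mu>\<close>. For constant \<open>p\<close> this gives norms comparable to \<open>(#\<Gamma>)\<^bsup>1/p\<^esup>\<close>, whatever
  \<open>\<Gamma>\<close> is, whereas \<open>N\<close> brushlets of level 0 that differ only in the \<open>i\<close>-th frequency index have a
  sum of norm comparable to \<open>N\<^bsup>1/p\<^sub>i\<^esup>\<close>; comparing two directions forces the exponents to agree.\<close>

section \<open>Lebesgue measure on coordinate space\<close>

text \<open>The exponents \<open>p $ i\<close> and \<open>q\<close> may lie below 1, so the
  quasi-norm itself offers neither a triangle inequality nor duality. Both estimates therefore
  concern powers of the square function. With \<open>t\<close> at most 1, \<open>q\<close> and every
  \<open>p $ i\<close>, the \<open>t\<close>-th power passes through all sums as an upper bound and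
  moves the mixed norm to exponents \<open>p $ i / t \<ge> 1\<close>. With \<open>r\<close> below 1
  and every \<open>p $ i\<close>, the exponents \<open>p $ i / r\<close> exceed 1 and have the
  conjugates \<open>1 / (1 - r / p $ i)\<close>. Smooth bells give decay of any order; starting from
  order \<open>2 / t\<close> or \<open>2 / r\<close>, the power leaves the order 2, which is
  integrable and has bounded lattice sums. The lower bound is a count: summing the coefficient bound
  over \<Gamma> puts #\<Gamma> on the left, while Hoelder's inequality puts the conjugate norm of
  the summed weights on the right. In the two cases considered this norm grows at most like
  #\<Gamma> to the power \<open>1 - r / p $ i\<close>, so \<open>r / p $ i\<close> remains for the
  \<open>r\<close>-th power of the quasi-norm. Applied to singletons, the same two estimates reveal
  the size of the coefficients \<open>c \<mu>\<close>, so the normalization enters only through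
  them.\<close>

lemma Basis_vec_axis: "(Basis :: (real, 'd::finite) vec set) = range (\<lambda>i. axis i 1)"
  by (auto simp: Basis_vec_def)

lemma prod_Basis_vec:
  fixes f :: "'d::finite rvec \<Rightarrow> 'b::comm_monoid_mult"
  shows "(\<Prod>b\<in>Basis. f b) = (\<Prod>i\<in>UNIV. f (axis i 1))"
  unfolding Basis_vec_axis by (subst prod.reindex) (auto simp: inj_on_def axis_eq_axis)

text \<open>Both measures agree on boxes, and this determines \<open>lborel\<close>. The product
  form gives access to Tonelli and Fubini in single coordinates.\<close>

lemma lborel_vec:
  "(lborel :: 'd::finite rvec measure) = distr (\<Pi>\<^sub>M i\<in>UNIV. lborel) borel (\<lambda>f. \<chi> i. f i)"
proof (rule lborel_eqI)
  interpret product_sigma_finite "\<lambda>i::'d. lborel :: real measure" by standard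
  have [measurable]: "(\<lambda>f. (\<chi> i. f i) :: 'd rvec) \<in> (\<Pi>\<^sub>M i\<in>UNIV. lborel) \<rightarrow>\<^sub>M borel"
    by (subst borel_measurable_euclidean_space) (auto simp: Basis_vec_axis inner_axis)
  fix l u :: "'d rvec" assume le: "\<And>b. b \<in> Basis \<Longrightarrow> l \<bullet> b \<le> u \<bullet> b"
  have le': "l $ i \<le> u $ i" for i using le[of "axis i 1"] by (simp add: Basis_vec_axis inner_axis)
  have "emeasure (distr (\<Pi>\<^sub>M i\<in>UNIV. lborel) borel (\<lambda>f. \<chi> i. f i)) (box l u)
    = emeasure (\<Pi>\<^sub>M i\<in>UNIV. lborel) ((\<lambda>f. \<chi> i. f i) -` box l u \<inter> space (\<Pi>\<^sub>M i\<in>(UNIV::'d set). (lborel :: real measure)))"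
    by (rule emeasure_distr) auto
  also have "(\<lambda>f. \<chi> i. f i) -` box l u \<inter> space (\<Pi>\<^sub>M i\<in>UNIV. (lborel :: real measure)) = (\<Pi>\<^sub>E i\<in>UNIV. {l$i<..<u$i})"
    by (auto simp: mem_box_cart space_PiM PiE_def Pi_def)
  also have "emeasure (\<Pi>\<^sub>M i\<in>UNIV. lborel) (\<Pi>\<^sub>E i\<in>UNIV. {l$i<..<u$i}) = (\<Prod>i\<in>UNIV. emeasure lborel {l$i<..<u$i})"
    by (rule emeasure_PiM) auto
  also have "\<dots> = ennreal (\<Prod>b\<in>Basis. (u - l) \<bullet> b)"
    using le' by (simp add: prod_Basis_vec prod_ennreal inner_axis)
  finally show "emeasure (distr (\<Pi>\<^sub>M i\<in>UNIV. lborel) borel (\<lambda>f. \<chi> i. f i)) (box l u) = ennreal (\<Prod>b\<in>Basis. (u - l) \<bullet> b)" .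
qed simp

lemma measurable_vec_lambda_PiM [measurable]:
  "(\<lambda>f. (\<chi> i. f i) :: 'd::finite rvec) \<in> (\<Pi>\<^sub>M i\<in>UNIV. lborel) \<rightarrow>\<^sub>M borel"
  by (subst borel_measurable_euclidean_space) (auto simp: Basis_vec_axis inner_axis)

lemma measurable_vec_nth [measurable]: "(\<lambda>x::'d::finite rvec. x $ i) \<in> borel_measurable borel"
  by (intro borel_measurable_continuous_onI continuous_intros)

lemma nn_integral_prod_vec:
  fixes f :: "'d::finite \<Rightarrow> real \<Rightarrow> ennreal"
  assumes [measurable]: "\<And>i. f i \<in> borel_measurable borel"
  shows "(\<integral>\<^sup>+x. (\<Prod>i\<in>UNIV. f i (x $ i)) \<partial>lborel) = (\<Prod>i\<in>UNIV. \<integral>\<^sup>+t. f i t \<partial>lborel)"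
proof -
  interpret product_sigma_finite "\<lambda>i::'d. lborel :: real measure" by standard
  show ?thesis
    by (subst lborel_vec, subst nn_integral_distr) (auto simp: product_nn_integral_prod)
qed

lemma
  fixes f :: "'d::finite \<Rightarrow> real \<Rightarrow> 'b::{real_normed_field,banach,second_countable_topology}"
  assumes "\<And>i. integrable lborel (f i)"
  shows integrable_prod_vec: "integrable lborel (\<lambda>x. \<Prod>i\<in>UNIV. f i (x $ i))"
    and integral_prod_vec: "(LINT x|lborel. (\<Prod>i\<in>UNIV. f i (x $ i))) = (\<Prod>i\<in>UNIV. (LINT t|lborel. f i t))"
proof -
  interpret product_sigma_finite "\<lambda>i::'d. lborel :: real measure" by standard
  have [measurable]: "f i \<in> borel_measurable borel" for i using assms[of i] by auto
  have 1: "integrable (\<Pi>\<^sub>M i\<in>UNIV. lborel) (\<lambda>x. \<Prod>i\<in>UNIV. f i (x i))"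
    by (rule product_integrable_prod) (use assms in auto)
  have 2: "(LINT x|(\<Pi>\<^sub>M i\<in>UNIV. lborel). (\<Prod>i\<in>UNIV. f i (x i))) = (\<Prod>i\<in>UNIV. (LINT t|lborel. f i t))"
    by (rule product_integral_prod) (use assms in auto)
  show "integrable lborel (\<lambda>x. \<Prod>i\<in>UNIV. f i (x $ i))"
    by (subst lborel_vec, subst integrable_distr_eq) (use 1 in auto)
  show "(LINT x|lborel. (\<Prod>i\<in>UNIV. f i (x $ i))) = (\<Prod>i\<in>UNIV. (LINT t|lborel. f i t))"
    by (subst lborel_vec, subst integral_distr) (use 2 in auto)
qed

lemma lborel_affine_vec:
  fixes c :: "'d::finite \<Rightarrow> real" and z :: "'d rvec"
  assumes "\<And>i. c i \<noteq> 0"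
  shows "lborel = density (distr lborel borel (\<lambda>x. z + (\<chi> i. c i * x $ i))) (\<lambda>_. ennreal (\<Prod>i\<in>UNIV. \<bar>c i\<bar>))"
proof -
  \<comment> \<open>The Euclidean substitution rule indexes its factors by basis vectors;
    \<open>C\<close> recovers the coordinate from the basis vector.\<close>
  define C where "C b = c (SOME i. b = axis i 1)" for b :: "'d rvec"
  have C: "C (axis i 1) = c i" for i
    by (simp add: C_def axis_eq_axis)
  have C0: "C b \<noteq> 0" for b using assms by (simp add: C_def)
  have sum: "(\<Sum>j\<in>Basis. (C j * (x \<bullet> j)) *\<^sub>R j) = (\<chi> i. c i * x $ i)" for x
  proof -
    have "(\<Sum>j\<in>Basis. (C j * (x \<bullet> j)) *\<^sub>R j) = (\<Sum>i\<in>UNIV. (c i * (x $ i)) *\<^sub>R axis i 1)"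
      unfolding Basis_vec_axis by (subst sum.reindex) (auto simp: inj_on_def axis_eq_axis C inner_axis)
    also have "\<dots> = (\<chi> i. c i * x $ i)"
      by (simp add: vec_eq_iff axis_def if_distrib sum.delta cong: if_cong)
    finally show ?thesis .
  qed
  show ?thesis
    using lborel_affine_euclidean[of C z] C0 by (simp add: sum prod_Basis_vec C)
qed

lemma measurable_affine_vec [measurable]:
  "(\<lambda>x::'d::finite rvec. z + (\<chi> i. c i * x $ i)) \<in> borel_measurable borel"
  by (intro borel_measurable_continuous_onI continuous_intros)

lemma nn_integral_affine_vec:
  fixes c :: "'d::finite \<Rightarrow> real"
  assumes c: "\<And>i. c i \<noteq> 0" and [measurable]: "f \<in> borel_measurable borel"
  shows "(\<integral>\<^sup>+x. f x \<partial>lborel) = ennreal (\<Prod>i\<in>UNIV. \<bar>c i\<bar>) * (\<integral>\<^sup>+x. f (z + (\<chi> i. c i * x $ i)) \<partial>lborel)"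
  by (subst lborel_affine_vec[OF c, of z])
     (simp add: nn_integral_density nn_integral_distr nn_integral_cmult)

lemma integrable_affine_vec:
  fixes c :: "'d::finite \<Rightarrow> real" and f :: "'d rvec \<Rightarrow> 'b::{banach,second_countable_topology}"
  assumes c: "\<And>i. c i \<noteq> 0" and f: "integrable lborel f"
  shows "integrable lborel (\<lambda>x. f (z + (\<chi> i. c i * x $ i)))"
proof -
  have [measurable]: "f \<in> borel_measurable borel" using f by auto
  have "(\<integral>\<^sup>+x. norm (f x) \<partial>lborel) < \<infinity>" using f by (auto simp: integrable_iff_bounded)
  then have "(\<integral>\<^sup>+x. norm (f (z + (\<chi> i. c i * x $ i))) \<partial>lborel) < \<infinity>"
    using c by (subst (asm) nn_integral_affine_vec[OF c, where z=z])
      (auto simp: ennreal_mult_less_top prod_nonneg)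
  then show ?thesis by (auto simp: integrable_iff_bounded)
qed

lemma integral_affine_vec:
  fixes c :: "'d::finite \<Rightarrow> real" and f :: "'d rvec \<Rightarrow> 'b::{banach,second_countable_topology}"
  assumes c: "\<And>i. c i \<noteq> 0"
  shows "(LINT x|lborel. f x) = (\<Prod>i\<in>UNIV. \<bar>c i\<bar>) *\<^sub>R (LINT x|lborel. f (z + (\<chi> i. c i * x $ i)))"
proof cases
  assume f: "integrable lborel f"
  then have [measurable]: "f \<in> borel_measurable borel" by auto
  show ?thesis
    by (subst lborel_affine_vec[OF c, of z])
       (simp add: integral_density integral_distr prod_nonneg)
next
  assume f: "\<not> integrable lborel f"
  \<comment> \<open>The inverse substitution would make \<open>f\<close> integrable. Hence both
    integrals have the default value 0.\<close>
  have "\<not> integrable lborel (\<lambda>x. f (z + (\<chi> i. c i * x $ i)))"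
  proof
    assume "integrable lborel (\<lambda>x. f (z + (\<chi> i. c i * x $ i)))"
    from integrable_affine_vec[OF _ this, of "\<lambda>i. inverse (c i)" "\<chi> i. - z $ i / c i"]
    have "integrable lborel (\<lambda>x. f (z + (\<chi> i. c i * ((\<chi> i. - z $ i / c i) + (\<chi> i. inverse (c i) * x $ i)) $ i)))"
      using c by simp
    moreover have "z + (\<chi> i. c i * ((\<chi> i. - z $ i / c i) + (\<chi> i. inverse (c i) * x $ i)) $ i) = x" for x :: "'d rvec"
      using c by (auto simp: vec_eq_iff field_simps)
    ultimately show False using f by simp
  qed
  then show ?thesis using f by (simp add: not_integrable_integral_eq)
qed

section \<open>The weight \<open>(1 + |u|)\<^sup>-\<^sup>2\<close>\<close>

definition tw :: "real \<Rightarrow> real" where "tw u = 1 / (1 + \<bar>u\<bar>)\<^sup>2"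

lemma tw_pos: "0 < tw u" and tw_le_1: "tw u \<le> 1"
  by (auto simp: tw_def divide_simps add_pos_nonneg one_le_power)

lemma tw_nonneg [simp]: "0 \<le> tw u" using tw_pos[of u] by simp

lemma tw_minus: "tw (- u) = tw u" by (simp add: tw_def)

lemma measurable_tw [measurable]: "tw \<in> borel_measurable borel"
  unfolding tw_def[abs_def] by measurable

lemma one_plus_abs_add: "1 + \<bar>u + v\<bar> \<le> (1 + \<bar>u\<bar>) * (1 + \<bar>v\<bar>)" for u v :: real
proof -
  have "1 + \<bar>u + v\<bar> \<le> 1 + \<bar>u\<bar> + \<bar>v\<bar>" by simp
  also have "\<dots> \<le> (1 + \<bar>u\<bar>) * (1 + \<bar>v\<bar>)" by (simp add: algebra_simps)
  finally show ?thesis .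
qed

lemma tw_add: "tw u \<le> (1 + \<bar>v\<bar>)\<^sup>2 * tw (u + v)"
proof -
  have "(1 + \<bar>u + v\<bar>)\<^sup>2 \<le> ((1 + \<bar>u\<bar>) * (1 + \<bar>v\<bar>))\<^sup>2"
    by (intro power_mono one_plus_abs_add) auto
  then show ?thesis
    using add_pos_nonneg[of 1 "\<bar>u\<bar>"] add_pos_nonneg[of 1 "\<bar>u + v\<bar>"]
    by (simp add: tw_def divide_simps power_mult_distrib mult.commute)
qed

lemma powr_le_tw:
  assumes "2 \<le> A" shows "(1 + \<bar>u\<bar>) powr (- A) \<le> tw u"
proof -
  have "(1 + \<bar>u\<bar>) powr (- A) \<le> (1 + \<bar>u\<bar>) powr (- 2)"
    using assms by (intro powr_mono) auto
  also have "\<dots> = tw u"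
    by (simp add: tw_def powr_minus_divide powr_numeral)
  finally show ?thesis .
qed

lemma integrable_tw: "integrable lborel tw"
proof -
  have "integrable lborel (\<lambda>x::real. inverse (1 + x\<^sup>2))"
    using integrable_inverse_1_plus_square by (simp add: set_integrable_def einterval_eq)
  then show ?thesis
  proof (rule Bochner_Integration.integrable_bound)
    have "1 + x\<^sup>2 \<le> (1 + \<bar>x\<bar>)\<^sup>2" for x :: real by (simp add: power2_eq_square algebra_simps)
    then show "AE x in lborel. norm (tw x) \<le> norm (inverse (1 + x\<^sup>2))"
      by (auto simp: tw_def divide_simps add_pos_nonneg intro!: AE_I2)
  qed simp
qed

definition tw_mass :: real where "tw_mass = (LINT u|lborel. tw u)"

lemma nn_integral_tw: "(\<integral>\<^sup>+u. tw u \<partial>lborel) = ennreal tw_mass"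
  unfolding tw_mass_def by (rule nn_integral_eq_integral[OF integrable_tw]) simp

lemma tw_mass_nonneg: "0 \<le> tw_mass" by (simp add: tw_mass_def)

lemma nn_integral_tw_affine:
  assumes "c \<noteq> 0" shows "(\<integral>\<^sup>+u. tw (y + c * u) \<partial>lborel) = ennreal (tw_mass / \<bar>c\<bar>)"
proof -
  have "ennreal \<bar>c\<bar> * (\<integral>\<^sup>+u. tw (y + c * u) \<partial>lborel) = ennreal tw_mass"
    using nn_integral_real_affine[of "\<lambda>u. ennreal (tw u)" c y] assms nn_integral_tw by simp
  then have "ennreal (1 / \<bar>c\<bar>) * (ennreal \<bar>c\<bar> * (\<integral>\<^sup>+u. tw (y + c * u) \<partial>lborel)) = ennreal (1 / \<bar>c\<bar>) * ennreal tw_mass"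
    by simp
  then show ?thesis
    using assms by (simp add: mult.assoc[symmetric] ennreal_mult[symmetric] tw_mass_nonneg)
qed

text \<open>According to the sign of \<open>v\<close>, one of the two translates equals the left
  side, because \<open>tw\<close> is even. This unfolds a weight in \<open>\<bar>v\<bar>\<close>
  into its two centres, to which affine substitutions apply.\<close>

lemma tw_abs_le: "tw (\<bar>v\<bar> - y) \<le> tw (- y + v) + tw (y + v)"
proof (cases "v \<ge> 0")
  case True then show ?thesis by (simp add: tw_nonneg add.commute)
next
  case False
  then have "tw (\<bar>v\<bar> - y) = tw (y + v)"
    using tw_minus[of "y + v"] by (simp add: algebra_simps)
  then show ?thesis by (simp add: tw_nonneg)
qed

lemma nn_integral_tw_abs:
  assumes "c > 0" shows "(\<integral>\<^sup>+u. tw (c * \<bar>u\<bar> - y) \<partial>lborel) \<le> ennreal (2 * tw_mass / c)"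
proof -
  have "(\<integral>\<^sup>+u. tw (c * \<bar>u\<bar> - y) \<partial>lborel) \<le> (\<integral>\<^sup>+u. ennreal (tw (- y + c * u)) + ennreal (tw (y + c * u)) \<partial>lborel)"
  proof (intro nn_integral_mono)
    fix u :: real
    have "c * \<bar>u\<bar> = \<bar>c * u\<bar>" using assms by (simp add: abs_mult)
    then show "ennreal (tw (c * \<bar>u\<bar> - y)) \<le> ennreal (tw (- y + c * u)) + ennreal (tw (y + c * u))"
      using tw_abs_le[of "c * u" y] by (simp add: ennreal_plus[symmetric] del: ennreal_plus)
  qed
  also have "\<dots> = ennreal (tw_mass / c) + ennreal (tw_mass / c)"
    using assms nn_integral_tw_affine[of c "- y"] nn_integral_tw_affine[of c y]
    by (subst nn_integral_add) simp_all
  also have "\<dots> = ennreal (2 * tw_mass / c)"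
    using assms tw_mass_nonneg by (simp add: ennreal_plus[symmetric] del: ennreal_plus)
  finally show ?thesis .
qed

text \<open>Comparison with an integral: on the interval of length \<delta> centred at a node the
  weight changes at most by the factor \<open>(1 + \<delta>)\<^sup>2\<close>. These intervals are
  disjoint, so the total mass bounds the sum uniformly in \<open>u\<close> and
  \<open>S\<close>.\<close>

lemma sum_tw_bounded:
  assumes "\<delta> > 0" "finite S"
  shows "(\<Sum>n\<in>S. tw (u - \<delta> * (real n + 1/2))) \<le> (1 + \<delta>)\<^sup>2 * tw_mass / \<delta>"
proof -
  let ?I = "\<lambda>n::nat. {\<delta> * real n ..< \<delta> * (real n + 1)}"
  have disj: "disjoint_family_on ?I S"
  proof (unfold disjoint_family_on_def, intro ballI impI)
    fix m n :: nat assume "m \<noteq> n"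
    then have "m + 1 \<le> n \<or> n + 1 \<le> m" by auto
    then have "real m + 1 \<le> real n \<or> real n + 1 \<le> real m" by linarith
    then have "\<delta> * (real m + 1) \<le> \<delta> * real n \<or> \<delta> * (real n + 1) \<le> \<delta> * real m"
      using assms by (auto intro: mult_left_mono)
    then show "?I m \<inter> ?I n = {}" by auto
  qed
  have one: "ennreal (\<delta> * tw (u - \<delta> * (real n + 1/2)) / (1 + \<delta>)\<^sup>2)
      \<le> (\<integral>\<^sup>+y. ennreal (tw (u - y)) * indicator (?I n) y \<partial>lborel)" for n
  proof -
    have "ennreal (\<delta> * tw (u - \<delta> * (real n + 1/2)) / (1 + \<delta>)\<^sup>2)
      = (\<integral>\<^sup>+y. ennreal (tw (u - \<delta> * (real n + 1/2)) / (1 + \<delta>)\<^sup>2) * indicator (?I n) y \<partial>lborel)"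
      using assms by (subst nn_integral_cmult_indicator)
        (auto simp: ennreal_mult[symmetric] algebra_simps)
    also have "\<dots> \<le> (\<integral>\<^sup>+y. ennreal (tw (u - y)) * indicator (?I n) y \<partial>lborel)"
    proof (intro nn_integral_mono)
      fix y
      show "ennreal (tw (u - \<delta> * (real n + 1/2)) / (1 + \<delta>)\<^sup>2) * indicator (?I n) y \<le> ennreal (tw (u - y)) * indicator (?I n) y"
      proof (cases "y \<in> ?I n")
        case True
        let ?v = "\<delta> * (real n + 1/2) - y"
        have "\<bar>?v\<bar> \<le> \<delta>" using True assms by (simp add: abs_le_iff algebra_simps)
        have "tw (u - \<delta> * (real n + 1/2)) \<le> (1 + \<bar>?v\<bar>)\<^sup>2 * tw (u - y)"
          using tw_add[of "u - \<delta> * (real n + 1/2)" ?v] by simp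
        also have "\<dots> \<le> (1 + \<delta>)\<^sup>2 * tw (u - y)"
          using \<open>\<bar>?v\<bar> \<le> \<delta>\<close> by (intro mult_right_mono power_mono) auto
        finally have "tw (u - \<delta> * (real n + 1/2)) / (1 + \<delta>)\<^sup>2 \<le> tw (u - y)"
          using assms by (simp add: divide_simps mult.commute)
        then show ?thesis using True by (simp add: ennreal_leI)
      qed simp
    qed
    finally show ?thesis .
  qed
  have "ennreal (\<Sum>n\<in>S. \<delta> * tw (u - \<delta> * (real n + 1/2)) / (1 + \<delta>)\<^sup>2)
    = (\<Sum>n\<in>S. ennreal (\<delta> * tw (u - \<delta> * (real n + 1/2)) / (1 + \<delta>)\<^sup>2))"
    using assms by (subst sum_ennreal) auto
  also have "\<dots> \<le> (\<Sum>n\<in>S. (\<integral>\<^sup>+y. ennreal (tw (u - y)) * indicator (?I n) y \<partial>lborel))"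
    by (intro sum_mono one)
  also have "\<dots> = (\<integral>\<^sup>+y. (\<Sum>n\<in>S. ennreal (tw (u - y)) * indicator (?I n) y) \<partial>lborel)"
    by (subst nn_integral_sum) auto
  also have "\<dots> \<le> (\<integral>\<^sup>+y. ennreal (tw (u + (-1) * y)) \<partial>lborel)"
  proof (intro nn_integral_mono)
    fix y
    have "(\<Sum>n\<in>S. ennreal (tw (u - y)) * indicator (?I n) y) = ennreal (tw (u - y)) * (\<Sum>n\<in>S. indicator (?I n) y)"
      by (simp add: sum_distrib_left)
    also have "(\<Sum>n\<in>S. indicator (?I n) y :: ennreal) = indicator (\<Union>n\<in>S. ?I n) y"
      by (rule indicator_UN_disjoint[symmetric]) (use assms disj in auto)
    also have "ennreal (tw (u - y)) * \<dots> \<le> ennreal (tw (u - y)) * 1"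
      by (intro mult_left_mono) (auto simp: indicator_def)
    finally show "(\<Sum>n\<in>S. ennreal (tw (u - y)) * indicator (?I n) y) \<le> ennreal (tw (u + (-1) * y))" by simp
  qed
  also have "\<dots> = ennreal tw_mass" by (subst nn_integral_tw_affine) auto
  finally have "(\<Sum>n\<in>S. \<delta> * tw (u - \<delta> * (real n + 1/2)) / (1 + \<delta>)\<^sup>2) \<le> tw_mass"
    using tw_mass_nonneg by (simp add: ennreal_le_iff)
  then have "(\<Sum>n\<in>S. tw (u - \<delta> * (real n + 1/2))) * (\<delta> / (1 + \<delta>)\<^sup>2) \<le> tw_mass"
    by (simp add: sum_distrib_left sum_divide_distrib mult.commute)
  then show ?thesis using assms by (simp add: divide_simps mult_ac)
qed

section \<open>Mixed quasi-norms\<close>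

lemma ennpow_ennreal: "0 < r \<Longrightarrow> 0 \<le> x \<Longrightarrow> ennpow (ennreal x) r = ennreal (x powr r)"
  by (simp add: ennpow_def)

lemma ennpow_top [simp]: "ennpow \<infinity> r = \<infinity>" "ennpow top r = top"
  by (simp_all add: ennpow_def)

lemma ennpow_0 [simp]: "ennpow 0 r = 0"
  by (simp add: ennpow_def)

lemma ennpow_1 [simp]: "ennpow x 1 = x"
  by (cases x) (auto simp: ennpow_def)

lemma ennpow_mono: "0 < r \<Longrightarrow> x \<le> y \<Longrightarrow> ennpow x r \<le> ennpow y r"
  by (cases x; cases y) (auto simp: ennpow_def top_unique intro!: ennreal_leI powr_mono2)

lemma measurable_ennpow [measurable]: "(\<lambda>x. ennpow x r) \<in> borel_measurable borel"
  unfolding ennpow_def[abs_def] by measurable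

lemma ennpow_mult: "0 < r \<Longrightarrow> ennpow (x * y) r = ennpow x r * ennpow y r"
proof (cases x; cases y)
  fix a b assume "0 < r" "x = ennreal a" "y = ennreal b" "0 \<le> a" "0 \<le> b"
  then show ?thesis by (simp add: ennreal_mult[symmetric] ennpow_ennreal powr_mult)
next
  fix a assume a: "0 < r" "x = ennreal a" "0 \<le> a" "y = top"
  then show ?thesis by (cases "a = 0") (auto simp: ennreal_mult_top ennpow_ennreal)
next
  fix a assume a: "0 < r" "y = ennreal a" "0 \<le> a" "x = top"
  then show ?thesis by (cases "a = 0") (auto simp: ennreal_top_mult ennpow_ennreal)
qed auto

lemma ennpow_ennpow: "0 < r \<Longrightarrow> 0 < s \<Longrightarrow> ennpow (ennpow x r) s = ennpow x (r * s)"
  by (cases x) (auto simp: ennpow_ennreal powr_powr)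

lemma ennpow_inverse: "0 < r \<Longrightarrow> ennpow (ennpow x r) (1 / r) = x" "0 < r \<Longrightarrow> ennpow (ennpow x (1 / r)) r = x"
  by (simp_all add: ennpow_ennpow)

text \<open>Divide by the sum: for \<open>z\<close> between 0 and 1 one has
  \<open>z \<le> z powr r\<close>, and the two quotients add up to 1.\<close>

lemma powr_add_le:
  fixes x y r :: real assumes "0 < r" "r \<le> 1" "0 \<le> x" "0 \<le> y"
  shows "(x + y) powr r \<le> x powr r + y powr r"
proof (cases "x + y = 0")
  case True then show ?thesis using assms by simp
next
  case False
  then have s: "x + y > 0" using assms by simp
  have *: "z / (x + y) \<le> (z / (x + y)) powr r" if "0 \<le> z" "z \<le> x + y" for z
  proof (cases "z = 0")
    case False
    then have "(z / (x + y)) powr 1 \<le> (z / (x + y)) powr r"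
      using that s assms by (intro powr_mono') auto
    then show ?thesis using that s by simp
  qed simp
  have "1 = x / (x + y) + y / (x + y)" using s by (simp add: add_divide_distrib[symmetric])
  also have "\<dots> \<le> (x / (x + y)) powr r + (y / (x + y)) powr r"
    using assms by (intro add_mono *) auto
  also have "\<dots> = (x powr r + y powr r) / (x + y) powr r"
    using s assms by (simp add: powr_divide add_divide_distrib)
  finally show ?thesis using s by (simp add: divide_simps)
qed

lemma powr_sum_le:
  fixes f :: "'b \<Rightarrow> real" assumes "0 < r" "r \<le> 1" "\<And>i. i \<in> A \<Longrightarrow> 0 \<le> f i"
  shows "(\<Sum>i\<in>A. f i) powr r \<le> (\<Sum>i\<in>A. f i powr r)"
  using assms(3)
proof (induction A rule: infinite_finite_induct)
  case (insert x F)
  have "(f x + (\<Sum>i\<in>F. f i)) powr r \<le> f x powr r + (\<Sum>i\<in>F. f i) powr r"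
    using insert assms by (intro powr_add_le sum_nonneg) auto
  also have "\<dots> \<le> f x powr r + (\<Sum>i\<in>F. f i powr r)" using insert by auto
  finally show ?case using insert by simp
qed auto

section \<open>Iterated integration in single coordinates\<close>

abbreviation upd :: "'d::finite rvec \<Rightarrow> 'd \<Rightarrow> real \<Rightarrow> 'd rvec" where
  "upd x i t \<equiv> (\<chi> k. if k = i then t else x $ k)"

lemma measurable_upd [measurable]:
  "(\<lambda>(x, t). upd x i t) \<in> borel_measurable (borel \<Otimes>\<^sub>M lborel)"
  by (subst borel_measurable_euclidean_space) (auto simp: Basis_vec_axis inner_axis split_beta')

lemma measurable_coord_Lp [measurable]:
  fixes p :: "'d::finite rvec"
  assumes [measurable]: "F \<in> borel_measurable borel"
  shows "coord_Lp p i F \<in> borel_measurable borel"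
proof -
  have "(\<lambda>x. \<integral>\<^sup>+ t. ennpow (F (upd x i t)) (p $ i) \<partial>lborel) \<in> borel_measurable borel"
  proof (rule lborel.borel_measurable_nn_integral)
    have "(\<lambda>z. ennpow (F ((\<lambda>(x, t). upd x i t) z)) (p $ i)) \<in> borel_measurable (borel \<Otimes>\<^sub>M lborel)"
      by measurable
    then show "(\<lambda>(x, t). ennpow (F (upd x i t)) (p $ i)) \<in> borel_measurable (borel \<Otimes>\<^sub>M lborel)"
      by (simp add: split_beta')
  qed
  then show ?thesis unfolding coord_Lp_def[abs_def] by measurable
qed

lemma measurable_upd' [measurable]:
  "(\<lambda>t. upd x i t) \<in> borel_measurable borel"
  by (subst borel_measurable_euclidean_space) (auto simp: Basis_vec_axis inner_axis)

lemma coord_Lp_mono: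
  assumes "\<And>i. 0 < p $ i" "\<And>x. F x \<le> G x"
  shows "coord_Lp p i F x \<le> coord_Lp p i G x"
  unfolding coord_Lp_def using assms by (intro ennpow_mono nn_integral_mono) auto

lemma fold_coord_Lp_mono:
  assumes "\<And>i. 0 < p $ i" "\<And>x. F x \<le> G x"
  shows "fold (coord_Lp p) xs F x \<le> fold (coord_Lp p) xs G x"
  using assms(2)
proof (induction xs arbitrary: F G)
  case (Cons a xs)
  show ?case using Cons.IH[of "coord_Lp p a F" "coord_Lp p a G"] coord_Lp_mono[of p F G] assms(1) Cons.prems
    by auto
qed simp

lemma mixed_norm_mono:
  assumes "\<And>i. 0 < p $ i" "\<And>x. F x \<le> G x"
  shows "mixed_norm p F \<le> mixed_norm p G"
  unfolding mixed_norm_def by (rule fold_coord_Lp_mono[OF assms])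

text \<open>In one coordinate the exponents \<open>p $ i / t\<close> applied to a
  \<open>t\<close>-th power give the \<open>t\<close>-th power of the old quasi-norm, so
  \<open>t\<close> travels through the whole iteration. This is the device that trades small
  exponents for larger ones.\<close>

lemma mixed_norm_power:
  assumes p: "\<And>i. 0 < p $ i" and t: "0 < t"
  shows "mixed_norm ((1 / t) *\<^sub>R p) (\<lambda>x. ennpow (F x) t) = ennpow (mixed_norm p F) t"
proof -
  have 1: "coord_Lp ((1 / t) *\<^sub>R p) i (\<lambda>x. ennpow (G x) t) = (\<lambda>x. ennpow (coord_Lp p i G x) t)" for i G
    using p[of i] t by (auto simp: coord_Lp_def ennpow_ennpow field_simps)
  have "fold (coord_Lp ((1 / t) *\<^sub>R p)) xs (\<lambda>x. ennpow (F x) t) = (\<lambda>x. ennpow (fold (coord_Lp p) xs F x) t)" for xs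
    by (induction xs arbitrary: F) (auto simp: 1)
  then show ?thesis by (simp add: mixed_norm_def)
qed

lemma mixed_norm_cmult:
  fixes p :: "'d::{finite,linorder} rvec"
  assumes p: "\<And>i. 0 < p $ i" and F: "F \<in> borel_measurable borel"
  shows "mixed_norm p (\<lambda>x. c * F x) = c * mixed_norm p F"
proof -
  have 1: "coord_Lp p i (\<lambda>x. c * G x) = (\<lambda>x. c * coord_Lp p i G x)" if [measurable]: "G \<in> borel_measurable borel" for i G
  proof
    fix x
    have "(\<integral>\<^sup>+ t. ennpow (c * G (upd x i t)) (p $ i) \<partial>lborel) = ennpow c (p $ i) * (\<integral>\<^sup>+ t. ennpow (G (upd x i t)) (p $ i) \<partial>lborel)"
      using p[of i] by (subst nn_integral_cmult[symmetric]) (auto simp: ennpow_mult)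
    then show "coord_Lp p i (\<lambda>x. c * G x) x = c * coord_Lp p i G x"
      using p[of i] by (simp add: coord_Lp_def ennpow_mult ennpow_inverse)
  qed
  have "fold (coord_Lp p) xs (\<lambda>x. c * F x) = (\<lambda>x. c * fold (coord_Lp p) xs F x)" for xs
    using F
  proof (induction xs arbitrary: F)
    case (Cons i xs)
    then show ?case using Cons.IH[of "coord_Lp p i F"] by (simp add: 1)
  qed simp
  then show ?thesis by (simp add: mixed_norm_def)
qed

lemma mixed_norm_prod:
  fixes p :: "'d::{finite,linorder} rvec" and f :: "'d \<Rightarrow> real \<Rightarrow> ennreal"
  assumes p: "\<And>i. 0 < p $ i" and [measurable]: "\<And>i. f i \<in> borel_measurable borel"
  shows "mixed_norm p (\<lambda>x. \<Prod>i\<in>UNIV. f i (x $ i))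
    = (\<Prod>i\<in>UNIV. ennpow (\<integral>\<^sup>+t. ennpow (f i t) (p $ i) \<partial>lborel) (1 / p $ i))"
proof -
  let ?N = "\<lambda>i. ennpow (\<integral>\<^sup>+t. ennpow (f i t) (p $ i) \<partial>lborel) (1 / p $ i)"
  \<comment> \<open>\<open>K\<close> collects the factors that are already integrated,
    \<open>A\<close> the coordinates on which the function still depends.\<close>
  have step: "coord_Lp p j (\<lambda>x. K * (\<Prod>i\<in>A. f i (x $ i))) = (\<lambda>x. K * ?N j * (\<Prod>i\<in>A - {j}. f i (x $ i)))"
    if "j \<in> A" for j K and A :: "'d set"
  proof
    fix x :: "'d rvec"
    have fin: "finite A" by simp
    let ?c = "K * (\<Prod>i\<in>A - {j}. f i (x $ i))"
    have "(\<integral>\<^sup>+ t. ennpow (K * (\<Prod>i\<in>A. f i (upd x j t $ i))) (p $ j) \<partial>lborel)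
      = (\<integral>\<^sup>+ t. ennpow ?c (p $ j) * ennpow (f j t) (p $ j) \<partial>lborel)"
    proof (intro nn_integral_cong)
      fix t
      have "(\<Prod>i\<in>A. f i (upd x j t $ i)) = f j t * (\<Prod>i\<in>A - {j}. f i (x $ i))"
        by (subst prod.remove[OF fin that]) auto
      then show "ennpow (K * (\<Prod>i\<in>A. f i (upd x j t $ i))) (p $ j) = ennpow ?c (p $ j) * ennpow (f j t) (p $ j)"
        using p[of j] by (simp add: ennpow_mult[symmetric] mult_ac)
    qed
    also have "\<dots> = ennpow ?c (p $ j) * (\<integral>\<^sup>+ t. ennpow (f j t) (p $ j) \<partial>lborel)"
      by (rule nn_integral_cmult) simp
    finally show "coord_Lp p j (\<lambda>x. K * (\<Prod>i\<in>A. f i (x $ i))) x = K * ?N j * (\<Prod>i\<in>A - {j}. f i (x $ i))"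
      using p[of j] by (simp add: coord_Lp_def ennpow_mult ennpow_inverse mult_ac)
  qed
  have "fold (coord_Lp p) xs (\<lambda>x. K * (\<Prod>i\<in>A. f i (x $ i))) = (\<lambda>x. K * (\<Prod>i\<in>set xs. ?N i) * (\<Prod>i\<in>A - set xs. f i (x $ i)))"
    if "distinct xs" "set xs \<subseteq> A" for xs K and A :: "'d set"
    using that
  proof (induction xs arbitrary: K A)
    case (Cons j xs)
    then have "fold (coord_Lp p) (j # xs) (\<lambda>x. K * (\<Prod>i\<in>A. f i (x $ i)))
      = fold (coord_Lp p) xs (\<lambda>x. K * ?N j * (\<Prod>i\<in>A - {j}. f i (x $ i)))"
      by (simp add: step)
    also have "\<dots> = (\<lambda>x. K * ?N j * (\<Prod>i\<in>set xs. ?N i) * (\<Prod>i\<in>A - {j} - set xs. f i (x $ i)))"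
      using Cons.prems by (intro Cons.IH) auto
    also have "A - {j} - set xs = A - set (j # xs)" by auto
    finally show ?case using Cons.prems by (simp add: mult.assoc)
  qed simp
  from this[of "sorted_list_of_set UNIV" UNIV 1] show ?thesis
    by (simp add: mixed_norm_def)
qed

text \<open>Tonelli's theorem. The induction appends at the end of the list, because the last
  coordinate carries the outermost integral.\<close>

lemma fold_coord_L1:
  fixes F :: "'d::finite rvec \<Rightarrow> ennreal"
  assumes [measurable]: "F \<in> borel_measurable borel" and "distinct xs"
  shows "fold (coord_Lp (\<chi> i. 1)) xs F x
    = (\<integral>\<^sup>+y. F (\<chi> k. if k \<in> set xs then y k else x $ k) \<partial>(\<Pi>\<^sub>M i\<in>set xs. lborel))"
  using assms(2)
proof (induction xs arbitrary: x rule: rev_induct)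
  case Nil
  interpret product_sigma_finite "\<lambda>i::'d. lborel :: real measure" by standard
  show ?case by (simp add: space_PiM_empty nn_integral_empty)
next
  case (snoc i xs)
  interpret product_sigma_finite "\<lambda>i::'d. lborel :: real measure" by standard
  have meas: "(\<lambda>y. \<chi> k. if k \<in> insert i (set xs) then y k else x $ k) \<in> (\<Pi>\<^sub>M i\<in>insert i (set xs). lborel) \<rightarrow>\<^sub>M borel"
  proof (subst borel_measurable_euclidean_space, safe)
    fix b :: "'d rvec" assume "b \<in> Basis"
    then obtain l where "b = axis l 1" by (auto simp: Basis_vec_axis)
    then show "(\<lambda>y. (\<chi> k. if k \<in> insert i (set xs) then y k else x $ k) \<bullet> b) \<in> borel_measurable (\<Pi>\<^sub>M i\<in>insert i (set xs). lborel)"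
      by (cases "l \<in> insert i (set xs)") (auto simp: inner_axis)
  qed
  have "fold (coord_Lp (\<chi> i. 1)) (xs @ [i]) F x = (\<integral>\<^sup>+t. fold (coord_Lp (\<chi> i. 1)) xs F (upd x i t) \<partial>lborel)"
    by (simp add: coord_Lp_def)
  also have "\<dots> = (\<integral>\<^sup>+t. \<integral>\<^sup>+y. F (\<chi> k. if k \<in> set xs then y k else upd x i t $ k) \<partial>(\<Pi>\<^sub>M i\<in>set xs. lborel) \<partial>lborel)"
    using snoc by simp
  also have "\<dots> = (\<integral>\<^sup>+t. \<integral>\<^sup>+y. F (\<chi> k. if k \<in> insert i (set xs) then (y(i := t)) k else x $ k) \<partial>(\<Pi>\<^sub>M i\<in>set xs. lborel) \<partial>lborel)"
    using snoc.prems
    by (intro nn_integral_cong arg_cong[of _ _ F]) (auto simp: vec_eq_iff)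
  also have "\<dots> = (\<integral>\<^sup>+y. F (\<chi> k. if k \<in> insert i (set xs) then y k else x $ k) \<partial>(\<Pi>\<^sub>M i\<in>insert i (set xs). lborel))"
    using snoc.prems measurable_compose[OF meas assms(1)] by (subst product_nn_integral_insert_rev) auto
  finally show ?case by simp
qed

lemma mixed_norm_1:
  fixes F :: "'d::{finite,linorder} rvec \<Rightarrow> ennreal"
  assumes [measurable]: "F \<in> borel_measurable borel"
  shows "mixed_norm (\<chi> i. 1) F = (\<integral>\<^sup>+x. F x \<partial>lborel)"
  unfolding mixed_norm_def
  by (subst fold_coord_L1) (auto simp: lborel_vec nn_integral_distr)

text \<open>The \<open>s\<close>-th power reduces equal exponents to exponents 1, where the iterated
  integral is the integral over the whole space.\<close>

lemma mixed_norm_const: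
  fixes p :: "'d::{finite,linorder} rvec"
  assumes "\<And>i. p $ i = s" "0 < s" and [measurable]: "F \<in> borel_measurable borel"
  shows "mixed_norm p F = ennpow (\<integral>\<^sup>+x. ennpow (F x) s \<partial>lborel) (1 / s)"
proof -
  have "(1 / s) *\<^sub>R p = (\<chi> i. 1)" using assms by (simp add: vec_eq_iff)
  then have "(\<integral>\<^sup>+x. ennpow (F x) s \<partial>lborel) = ennpow (mixed_norm p F) s"
    using mixed_norm_power[of p s F] assms by (simp add: mixed_norm_1)
  then show ?thesis using assms by (simp add: ennpow_inverse)
qed

section \<open>Hoelder's inequality for mixed norms\<close>

lemma Young_ennreal:
  assumes "1 < s" "1 / s + 1 / s' = 1"
  shows "x * y \<le> ennreal (1 / s) * ennpow x s + ennreal (1 / s') * ennpow y s'"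
proof -
  have s': "0 < s'" "0 < s" using assms by (auto simp: field_simps intro: ccontr)
     (smt (verit) divide_nonneg_nonpos divide_less_eq_1 assms)+
  have top: "ennreal (1 / s) * top = top" "ennreal (1 / s') * top = top"
    using s' by (auto simp: ennreal_mult_top)
  show ?thesis
  proof (cases x; cases y)
    fix a b assume ab: "x = ennreal a" "y = ennreal b" "0 \<le> a" "0 \<le> b"
    have "1 < s'" using assms s' by (smt (verit) divide_less_eq_1 zero_less_divide_1_iff)
    then have "a * b \<le> a powr s / s + b powr s' / s'"
      using assms ab by (intro Youngs_inequality) auto
    then show ?thesis using ab s'
      by (simp add: ennpow_ennreal ennreal_mult[symmetric] ennreal_plus[symmetric] del: ennreal_plus)
  next
    fix a assume "x = ennreal a" "y = top"
    then show ?thesis using top by simp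
  next
    fix a assume "y = ennreal a" "x = top"
    then show ?thesis using top by simp
  next
    assume "x = top" "y = top"
    then show ?thesis using top by simp
  qed
qed

lemma Holder_nn_integral:
  fixes f g :: "'b \<Rightarrow> ennreal"
  assumes s: "1 < s" "1 / s + 1 / s' = 1"
    and [measurable]: "f \<in> borel_measurable M" "g \<in> borel_measurable M"
  shows "(\<integral>\<^sup>+x. f x * g x \<partial>M) \<le> ennpow (\<integral>\<^sup>+x. ennpow (f x) s \<partial>M) (1 / s) * ennpow (\<integral>\<^sup>+x. ennpow (g x) s' \<partial>M) (1 / s')"
proof -
  have s': "0 < s'" "0 < s" using assms by (auto simp: field_simps intro: ccontr)
     (smt (verit) divide_nonneg_nonpos divide_less_eq_1 assms)+
  let ?I = "\<integral>\<^sup>+x. ennpow (f x) s \<partial>M" and ?J = "\<integral>\<^sup>+x. ennpow (g x) s' \<partial>M"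
  \<comment> \<open>With the convention \<open>0 * top = 0\<close> the right side is 0 as soon as
    one integral vanishes, even if the other one is infinite, so this case is settled
    separately.\<close>
  have eq0: "(\<integral>\<^sup>+x. f x * g x \<partial>M) = 0" if "?I = 0 \<or> ?J = 0"
  proof -
    have p0: "ennpow z r = 0 \<longleftrightarrow> z = 0" if "0 < r" for z r
      using that by (cases z) (auto simp: ennpow_ennreal)
    have "AE x in M. f x = 0 \<or> g x = 0"
      using \<open>?I = 0 \<or> ?J = 0\<close>
    proof
      assume "?I = 0"
      then have "AE x in M. ennpow (f x) s = 0" by (subst (asm) nn_integral_0_iff_AE) auto
      then show ?thesis using s' by (simp add: p0) (auto elim: eventually_mono)
    next
      assume "?J = 0"
      then have "AE x in M. ennpow (g x) s' = 0" by (subst (asm) nn_integral_0_iff_AE) auto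
      then show ?thesis using s' by (simp add: p0) (auto elim: eventually_mono)
    qed
    then show ?thesis by (subst nn_integral_0_iff_AE) auto
  qed
  show ?thesis
  proof (cases "?I = 0 \<or> ?J = 0")
    case True then show ?thesis using eq0 by simp
  next
    case ne: False
    show ?thesis
    proof (cases "?I = top \<or> ?J = top")
      case True
      have "ennpow z r \<noteq> 0" if "z \<noteq> 0" "0 < r" for z r
        using that by (cases z) (auto simp: ennpow_ennreal)
      then show ?thesis using True ne s' by (auto simp: ennreal_mult_top ennreal_top_mult)
    next
      case False
      then obtain a b where ab: "?I = ennreal a" "?J = ennreal b" "0 < a" "0 < b"
        using ne by (cases ?I; cases ?J) (auto simp: less_le)
      \<comment> \<open>After division by these norms, Young's inequality integrates to exactly
        \<open>1 / s + 1 / s' = 1\<close>.\<close>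
      define A B where "A = a powr (1 / s)" and "B = b powr (1 / s')"
      have AB: "A > 0" "B > 0" "A powr s = a" "B powr s' = b"
        using ab s' by (auto simp: A_def B_def powr_powr)
      have one: "x * y \<le> ennreal (A * B) * (ennreal (1 / (s * a)) * ennpow x s + ennreal (1 / (s' * b)) * ennpow y s')" for x y
      proof -
        have eq: "x * y = ennreal (A * B) * ((ennreal (1 / A) * x) * (ennreal (1 / B) * y))"
        proof -
          have "ennreal (A * B) * ((ennreal (1 / A) * x) * (ennreal (1 / B) * y))
            = (ennreal (A * B) * ennreal (1 / A) * ennreal (1 / B)) * (x * y)" by (simp add: mult_ac)
          also have "ennreal (A * B) * ennreal (1 / A) * ennreal (1 / B) = 1"
            using AB by (simp add: ennreal_mult[symmetric] field_simps)
          finally show ?thesis by simp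
        qed
        have "(ennreal (1 / A) * x) * (ennreal (1 / B) * y) \<le>
          ennreal (1 / s) * ennpow (ennreal (1 / A) * x) s + ennreal (1 / s') * ennpow (ennreal (1 / B) * y) s'"
          by (rule Young_ennreal[OF s])
        also have "\<dots> = ennreal (1 / (s * a)) * ennpow x s + ennreal (1 / (s' * b)) * ennpow y s'"
          using AB s' ab by (simp add: ennpow_mult ennpow_ennreal powr_divide mult.assoc[symmetric] ennreal_mult[symmetric])
        finally show ?thesis unfolding eq by (rule mult_left_mono) simp
      qed
      have "(\<integral>\<^sup>+x. f x * g x \<partial>M) \<le> (\<integral>\<^sup>+x. ennreal (A * B) * (ennreal (1 / (s * a)) * ennpow (f x) s + ennreal (1 / (s' * b)) * ennpow (g x) s') \<partial>M)"
        by (intro nn_integral_mono one)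
      also have "\<dots> = ennreal (A * B) * (ennreal (1 / (s * a)) * ?I + ennreal (1 / (s' * b)) * ?J)"
        by (simp add: nn_integral_cmult nn_integral_add)
      also have "ennreal (1 / (s * a)) * ?I + ennreal (1 / (s' * b)) * ?J = ennreal (1 / s + 1 / s')"
        using ab s' by (simp add: ennreal_mult[symmetric] ennreal_plus[symmetric] del: ennreal_plus)
      also have "ennreal (A * B) * ennreal (1 / s + 1 / s') = ennpow ?I (1 / s) * ennpow ?J (1 / s')"
        using s s' ab AB by (simp add: ennpow_ennreal ennreal_mult A_def B_def)
      finally show ?thesis .
    qed
  qed
qed

text \<open>The one-dimensional inequality is applied coordinate by coordinate to the norms already
  formed, so the pair of conjugate exponents may change with the coordinate.\<close>

lemma Holder_mixed_norm:
  fixes s s' :: "'d::{finite,linorder} rvec"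
  assumes s: "\<And>i. 1 < s $ i" "\<And>i. 1 / s $ i + 1 / s' $ i = 1"
    and F: "F \<in> borel_measurable borel" and H: "H \<in> borel_measurable borel"
  shows "(\<integral>\<^sup>+x. F x * H x \<partial>lborel) \<le> mixed_norm s F * mixed_norm s' H"
proof -
  have step: "coord_Lp (\<chi> i. 1) i (\<lambda>x. F x * H x) x \<le> coord_Lp s i F x * coord_Lp s' i H x"
    if [measurable]: "F \<in> borel_measurable borel" "H \<in> borel_measurable borel" for i F H x
    unfolding coord_Lp_def using Holder_nn_integral[OF s(1,2)[of i], of "\<lambda>t. F (upd x i t)" lborel "\<lambda>t. H (upd x i t)"]
    by simp
  have "fold (coord_Lp (\<chi> i. 1)) xs (\<lambda>x. F x * H x) x \<le> fold (coord_Lp s) xs F x * fold (coord_Lp s') xs H x" for xs x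
    using F H
  proof (induction xs arbitrary: F H)
    case (Cons i xs)
    have "fold (coord_Lp (\<chi> i. 1)) xs (coord_Lp (\<chi> i. 1) i (\<lambda>x. F x * H x)) x
      \<le> fold (coord_Lp (\<chi> i. 1)) xs (\<lambda>x. coord_Lp s i F x * coord_Lp s' i H x) x"
      by (intro fold_coord_Lp_mono) (auto intro: step Cons.prems)
    also have "\<dots> \<le> fold (coord_Lp s) xs (coord_Lp s i F) x * fold (coord_Lp s') xs (coord_Lp s' i H) x"
      using Cons.prems by (intro Cons.IH) auto
    finally show ?case by simp
  qed simp
  from this[of "sorted_list_of_set UNIV" 0] show ?thesis
    using F H by (simp add: mixed_norm_def[symmetric] mixed_norm_1)
qed

section \<open>Functions of class \<open>C\<^sup>k\<close> on an open set\<close>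

text \<open>A finite order of smoothness makes induction possible for products and quotients. The
  open set \<open>S\<close> allows gluing by \<open>Ck_Un\<close>, and thereby division by a
  function that may vanish outside the region of interest.\<close>

fun Ck :: "nat \<Rightarrow> 'a::euclidean_space set \<Rightarrow> ('a \<Rightarrow> 'b::real_normed_vector) \<Rightarrow> bool" where
  "Ck 0 S f \<longleftrightarrow> continuous_on S f"
| "Ck (Suc n) S f \<longleftrightarrow> (\<forall>x\<in>S. f differentiable (at x)) \<and>
     (\<forall>b\<in>Basis. Ck n S (\<lambda>x. frechet_derivative f (at x) b))"

lemma Ck_cong:
  assumes "open S" "\<And>x. x \<in> S \<Longrightarrow> f x = g x" "Ck n S f"
  shows "Ck n S g"
  using assms(2,3)
proof (induction n arbitrary: f g)
  case 0 then show ?case by (simp cong: continuous_on_cong)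
next
  case (Suc n)
  have D: "(g has_derivative frechet_derivative f (at x)) (at x)" if "x \<in> S" for x
  proof (rule has_derivative_transform_within_open[OF _ assms(1) that])
    show "(f has_derivative frechet_derivative f (at x)) (at x)"
      using Suc.prems(2) that by (simp add: frechet_derivative_works)
  qed (use Suc.prems in auto)
  show ?case unfolding Ck.simps
  proof (intro conjI ballI)
    fix x assume "x \<in> S" then show "g differentiable (at x)" using D differentiableI by blast
  next
    fix b :: 'a assume b: "b \<in> Basis"
    show "Ck n S (\<lambda>x. frechet_derivative g (at x) b)"
    proof (rule Suc.IH)
      show "Ck n S (\<lambda>x. frechet_derivative f (at x) b)" using Suc.prems b by simp
      show "frechet_derivative f (at x) b = frechet_derivative g (at x) b" if "x \<in> S" for x
        using frechet_derivative_at[OF D[OF that]] by simp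
    qed
  qed
qed

lemma Ck_SucI:
  assumes "open S" "\<And>x. x \<in> S \<Longrightarrow> (f has_derivative f' x) (at x)"
    "\<And>b. b \<in> Basis \<Longrightarrow> Ck n S (\<lambda>x. f' x b)"
  shows "Ck (Suc n) S f"
  unfolding Ck.simps
proof (intro conjI ballI)
  fix x assume "x \<in> S" then show "f differentiable (at x)" using assms(2) differentiableI by blast
next
  fix b :: 'a assume "b \<in> Basis"
  then have "Ck n S (\<lambda>x. f' x b)" by (rule assms(3))
  moreover have "f' x b = frechet_derivative f (at x) b" if "x \<in> S" for x
    using frechet_derivative_at[OF assms(2)[OF that]] by simp
  ultimately show "Ck n S (\<lambda>x. frechet_derivative f (at x) b)"
    by (rule Ck_cong[OF assms(1), rotated])
qed

lemma Ck_has_derivative: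
  "Ck (Suc n) S f \<Longrightarrow> x \<in> S \<Longrightarrow> (f has_derivative frechet_derivative f (at x)) (at x)"
  by (simp add: frechet_derivative_works)

lemma Ck_partial: "Ck (Suc n) S f \<Longrightarrow> b \<in> Basis \<Longrightarrow> Ck n S (\<lambda>x. frechet_derivative f (at x) b)"
  by simp

lemma Ck_Suc_imp: "Ck (Suc n) S f \<Longrightarrow> Ck n S f"
proof (induction n arbitrary: f)
  case 0
  then have "continuous (at x) f" if "x \<in> S" for x
    using that differentiable_imp_continuous_within[of f x UNIV] by simp
  then show ?case by (simp add: continuous_at_imp_continuous_on)
next
  case (Suc n)
  from Suc.prems have "\<forall>x\<in>S. f differentiable (at x)" "\<forall>b\<in>Basis. Ck (Suc n) S (\<lambda>x. frechet_derivative f (at x) b)"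
    by (auto simp only: Ck.simps(2)[of "Suc n"])
  then show ?case using Suc.IH by (simp only: Ck.simps(2)[of n]) blast
qed

lemma Ck_continuous_on: "Ck n S f \<Longrightarrow> continuous_on S f"
proof (induction n)
  case (Suc n) then show ?case using Ck_Suc_imp by blast
qed simp

lemma Ck_subset: "Ck n S f \<Longrightarrow> T \<subseteq> S \<Longrightarrow> Ck n T f"
  by (induction n arbitrary: f) (auto intro: continuous_on_subset)

lemma Ck_Un: "open S \<Longrightarrow> open T \<Longrightarrow> Ck n S f \<Longrightarrow> Ck n T f \<Longrightarrow> Ck n (S \<union> T) f"
  by (induction n arbitrary: f) (auto intro: continuous_on_open_Un)

lemma Ck_const: "Ck n S (\<lambda>_. c)"
  by (induction n arbitrary: c) auto

lemma Ck_add: "open S \<Longrightarrow> Ck n S f \<Longrightarrow> Ck n S g \<Longrightarrow> Ck n S (\<lambda>x. f x + g x)"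
proof (induction n arbitrary: f g)
  case 0 then show ?case by (auto intro: continuous_on_add)
next
  case (Suc n)
  show ?case
    by (rule Ck_SucI[OF \<open>open S\<close> has_derivative_add[OF Ck_has_derivative Ck_has_derivative]])
       (use Suc in auto)
qed

lemma Ck_bounded_linear: "open S \<Longrightarrow> bounded_linear L \<Longrightarrow> Ck n S f \<Longrightarrow> Ck n S (\<lambda>x. L (f x))"
proof (induction n arbitrary: f)
  case 0 then show ?case by (simp add: bounded_linear.continuous_on)
next
  case (Suc n)
  show ?case
    by (rule Ck_SucI[OF \<open>open S\<close> bounded_linear.has_derivative[OF Suc(3) Ck_has_derivative]])
       (use Suc in auto)
qed

lemma Ck_mult:
  fixes f g :: "'a::euclidean_space \<Rightarrow> 'b::real_normed_algebra"
  shows "open S \<Longrightarrow> Ck n S f \<Longrightarrow> Ck n S g \<Longrightarrow> Ck n S (\<lambda>x. f x * g x)"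
proof (induction n arbitrary: f g)
  case 0 then show ?case by (auto intro: continuous_on_mult)
next
  case (Suc n)
  show ?case
  proof (rule Ck_SucI[OF \<open>open S\<close> has_derivative_mult[OF Ck_has_derivative Ck_has_derivative]])
    fix b :: 'a assume "b \<in> Basis"
    then show "Ck n S (\<lambda>x. f x * frechet_derivative g (at x) b + frechet_derivative f (at x) b * g x)"
      using Suc.prems Ck_Suc_imp[OF Suc.prems(2)] Ck_Suc_imp[OF Suc.prems(3)]
      by (intro Ck_add Suc.IH) auto
  qed (use Suc.prems in auto)
qed

lemma Ck_sum:
  assumes "open S" "\<And>i. i \<in> A \<Longrightarrow> Ck n S (f i)" shows "Ck n S (\<lambda>x. \<Sum>i\<in>A. f i x)"
  using assms(2) by (induction A rule: infinite_finite_induct) (auto intro!: Ck_const Ck_add assms(1))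

lemma Ck_prod:
  fixes f :: "'i \<Rightarrow> 'a::euclidean_space \<Rightarrow> 'b::real_normed_field"
  assumes "open S" "\<And>i. i \<in> A \<Longrightarrow> Ck n S (f i)" shows "Ck n S (\<lambda>x. \<Prod>i\<in>A. f i x)"
  using assms(2) by (induction A rule: infinite_finite_induct) (auto intro!: Ck_const Ck_mult assms(1))

lemma Ck_inverse:
  fixes f :: "'a::euclidean_space \<Rightarrow> 'b::real_normed_field"
  shows "open S \<Longrightarrow> Ck n S f \<Longrightarrow> (\<And>x. x \<in> S \<Longrightarrow> f x \<noteq> 0) \<Longrightarrow> Ck n S (\<lambda>x. inverse (f x))"
proof (induction n arbitrary: f)
  case 0 then show ?case by (auto intro: continuous_on_inverse)
next
  case (Suc n)
  show ?case
  proof (rule Ck_SucI[OF \<open>open S\<close> Deriv.has_derivative_inverse[OF _ Ck_has_derivative]])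
    fix b :: 'a assume b: "b \<in> Basis"
    have "Ck n S (\<lambda>x. inverse (f x))"
      using Suc.prems by (intro Suc.IH Ck_Suc_imp[of n S f]) auto
    then show "Ck n S (\<lambda>x. - (inverse (f x) * frechet_derivative f (at x) b * inverse (f x)))"
      using b Suc.prems by (intro Ck_bounded_linear[OF \<open>open S\<close>, of uminus] Ck_mult Ck_partial bounded_linear_minus bounded_linear_ident)
  qed (use Suc.prems in auto)
qed

lemma Ck_compose_affine:
  fixes f :: "real \<Rightarrow> 'b::real_normed_vector" and c :: "'a::euclidean_space"
  shows "Ck n UNIV f \<Longrightarrow> Ck n UNIV (\<lambda>x. f (c \<bullet> x + d))"
proof (induction n arbitrary: f)
  case 0
  have "continuous_on UNIV (\<lambda>x. c \<bullet> x + d)" by (intro continuous_intros)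
  with 0 show ?case using continuous_on_compose2[of UNIV f UNIV "\<lambda>x. c \<bullet> x + d"] by simp
next
  case (Suc n)
  have D: "((\<lambda>x. f (c \<bullet> x + d)) has_derivative (\<lambda>h. (c \<bullet> h) *\<^sub>R frechet_derivative f (at (c \<bullet> x + d)) 1)) (at x)" for x
  proof -
    have "(f has_derivative frechet_derivative f (at (c \<bullet> x + d))) (at (c \<bullet> x + d))"
      using Suc.prems by (simp add: frechet_derivative_works)
    then have "((\<lambda>x. f (c \<bullet> x + d)) has_derivative (\<lambda>h. frechet_derivative f (at (c \<bullet> x + d)) (c \<bullet> h))) (at x)"
      by (rule has_derivative_compose[rotated])
         (intro has_derivative_add_const has_derivative_inner_right has_derivative_ident)
    moreover have "frechet_derivative f (at (c \<bullet> x + d)) (c \<bullet> h) = (c \<bullet> h) *\<^sub>R frechet_derivative f (at (c \<bullet> x + d)) 1" for h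
      using Suc.prems linear_scale[OF linear_frechet_derivative, of f "at (c \<bullet> x + d)" "c \<bullet> h" 1] by simp
    ultimately show ?thesis by simp
  qed
  show ?case
  proof (rule Ck_SucI[OF open_UNIV D])
    fix b :: 'a
    show "Ck n UNIV (\<lambda>x. (c \<bullet> b) *\<^sub>R frechet_derivative f (at (c \<bullet> x + d)) 1)"
      using Suc.IH[of "\<lambda>y. frechet_derivative f (at y) 1"] Suc.prems
      by (intro Ck_bounded_linear[OF open_UNIV bounded_linear_scaleR_right]) auto
  qed
qed

text \<open>\<open>iterated_partial\<close> applies the head of its list last, whereas
  \<open>Ck\<close> differentiates the given function first. Splitting off the last direction
  mediates between the two orders.\<close>

lemma iterated_partial_snoc:
  "iterated_partial (bs @ [b]) f = iterated_partial bs (\<lambda>x. frechet_derivative f (at x) b)"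
  by (induction bs) auto

lemma smooth_partial: "smooth f \<Longrightarrow> b \<in> Basis \<Longrightarrow> smooth (\<lambda>x. frechet_derivative f (at x) b)"
  unfolding smooth_def
proof (intro allI impI)
  fix bs :: "'a list"
  assume f: "\<forall>bs. set bs \<subseteq> Basis \<longrightarrow> iterated_partial bs f differentiable_on UNIV" and "b \<in> Basis" "set bs \<subseteq> Basis"
  then have "set (bs @ [b]) \<subseteq> Basis" by simp
  with f have "iterated_partial (bs @ [b]) f differentiable_on UNIV" by blast
  then show "iterated_partial bs (\<lambda>x. frechet_derivative f (at x) b) differentiable_on UNIV"
    by (simp only: iterated_partial_snoc)
qed

lemma smooth_differentiable:
  fixes f :: "'a::euclidean_space \<Rightarrow> 'b::real_normed_vector"
  shows "smooth f \<Longrightarrow> f differentiable (at x)"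
proof -
  assume "smooth f"
  then have "set ([] :: 'a list) \<subseteq> Basis \<longrightarrow> iterated_partial [] f differentiable_on UNIV"
    unfolding smooth_def by blast
  then show "f differentiable (at x)" by (simp add: differentiable_on_def)
qed

lemma smooth_imp_Ck: "smooth f \<Longrightarrow> Ck n UNIV f"
proof (induction n arbitrary: f)
  case 0
  have "continuous (at x) f" for x
    by (rule differentiable_imp_continuous_within[OF smooth_differentiable[OF 0]])
  then show ?case by (simp add: continuous_at_imp_continuous_on)
next
  case (Suc n)
  then show ?case
    by (auto simp only: Ck.simps intro!: Suc.IH smooth_partial smooth_differentiable)
qed

section \<open>The Fourier transform\<close>

abbreviation fourier_const :: "'d::finite itself \<Rightarrow> complex" where
  "fourier_const _ \<equiv> complex_of_real ((2 * pi) powr (- real CARD('d) / 2))"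

text \<open>The part of the Schwartz condition without derivatives. It is stable under
  multiplication by coordinates, and hence under differentiation of the Fourier transform.\<close>

definition rapid :: "('d::finite rvec \<Rightarrow> complex) \<Rightarrow> bool" where
  "rapid u \<longleftrightarrow> continuous_on UNIV u \<and> (\<forall>k. \<exists>C. \<forall>x. (1 + norm x) ^ k * norm (u x) \<le> C)"

lemma prod_abs_le_norm:
  fixes x :: "'d::finite rvec"
  shows "(\<Prod>i\<in>UNIV. (1 + \<bar>x $ i\<bar>) ^ n) \<le> (1 + norm x) ^ (n * CARD('d))"
proof -
  have "(\<Prod>i\<in>UNIV. (1 + \<bar>x $ i\<bar>) ^ n) \<le> (\<Prod>i\<in>(UNIV::'d set). (1 + norm x) ^ n)"
    using component_le_norm_cart[of x] by (intro prod_mono conjI power_mono) auto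
  then show ?thesis by (simp add: power_mult)
qed

lemma integrable_prod_tw: "integrable lborel (\<lambda>x::'d::finite rvec. \<Prod>i\<in>UNIV. tw (x $ i))"
  by (rule integrable_prod_vec) (rule integrable_tw)

lemma rapid_bound:
  fixes u :: "'d::finite rvec \<Rightarrow> complex"
  assumes "rapid u"
  obtains C where "0 \<le> C" "\<And>x. (1 + norm x) ^ k * norm (u x) \<le> C * (\<Prod>i\<in>UNIV. tw (x $ i))"
proof -
  obtain C where C: "\<And>x. (1 + norm x) ^ (2 * CARD('d) + k) * norm (u x) \<le> C"
    using assms unfolding rapid_def by blast
  have "0 \<le> (1 + norm (0::'d rvec)) ^ (2 * CARD('d) + k) * norm (u 0)" by simp
  then have "0 \<le> C" using C[of 0] by linarith
  moreover have "(1 + norm x) ^ k * norm (u x) \<le> C * (\<Prod>i\<in>UNIV. tw (x $ i))" for x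
  proof -
    have pos: "0 < (\<Prod>i\<in>UNIV. (1 + \<bar>x $ i\<bar>) ^ 2)" by (intro prod_pos) (auto intro: add_pos_nonneg)
    have "(\<Prod>i\<in>UNIV. (1 + \<bar>x $ i\<bar>) ^ 2) * ((1 + norm x) ^ k * norm (u x)) \<le> (1 + norm x) ^ (2 * CARD('d)) * ((1 + norm x) ^ k * norm (u x))"
      by (intro mult_right_mono prod_abs_le_norm) auto
    also have "\<dots> \<le> C" using C[of x] by (simp add: power_add mult_ac)
    finally show ?thesis using pos
      by (simp add: tw_def prod_dividef field_simps)
  qed
  ultimately show ?thesis using that by blast
qed

lemma rapid_measurable: "rapid u \<Longrightarrow> u \<in> borel_measurable borel"
  unfolding rapid_def by (intro borel_measurable_continuous_onI) auto

lemma rapid_integrable: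
  fixes u :: "'d::finite rvec \<Rightarrow> complex"
  assumes "rapid u" shows "integrable lborel (\<lambda>x. (1 + norm x) ^ k *\<^sub>R u x)" "integrable lborel u"
proof -
  note [measurable] = rapid_measurable[OF assms]
  have *: "integrable lborel (\<lambda>x. (1 + norm x) ^ k *\<^sub>R u x)" for k
  proof -
    obtain C where "0 \<le> C" and C: "\<And>x. (1 + norm x) ^ k * norm (u x) \<le> C * (\<Prod>i\<in>UNIV. tw (x $ i))"
      using rapid_bound[OF assms, of k] by blast
    have "integrable lborel (\<lambda>x::'d rvec. C * (\<Prod>i\<in>UNIV. tw (x $ i)))"
      by (intro integrable_mult_right integrable_prod_tw)
    then show ?thesis
      by (rule Bochner_Integration.integrable_bound)
        (use C \<open>0 \<le> C\<close> in \<open>auto simp: prod_nonneg abs_mult\<close>)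
  qed
  show "integrable lborel (\<lambda>x. (1 + norm x) ^ k *\<^sub>R u x)" by fact
  show "integrable lborel u" using *[of 0] by simp
qed

lemma rapid_mult_bounded_by:
  fixes u :: "'d::finite rvec \<Rightarrow> complex"
  assumes "rapid u" "continuous_on UNIV f" "\<And>x. norm (f x) \<le> B * (1 + norm x) ^ m"
  shows "rapid (\<lambda>x. f x * u x)"
proof -
  have "0 \<le> norm (f 0)" by simp
  then have B: "0 \<le> B" using assms(3)[of 0] by (simp del: norm_ge_zero)
  have "\<exists>C. \<forall>x. (1 + norm x) ^ k * norm (f x * u x) \<le> C" for k
  proof -
    obtain C where C: "\<And>x. (1 + norm x) ^ (m + k) * norm (u x) \<le> C"
      using assms(1) unfolding rapid_def by blast
    have "(1 + norm x) ^ k * norm (f x * u x) \<le> B * C" for x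
    proof -
      have "(1 + norm x) ^ k * norm (f x * u x) \<le> (1 + norm x) ^ k * (B * (1 + norm x) ^ m * norm (u x))"
        using assms(3)[of x] by (simp add: norm_mult mult_left_mono mult_right_mono)
      also have "\<dots> = B * ((1 + norm x) ^ (m + k) * norm (u x))" by (simp add: power_add mult_ac)
      also have "\<dots> \<le> B * C" using C B by (intro mult_left_mono) auto
      finally show ?thesis .
    qed
    then show ?thesis by blast
  qed
  then show ?thesis using assms(1,2) unfolding rapid_def by (auto intro: continuous_on_mult)
qed

lemma rapid_mult_inner:
  fixes u :: "'d::finite rvec \<Rightarrow> complex"
  assumes "rapid u" shows "rapid (\<lambda>x. (c * complex_of_real (x \<bullet> b)) * u x)"
proof (rule rapid_mult_bounded_by[OF assms, of _ "norm c * norm b" 1])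
  fix x :: "'d rvec"
  have "\<bar>x \<bullet> b\<bar> \<le> norm x * norm b" by (rule Cauchy_Schwarz_ineq2)
  also have "\<dots> \<le> norm b * (1 + norm x)" by (simp add: algebra_simps)
  finally show "norm (c * complex_of_real (x \<bullet> b)) \<le> norm c * norm b * (1 + norm x) ^ 1"
    by (simp add: norm_mult mult_left_mono mult.assoc)
qed (intro continuous_intros)

lemma schwartz_rapid:
  fixes f :: "'a::finite rvec \<Rightarrow> complex"
  assumes "f \<in> schwartz" shows "rapid f"
proof -
  have "continuous_on UNIV f"
    using assms smooth_imp_Ck[of f 0] by (auto simp: schwartz_def)
  moreover have "\<exists>C. \<forall>x. (1 + norm x) ^ k * norm (f x) \<le> C" for k
  proof -
    have "set ([] :: 'a rvec list) \<subseteq> Basis \<longrightarrow> bounded (range (\<lambda>x. (1 + norm x) ^ k *\<^sub>R iterated_partial [] f x))"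
      using assms unfolding schwartz_def mem_Collect_eq by blast
    then show ?thesis by (auto simp: bounded_iff)
  qed
  ultimately show ?thesis by (auto simp: rapid_def)
qed

lemma integrable_mult_exp:
  fixes u :: "'a::euclidean_space \<Rightarrow> complex"
  assumes "integrable lborel u"
  shows "integrable lborel (\<lambda>x. u x * exp (- (\<i> * complex_of_real (x \<bullet> \<xi>))))"
    "integrable lborel (\<lambda>x. u x * exp (\<i> * complex_of_real (\<xi> \<bullet> x)))"
proof -
  have [measurable]: "u \<in> borel_measurable borel" using assms by auto
  show "integrable lborel (\<lambda>x. u x * exp (- (\<i> * complex_of_real (x \<bullet> \<xi>))))"
    using assms by (rule Bochner_Integration.integrable_bound) (auto simp: norm_mult)
  show "integrable lborel (\<lambda>x. u x * exp (\<i> * complex_of_real (\<xi> \<bullet> x)))"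
    using assms by (rule Bochner_Integration.integrable_bound) (auto simp: norm_mult)
qed

lemma norm_integral_le:
  fixes f :: "'a \<Rightarrow> 'b::{banach, second_countable_topology}"
  assumes "integrable M f" "integrable M g" "\<And>x. norm (f x) \<le> g x"
  shows "norm (integral\<^sup>L M f) \<le> integral\<^sup>L M g"
proof -
  have "norm (integral\<^sup>L M f) \<le> (\<integral>x. norm (f x) \<partial>M)" by (rule integral_norm_bound)
  also have "\<dots> \<le> integral\<^sup>L M g" using assms by (intro integral_mono) auto
  finally show ?thesis .
qed

text \<open>The first order Taylor remainder of the exponential is at most the square of
  \<open>x \<bullet> (\<eta> - \<xi>)\<close>, and two powers of \<open>norm x\<close> are
  integrable against a rapidly decreasing \<open>u\<close>. The derivative is again the transform of
  a rapidly decreasing function, which is what \<open>fourier_Ck\<close> iterates.\<close>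

lemma fourier_has_derivative:
  fixes u :: "'d::finite rvec \<Rightarrow> complex"
  assumes "rapid u"
  shows "(fourier u has_derivative (\<lambda>\<eta>. fourier (\<lambda>x. (- \<i> * complex_of_real (x \<bullet> \<eta>)) * u x) \<xi>)) (at \<xi>)"
proof -
  let ?e = "\<lambda>x \<xi>. exp (- (\<i> * complex_of_real (x \<bullet> \<xi>)))"
  let ?L = "\<lambda>\<eta>. fourier (\<lambda>x. (- \<i> * complex_of_real (x \<bullet> \<eta>)) * u x) \<xi>"
  note [measurable] = rapid_measurable[OF assms]
  have int: "integrable lborel (\<lambda>x. (- \<i> * complex_of_real (x \<bullet> \<eta>)) * u x * ?e x \<xi>)" for \<eta>
    by (intro integrable_mult_exp rapid_integrable rapid_mult_inner assms)
  have "linear ?L"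
  proof (rule linearI)
    fix \<eta> \<zeta> :: "'d rvec" and c :: real
    show "?L (\<eta> + \<zeta>) = ?L \<eta> + ?L \<zeta>"
      unfolding fourier_def distrib_left[symmetric]
      by (subst Bochner_Integration.integral_add[symmetric, OF int int]) (simp add: inner_add_right algebra_simps)
    show "?L (c *\<^sub>R \<eta>) = c *\<^sub>R ?L \<eta>"
    proof -
      have "(\<lambda>x. (- \<i> * complex_of_real (x \<bullet> (c *\<^sub>R \<eta>))) * u x * ?e x \<xi>)
        = (\<lambda>x. complex_of_real c * ((- \<i> * complex_of_real (x \<bullet> \<eta>)) * u x * ?e x \<xi>))"
        by (auto simp: mult_ac)
      then show ?thesis
        unfolding fourier_def by (simp only: integral_mult_right_zero) (simp add: scaleR_conv_of_real mult_ac)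
    qed
  qed
  then have bl: "bounded_linear ?L" by (simp add: linear_conv_bounded_linear)
  obtain C where C: "0 \<le> C" "\<And>x. (1 + norm x) ^ 2 * norm (u x) \<le> C * (\<Prod>i\<in>UNIV. tw (x $ i))"
    using rapid_bound[OF assms, of 2] by blast
  define D where "D = (LINT x|lborel. C * (\<Prod>i\<in>UNIV. tw ((x::'d rvec) $ i)))"
  have intD: "integrable lborel (\<lambda>x::'d rvec. C * (\<Prod>i\<in>UNIV. tw (x $ i)))"
    by (intro integrable_mult_right integrable_prod_tw)
  have bound: "norm (fourier u \<eta> - fourier u \<xi> - ?L (\<eta> - \<xi>)) \<le> norm (fourier_const TYPE('d)) * D * (norm (\<eta> - \<xi>))\<^sup>2" for \<eta>
  proof -
    have int0: "integrable lborel (\<lambda>x. u x * ?e x \<eta>)" for \<eta>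
      by (intro integrable_mult_exp rapid_integrable assms)
    have eq: "fourier u \<eta> - fourier u \<xi> - ?L (\<eta> - \<xi>) = fourier_const TYPE('d) *
      (LINT x|lborel. u x * ?e x \<eta> - u x * ?e x \<xi> - (- \<i> * complex_of_real (x \<bullet> (\<eta> - \<xi>))) * u x * ?e x \<xi>)"
      using int0[of \<eta>] int0[of \<xi>] int[of "\<eta> - \<xi>"]
      by (simp only: fourier_def Bochner_Integration.integral_diff Bochner_Integration.integrable_diff
          right_diff_distrib DIM_cart DIM_real mult_1_right)
    have "norm (LINT x|lborel. u x * ?e x \<eta> - u x * ?e x \<xi> - (- \<i> * complex_of_real (x \<bullet> (\<eta> - \<xi>))) * u x * ?e x \<xi>)
      \<le> (LINT x|lborel. (norm (\<eta> - \<xi>))\<^sup>2 * (C * (\<Prod>i\<in>UNIV. tw ((x :: 'd rvec) $ i))))"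
    proof (rule norm_integral_le)
      show "integrable lborel (\<lambda>x. u x * ?e x \<eta> - u x * ?e x \<xi> - (- \<i> * complex_of_real (x \<bullet> (\<eta> - \<xi>))) * u x * ?e x \<xi>)"
        by (intro Bochner_Integration.integrable_diff int0 int)
      show "integrable lborel (\<lambda>x::'d rvec. (norm (\<eta> - \<xi>))\<^sup>2 * (C * (\<Prod>i\<in>UNIV. tw (x $ i))))"
        using intD by (rule integrable_mult_right)
      fix x :: "'d rvec"
      let ?s = "- (x \<bullet> (\<eta> - \<xi>))"
      have "u x * ?e x \<eta> - u x * ?e x \<xi> - (- \<i> * complex_of_real (x \<bullet> (\<eta> - \<xi>))) * u x * ?e x \<xi>
        = u x * ?e x \<xi> * (iexp ?s - (\<Sum>k\<le>1. (\<i> * complex_of_real ?s) ^ k / fact k))"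
      proof -
        have "?e x \<eta> = ?e x \<xi> * iexp ?s"
          unfolding exp_add[symmetric] by (simp add: inner_diff_right right_diff_distrib)
        then show ?thesis by (simp add: algebra_simps)
      qed
      then have "norm (u x * ?e x \<eta> - u x * ?e x \<xi> - (- \<i> * complex_of_real (x \<bullet> (\<eta> - \<xi>))) * u x * ?e x \<xi>)
        = norm (u x) * norm (iexp ?s - (\<Sum>k\<le>1. (\<i> * complex_of_real ?s) ^ k / fact k))"
        by (simp add: norm_mult)
      also have "\<dots> \<le> norm (u x) * \<bar>?s\<bar>\<^sup>2"
      proof (rule mult_left_mono)
        have "norm (iexp ?s - (\<Sum>k\<le>1. (\<i> * complex_of_real ?s) ^ k / fact k)) \<le> \<bar>?s\<bar> ^ Suc 1 / fact (Suc 1)"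
          by (rule iexp_approx1)
        also have "\<dots> \<le> \<bar>?s\<bar>\<^sup>2" by (simp add: numeral_2_eq_2)
        finally show "norm (iexp ?s - (\<Sum>k\<le>1. (\<i> * complex_of_real ?s) ^ k / fact k)) \<le> \<bar>?s\<bar>\<^sup>2" .
      qed simp
      also have "\<dots> \<le> norm (u x) * (((1 + norm x) * norm (\<eta> - \<xi>))\<^sup>2)"
      proof (intro mult_left_mono power_mono)
        have "\<bar>?s\<bar> \<le> norm x * norm (\<eta> - \<xi>)" using Cauchy_Schwarz_ineq2[of x "\<eta> - \<xi>"] by simp
        then show "\<bar>?s\<bar> \<le> (1 + norm x) * norm (\<eta> - \<xi>)"
          by (smt (verit) mult_right_mono norm_ge_zero)
      qed auto
      also have "\<dots> = (norm (\<eta> - \<xi>))\<^sup>2 * ((1 + norm x) ^ 2 * norm (u x))" by (simp add: power_mult_distrib mult_ac)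
      also have "\<dots> \<le> (norm (\<eta> - \<xi>))\<^sup>2 * (C * (\<Prod>i\<in>UNIV. tw (x $ i)))"
        by (intro mult_left_mono C) auto
      finally show "norm (u x * ?e x \<eta> - u x * ?e x \<xi> - (- \<i> * complex_of_real (x \<bullet> (\<eta> - \<xi>))) * u x * ?e x \<xi>)
        \<le> (norm (\<eta> - \<xi>))\<^sup>2 * (C * (\<Prod>i\<in>UNIV. tw (x $ i)))" .
    qed
    also have "\<dots> = (norm (\<eta> - \<xi>))\<^sup>2 * D" unfolding D_def by (rule integral_mult_right_zero)
    finally show ?thesis unfolding eq norm_mult by (simp add: mult_left_mono mult_ac)
  qed
  show ?thesis
  proof (rule has_derivativeI_sandwich[OF zero_less_one bl, of _ _ _ "\<lambda>\<eta>. norm (fourier_const TYPE('d)) * D * norm (\<eta> - \<xi>)"])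
    fix \<eta> assume "\<eta> \<noteq> \<xi>"
    then show "norm (fourier u \<eta> - fourier u \<xi> - ?L (\<eta> - \<xi>)) / norm (\<eta> - \<xi>) \<le> norm (fourier_const TYPE('d)) * D * norm (\<eta> - \<xi>)"
      using bound[of \<eta>] by (simp add: divide_simps power2_eq_square mult_ac)
  next
    have "((\<lambda>\<eta>. norm (fourier_const TYPE('d)) * D * norm (\<eta> - \<xi>)) \<longlongrightarrow> norm (fourier_const TYPE('d)) * D * norm (\<xi> - \<xi>)) (at \<xi>)"
      by (intro tendsto_intros)
    then show "((\<lambda>\<eta>. norm (fourier_const TYPE('d)) * D * norm (\<eta> - \<xi>)) \<longlongrightarrow> 0) (at \<xi>)" by simp
  qed
qed

lemma fourier_Ck:
  fixes u :: "'d::finite rvec \<Rightarrow> complex"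
  shows "rapid u \<Longrightarrow> Ck n UNIV (fourier u)"
proof (induction n arbitrary: u)
  case 0
  then show ?case
    by (auto intro!: continuous_at_imp_continuous_on has_derivative_continuous[OF fourier_has_derivative])
next
  case (Suc n)
  show ?case
    by (rule Ck_SucI[OF open_UNIV fourier_has_derivative[OF Suc.prems]])
       (intro Suc.IH rapid_mult_inner Suc.prems)
qed

text \<open>Differentiating the vanishing Fourier transform at the origin produces the moments.\<close>

lemma moments_vanish:
  fixes u :: "'d::finite rvec \<Rightarrow> complex"
  assumes u: "rapid u" and r: "0 < r" and zero: "\<And>\<xi>. norm \<xi> < r \<Longrightarrow> fourier u \<xi> = 0"
    and P: "polynomial_function P"
  shows "(LINT x|lborel. P x * u x) = 0"
proof -
  \<comment> \<open>The multipliers that keep the transform zero near the origin are closed under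
    sums, scalars and multiplication by a coordinate; hence every polynomial is among them.\<close>
  define good where "good f \<longleftrightarrow> rapid (\<lambda>x. f x * u x) \<and> (\<forall>\<xi>. norm \<xi> < r \<longrightarrow> fourier (\<lambda>x. f x * u x) \<xi> = 0)" for f :: "'d rvec \<Rightarrow> complex"
  have good_add: "good (\<lambda>x. f x + g x)" if f: "good f" and g: "good g" for f g
  proof -
    have "rapid (\<lambda>x. (f x + g x) * u x)" unfolding rapid_def
    proof (intro conjI allI)
      have "continuous_on UNIV (\<lambda>x. f x * u x)" "continuous_on UNIV (\<lambda>x. g x * u x)"
        using that by (auto simp: good_def rapid_def)
      from continuous_on_add[OF this] show "continuous_on UNIV (\<lambda>x. (f x + g x) * u x)" by (simp add: algebra_simps)
      fix k
      obtain C where C: "\<And>x. (1 + norm x) ^ k * norm (f x * u x) \<le> C"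
        using f unfolding good_def rapid_def by blast
      obtain D where D: "\<And>x. (1 + norm x) ^ k * norm (g x * u x) \<le> D"
        using g unfolding good_def rapid_def by blast
      have "(1 + norm x) ^ k * norm ((f x + g x) * u x) \<le> C + D" for x
      proof -
        have "norm ((f x + g x) * u x) \<le> norm (f x * u x) + norm (g x * u x)"
          by (simp add: distrib_right norm_triangle_ineq)
        then have "(1 + norm x) ^ k * norm ((f x + g x) * u x) \<le> (1 + norm x) ^ k * (norm (f x * u x) + norm (g x * u x))"
          by (rule mult_left_mono) simp
        then show ?thesis using C[of x] D[of x] by (simp add: distrib_left)
      qed
      then show "\<exists>C. \<forall>x. (1 + norm x) ^ k * norm ((f x + g x) * u x) \<le> C" by blast
    qed
    moreover have "fourier (\<lambda>x. (f x + g x) * u x) \<xi> = fourier (\<lambda>x. f x * u x) \<xi> + fourier (\<lambda>x. g x * u x) \<xi>" for \<xi>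
      using that integrable_mult_exp(1)[OF rapid_integrable(2), of "\<lambda>x. f x * u x" \<xi>] integrable_mult_exp(1)[OF rapid_integrable(2), of "\<lambda>x. g x * u x" \<xi>]
      by (simp add: good_def fourier_def distrib_right distrib_left)
    ultimately show ?thesis using that by (simp add: good_def)
  qed
  have scale: "good (\<lambda>x. c * f x)" if "good f" for c f
  proof -
    have "rapid (\<lambda>x. c * (f x * u x))"
      using that by (intro rapid_mult_bounded_by[of _ "\<lambda>_. c" "norm c" 0]) (auto simp: good_def)
    moreover have "fourier (\<lambda>x. c * (f x * u x)) \<xi> = c * fourier (\<lambda>x. f x * u x) \<xi>" for \<xi>
      by (simp add: fourier_def mult.assoc)
    ultimately show ?thesis using that by (simp add: good_def mult.assoc)
  qed
  have coord: "good (\<lambda>x. complex_of_real (x \<bullet> b) * f x)" if "good f" for f b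
  proof -
    have rap: "rapid (\<lambda>x. f x * u x)" using that by (simp add: good_def)
    have "fourier (\<lambda>x. (- \<i> * complex_of_real (x \<bullet> b)) * (f x * u x)) \<xi> = 0" if "norm \<xi> < r" for \<xi>
    proof -
      have "((\<lambda>_. 0) has_derivative (\<lambda>\<eta>. fourier (\<lambda>x. (- \<i> * complex_of_real (x \<bullet> \<eta>)) * (f x * u x)) \<xi>)) (at \<xi>)"
        by (rule has_derivative_transform_within_open[OF fourier_has_derivative[OF rap], of "ball 0 r"])
           (use \<open>good f\<close> that in \<open>auto simp: good_def\<close>)
      then have "(\<lambda>\<eta>. fourier (\<lambda>x. (- \<i> * complex_of_real (x \<bullet> \<eta>)) * (f x * u x)) \<xi>) = (\<lambda>\<eta>. 0)"
        by (rule has_derivative_unique) (rule has_derivative_const)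
      then show ?thesis by (rule fun_cong)
    qed
    then have "good (\<lambda>x. (- \<i> * complex_of_real (x \<bullet> b)) * f x)"
      using rapid_mult_inner[OF rap, of "- \<i>" b] by (simp add: good_def mult.assoc)
    from scale[OF this, of \<i>] show ?thesis by (simp add: mult.assoc[symmetric])
  qed
  have one: "good (\<lambda>x. 1)" using u zero by (simp add: good_def)
  have sum: "good (\<lambda>x. \<Sum>i\<in>A. f i x)" if "\<And>i. i \<in> A \<Longrightarrow> good (f i)" for A and f :: "'d rvec \<Rightarrow> _"
    using that
  proof (induction A rule: infinite_finite_induct)
    case (insert i A)
    have "good (\<lambda>x. f i x + (\<Sum>i\<in>A. f i x))"
      by (rule good_add) (use insert in auto)
    then show ?case using insert by simp
  qed (use scale[OF one, of 0] in simp_all)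
  \<comment> \<open>The additional factor \<open>f\<close> carries the case of products: the
    hypothesis for \<open>p1\<close> is applied to \<open>p2 * f\<close>.\<close>
  have real: "good (\<lambda>x. complex_of_real (p x) * f x)" if "real_polynomial_function p" "good f" for p f
    using that
  proof (induction p arbitrary: f rule: real_polynomial_function.induct)
    case (linear p)
    have "complex_of_real (p x) * f x = (\<Sum>b\<in>Basis. complex_of_real (p b) * (complex_of_real (x \<bullet> b) * f x))" for x
    proof -
      have "p x = p (\<Sum>b\<in>Basis. (x \<bullet> b) *\<^sub>R b)" by (simp add: euclidean_representation)
      also have "\<dots> = (\<Sum>b\<in>Basis. (x \<bullet> b) * p b)"
        using linear(1) by (simp add: bounded_linear.linear linear_sum linear_scale)
      finally have "p x = (\<Sum>b\<in>Basis. (x \<bullet> b) * p b)" .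
      then have "complex_of_real (p x) = (\<Sum>b\<in>Basis. complex_of_real (x \<bullet> b) * complex_of_real (p b))"
        by (simp only: of_real_sum of_real_mult)
      then show ?thesis by (simp add: sum_distrib_right sum_distrib_left mult_ac)
    qed
    moreover have "good (\<lambda>x. \<Sum>b\<in>Basis. complex_of_real (p b) * (complex_of_real (x \<bullet> b) * f x))"
      by (rule sum, rule scale, rule coord, rule linear(2))
    ultimately show ?case by simp
  next
    case (const c) then show ?case by (rule scale)
  next
    case (add p1 p2)
    have "good (\<lambda>x. complex_of_real (p1 x) * f x + complex_of_real (p2 x) * f x)"
      by (rule good_add[OF add.IH(1)[OF add.prems] add.IH(2)[OF add.prems]])
    then show ?case by (simp add: distrib_right)
  next
    case (mult p1 p2)
    have "good (\<lambda>x. complex_of_real (p1 x) * (complex_of_real (p2 x) * f x))"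
      by (rule mult.IH(1)[OF mult.IH(2)[OF mult.prems]])
    then show ?case by (simp add: mult.assoc)
  qed
  have ReP: "real_polynomial_function (\<lambda>x. Re (P x))" "real_polynomial_function (\<lambda>x. Im (P x))"
    using P bounded_linear_Re bounded_linear_Im by (auto simp: polynomial_function_def comp_def)
  have "good (\<lambda>x. complex_of_real (Re (P x)) * 1 + \<i> * (complex_of_real (Im (P x)) * 1))"
    by (rule good_add real ReP one scale)+
  then have "good P" by (simp add: complex_eq[symmetric])
  then have "fourier (\<lambda>x. P x * u x) 0 = 0" using r by (simp add: good_def)
  then show ?thesis by (simp add: fourier_def)
qed

section \<open>Inverse Fourier transforms of test functions\<close>

abbreviation diag_mult :: "('d::finite \<Rightarrow> real) \<Rightarrow> 'd rvec \<Rightarrow> 'd rvec" where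
  "diag_mult c x \<equiv> (\<chi> i. c i * x $ i)"

lemma inner_diag_mult: "x \<bullet> diag_mult c y = diag_mult c x \<bullet> y"
  by (simp add: inner_vec_def mult_ac)

lemma compact_support_bound:
  fixes m :: "'d::finite rvec \<Rightarrow> complex"
  assumes "continuous_on UNIV m" "\<And>x. R < norm x \<Longrightarrow> m x = 0"
  obtains B where "0 \<le> B" "\<And>x. norm (m x) \<le> B"
proof -
  have "compact (m ` cball 0 R)"
    by (intro compact_continuous_image continuous_on_subset[OF assms(1)]) auto
  from compact_imp_bounded[OF this] obtain B where B: "\<forall>y\<in>m ` cball 0 R. norm y \<le> B"
    unfolding bounded_iff by (rule exE)
  have "norm (m x) \<le> max 0 B" for x
  proof (cases "R < norm x")
    case True then show ?thesis using assms(2) by simp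
  next
    case False then have "m x \<in> m ` cball 0 R" by simp
    then have "norm (m x) \<le> B" by (rule bspec[OF B])
    then show ?thesis by simp
  qed
  then show ?thesis using that[of "max 0 B"] by simp
qed

lemma compact_support_integrable:
  fixes m :: "'d::finite rvec \<Rightarrow> complex"
  assumes "continuous_on UNIV m" "\<And>x. R < norm x \<Longrightarrow> m x = 0"
  shows "integrable lborel m"
proof -
  have [measurable]: "m \<in> borel_measurable borel"
    using assms(1) by (rule borel_measurable_continuous_onI)
  obtain B where B: "0 \<le> B" "\<And>x. norm (m x) \<le> B"
    using compact_support_bound[OF assms] by blast
  have fin: "emeasure lborel (cball (0::'d rvec) R) < \<infinity>"
    by (rule emeasure_bounded_finite) simp
  have "integrable lborel (\<lambda>x::'d rvec. B * indicator (cball 0 R) x)"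
    using fin by (intro integrable_mult_right integrable_real_indicator) auto
  then show ?thesis
  proof (rule Bochner_Integration.integrable_bound)
    show "AE x in lborel. norm (m x) \<le> norm (B * indicator (cball 0 R) x :: real)"
    proof (rule AE_I2)
      fix x show "norm (m x) \<le> norm (B * indicator (cball 0 R) x :: real)"
        using assms(2)[of x] B by (cases "R < norm x") auto
    qed
  qed simp
qed

lemma partial_support:
  fixes m :: "'d::finite rvec \<Rightarrow> complex"
  assumes "\<And>x. R < norm x \<Longrightarrow> m x = 0" "R < norm x"
  shows "frechet_derivative m (at x) b = 0"
proof -
  have "open {x::'d rvec. R < norm x}" by (intro open_Collect_less continuous_intros)
  then have "(m has_derivative (\<lambda>_. 0)) (at x)"
    by (rule has_derivative_transform_within_open[OF has_derivative_const[of 0]]) (use assms in auto)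
  then have "(\<lambda>_. 0) = frechet_derivative m (at x)" by (rule frechet_derivative_at)
  from fun_cong[OF this, of b] show ?thesis by simp
qed

lemma tendsto_at_0_inverse: "filterlim (\<lambda>n. inverse (real (Suc n))) (at 0) sequentially"
  by (rule filterlim_atI[OF LIMSEQ_inverse_real_of_nat]) simp

text \<open>The transforms of the difference quotients in direction \<open>b\<close> have a limit
  that is computed twice. Dominated convergence gives the transform of the derivative; translating
  the integral gives the derivative of a character at 0 times the transform of
  \<open>m\<close>.\<close>

lemma inverse_fourier_partial:
  fixes m :: "'d::finite rvec \<Rightarrow> complex"
  assumes m: "Ck (Suc 0) UNIV m" and supp: "\<And>x. R < norm x \<Longrightarrow> m x = 0" and b: "b \<in> Basis"
  shows "inverse_fourier (\<lambda>\<xi>. frechet_derivative m (at \<xi>) b) x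
    = - (\<i> * complex_of_real (x \<bullet> b)) * inverse_fourier m x"
proof -
  define e where "e \<xi> = exp (\<i> * complex_of_real (x \<bullet> \<xi>))" for \<xi>
  define D where "D \<xi> = frechet_derivative m (at \<xi>) b" for \<xi>
  define h where "h n = inverse (real (Suc n))" for n
  define G where "G n \<xi> = (m (h n *\<^sub>R b + \<xi>) - m \<xi>) / complex_of_real (h n)" for n \<xi>
  have h0: "0 < h n" "h n \<le> 1" for n by (auto simp: h_def field_simps)
  have hlim: "filterlim h (at 0) sequentially" unfolding h_def by (rule tendsto_at_0_inverse)
  have cm: "continuous_on UNIV m" using Ck_continuous_on[OF m] .
  have cD: "continuous_on UNIV D" using Ck_partial[OF m b] by (simp add: D_def[abs_def])
  have [measurable]: "m \<in> borel_measurable borel" "D \<in> borel_measurable borel"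
    using cm cD by (auto intro: borel_measurable_continuous_onI)
  have [measurable]: "e \<in> borel_measurable borel" unfolding e_def[abs_def] by measurable
  have suppD: "D \<xi> = 0" if "R < norm \<xi>" for \<xi>
    unfolding D_def using supp that by (rule partial_support)
  obtain L where L: "0 \<le> L" "\<And>\<xi>. norm (D \<xi>) \<le> L"
    using compact_support_bound[OF cD suppD] by blast
  have der: "((\<lambda>t. m (t *\<^sub>R b + \<xi>)) has_derivative (\<lambda>t. t *\<^sub>R D (s *\<^sub>R b + \<xi>))) (at s)" for \<xi> s
  proof -
    let ?F = "frechet_derivative m (at (s *\<^sub>R b + \<xi>))"
    have 1: "(m has_derivative ?F) (at (s *\<^sub>R b + \<xi>))"
      using Ck_has_derivative[OF m] by simp
    have 2: "((\<lambda>t. t *\<^sub>R b + \<xi>) has_derivative (\<lambda>t. t *\<^sub>R b)) (at s)"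
      by (intro has_derivative_add_const has_derivative_scaleR_left has_derivative_ident)
    have "((\<lambda>t. m (t *\<^sub>R b + \<xi>)) has_derivative (\<lambda>t. ?F (t *\<^sub>R b))) (at s)"
      using has_derivative_compose[OF 2 1] .
    moreover have "?F (t *\<^sub>R b) = t *\<^sub>R D (s *\<^sub>R b + \<xi>)" for t
      unfolding D_def by (rule linear_scale[OF has_derivative_linear[OF 1]])
    ultimately show ?thesis by simp
  qed
  have Glim: "(\<lambda>n. G n \<xi>) \<longlonglongrightarrow> D \<xi>" for \<xi>
  proof -
    have "((\<lambda>t. norm (m ((0 + t) *\<^sub>R b + \<xi>) - m (0 *\<^sub>R b + \<xi>) - t *\<^sub>R D \<xi>) / norm t) \<longlongrightarrow> 0) (at 0)"
      using der[of \<xi> 0] by (simp add: has_derivative_at)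
    from filterlim_compose[OF this hlim]
    have "(\<lambda>n. norm (m (h n *\<^sub>R b + \<xi>) - m \<xi> - h n *\<^sub>R D \<xi>) / norm (h n)) \<longlonglongrightarrow> 0" by simp
    moreover have "norm (m (h n *\<^sub>R b + \<xi>) - m \<xi> - h n *\<^sub>R D \<xi>) / norm (h n) = norm (G n \<xi> - D \<xi>)" for n
    proof -
      have "G n \<xi> - D \<xi> = (m (h n *\<^sub>R b + \<xi>) - m \<xi> - h n *\<^sub>R D \<xi>) / complex_of_real (h n)"
        using h0[of n] by (simp add: G_def diff_divide_distrib scaleR_conv_of_real)
      then show ?thesis using h0[of n] by (simp add: norm_divide)
    qed
    ultimately have "(\<lambda>n. norm (G n \<xi> - D \<xi>)) \<longlonglongrightarrow> 0" by simp
    then show ?thesis using tendsto_norm_zero_iff LIM_zero_iff by blast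
  qed
  \<comment> \<open>An integrable majorant: the mean value inequality bounds the quotients by
    \<open>L\<close>, and steps of length at most 1 keep their supports within radius
    \<open>R + 1\<close>.\<close>
  have Gbound: "norm (G n \<xi>) \<le> L * indicator (cball 0 (R + 1)) \<xi>" for n \<xi>
  proof (cases "norm \<xi> \<le> R + 1")
    case True
    have "norm (m (h n *\<^sub>R b + \<xi>) - m (0 *\<^sub>R b + \<xi>)) \<le> L * norm (h n - 0)"
    proof (rule differentiable_bound[OF convex_UNIV])
      show "((\<lambda>t. m (t *\<^sub>R b + \<xi>)) has_derivative (\<lambda>t. t *\<^sub>R D (s *\<^sub>R b + \<xi>))) (at s within UNIV)" for s
        using der by simp
      show "onorm (\<lambda>t. t *\<^sub>R D (s *\<^sub>R b + \<xi>)) \<le> L" for s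
      proof (rule onorm_le)
        fix t :: real
        show "norm (t *\<^sub>R D (s *\<^sub>R b + \<xi>)) \<le> L * norm t"
          using mult_left_mono[OF L(2)[of "s *\<^sub>R b + \<xi>"], of "\<bar>t\<bar>"] by (simp add: mult.commute)
      qed
    qed auto
    then have "norm (G n \<xi>) \<le> L" using h0[of n] by (simp add: G_def norm_divide divide_simps)
    then show ?thesis using True by simp
  next
    case False
    have "norm (h n *\<^sub>R b) \<le> 1" using h0[of n] b by simp
    moreover have "norm \<xi> \<le> norm (h n *\<^sub>R b + \<xi>) + norm (h n *\<^sub>R b)"
      using norm_triangle_ineq4[of "h n *\<^sub>R b + \<xi>" "h n *\<^sub>R b"] by simp
    ultimately have "R < norm (h n *\<^sub>R b + \<xi>)" "R < norm \<xi>" using False by linarith+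
    then show ?thesis using supp L(1) by (simp add: G_def indicator_def)
  qed
  have lim1: "(\<lambda>n. LINT \<xi>|lborel. G n \<xi> * e \<xi>) \<longlonglongrightarrow> (LINT \<xi>|lborel. D \<xi> * e \<xi>)"
  proof (rule integral_dominated_convergence)
    have fin: "emeasure lborel (cball (0::'d rvec) (R + 1)) < \<infinity>"
      by (rule emeasure_bounded_finite) simp
    show "integrable lborel (\<lambda>\<xi>::'d rvec. L * indicator (cball 0 (R + 1)) \<xi>)"
      using fin by (intro integrable_mult_right integrable_real_indicator) auto
    show "AE \<xi> in lborel. (\<lambda>n. G n \<xi> * e \<xi>) \<longlonglongrightarrow> D \<xi> * e \<xi>"
      by (intro AE_I2 tendsto_mult Glim tendsto_const)
    show "AE \<xi> in lborel. norm (G n \<xi> * e \<xi>) \<le> L * indicator (cball 0 (R + 1)) \<xi>" for n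
    proof (rule AE_I2)
      fix \<xi>
      have "norm (e \<xi>) = 1" by (simp add: e_def)
      then show "norm (G n \<xi> * e \<xi>) \<le> L * indicator (cball 0 (R + 1)) \<xi>"
        using Gbound[of n \<xi>] by (simp add: norm_mult)
    qed
    show "(\<lambda>\<xi>. D \<xi> * e \<xi>) \<in> borel_measurable lborel" by measurable
    show "(\<lambda>\<xi>. G n \<xi> * e \<xi>) \<in> borel_measurable lborel" for n unfolding G_def by measurable
  qed
  have intm: "integrable lborel (\<lambda>\<xi>. m \<xi> * e \<xi>)"
    unfolding e_def by (rule integrable_mult_exp(2)[OF compact_support_integrable[OF cm supp]])
  have inth: "integrable lborel (\<lambda>\<xi>. m (h n *\<^sub>R b + \<xi>) * e \<xi>)"
    "(LINT \<xi>|lborel. m (h n *\<^sub>R b + \<xi>) * e \<xi>) = exp (complex_of_real (h n) * - (\<i> * complex_of_real (x \<bullet> b))) * (LINT \<xi>|lborel. m \<xi> * e \<xi>)" for n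
  proof -
    let ?c = "exp (complex_of_real (h n) * - (\<i> * complex_of_real (x \<bullet> b)))"
    have "m (h n *\<^sub>R b + \<xi>) * e \<xi> = ?c * (m (h n *\<^sub>R b + \<xi>) * e (h n *\<^sub>R b + \<xi>))" for \<xi>
    proof -
      have "x \<bullet> (h n *\<^sub>R b + \<xi>) = h n * (x \<bullet> b) + x \<bullet> \<xi>" by (simp add: inner_add_right)
      then have "\<i> * complex_of_real (x \<bullet> \<xi>) = complex_of_real (h n) * - (\<i> * complex_of_real (x \<bullet> b)) + \<i> * complex_of_real (x \<bullet> (h n *\<^sub>R b + \<xi>))"
        by (simp only: of_real_add of_real_mult) (simp add: distrib_left)
      then have "e \<xi> = ?c * e (h n *\<^sub>R b + \<xi>)"
        unfolding e_def by (simp only: exp_add)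
      then have "m (h n *\<^sub>R b + \<xi>) * e \<xi> = m (h n *\<^sub>R b + \<xi>) * (?c * e (h n *\<^sub>R b + \<xi>))" by (rule arg_cong)
      then show ?thesis by (rule trans) (rule mult.left_commute)
    qed
    then have eq: "(\<lambda>\<xi>. m (h n *\<^sub>R b + \<xi>) * e \<xi>) = (\<lambda>\<xi>. ?c * (m (h n *\<^sub>R b + \<xi>) * e (h n *\<^sub>R b + \<xi>)))"
      by (rule ext)
    have "integrable lborel (\<lambda>\<xi>. m (h n *\<^sub>R b + \<xi>) * e (h n *\<^sub>R b + \<xi>))"
      using integrable_affine_vec[of "\<lambda>_. 1" "\<lambda>\<xi>. m \<xi> * e \<xi>" "h n *\<^sub>R b"] intm by simp
    then show "integrable lborel (\<lambda>\<xi>. m (h n *\<^sub>R b + \<xi>) * e \<xi>)"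
      unfolding eq by (rule integrable_mult_right)
    have "(LINT \<xi>|lborel. m (h n *\<^sub>R b + \<xi>) * e (h n *\<^sub>R b + \<xi>)) = (LINT \<xi>|lborel. m \<xi> * e \<xi>)"
      using integral_affine_vec[of "\<lambda>_. 1" "\<lambda>\<xi>. m \<xi> * e \<xi>" "h n *\<^sub>R b"] by simp
    then show "(LINT \<xi>|lborel. m (h n *\<^sub>R b + \<xi>) * e \<xi>) = ?c * (LINT \<xi>|lborel. m \<xi> * e \<xi>)"
      unfolding eq by (simp only: integral_mult_right_zero)
  qed
  have lim2: "(\<lambda>n. LINT \<xi>|lborel. G n \<xi> * e \<xi>) \<longlonglongrightarrow> - (\<i> * complex_of_real (x \<bullet> b)) * (LINT \<xi>|lborel. m \<xi> * e \<xi>)"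
  proof -
    let ?c = "- (\<i> * complex_of_real (x \<bullet> b))"
    have eq: "(LINT \<xi>|lborel. G n \<xi> * e \<xi>) = (exp (complex_of_real (h n) * ?c) - 1) / complex_of_real (h n) * (LINT \<xi>|lborel. m \<xi> * e \<xi>)" for n
    proof -
      have "(LINT \<xi>|lborel. G n \<xi> * e \<xi>) = (LINT \<xi>|lborel. (m (h n *\<^sub>R b + \<xi>) * e \<xi> - m \<xi> * e \<xi>) / complex_of_real (h n))"
        by (simp add: G_def left_diff_distrib diff_divide_distrib)
      also have "\<dots> = (exp (complex_of_real (h n) * ?c) * (LINT \<xi>|lborel. m \<xi> * e \<xi>) - (LINT \<xi>|lborel. m \<xi> * e \<xi>)) / complex_of_real (h n)"
        by (simp only: integral_divide_zero Bochner_Integration.integral_diff[OF inth(1) intm] inth(2))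
      finally show ?thesis by (simp add: left_diff_distrib)
    qed
    have "((\<lambda>z. exp (z * ?c)) has_field_derivative ?c) (at 0)"
      by (rule derivative_eq_intros refl | simp)+
    then have "((\<lambda>z. (exp (z * ?c) - 1) / z) \<longlongrightarrow> ?c) (at 0)"
      by (simp add: has_field_derivative_iff)
    moreover have "filterlim (\<lambda>n. complex_of_real (h n)) (at 0) sequentially"
    proof (rule filterlim_atI)
      have "h \<longlonglongrightarrow> 0" using hlim by (simp add: filterlim_at)
      then show "(\<lambda>n. complex_of_real (h n)) \<longlonglongrightarrow> 0" using tendsto_of_real by fastforce
      have "complex_of_real (h n) \<noteq> 0" for n using h0[of n] by simp
      then show "\<forall>\<^sub>F n in sequentially. complex_of_real (h n) \<noteq> 0" by simp
    qed
    ultimately have "(\<lambda>n. (exp (complex_of_real (h n) * ?c) - 1) / complex_of_real (h n)) \<longlonglongrightarrow> ?c"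
      by (rule filterlim_compose)
    then show ?thesis unfolding eq by (rule tendsto_mult_right)
  qed
  have "(LINT \<xi>|lborel. D \<xi> * e \<xi>) = - (\<i> * complex_of_real (x \<bullet> b)) * (LINT \<xi>|lborel. m \<xi> * e \<xi>)"
    using LIMSEQ_unique[OF lim1 lim2] .
  then show ?thesis by (simp add: inverse_fourier_def D_def e_def)
qed

lemma norm_inverse_fourier_le:
  fixes m :: "'d::finite rvec \<Rightarrow> complex"
  assumes "integrable lborel m"
  shows "norm (inverse_fourier m x) \<le> norm (fourier_const TYPE('d)) * (LINT \<xi>|lborel. norm (m \<xi>))"
proof -
  have "norm (LINT \<xi>|lborel. m \<xi> * exp (\<i> * complex_of_real (x \<bullet> \<xi>))) \<le> (LINT \<xi>|lborel. norm (m \<xi>))"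
    using assms by (intro norm_integral_le integrable_mult_exp) (auto simp: norm_mult)
  then have "norm (fourier_const TYPE('d)) * norm (LINT \<xi>|lborel. m \<xi> * exp (\<i> * complex_of_real (x \<bullet> \<xi>)))
    \<le> norm (fourier_const TYPE('d)) * (LINT \<xi>|lborel. norm (m \<xi>))"
    by (rule mult_left_mono) simp
  then show ?thesis by (simp only: inverse_fourier_def norm_mult DIM_cart DIM_real mult_1_right)
qed

text \<open>Each derivative of the symbol in direction \<open>b\<close> is worth one factor
  \<open>x \<bullet> b\<close>, and the support does not grow.\<close>

lemma inverse_fourier_coord_decay:
  fixes m :: "'d::finite rvec \<Rightarrow> complex"
  assumes "Ck n UNIV m" "\<And>x. R < norm x \<Longrightarrow> m x = 0" "b \<in> Basis"
  shows "\<exists>C. \<forall>x. \<bar>x \<bullet> b\<bar> ^ n * norm (inverse_fourier m x) \<le> C"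
  using assms(1,2)
proof (induction n arbitrary: m)
  case 0
  then have "integrable lborel m"
    by (intro compact_support_integrable[of m R]) auto
  from norm_inverse_fourier_le[OF this] show ?case by auto
next
  case (Suc n)
  have C1: "Ck (Suc 0) UNIV m"
    using Suc.prems(1) Ck_continuous_on[OF Ck_partial[OF Suc.prems(1)]] by simp
  have "\<exists>C. \<forall>x. \<bar>x \<bullet> b\<bar> ^ n * norm (inverse_fourier (\<lambda>\<xi>. frechet_derivative m (at \<xi>) b) x) \<le> C"
  proof (rule Suc.IH)
    show "Ck n UNIV (\<lambda>\<xi>. frechet_derivative m (at \<xi>) b)" using Ck_partial[OF Suc.prems(1) assms(3)] .
    show "frechet_derivative m (at x) b = 0" if "R < norm x" for x
      using Suc.prems(2) that by (rule partial_support)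
  qed
  then show ?case
    by (simp add: inverse_fourier_partial[OF C1 Suc.prems(2) assms(3)] norm_mult mult_ac)
qed

abbreviation decay :: "real \<Rightarrow> 'd::finite rvec \<Rightarrow> real" where
  "decay A x \<equiv> (\<Prod>i\<in>UNIV. (1 + \<bar>x $ i\<bar>) powr (- A))"

text \<open>The largest coordinate, raised to the order \<open>A\<close> times the dimension,
  dominates the whole product. Decay in one coordinate at a time is therefore enough.\<close>

lemma inverse_fourier_decay:
  fixes m :: "'d::finite rvec \<Rightarrow> complex"
  assumes "\<And>n. Ck n UNIV m" "\<And>x. R < norm x \<Longrightarrow> m x = 0" "0 \<le> A"
  shows "\<exists>C\<ge>0. \<forall>x. norm (inverse_fourier m x) \<le> C * decay A x"
proof -
  define n where "n = nat \<lceil>A * real CARD('d)\<rceil>"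
  have n: "A * real CARD('d) \<le> real n" unfolding n_def by linarith
  have "\<exists>C. \<forall>x. norm (inverse_fourier m x) \<le> C"
    using norm_inverse_fourier_le[OF compact_support_integrable[OF Ck_continuous_on[OF assms(1)] assms(2)]] by blast
  then obtain C0 where C0: "\<And>x. norm (inverse_fourier m x) \<le> C0" by blast
  have "\<forall>i. \<exists>C. \<forall>x. \<bar>x $ i\<bar> ^ n * norm (inverse_fourier m x) \<le> C"
  proof
    fix i
    have "\<exists>C. \<forall>x. \<bar>x \<bullet> axis i 1\<bar> ^ n * norm (inverse_fourier m x) \<le> C"
      by (rule inverse_fourier_coord_decay[OF assms(1,2)]) (auto simp: Basis_vec_axis)
    then show "\<exists>C. \<forall>x. \<bar>x $ i\<bar> ^ n * norm (inverse_fourier m x) \<le> C" by (simp add: inner_axis)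
  qed
  then obtain C where C: "\<And>i x. \<bar>x $ i\<bar> ^ n * norm (inverse_fourier m x) \<le> C i" by metis
  have "norm (inverse_fourier m 0) \<le> C0" by (rule C0)
  then have C00: "0 \<le> C0" using norm_ge_zero order_trans by blast
  have Cnn: "0 \<le> C i" for i using order_trans[OF _ C[where x=0 and i=i]] by simp
  define K where "K = 2 ^ n * (C0 + (\<Sum>i\<in>UNIV. C i))"
  have K: "0 \<le> K" using C00 Cnn by (simp add: K_def sum_nonneg)
  have "norm (inverse_fourier m x) \<le> K * decay A x" for x
  proof -
    have fin: "finite (range (\<lambda>k. \<bar>x $ k\<bar>))" by simp
    have "Max (range (\<lambda>k. \<bar>x $ k\<bar>)) \<in> range (\<lambda>k. \<bar>x $ k\<bar>)" using Max_in[OF fin] by simp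
    then obtain i where "Max (range (\<lambda>k. \<bar>x $ k\<bar>)) = \<bar>x $ i\<bar>" by (rule imageE)
    then have i: "\<bar>x $ i\<bar> = Max (range (\<lambda>k. \<bar>x $ k\<bar>))" by simp
    have imax: "\<bar>x $ k\<bar> \<le> \<bar>x $ i\<bar>" for k unfolding i using fin by (intro Max_ge) auto
    let ?X = "\<bar>x $ i\<bar>" and ?N = "norm (inverse_fourier m x)"
    have "(\<Prod>k\<in>UNIV. (1 + \<bar>x $ k\<bar>) powr A) \<le> (\<Prod>k\<in>(UNIV::'d set). (1 + ?X) powr A)"
      using imax assms(3) by (intro prod_mono conjI powr_mono2) auto
    also have "\<dots> = (1 + ?X) powr (A * real CARD('d))"
      by (simp add: powr_realpow[symmetric] powr_powr)
    also have "\<dots> \<le> (1 + ?X) powr real n" using n by (intro powr_mono) auto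
    also have "\<dots> = (1 + ?X) ^ n" by (intro powr_realpow) (simp add: add_pos_nonneg)
    also have "\<dots> \<le> 2 ^ n * (1 + ?X ^ n)"
    proof (cases "?X \<le> 1")
      case True
      then have "(1 + ?X) ^ n \<le> 2 ^ n" by (intro power_mono) auto
      also have "\<dots> \<le> 2 ^ n * (1 + ?X ^ n)" by simp
      finally show ?thesis .
    next
      case False
      then have "(1 + ?X) ^ n \<le> (2 * ?X) ^ n" by (intro power_mono) auto
      also have "\<dots> \<le> 2 ^ n * (1 + ?X ^ n)" by (simp add: power_mult_distrib)
      finally show ?thesis .
    qed
    finally have le: "(\<Prod>k\<in>UNIV. (1 + \<bar>x $ k\<bar>) powr A) \<le> 2 ^ n * (1 + ?X ^ n)" .
    have "?N * (\<Prod>k\<in>UNIV. (1 + \<bar>x $ k\<bar>) powr A) \<le> ?N * (2 ^ n * (1 + ?X ^ n))"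
      using le by (rule mult_left_mono) simp
    also have "\<dots> = 2 ^ n * (?N + ?X ^ n * ?N)" by (simp only: distrib_left distrib_right mult_1 mult_1_right mult_ac)
    also have "\<dots> \<le> 2 ^ n * (C0 + C i)" using C0[of x] C[of x i] by (intro mult_left_mono add_mono) auto
    also have "\<dots> \<le> K"
      unfolding K_def using Cnn by (intro mult_left_mono add_left_mono member_le_sum) auto
    finally have "?N * (\<Prod>k\<in>UNIV. (1 + \<bar>x $ k\<bar>) powr A) \<le> K" .
    moreover have "0 < (\<Prod>k\<in>UNIV. (1 + \<bar>x $ k\<bar>) powr A)"
      by (intro prod_pos) (simp add: add_pos_nonneg)
    ultimately have "?N \<le> K / (\<Prod>k\<in>UNIV. (1 + \<bar>x $ k\<bar>) powr A)" by (simp add: pos_le_divide_eq)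
    also have "\<dots> = K * decay A x"
      by (simp add: powr_minus divide_inverse prod_inversef[symmetric] comp_def)
    finally show ?thesis .
  qed
  then show ?thesis using K by blast
qed

lemma integrable_prod_lborel:
  fixes F :: "'a::euclidean_space \<times> 'b::euclidean_space \<Rightarrow> complex"
  assumes [measurable]: "F \<in> borel_measurable (lborel \<Otimes>\<^sub>M lborel)"
    and H: "integrable lborel H" and U: "integrable lborel U"
    and F: "\<And>x y. norm (F (x, y)) = norm (H x :: complex) * norm (U y :: complex)"
  shows "integrable (lborel \<Otimes>\<^sub>M lborel) F"
proof (rule lborel_pair.Fubini_integrable)
  show "integrable lborel (\<lambda>x. LINT y|lborel. norm (F (x, y)))"
    using H unfolding F by simp
  have "integrable lborel (\<lambda>y. F (x, y))" for x
  proof (rule Bochner_Integration.integrable_bound)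
    show "integrable lborel (\<lambda>y. norm (H x) * norm (U y))" using U by simp
  qed (auto simp: F)
  then show "AE x in lborel. integrable lborel (\<lambda>y. F (x, y))" by simp
qed measurable

text \<open>Fubini's theorem, in a form with several uses: with all factors -1 and
  \<open>z = 0\<close> it is the multiplication formula behind Fourier inversion, with the factors
  of a dilation it is the convolution theorem for the Littlewood--Paley pieces.\<close>

lemma inverse_fourier_mult_fourier:
  fixes H U :: "'d::finite rvec \<Rightarrow> complex"
  assumes H: "integrable lborel H" and U: "integrable lborel U"
  shows "inverse_fourier (\<lambda>\<xi>. H \<xi> * fourier U (diag_mult c \<xi>)) z
    = fourier_const TYPE('d) * (LINT x|lborel. U x * inverse_fourier H (z - diag_mult c x))"
proof -
  let ?K = "fourier_const TYPE('d)"
  define F where "F \<xi> x = H \<xi> * U x * exp (\<i> * complex_of_real ((z - diag_mult c x) \<bullet> \<xi>))" for \<xi> x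
  have [measurable]: "H \<in> borel_measurable borel" "U \<in> borel_measurable borel" using H U by auto
  have [measurable]: "(\<lambda>x::'d rvec. diag_mult c x) \<in> borel_measurable borel"
    by (intro borel_measurable_continuous_onI continuous_intros)
  have int: "integrable (lborel \<Otimes>\<^sub>M lborel) (case_prod F)"
  proof (rule integrable_prod_lborel[OF _ H U])
    show "case_prod F \<in> borel_measurable (lborel \<Otimes>\<^sub>M lborel)"
      unfolding F_def[abs_def] split_beta' by measurable
  qed (simp add: F_def norm_mult)
  have 1: "H \<xi> * fourier U (diag_mult c \<xi>) * exp (\<i> * complex_of_real (z \<bullet> \<xi>)) = ?K * (LINT x|lborel. F \<xi> x)" for \<xi>
  proof -
    have F: "F \<xi> x = (H \<xi> * exp (\<i> * complex_of_real (z \<bullet> \<xi>))) * (U x * exp (- (\<i> * complex_of_real (x \<bullet> diag_mult c \<xi>))))" for x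
    proof -
      have "exp (\<i> * complex_of_real ((z - diag_mult c x) \<bullet> \<xi>)) = exp (\<i> * complex_of_real (z \<bullet> \<xi>)) * exp (- (\<i> * complex_of_real (x \<bullet> diag_mult c \<xi>)))"
        unfolding exp_add[symmetric] inner_diag_mult by (simp add: inner_diff_left right_diff_distrib)
      then show ?thesis by (simp add: F_def mult_ac)
    qed
    have "(LINT x|lborel. F \<xi> x) = (H \<xi> * exp (\<i> * complex_of_real (z \<bullet> \<xi>))) * (LINT x|lborel. U x * exp (- (\<i> * complex_of_real (x \<bullet> diag_mult c \<xi>))))"
      unfolding F by (rule integral_mult_right_zero)
    then show ?thesis by (simp add: fourier_def mult_ac)
  qed
  have 2: "U x * inverse_fourier H (z - diag_mult c x) = ?K * (LINT \<xi>|lborel. F \<xi> x)" for x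
  proof -
    have "(LINT \<xi>|lborel. F \<xi> x) = (LINT \<xi>|lborel. U x * (H \<xi> * exp (\<i> * complex_of_real ((z - diag_mult c x) \<bullet> \<xi>))))"
      unfolding F_def by (simp add: mult_ac)
    also have "\<dots> = U x * (LINT \<xi>|lborel. H \<xi> * exp (\<i> * complex_of_real ((z - diag_mult c x) \<bullet> \<xi>)))"
      by (rule integral_mult_right_zero)
    finally show ?thesis by (simp add: inverse_fourier_def mult_ac)
  qed
  have "inverse_fourier (\<lambda>\<xi>. H \<xi> * fourier U (diag_mult c \<xi>)) z = ?K * (LINT \<xi>|lborel. ?K * (LINT x|lborel. F \<xi> x))"
    unfolding inverse_fourier_def 1 by simp
  also have "\<dots> = ?K * (?K * (LINT \<xi>|lborel. LINT x|lborel. F \<xi> x))" by simp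
  also have "(LINT \<xi>|lborel. LINT x|lborel. F \<xi> x) = (LINT x|lborel. LINT \<xi>|lborel. F \<xi> x)"
    by (rule lborel_pair.Fubini_integral[OF int, symmetric])
  also have "?K * (?K * \<dots>) = ?K * (LINT x|lborel. ?K * (LINT \<xi>|lborel. F \<xi> x))" by simp
  finally show ?thesis unfolding 2 .
qed

section \<open>Gaussian regularization and Fourier inversion\<close>

lemma gauss_integrable: "integrable lborel (\<lambda>t::real. exp (- t\<^sup>2 / 2))"
proof -
  have "integrable lborel (\<lambda>t. sqrt (2 * pi) * std_normal_density t)"
    by (intro integrable_mult_right integrable_normal_density) simp
  then show ?thesis by (simp add: std_normal_density_def)
qed

text \<open>Up to normalization this is the characteristic function of the standard normal
  distribution.\<close>

lemma gauss_fourier_1d: "(LINT t|lborel. complex_of_real (exp (- t\<^sup>2 / 2)) * iexp (t * s)) = complex_of_real (sqrt (2 * pi) * exp (- s\<^sup>2 / 2))"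
proof -
  have "char std_normal_distribution s = (LINT t|lborel. std_normal_density t *\<^sub>R iexp (s * t))"
    unfolding char_def by (subst integral_density) (auto simp: normal_density_nonneg)
  also have "\<dots> = (LINT t|lborel. complex_of_real (1 / sqrt (2 * pi)) * (complex_of_real (exp (- t\<^sup>2 / 2)) * iexp (t * s)))"
    by (simp add: std_normal_density_def scaleR_conv_of_real mult_ac)
  also have "\<dots> = complex_of_real (1 / sqrt (2 * pi)) * (LINT t|lborel. complex_of_real (exp (- t\<^sup>2 / 2)) * iexp (t * s))"
    by (rule integral_mult_right_zero)
  finally have "complex_of_real (1 / sqrt (2 * pi)) * (LINT t|lborel. complex_of_real (exp (- t\<^sup>2 / 2)) * iexp (t * s)) = complex_of_real (exp (- s\<^sup>2 / 2))"
    by (simp add: char_std_normal_distribution)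
  then have "complex_of_real (sqrt (2 * pi)) * (complex_of_real (1 / sqrt (2 * pi)) * (LINT t|lborel. complex_of_real (exp (- t\<^sup>2 / 2)) * iexp (t * s))) = complex_of_real (sqrt (2 * pi)) * complex_of_real (exp (- s\<^sup>2 / 2))"
    by simp
  moreover have "complex_of_real (sqrt (2 * pi)) * complex_of_real (1 / sqrt (2 * pi)) = 1"
    unfolding of_real_mult[symmetric] by simp
  ultimately show ?thesis by (simp only: mult.assoc[symmetric] mult_1_left of_real_mult)
qed

abbreviation gauss :: "'d::finite rvec \<Rightarrow> real" where
  "gauss x \<equiv> exp (- (x \<bullet> x) / 2)"

lemma gauss_prod: "gauss x = (\<Prod>i\<in>UNIV. exp (- (x $ i)\<^sup>2 / 2))"
  by (simp add: exp_sum[symmetric] inner_vec_def power2_eq_square sum_divide_distrib[symmetric] sum_negf)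

lemma gauss_integrable_vec: "integrable lborel (\<lambda>x::'d::finite rvec. gauss x)"
  unfolding gauss_prod by (rule integrable_prod_vec) (rule gauss_integrable)

lemma gauss_fourier_vec:
  "(LINT x|lborel. complex_of_real (gauss (x::'d::finite rvec)) * iexp (x \<bullet> \<eta>))
    = complex_of_real ((2 * pi) powr (real CARD('d) / 2) * gauss \<eta>)"
proof -
  have eq: "complex_of_real (gauss x) * iexp (x \<bullet> \<eta>) = (\<Prod>i\<in>UNIV. complex_of_real (exp (- (x $ i)\<^sup>2 / 2)) * iexp (x $ i * \<eta> $ i))" for x :: "'d rvec"
  proof -
    have "iexp (x \<bullet> \<eta>) = (\<Prod>i\<in>UNIV. iexp (x $ i * \<eta> $ i))"
      unfolding inner_vec_def by (simp add: exp_sum sum_distrib_left)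
    then show ?thesis unfolding gauss_prod of_real_prod prod.distrib by simp
  qed
  have int: "integrable lborel (\<lambda>t. complex_of_real (exp (- t\<^sup>2 / 2)) * iexp (t * \<eta> $ i))" for i
    using gauss_integrable by (rule Bochner_Integration.integrable_bound) (auto simp: norm_mult)
  have "(LINT x|lborel. complex_of_real (gauss (x::'d rvec)) * iexp (x \<bullet> \<eta>)) = (\<Prod>i\<in>UNIV. complex_of_real (sqrt (2 * pi) * exp (- (\<eta> $ i)\<^sup>2 / 2)))"
    unfolding eq by (subst integral_prod_vec[OF int]) (simp only: gauss_fourier_1d)
  also have "\<dots> = complex_of_real (sqrt (2 * pi) ^ CARD('d) * gauss \<eta>)"
    unfolding gauss_prod of_real_prod[symmetric] by (simp add: prod.distrib)
  also have "sqrt (2 * pi) ^ CARD('d) = (2 * pi) powr (real CARD('d) / 2)"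
    by (simp add: powr_half_sqrt[symmetric] powr_realpow[symmetric] powr_powr)
  finally show ?thesis .
qed

text \<open>A Gaussian factor of width \<open>1 / h n\<close> is inserted into the outer integral.
  The multiplication formula turns the result into an average of \<open>m\<close> around \<xi>
  against a Gaussian of width \<open>h n\<close>, and dominated convergence applies on both sides as
  \<open>h n\<close> tends to 0.\<close>

lemma fourier_inversion:
  fixes m :: "'d::finite rvec \<Rightarrow> complex"
  assumes cont: "continuous_on UNIV m" and B: "\<And>x. norm (m x) \<le> B"
    and m: "integrable lborel m" and M: "integrable lborel (inverse_fourier m)"
  shows "fourier (inverse_fourier m) \<xi> = m \<xi>"
proof -
  let ?K = "fourier_const TYPE('d)" and ?M = "inverse_fourier m" and ?d = "CARD('d)"
  let ?k = "(2 * pi) powr (real ?d / 2)"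
  have Kk: "?K * complex_of_real ?k = 1"
    unfolding of_real_mult[symmetric] powr_add[symmetric] by simp
  have [measurable]: "m \<in> borel_measurable borel" "?M \<in> borel_measurable borel" using m M by auto
  have [measurable]: "(\<lambda>x::'d rvec. gauss (z + c *\<^sub>R x)) \<in> borel_measurable borel" for c z
    by (intro borel_measurable_continuous_onI continuous_intros) auto
  define h where "h n = inverse (real (Suc n))" for n
  have h0: "0 < h n" for n by (auto simp: h_def)
  have hlim: "h \<longlonglongrightarrow> 0" unfolding h_def by (rule LIMSEQ_inverse_real_of_nat)
  define U where "U n x = exp (- (\<i> * complex_of_real (x \<bullet> \<xi>))) * complex_of_real (gauss (h n *\<^sub>R x))" for n x
  have diag: "diag_mult (\<lambda>_. c) x = c *\<^sub>R x" for c and x :: "'d rvec" by (simp add: vec_eq_iff)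
  have g1: "gauss y \<le> 1" for y :: "'d rvec" by simp
  have neg: "(\<chi> i. - x $ i) = - x" for x :: "'d rvec" by (simp add: vec_eq_iff)
  have intU: "integrable lborel (U n)" for n
  proof -
    have "integrable lborel (\<lambda>x::'d rvec. gauss (h n *\<^sub>R x))"
      using integrable_affine_vec[OF _ gauss_integrable_vec, of "\<lambda>_::'d. h n" 0] h0[of n] by (simp add: diag)
    then show ?thesis
    proof (rule Bochner_Integration.integrable_bound)
      show "U n \<in> borel_measurable lborel"
        unfolding U_def[abs_def] measurable_lborel2
        by (intro borel_measurable_continuous_onI continuous_intros) auto
    qed (simp add: U_def norm_mult)
  qed
  have lim1: "(\<lambda>n. LINT x|lborel. U n x * ?M x) \<longlonglongrightarrow> (LINT x|lborel. exp (- (\<i> * complex_of_real (x \<bullet> \<xi>))) * ?M x)"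
  proof (rule integral_dominated_convergence[where w="\<lambda>x. norm (?M x)"])
    show "integrable lborel (\<lambda>x. norm (?M x))" using M by simp
    show "AE x in lborel. (\<lambda>n. U n x * ?M x) \<longlonglongrightarrow> exp (- (\<i> * complex_of_real (x \<bullet> \<xi>))) * ?M x"
    proof (rule AE_I2)
      fix x :: "'d rvec"
      have "(\<lambda>n. gauss (h n *\<^sub>R x)) \<longlonglongrightarrow> gauss (0 *\<^sub>R x)" by (intro tendsto_intros hlim) auto
      then have "(\<lambda>n. complex_of_real (gauss (h n *\<^sub>R x))) \<longlonglongrightarrow> complex_of_real (gauss (0 *\<^sub>R x))" by (rule tendsto_of_real)
      then have "(\<lambda>n. U n x) \<longlonglongrightarrow> exp (- (\<i> * complex_of_real (x \<bullet> \<xi>))) * complex_of_real (gauss (0 *\<^sub>R x))"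
        unfolding U_def by (intro tendsto_mult tendsto_const)
      then show "(\<lambda>n. U n x * ?M x) \<longlonglongrightarrow> exp (- (\<i> * complex_of_real (x \<bullet> \<xi>))) * ?M x"
        by (intro tendsto_mult tendsto_const) simp
    qed
    show "AE x in lborel. norm (U n x * ?M x) \<le> norm (?M x)" for n
    proof (rule AE_I2)
      fix x
      have "gauss (h n *\<^sub>R x) * norm (?M x) \<le> norm (?M x)"
        by (rule mult_left_le_one_le[OF norm_ge_zero _ g1]) simp
      then show "norm (U n x * ?M x) \<le> norm (?M x)" by (simp only: U_def norm_mult) simp
    qed
    show "(\<lambda>x. U n x * ?M x) \<in> borel_measurable lborel" for n
      using intU[of n] by (intro borel_measurable_times) auto
  qed measurable
  \<comment> \<open>A Gaussian of width \<open>h n\<close> centred at \<xi>. Its factor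
    \<open>inverse (h n ^ ?d)\<close> cancels against the Jacobian of the substitution
    \<open>\<eta> = \<xi> + h n *\<^sub>R z\<close> made below.\<close>
  have FU: "fourier (U n) (- \<eta>) = complex_of_real (inverse (h n ^ ?d)) * complex_of_real (gauss ((1 / h n) *\<^sub>R (\<eta> - \<xi>)))" for n \<eta>
  proof -
    let ?f = "\<lambda>y. complex_of_real (gauss y) * iexp (y \<bullet> ((1 / h n) *\<^sub>R (\<eta> - \<xi>)))"
    have "(LINT x|lborel. U n x * exp (- (\<i> * complex_of_real (x \<bullet> (- \<eta>))))) = (LINT x|lborel. ?f (h n *\<^sub>R x))"
    proof (intro Bochner_Integration.integral_cong refl)
      fix x
      have "exp (- (\<i> * complex_of_real (x \<bullet> \<xi>))) * exp (- (\<i> * complex_of_real (x \<bullet> (- \<eta>)))) = iexp (x \<bullet> (\<eta> - \<xi>))"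
        unfolding exp_add[symmetric] by (simp add: inner_diff_right right_diff_distrib)
      then show "U n x * exp (- (\<i> * complex_of_real (x \<bullet> (- \<eta>)))) = ?f (h n *\<^sub>R x)"
        using h0[of n] by (simp add: U_def mult_ac)
    qed
    also have "complex_of_real (h n ^ ?d) * \<dots> = (LINT x|lborel. ?f x)"
      using integral_affine_vec[of "\<lambda>_. h n" ?f 0] h0[of n] by (simp add: diag scaleR_conv_of_real)
    also have "\<dots> = complex_of_real (?k * gauss ((1 / h n) *\<^sub>R (\<eta> - \<xi>)))" by (rule gauss_fourier_vec)
    finally have "?K * (complex_of_real (h n ^ ?d) * (LINT x|lborel. U n x * exp (- (\<i> * complex_of_real (x \<bullet> (- \<eta>)))))) = complex_of_real (gauss ((1 / h n) *\<^sub>R (\<eta> - \<xi>)))"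
      using Kk by (simp add: mult.assoc[symmetric])
    then have "complex_of_real (h n ^ ?d) * fourier (U n) (- \<eta>) = complex_of_real (gauss ((1 / h n) *\<^sub>R (\<eta> - \<xi>)))"
      by (simp add: fourier_def mult_ac)
    moreover have "complex_of_real (inverse (h n ^ ?d)) * complex_of_real (h n ^ ?d) = 1"
      unfolding of_real_mult[symmetric] using h0[of n] by simp
    ultimately show ?thesis by (metis mult.assoc mult_1)
  qed
  have eq: "(LINT x|lborel. U n x * ?M x) = (LINT z|lborel. m (\<xi> + h n *\<^sub>R z) * complex_of_real (gauss z))" for n
  proof -
    have "?K * (LINT x|lborel. U n x * ?M x) = inverse_fourier (\<lambda>\<eta>. m \<eta> * fourier (U n) (- \<eta>)) 0"
      using inverse_fourier_mult_fourier[OF m intU[of n], of "\<lambda>_. -1" 0] by (simp add: neg)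
    also have "\<dots> = ?K * (LINT \<eta>|lborel. m \<eta> * fourier (U n) (- \<eta>))"
      by (simp add: inverse_fourier_def)
    finally have "(LINT x|lborel. U n x * ?M x) = (LINT \<eta>|lborel. m \<eta> * fourier (U n) (- \<eta>))"
      by simp
    also have "\<dots> = (h n ^ ?d) *\<^sub>R (LINT z|lborel. m (\<xi> + h n *\<^sub>R z) * fourier (U n) (- (\<xi> + h n *\<^sub>R z)))"
      using integral_affine_vec[of "\<lambda>_. h n" "\<lambda>\<eta>. m \<eta> * fourier (U n) (- \<eta>)" \<xi>] h0[of n] by (simp add: diag)
    also have "\<dots> = (LINT z|lborel. m (\<xi> + h n *\<^sub>R z) * complex_of_real (gauss z))"
    proof -
      have one: "complex_of_real (h n ^ ?d) * complex_of_real (inverse (h n ^ ?d)) = 1"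
        unfolding of_real_mult[symmetric] using h0[of n] by simp
      have "(\<lambda>z. m (\<xi> + h n *\<^sub>R z) * fourier (U n) (- (\<xi> + h n *\<^sub>R z)))
        = (\<lambda>z. complex_of_real (inverse (h n ^ ?d)) * (m (\<xi> + h n *\<^sub>R z) * complex_of_real (gauss z)))"
      proof
        fix z
        have "(1 / h n) *\<^sub>R (\<xi> + h n *\<^sub>R z - \<xi>) = z" using h0[of n] by simp
        then show "m (\<xi> + h n *\<^sub>R z) * fourier (U n) (- (\<xi> + h n *\<^sub>R z)) = complex_of_real (inverse (h n ^ ?d)) * (m (\<xi> + h n *\<^sub>R z) * complex_of_real (gauss z))"
          unfolding FU by (simp only: mult.left_commute)
      qed
      then have I: "(LINT z|lborel. m (\<xi> + h n *\<^sub>R z) * fourier (U n) (- (\<xi> + h n *\<^sub>R z)))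
        = complex_of_real (inverse (h n ^ ?d)) * (LINT z|lborel. m (\<xi> + h n *\<^sub>R z) * complex_of_real (gauss z))"
        by (simp only: integral_mult_right_zero)
      have "(h n ^ ?d) *\<^sub>R (complex_of_real (inverse (h n ^ ?d)) * w) = w" for w
        using one by (simp only: scaleR_conv_of_real mult.assoc[symmetric] mult_1)
      then show ?thesis unfolding I .
    qed
    finally show ?thesis .
  qed
  have lim2: "(\<lambda>n. LINT z|lborel. m (\<xi> + h n *\<^sub>R z) * complex_of_real (gauss z)) \<longlonglongrightarrow> (LINT z|lborel. m \<xi> * complex_of_real (gauss (z::'d rvec)))"
  proof (rule integral_dominated_convergence[where w="\<lambda>x. B * gauss x"])
    show "integrable lborel (\<lambda>x::'d rvec. B * gauss x)" by (intro integrable_mult_right gauss_integrable_vec)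
    show "AE z in lborel. (\<lambda>n. m (\<xi> + h n *\<^sub>R z) * complex_of_real (gauss z)) \<longlonglongrightarrow> m \<xi> * complex_of_real (gauss z)"
    proof (rule AE_I2)
      fix z :: "'d rvec"
      have "(\<lambda>n. \<xi> + h n *\<^sub>R z) \<longlonglongrightarrow> \<xi> + 0 *\<^sub>R z" by (intro tendsto_intros hlim)
      moreover have "isCont m \<xi>" using cont by (simp add: continuous_on_eq_continuous_at)
      ultimately have "(\<lambda>n. m (\<xi> + h n *\<^sub>R z)) \<longlonglongrightarrow> m \<xi>"
        by (intro isCont_tendsto_compose[of \<xi> m]) auto
      then show "(\<lambda>n. m (\<xi> + h n *\<^sub>R z) * complex_of_real (gauss z)) \<longlonglongrightarrow> m \<xi> * complex_of_real (gauss z)"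
        by (intro tendsto_mult tendsto_const)
    qed
    show "AE z in lborel. norm (m (\<xi> + h n *\<^sub>R z) * complex_of_real (gauss z)) \<le> B * gauss z" for n
    proof (rule AE_I2)
      fix z :: "'d rvec"
      have "norm (m (\<xi> + h n *\<^sub>R z)) * gauss z \<le> B * gauss z"
        by (rule mult_right_mono[OF B]) simp
      then show "norm (m (\<xi> + h n *\<^sub>R z) * complex_of_real (gauss z)) \<le> B * gauss z"
        unfolding norm_mult norm_of_real by simp
    qed
    have "integrable lborel (\<lambda>z::'d rvec. complex_of_real (gauss z))"
      by (rule integrable_of_real) (rule gauss_integrable_vec)
    then have g: "(\<lambda>z::'d rvec. complex_of_real (gauss z)) \<in> borel_measurable lborel"
      by (rule borel_measurable_integrable)
    show "(\<lambda>z::'d rvec. m \<xi> * complex_of_real (gauss z)) \<in> borel_measurable lborel"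
      by (intro borel_measurable_times borel_measurable_const g)
    have "(\<lambda>z. m (\<xi> + h n *\<^sub>R z)) \<in> borel_measurable lborel" for n by measurable
    then show "(\<lambda>z. m (\<xi> + h n *\<^sub>R z) * complex_of_real (gauss z)) \<in> borel_measurable lborel" for n
      by (intro borel_measurable_times g)
  qed
  have "(LINT z|lborel. m \<xi> * complex_of_real (gauss (z::'d rvec))) = m \<xi> * complex_of_real ?k"
    using gauss_fourier_vec[of "0::'d rvec"] by simp
  moreover have "(LINT x|lborel. exp (- (\<i> * complex_of_real (x \<bullet> \<xi>))) * ?M x) = (LINT z|lborel. m \<xi> * complex_of_real (gauss (z::'d rvec)))"
    using LIMSEQ_unique[OF lim1 lim2[folded eq]] .
  ultimately have "(LINT x|lborel. exp (- (\<i> * complex_of_real (x \<bullet> \<xi>))) * ?M x) = m \<xi> * complex_of_real ?k" by simp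
  then have "fourier ?M \<xi> = m \<xi> * (?K * complex_of_real ?k)"
    by (simp add: fourier_def mult_ac)
  then show ?thesis using Kk by simp
qed

lemma integrable_decay:
  assumes "2 \<le> A" shows "integrable lborel (\<lambda>x::'d::finite rvec. decay A x)"
proof (rule Bochner_Integration.integrable_bound[OF integrable_prod_tw])
  have "decay A x \<le> (\<Prod>i\<in>UNIV. tw (x $ i))" for x :: "'d rvec"
    using powr_le_tw[OF assms] by (intro prod_mono) auto
  then show "AE x in lborel. norm (decay A (x :: 'd rvec)) \<le> norm (\<Prod>i\<in>UNIV. tw (x $ i))"
    by (intro AE_I2) (simp add: prod_nonneg)
qed simp

lemma test_function_inversion:
  fixes m :: "'d::finite rvec \<Rightarrow> complex"
  assumes "\<And>n. Ck n UNIV m" "\<And>x. R < norm x \<Longrightarrow> m x = 0"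
  shows "integrable lborel (inverse_fourier m)" "fourier (inverse_fourier m) = m"
proof -
  have c: "continuous_on UNIV m" using Ck_continuous_on[OF assms(1)] .
  note i = compact_support_integrable[OF c assms(2)]
  then have [measurable]: "m \<in> borel_measurable borel" by auto
  obtain C where C: "0 \<le> C" "\<And>x. norm (inverse_fourier m x) \<le> C * decay 2 x"
    using inverse_fourier_decay[OF assms(1,2), where A=2] by auto
  show I: "integrable lborel (inverse_fourier m)"
  proof (rule Bochner_Integration.integrable_bound)
    show "integrable lborel (\<lambda>x::'d rvec. C * decay 2 x)"
      by (intro integrable_mult_right integrable_decay) simp
    show "inverse_fourier m \<in> borel_measurable lborel"
      unfolding inverse_fourier_def[abs_def] by measurable
  qed (use C in \<open>auto simp: prod_nonneg abs_mult\<close>)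
  obtain B where "\<And>x. norm (m x) \<le> B" using compact_support_bound[OF c assms(2)] by blast
  from fourier_inversion[OF c this i I] show "fourier (inverse_fourier m) = m" by (rule ext)
qed

text \<open>Each cosine factor splits the kernel into two translates, to \<open>\<plusminus>\<tau> i\<close> in direction \<open>i\<close>;
  both are dominated by the same even weight.\<close>

lemma inverse_fourier_cos_decay:
  fixes u :: "'d::finite rvec \<Rightarrow> complex"
  assumes u: "integrable lborel u" and C: "0 \<le> C" "\<And>x. norm (inverse_fourier u x) \<le> C * decay A x"
    and A: "0 \<le> A" and \<tau>: "\<And>i. 0 \<le> \<tau> i"
  shows "norm (inverse_fourier (\<lambda>\<xi>. u \<xi> * complex_of_real (\<Prod>i\<in>S. cos (\<tau> i * (\<xi> $ i - \<alpha> i)))) x)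
    \<le> C * (\<Prod>i\<in>UNIV. (1 + \<bar>if i \<in> S then \<bar>x $ i\<bar> - \<tau> i else x $ i\<bar>) powr (- A))"
proof -
  have "finite S" by simp
  then show ?thesis
  proof (induction S arbitrary: x rule: finite_induct)
    case empty show ?case using C(2)[of x] by simp
  next
    case (insert k S)
    let ?v = "\<lambda>\<xi>. u \<xi> * complex_of_real (\<Prod>i\<in>S. cos (\<tau> i * (\<xi> $ i - \<alpha> i)))"
    let ?W = "\<lambda>S x. \<Prod>i\<in>UNIV. (1 + \<bar>if i \<in> S then \<bar>x $ i\<bar> - \<tau> i else x $ i\<bar>) powr (- A)"
    have [measurable]: "u \<in> borel_measurable borel" using u by auto
    have v: "integrable lborel ?v"
    proof (rule Bochner_Integration.integrable_bound[OF u])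
      have "\<bar>\<Prod>i\<in>S. cos (\<tau> i * (\<xi> $ i - \<alpha> i))\<bar> \<le> 1" for \<xi> :: "'d rvec"
        unfolding abs_prod by (intro prod_le_1) auto
      then show "AE \<xi> in lborel. norm (?v \<xi>) \<le> norm (u \<xi>)"
        by (intro AE_I2) (simp add: norm_mult mult_left_le del: of_real_prod)
    qed measurable
    let ?e = "axis k (\<tau> k) :: 'd rvec"
    let ?c = "exp (\<i> * complex_of_real (\<tau> k * \<alpha> k))"
    \<comment> \<open>For \<open>\<tau> k \<ge> 0\<close> the number
      \<open>\<bar>\<bar>x $ k\<bar> - \<tau> k\<bar>\<close> is the distance of
      \<open>x $ k\<close> to the nearer one of the two centres \<plusminus>\<open>\<tau> k\<close>,
      so it bounds both translates.\<close>
    have W: "?W S (x + y) \<le> ?W (insert k S) x" if y: "y = ?e \<or> y = - ?e" for y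
    proof (intro prod_mono conjI)
      fix i
      have "\<bar>if i \<in> insert k S then \<bar>x $ i\<bar> - \<tau> i else x $ i\<bar> \<le> \<bar>if i \<in> S then \<bar>(x + y) $ i\<bar> - \<tau> i else (x + y) $ i\<bar>"
        using y insert.hyps \<tau>[of k] by (cases "i = k") (auto simp: axis_def)
      then show "(1 + \<bar>if i \<in> S then \<bar>(x + y) $ i\<bar> - \<tau> i else (x + y) $ i\<bar>) powr - A \<le> (1 + \<bar>if i \<in> insert k S then \<bar>x $ i\<bar> - \<tau> i else x $ i\<bar>) powr - A"
        using A by (intro powr_mono2') auto
    qed simp
    have eq: "?v \<xi> * complex_of_real (cos (\<tau> k * (\<xi> $ k - \<alpha> k))) * exp (\<i> * complex_of_real (x \<bullet> \<xi>))
      = (inverse ?c * (?v \<xi> * exp (\<i> * complex_of_real ((x + ?e) \<bullet> \<xi>))) + ?c * (?v \<xi> * exp (\<i> * complex_of_real ((x + (- ?e)) \<bullet> \<xi>)))) / 2" for \<xi>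
    proof -
      let ?t = "exp (\<i> * complex_of_real (\<tau> k * \<xi> $ k))" and ?x = "exp (\<i> * complex_of_real (x \<bullet> \<xi>))"
      have "complex_of_real (cos (\<tau> k * (\<xi> $ k - \<alpha> k))) = (?t * inverse ?c + inverse ?t * ?c) / 2"
      proof -
        let ?q = "complex_of_real (\<tau> k * (\<xi> $ k - \<alpha> k))"
        have "exp (\<i> * ?q) = ?t * inverse ?c" "exp (- (\<i> * ?q)) = inverse ?t * ?c"
          unfolding exp_minus[symmetric] exp_add[symmetric] by (simp_all add: right_diff_distrib)
        then show ?thesis using cos_exp_eq[of ?q] by (simp only: cos_of_real)
      qed
      moreover have "exp (\<i> * complex_of_real ((x + ?e) \<bullet> \<xi>)) = ?x * ?t"
        unfolding exp_add[symmetric] by (simp add: inner_add_left inner_axis' distrib_left)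
      moreover have "exp (\<i> * complex_of_real ((x + (- ?e)) \<bullet> \<xi>)) = ?x * inverse ?t"
        unfolding exp_minus[symmetric] exp_add[symmetric] by (simp add: inner_diff_left inner_axis' right_diff_distrib)
      ultimately show ?thesis
        by (simp only: times_divide_eq_right times_divide_eq_left distrib_left distrib_right mult_ac)
    qed
    have "inverse_fourier (\<lambda>\<xi>. ?v \<xi> * complex_of_real (cos (\<tau> k * (\<xi> $ k - \<alpha> k)))) x
      = (inverse ?c * inverse_fourier ?v (x + ?e) + ?c * inverse_fourier ?v (x + (- ?e))) / 2"
    proof -
      have i1: "integrable lborel (\<lambda>\<xi>. inverse ?c * (?v \<xi> * exp (\<i> * complex_of_real ((x + ?e) \<bullet> \<xi>))))"
        and i2: "integrable lborel (\<lambda>\<xi>. ?c * (?v \<xi> * exp (\<i> * complex_of_real ((x + (- ?e)) \<bullet> \<xi>))))"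
        by (intro integrable_mult_right integrable_mult_exp v)+
      show ?thesis unfolding inverse_fourier_def eq integral_divide_zero
          Bochner_Integration.integral_add[OF i1 i2] integral_mult_right_zero
        by (simp only: distrib_left mult.left_commute times_divide_eq_right)
    qed
    moreover have "norm ((inverse ?c * y + ?c * z) / 2) \<le> (norm y + norm z) / 2" for y z
    proof -
      have "norm (inverse ?c * y) = norm y" "norm (?c * z) = norm z"
        by (simp_all only: norm_mult norm_inverse norm_exp_i_times inverse_1 mult_1)
      then show ?thesis using norm_triangle_ineq[of "inverse ?c * y" "?c * z"] by (simp add: norm_divide)
    qed
    ultimately have "norm (inverse_fourier (\<lambda>\<xi>. ?v \<xi> * complex_of_real (cos (\<tau> k * (\<xi> $ k - \<alpha> k)))) x)
      \<le> (norm (inverse_fourier ?v (x + ?e)) + norm (inverse_fourier ?v (x + (- ?e)))) / 2"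
      by (simp only:)
    also have "\<dots> \<le> (C * ?W (insert k S) x + C * ?W (insert k S) x) / 2"
    proof (intro divide_right_mono add_mono)
      show "norm (inverse_fourier ?v (x + ?e)) \<le> C * ?W (insert k S) x"
        using insert.IH[of "x + ?e"] mult_left_mono[OF W[OF disjI1[OF refl]] C(1)] by linarith
      show "norm (inverse_fourier ?v (x + (- ?e))) \<le> C * ?W (insert k S) x"
        using insert.IH[of "x + (- ?e)"] mult_left_mono[OF W[OF disjI2[OF refl]] C(1)] by linarith
    qed simp
    finally show ?case using insert.hyps by (simp add: mult_ac)
  qed
qed

section \<open>Anisotropic dilations\<close>

definition scl :: "'d::finite rvec \<Rightarrow> int \<Rightarrow> 'd \<Rightarrow> real" where
  "scl a j i = 2 powr (real_of_int j * a $ i)"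

lemma scl_pos [simp]: "0 < scl a j i" "scl a j i \<noteq> 0" "0 \<le> scl a j i"
  by (simp_all add: scl_def)

lemma scl_add: "scl a (j + k) i = scl a j i * scl a k i"
  by (simp add: scl_def powr_add distrib_right)

lemma scl_0 [simp]: "scl a 0 i = 1" by (simp add: scl_def)

lemma scl_minus: "scl a (- j) i = inverse (scl a j i)"
  by (simp add: scl_def powr_minus)

lemma scl_mult_minus [simp]: "scl a j i * scl a (- j) i = 1" "scl a (- j) i * scl a j i = 1"
  by (simp_all add: scl_minus)

definition aniso_dim :: "'d::finite rvec \<Rightarrow> real" where "aniso_dim a = (\<Sum>i\<in>UNIV. a $ i)"

lemma prod_scl: "(\<Prod>i\<in>UNIV. scl a j i) = 2 powr (real_of_int j * aniso_dim a)"
  by (simp add: scl_def powr_sum[symmetric] aniso_dim_def sum_distrib_left)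

lemma dilate_scl: "dilate 2 (real_of_int j *\<^sub>R a) x = diag_mult (scl a j) x"
  by (simp add: dilate_def scl_def vec_eq_iff)

section \<open>Affine substitutions in Schwartz functions\<close>

lemma norm_diag_mult_le: "norm (diag_mult c x) \<le> (\<Sum>i\<in>UNIV. \<bar>c i\<bar>) * norm x"
proof -
  have "norm (diag_mult c x) \<le> (\<Sum>i\<in>UNIV. \<bar>diag_mult c x $ i\<bar>)" by (rule norm_le_l1_cart)
  also have "\<dots> \<le> (\<Sum>i\<in>UNIV. \<bar>c i\<bar> * norm x)"
    using component_le_norm_cart[of x] by (intro sum_mono) (simp add: abs_mult mult_left_mono)
  finally show ?thesis by (simp add: sum_distrib_right)
qed

lemma bounded_linear_diag_mult: "bounded_linear (diag_mult c)"
proof (rule bounded_linear_intro)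
  show "norm (diag_mult c x) \<le> norm x * (\<Sum>i\<in>UNIV. \<bar>c i\<bar>)" for x
    using norm_diag_mult_le[of c x] by (simp add: mult.commute)
qed (simp_all add: vec_eq_iff algebra_simps)

lemma has_derivative_diag_affine:
  "((\<lambda>y. z + diag_mult s y) has_derivative (\<lambda>h. diag_mult s h)) (at y)"
  using has_derivative_add[OF has_derivative_const[of z] bounded_linear_imp_has_derivative[OF bounded_linear_diag_mult]]
  by simp

text \<open>A diagonal map sends basis vectors to multiples of themselves. Hence each iterated
  partial derivative of the substituted function is a constant times the substituted derivative of
  \<open>\<phi>\<close>, and only the polynomial weights have to be compared.\<close>

lemma schwartz_affine:
  fixes \<phi> :: "'d::finite rvec \<Rightarrow> complex"
  assumes \<phi>: "\<phi> \<in> schwartz" and s: "\<And>i. s i \<noteq> 0"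
  shows "(\<lambda>y. c * \<phi> (z + diag_mult s y)) \<in> schwartz"
proof -
  let ?\<psi> = "\<lambda>y. c * \<phi> (z + diag_mult s y)"
  have diff: "iterated_partial bs \<phi> differentiable (at x)" if "set bs \<subseteq> Basis" for bs x
    using \<phi> that by (simp add: schwartz_def smooth_def differentiable_on_def)
  have comp: "((\<lambda>y. K * iterated_partial bs \<phi> (z + diag_mult s y)) has_derivative
      (\<lambda>h. K * frechet_derivative (iterated_partial bs \<phi>) (at (z + diag_mult s y)) (diag_mult s h))) (at y)"
    if "set bs \<subseteq> Basis" for bs K y
  proof -
    have 1: "(iterated_partial bs \<phi> has_derivative frechet_derivative (iterated_partial bs \<phi>) (at (z + diag_mult s y))) (at (z + diag_mult s y))"
      using diff[OF that] frechet_derivative_works by blast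
    show ?thesis by (rule has_derivative_mult_right[OF has_derivative_compose[OF has_derivative_diag_affine 1]])
  qed
  have ex: "\<exists>K. iterated_partial bs ?\<psi> = (\<lambda>y. K * iterated_partial bs \<phi> (z + diag_mult s y))" if "set bs \<subseteq> Basis" for bs
    using that
  proof (induction bs)
    case Nil show ?case by auto
  next
    case (Cons b bs)
    then obtain K where K: "iterated_partial bs ?\<psi> = (\<lambda>y. K * iterated_partial bs \<phi> (z + diag_mult s y))" by auto
    from Cons.prems obtain i where i: "b = axis i 1" by (auto simp: Basis_vec_axis)
    have sb: "diag_mult s b = s i *\<^sub>R b" by (simp add: i vec_eq_iff axis_def)
    have bs: "set bs \<subseteq> Basis" using Cons.prems by simp
    have "frechet_derivative (iterated_partial bs ?\<psi>) (at y) b = (K * complex_of_real (s i)) * frechet_derivative (iterated_partial bs \<phi>) (at (z + diag_mult s y)) b" for y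
    proof -
      let ?F = "frechet_derivative (iterated_partial bs \<phi>) (at (z + diag_mult s y))"
      have "(\<lambda>h. K * ?F (diag_mult s h)) = frechet_derivative (iterated_partial bs ?\<psi>) (at y)"
        unfolding K by (rule frechet_derivative_at[OF comp[OF bs]])
      from fun_cong[OF this, of b] have "frechet_derivative (iterated_partial bs ?\<psi>) (at y) b = K * ?F (diag_mult s b)" by simp
      also have "?F (diag_mult s b) = s i *\<^sub>R ?F b"
        unfolding sb by (rule linear_scale[OF linear_frechet_derivative[OF diff[OF bs]]])
      finally show ?thesis by (simp add: scaleR_conv_of_real mult.assoc)
    qed
    then have "iterated_partial (b # bs) ?\<psi> = (\<lambda>y. (K * complex_of_real (s i)) * iterated_partial (b # bs) \<phi> (z + diag_mult s y))"
      by simp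
    then show ?case by blast
  qed
  have "smooth ?\<psi>" unfolding smooth_def
  proof (intro allI impI)
    fix bs :: "'d rvec list" assume bs: "set bs \<subseteq> Basis"
    then obtain K where K: "iterated_partial bs ?\<psi> = (\<lambda>y. K * iterated_partial bs \<phi> (z + diag_mult s y))" using ex by blast
    show "iterated_partial bs ?\<psi> differentiable_on UNIV"
      unfolding K differentiable_on_def by (intro ballI differentiableI[OF comp[OF bs]])
  qed
  moreover have "bounded (range (\<lambda>x. (1 + norm x) ^ k *\<^sub>R iterated_partial bs ?\<psi> x))" if bs: "set bs \<subseteq> Basis" for k bs
  proof -
    obtain K where K: "iterated_partial bs ?\<psi> = (\<lambda>y. K * iterated_partial bs \<phi> (z + diag_mult s y))" using ex bs by blast
    have "bounded (range (\<lambda>x. (1 + norm x) ^ k *\<^sub>R iterated_partial bs \<phi> x))" using \<phi> bs by (simp add: schwartz_def)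
    then obtain B where B: "\<And>x. norm ((1 + norm x) ^ k *\<^sub>R iterated_partial bs \<phi> x) \<le> B" by (auto simp: bounded_iff)
    define M where "M = (\<Sum>i\<in>UNIV. \<bar>inverse (s i)\<bar>)"
    have M: "0 \<le> M" by (simp add: M_def sum_nonneg)
    define L where "L = 1 + M + M * norm z"
    have L: "0 \<le> L" using M by (simp add: L_def)
    have ny: "1 + norm y \<le> L * (1 + norm (z + diag_mult s y))" for y
    proof -
      let ?w = "z + diag_mult s y"
      have "y = diag_mult (\<lambda>i. inverse (s i)) (?w - z)" using s by (simp add: vec_eq_iff)
      then have "norm y \<le> M * norm (?w - z)" using norm_diag_mult_le[of "\<lambda>i. inverse (s i)" "?w - z"] by (simp add: M_def)
      also have "\<dots> \<le> M * (norm ?w + norm z)" using M by (intro mult_left_mono norm_triangle_ineq4)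
      finally have "1 + norm y \<le> 1 + M * norm ?w + M * norm z" by (simp add: distrib_left)
      also have "\<dots> \<le> L * (1 + norm ?w)"
        using M mult_nonneg_nonneg[of "1 + M * norm z" "norm ?w"] by (simp add: L_def algebra_simps)
      finally show ?thesis .
    qed
    have "norm ((1 + norm y) ^ k *\<^sub>R iterated_partial bs ?\<psi> y) \<le> norm K * L ^ k * B" for y
    proof -
      let ?w = "z + diag_mult s y"
      have "norm ((1 + norm y) ^ k *\<^sub>R iterated_partial bs ?\<psi> y) = (1 + norm y) ^ k * (norm K * norm (iterated_partial bs \<phi> ?w))"
        unfolding K by (simp add: norm_mult norm_power)
      also have "\<dots> \<le> (L * (1 + norm ?w)) ^ k * (norm K * norm (iterated_partial bs \<phi> ?w))"
        using ny[of y] by (intro mult_right_mono power_mono) auto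
      also have "\<dots> = norm K * L ^ k * norm ((1 + norm ?w) ^ k *\<^sub>R iterated_partial bs \<phi> ?w)"
        by (simp add: power_mult_distrib norm_power)
      also have "\<dots> \<le> norm K * L ^ k * B" using L by (intro mult_left_mono B) auto
      finally show ?thesis .
    qed
    then show ?thesis by (auto simp: bounded_iff)
  qed
  ultimately show ?thesis by (simp add: schwartz_def)
qed

lemma level_fun_schwartz:
  assumes "\<phi> \<in> schwartz" shows "(\<lambda>y. level_fun a \<phi> j (x - y)) \<in> schwartz"
proof -
  have "(\<lambda>y. complex_of_real (2 powr (real_of_int j * aniso_dim a)) * \<phi> (diag_mult (scl a j) x + diag_mult (\<lambda>i. - scl a j i) y)) \<in> schwartz"
    by (rule schwartz_affine[OF assms]) simp
  moreover have "diag_mult (scl a j) x + diag_mult (\<lambda>i. - scl a j i) y = diag_mult (scl a j) (x - y)" for y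
    by (simp add: vec_eq_iff right_diff_distrib)
  ultimately show ?thesis by (simp add: level_fun_def dilate_scl aniso_dim_def)
qed

text \<open>The substitution moves the dilation from the kernel to \<open>g\<close>, so that the
  same function \<open>\<phi>\<close> is integrated at every level.\<close>

lemma convolve_level_fun:
  fixes g :: "'d::finite rvec \<Rightarrow> complex"
  shows "convolve (level_fun a \<phi> j) (dist_of g) x
    = (LINT z|lborel. \<phi> z * g (x - diag_mult (scl a (- j)) z))"
proof -
  let ?c = "\<lambda>i. - scl a (- j) i"
  let ?k = "2 powr (real_of_int j * aniso_dim a)"
  have "(\<Prod>i\<in>UNIV. \<bar>?c i\<bar>) = inverse ?k"
    using prod_scl[of a "- j"] by (simp add: powr_minus)
  moreover have "x + diag_mult ?c u = x - diag_mult (scl a (- j)) u" for u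
    by (simp add: vec_eq_iff)
  moreover have "diag_mult (scl a j) (diag_mult (scl a (- j)) u) = u" for u
    by (simp add: vec_eq_iff mult.assoc[symmetric])
  ultimately have "convolve (level_fun a \<phi> j) (dist_of g) x
    = inverse ?k *\<^sub>R (LINT u|lborel. g (x - diag_mult (scl a (- j)) u) * (complex_of_real ?k * \<phi> u))"
    unfolding convolve_def dist_of_def
    by (subst integral_affine_vec[of ?c _ x]) (simp_all add: level_fun_def dilate_scl aniso_dim_def)
  also have "(\<lambda>u. g (x - diag_mult (scl a (- j)) u) * (complex_of_real ?k * \<phi> u)) = (\<lambda>u. complex_of_real ?k * (\<phi> u * g (x - diag_mult (scl a (- j)) u)))"
    by (simp add: mult_ac)
  also have "inverse ?k *\<^sub>R (LINT u|lborel. complex_of_real ?k * (\<phi> u * g (x - diag_mult (scl a (- j)) u)))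
    = (LINT z|lborel. \<phi> z * g (x - diag_mult (scl a (- j)) z))"
  proof -
    have "complex_of_real (inverse ?k) * complex_of_real ?k = 1" unfolding of_real_mult[symmetric] by simp
    then have "inverse ?k *\<^sub>R (complex_of_real ?k * w) = w" for w
      by (simp only: scaleR_conv_of_real mult.assoc[symmetric] mult_1)
    then show ?thesis by (simp only: integral_mult_right_zero)
  qed
  finally show ?thesis .
qed

section \<open>The anisotropic quasi-norm\<close>

text \<open>Since every exponent is at least 1, the norm of the dilate decreases at least like
  \<open>1 / t\<close>. This gives uniqueness in \<open>aniso_norm_exists\<close>, and at
  \<open>min 1 (norm x)\<close> and \<open>max 1 (norm x)\<close> it gives values on the two sides
  of 1 for the intermediate value theorem.\<close>

lemma norm_dilate_minus_le:
  fixes a x :: "'d::finite rvec"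
  assumes a: "\<forall>i. 1 \<le> a $ i" and t: "0 < t" "t \<le> t'"
  shows "norm (dilate t' (- a) x) \<le> (t / t') * norm (dilate t (- a) x)"
proof -
  have "norm (dilate t' (- a) x) \<le> norm ((t / t') *\<^sub>R dilate t (- a) x)"
  proof (rule norm_le_componentwise_cart)
    fix i
    have "(t / t') powr a $ i \<le> (t / t') powr 1" using a t by (intro powr_mono') auto
    then have "t' powr (- a $ i) \<le> (t / t') * t powr (- a $ i)"
      using t by (simp add: powr_divide powr_minus divide_simps mult_ac)
    from mult_right_mono[OF this abs_ge_zero[of "x $ i"]]
    show "norm (dilate t' (- a) x $ i) \<le> norm (((t / t') *\<^sub>R dilate t (- a) x) $ i)"
      using t by (simp add: dilate_def abs_mult mult.assoc)
  qed
  then show ?thesis using t by simp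
qed

lemma aniso_norm_exists:
  fixes a x :: "'d::finite rvec"
  assumes a: "\<forall>i. 1 \<le> a $ i" and x: "x \<noteq> 0"
  shows "\<exists>!t. t > 0 \<and> norm (dilate t (- a) x) = 1"
proof -
  let ?N = "\<lambda>t. norm (dilate t (- a) x)"
  let ?n = "norm x"
  have n: "0 < ?n" using x by simp
  have m0: "0 < min 1 ?n" using n by (auto simp: min_def)
  have d1: "dilate 1 (- a) x = x" by (simp add: dilate_def vec_eq_iff)
  have "?N (max 1 ?n) \<le> 1 / max 1 ?n * ?n"
    using norm_dilate_minus_le[OF a, of 1 "max 1 ?n" x] by (simp add: d1)
  also have "\<dots> \<le> 1" using n by (simp add: divide_simps)
  finally have hi: "?N (max 1 ?n) \<le> 1" .
  have "?n \<le> min 1 ?n / 1 * ?N (min 1 ?n)"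
    using norm_dilate_minus_le[OF a m0, of 1 x] by (simp add: d1)
  then have "?n \<le> ?n * ?N (min 1 ?n)"
    using mult_right_mono[of "min 1 ?n" ?n "?N (min 1 ?n)"] by simp
  then have lo: "1 \<le> ?N (min 1 ?n)" using n by simp
  have cont: "continuous_on {min 1 ?n..max 1 ?n} ?N"
  proof -
    have "continuous_on {min 1 ?n..max 1 ?n} (\<lambda>t. \<chi> i. t powr ((- a) $ i) * x $ i)"
      using m0 by (intro continuous_intros) (auto simp: min_le_iff_disj)
    then show ?thesis unfolding dilate_def by (rule continuous_on_norm)
  qed
  obtain t where t: "min 1 ?n \<le> t" "?N t = 1"
    using IVT2'[OF hi lo min.coboundedI1[OF max.cobounded1] cont] by blast
  have "t > 0" using t(1) m0 by linarith
  moreover have uniq: "s = t'" if s: "s > 0" "t' > 0" "?N s = 1" "?N t' = 1" "s \<le> t'" for s t'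
  proof -
    have "1 \<le> s / t'" using norm_dilate_minus_le[OF a, of s t' x] s by simp
    then show ?thesis using s by (simp add: divide_simps)
  qed
  ultimately show ?thesis using t(2)
  proof (intro ex1I[of _ t])
    fix s assume "0 < s \<and> ?N s = 1"
    then show "s = t" using uniq[of s t] uniq[of t s] \<open>t > 0\<close> t(2) by (cases "s \<le> t") auto
  qed auto
qed

lemma aniso_norm_props:
  assumes "\<forall>i. 1 \<le> a $ i" "x \<noteq> 0"
  shows "0 < aniso_norm a x" "norm (dilate (aniso_norm a x) (- a) x) = 1"
  using theI'[OF aniso_norm_exists[OF assms]] assms(2) by (simp_all add: aniso_norm_def)

lemma aniso_norm_eqI:
  assumes "\<forall>i. 1 \<le> a $ i" "x \<noteq> 0" "0 < t" "norm (dilate t (- a) x) = 1"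
  shows "aniso_norm a x = t"
  using the1_equality[OF aniso_norm_exists[OF assms(1,2)], of t] assms by (simp add: aniso_norm_def)

lemma aniso_norm_scl:
  fixes a x :: "'d::finite rvec"
  assumes a: "\<forall>i. 1 \<le> a $ i"
  shows "aniso_norm a (diag_mult (scl a j) x) = 2 powr (real_of_int j) * aniso_norm a x"
proof (cases "x = 0")
  case True
  then have "diag_mult (scl a j) x = 0" by (simp add: vec_eq_iff)
  then show ?thesis using True by (simp add: aniso_norm_def)
next
  case False
  let ?t = "aniso_norm a x" and ?y = "diag_mult (scl a j) x"
  have y: "?y \<noteq> 0" using False by (auto simp: vec_eq_iff)
  note p = aniso_norm_props[OF a False]
  have "dilate (2 powr (real_of_int j) * ?t) (- a) ?y = dilate ?t (- a) x"
    using p(1) by (simp add: dilate_def vec_eq_iff powr_mult scl_def powr_powr powr_minus)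
  then show ?thesis using p by (intro aniso_norm_eqI[OF a y]) auto
qed

lemma abs_component_le_aniso:
  assumes a: "\<forall>i. 1 \<le> a $ i"
  shows "\<bar>x $ i\<bar> \<le> aniso_norm a x powr (a $ i)"
proof (cases "x = 0")
  case False
  note p = aniso_norm_props[OF a False]
  have "\<bar>dilate (aniso_norm a x) (- a) x $ i\<bar> \<le> 1" using component_le_norm_cart[of "dilate (aniso_norm a x) (- a) x" i] p(2) by simp
  then show ?thesis using p(1) by (simp add: dilate_def abs_mult powr_minus field_simps)
qed simp

lemma aniso_norm_le:
  fixes a x :: "'d::finite rvec"
  assumes a: "\<forall>i. 1 \<le> a $ i" and x: "\<And>i. \<bar>x $ i\<bar> \<le> M" and t: "0 < t" "(\<Sum>i\<in>UNIV. t powr (- a $ i) * M) < 1"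
  shows "aniso_norm a x < t"
proof (cases "x = 0")
  case True then show ?thesis using t by (simp add: aniso_norm_def)
next
  case False
  let ?s = "aniso_norm a x"
  note p = aniso_norm_props[OF a False]
  show ?thesis
  proof (rule ccontr)
    assume "\<not> ?s < t"
    then have st: "t \<le> ?s" by simp
    have "1 \<le> (\<Sum>i\<in>UNIV. \<bar>dilate ?s (- a) x $ i\<bar>)" using norm_le_l1_cart[of "dilate ?s (- a) x"] p(2) by simp
    also have "\<dots> \<le> (\<Sum>i\<in>UNIV. t powr (- a $ i) * M)"
    proof (rule sum_mono)
      fix i
      have "1 \<le> a $ i" using a by simp
      then have "?s powr (- a $ i) \<le> t powr (- a $ i)" using st t by (intro powr_mono2') auto
      then show "\<bar>dilate ?s (- a) x $ i\<bar> \<le> t powr (- a $ i) * M"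
        using x[of i] by (simp add: dilate_def abs_mult mult_mono)
    qed
    finally show False using t(2) by simp
  qed
qed

lemma admissible_support:
  assumes "admissible a \<phi>" "fourier \<phi> \<xi> \<noteq> 0"
  shows "1 / 2 \<le> aniso_norm a \<xi>" "aniso_norm a \<xi> \<le> 2"
  using assms closure_subset[of "{\<xi>. fourier \<phi> \<xi> \<noteq> 0}"] by (auto simp: admissible_def)

text \<open>On a small Euclidean ball the quasi-norm stays below \<open>1 / 2\<close>, the inner
  radius of the spectrum of \<open>\<phi>\<close>. The Euclidean form is the one in which
  \<open>moments_vanish\<close> differentiates near the origin.\<close>

lemma admissible_zero:
  fixes a :: "'d::finite rvec"
  assumes a: "\<forall>i. 1 \<le> a $ i" and "admissible a \<phi>"
  obtains r where "0 < r" "\<And>\<xi>. norm \<xi> < r \<Longrightarrow> fourier \<phi> \<xi> = 0"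
proof -
  define S where "S = (\<Sum>i\<in>UNIV. (1 / 2 :: real) powr (- a $ i))"
  have S: "0 < S" unfolding S_def by (intro sum_pos) auto
  have "fourier \<phi> \<xi> = 0" if "norm \<xi> < 1 / S" for \<xi>
  proof (rule ccontr)
    assume "fourier \<phi> \<xi> \<noteq> 0"
    from admissible_support(1)[OF assms(2) this] have "1 / 2 \<le> aniso_norm a \<xi>" .
    moreover have "(\<Sum>i\<in>UNIV. (1 / 2) powr (- a $ i) * norm \<xi>) < 1"
    proof -
      have "(\<Sum>i\<in>UNIV. (1 / 2) powr (- a $ i) * norm \<xi>) = norm \<xi> * S"
        unfolding S_def sum_distrib_right[symmetric] by (rule mult.commute)
      then show ?thesis using that S by (simp only: pos_less_divide_eq)
    qed
    then have "aniso_norm a \<xi> < 1 / 2"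
      by (intro aniso_norm_le[OF a component_le_norm_cart]) auto
    ultimately show False by simp
  qed
  then show ?thesis using that[of "1 / S"] S by simp
qed

section \<open>The quasi-norm of a class of distributions\<close>

lemma polynomial_function_affine:
  fixes P :: "'d::finite rvec \<Rightarrow> complex"
  assumes "polynomial_function P"
  shows "polynomial_function (\<lambda>z. P (x - diag_mult c z))"
proof -
  have "polynomial_function (\<lambda>z. x - diag_mult c z)"
    by (intro polynomial_function_diff polynomial_function_const polynomial_function_bounded_linear
        bounded_linear_diag_mult)
  from polynomial_function_compose[OF this assms] show ?thesis by (simp add: comp_def)
qed

lemma convolve_polynomial:
  fixes P :: "'d::finite rvec \<Rightarrow> complex"
  assumes a: "\<forall>i. 1 \<le> a $ i" and \<phi>: "admissible a \<phi>" and P: "polynomial_function P"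
  shows "convolve (level_fun a \<phi> j) (dist_of P) x = 0"
proof -
  obtain r where r: "0 < r" "\<And>\<xi>. norm \<xi> < r \<Longrightarrow> fourier \<phi> \<xi> = 0"
    using admissible_zero[OF a \<phi>] by blast
  have "rapid \<phi>" using \<phi> by (auto simp: admissible_def intro: schwartz_rapid)
  from moments_vanish[OF this r polynomial_function_affine[OF P]]
  have "(LINT z|lborel. P (x - diag_mult (scl a (- j)) z) * \<phi> z) = 0" .
  then show ?thesis
    unfolding convolve_level_fun by (simp only: mult.commute[of "\<phi> z" for z])
qed

text \<open>\<open>TL_norm\<close> takes the only element of the set of values on a class, so the
  values have to agree and the class has to be nonempty. Two representatives differ by a polynomial,
  which every convolution with a \<open>level_fun\<close> annihilates; and \<open>dist_of g\<close>
  belongs to its class once it is tempered.\<close>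

lemma TL_norm_class_of:
  fixes g :: "'d::{finite,linorder} rvec \<Rightarrow> complex"
  assumes a: "\<forall>i. 1 \<le> a $ i" and \<phi>: "admissible a \<phi>" and g: "tempered (dist_of g)"
  shows "TL_norm a p q \<beta> \<phi> (class_of g) = TL_norm_rep a p q \<beta> \<phi> (dist_of g)"
proof -
  have \<phi>S: "\<phi> \<in> schwartz" using \<phi> by (simp add: admissible_def)
  have eq: "TL_norm_rep a p q \<beta> \<phi> U = TL_norm_rep a p q \<beta> \<phi> (dist_of g)" if "U \<in> class_of g" for U
  proof -
    from that obtain P where P: "polynomial_function P" "\<forall>f\<in>schwartz. dist_of g f - U f = dist_of P f"
      unfolding class_of_def poly_equiv_def by blast
    have "convolve (level_fun a \<phi> j) U x = convolve (level_fun a \<phi> j) (dist_of g) x" for j x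
    proof -
      have "dist_of g (\<lambda>y. level_fun a \<phi> j (x - y)) - U (\<lambda>y. level_fun a \<phi> j (x - y)) = 0"
        using bspec[OF P(2) level_fun_schwartz[OF \<phi>S, of a j x]] convolve_polynomial[OF a \<phi> P(1), of j x]
        by (simp add: convolve_def)
      then show ?thesis by (simp add: convolve_def)
    qed
    then show ?thesis by (simp add: TL_norm_rep_def)
  qed
  have "polynomial_function (\<lambda>_::'d rvec. 0 :: complex)" by (rule polynomial_function_const)
  moreover have "\<forall>f\<in>schwartz. dist_of g f - dist_of g f = dist_of (\<lambda>_. 0) f" by (simp add: dist_of_def)
  ultimately have mem: "dist_of g \<in> class_of g"
    using g unfolding class_of_def poly_equiv_def by blast
  have "TL_norm_rep a p q \<beta> \<phi> ` class_of g = (\<lambda>_. TL_norm_rep a p q \<beta> \<phi> (dist_of g)) ` class_of g"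
    by (rule image_cong[OF refl eq])
  also have "\<dots> = {TL_norm_rep a p q \<beta> \<phi> (dist_of g)}"
    using mem by (rule image_constant)
  finally show ?thesis by (simp only: TL_norm_def the_elem_eq)
qed

text \<open>One seminorm without derivatives controls the functional: the weight
  \<open>(1 + norm x) ^ (2 * CARD('d))\<close> dominates a product whose inverse is
  integrable.\<close>

lemma tempered_dist_of_bounded:
  fixes g :: "'d::finite rvec \<Rightarrow> complex"
  assumes [measurable]: "g \<in> borel_measurable borel" and B: "\<And>x. norm (g x) \<le> B"
  shows "tempered (dist_of g)"
proof -
  have "0 \<le> norm (g 0)" by simp
  then have B0: "0 \<le> B" using B[of 0] by linarith
  have int: "integrable lborel (\<lambda>x. g x * f x)" if "rapid f" for f
  proof (rule Bochner_Integration.integrable_bound)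
    show "integrable lborel (\<lambda>x. B *\<^sub>R f x)" using rapid_integrable(2)[OF that] by simp
    have [measurable]: "f \<in> borel_measurable borel" using that by (rule rapid_measurable)
    show "(\<lambda>x. g x * f x) \<in> borel_measurable lborel" by measurable
    show "AE x in lborel. norm (g x * f x) \<le> norm (B *\<^sub>R f x)"
      using B B0 by (intro AE_I2) (simp add: norm_mult mult_right_mono)
  qed
  note intS = int[OF schwartz_rapid]
  show ?thesis unfolding tempered_def
  proof (intro conjI ballI allI impI)
    fix f h :: "'d rvec \<Rightarrow> complex" assume "f \<in> schwartz" "h \<in> schwartz"
    then show "dist_of g (\<lambda>x. f x + h x) = dist_of g f + dist_of g h"
      unfolding dist_of_def distrib_left by (intro Bochner_Integration.integral_add intS)
  next
    fix c and f :: "'d rvec \<Rightarrow> complex"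
    have "(\<lambda>x. g x * (c * f x)) = (\<lambda>x. c * (g x * f x))" by (simp add: mult_ac)
    then show "dist_of g (\<lambda>x. c * f x) = c * dist_of g f"
      unfolding dist_of_def by (simp only: integral_mult_right_zero)
  next
    fix F :: "nat \<Rightarrow> 'd rvec \<Rightarrow> complex" and f :: "'d rvec \<Rightarrow> complex"
    assume F: "range F \<subseteq> schwartz" and f: "f \<in> schwartz" and lim: "schwartz_tendsto F f"
    have FS: "F n \<in> schwartz" for n using F by blast
    let ?k = "2 * CARD('d)"
    define D where "D = (LINT x|lborel. (\<Prod>i\<in>UNIV. tw ((x :: 'd rvec) $ i)))"
    have "set ([] :: 'd rvec list) \<subseteq> Basis \<longrightarrow> uniform_limit UNIV (\<lambda>n x. (1 + norm x) ^ ?k *\<^sub>R iterated_partial [] (F n) x)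
          (\<lambda>x. (1 + norm x) ^ ?k *\<^sub>R iterated_partial [] f x) sequentially"
      using lim unfolding schwartz_tendsto_def by blast
    then have ul: "uniform_limit UNIV (\<lambda>n x. (1 + norm x) ^ ?k *\<^sub>R F n x) (\<lambda>x. (1 + norm x) ^ ?k *\<^sub>R f x) sequentially"
      by simp
    have "\<forall>\<^sub>F n in sequentially. norm (dist_of g (F n) - dist_of g f) \<le> B * D * e" if "0 < e" for e
    proof -
      from ul[unfolded uniform_limit_iff] that
      have "\<forall>\<^sub>F n in sequentially. \<forall>x\<in>UNIV. dist ((1 + norm x) ^ ?k *\<^sub>R F n x) ((1 + norm x) ^ ?k *\<^sub>R f x) < e" by blast
      then show ?thesis
      proof (rule eventually_mono)
        fix n assume n: "\<forall>x\<in>UNIV. dist ((1 + norm x) ^ ?k *\<^sub>R F n x) ((1 + norm x) ^ ?k *\<^sub>R f x) < e"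
        have eq: "dist_of g (F n) - dist_of g f = (LINT x|lborel. g x * F n x - g x * f x)"
          unfolding dist_of_def by (rule Bochner_Integration.integral_diff[symmetric, OF intS[OF FS] intS[OF f]])
        have "norm (LINT x|lborel. g x * F n x - g x * f x) \<le> (LINT x|lborel. B * e * (\<Prod>i\<in>UNIV. tw ((x :: 'd rvec) $ i)))"
        proof (rule norm_integral_le)
          show "integrable lborel (\<lambda>x. g x * F n x - g x * f x)"
            by (rule Bochner_Integration.integrable_diff[OF intS[OF FS] intS[OF f]])
          show "integrable lborel (\<lambda>x::'d rvec. B * e * (\<Prod>i\<in>UNIV. tw (x $ i)))"
            by (rule integrable_mult_right[OF integrable_prod_tw])
          fix x :: "'d rvec"
          have p: "0 < (\<Prod>i\<in>UNIV. (1 + \<bar>x $ i\<bar>) ^ 2)" by (intro prod_pos) (auto intro: add_pos_nonneg)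
          have "(1 + norm x) ^ ?k *\<^sub>R F n x - (1 + norm x) ^ ?k *\<^sub>R f x = (1 + norm x) ^ ?k *\<^sub>R (F n x - f x)"
            by (simp add: scaleR_diff_right)
          then have "(1 + norm x) ^ ?k * norm (F n x - f x) \<le> e"
            using n[rule_format, of x] by (simp add: dist_norm norm_power)
          moreover have "(\<Prod>i\<in>UNIV. (1 + \<bar>x $ i\<bar>) ^ 2) * norm (F n x - f x) \<le> (1 + norm x) ^ ?k * norm (F n x - f x)"
            by (rule mult_right_mono[OF prod_abs_le_norm]) simp
          ultimately have "norm (F n x - f x) \<le> e * (\<Prod>i\<in>UNIV. tw (x $ i))"
            using p by (simp add: tw_def prod_dividef field_simps)
          then have "norm (g x) * norm (F n x - f x) \<le> B * (e * (\<Prod>i\<in>UNIV. tw (x $ i)))"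
            using B B0 by (intro mult_mono) auto
          then show "norm (g x * F n x - g x * f x) \<le> B * e * (\<Prod>i\<in>UNIV. tw (x $ i))"
            by (simp add: right_diff_distrib[symmetric] norm_mult mult.assoc)
        qed
        also have "\<dots> = B * D * e" unfolding D_def by (simp add: mult_ac)
        finally show "norm (dist_of g (F n) - dist_of g f) \<le> B * D * e" unfolding eq .
      qed
    qed
    note ev = this
    have D0: "0 \<le> D" unfolding D_def by (intro integral_nonneg_AE AE_I2 prod_nonneg) auto
    show "(\<lambda>n. dist_of g (F n)) \<longlonglongrightarrow> dist_of g f"
    proof (rule tendstoI)
      fix e :: real assume e: "0 < e"
      have p: "0 < B * D + 1" using B0 D0 by (simp add: add_nonneg_pos)
      have "B * D * (e / (B * D + 1)) < e" using e p by (simp add: field_simps)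
      with ev[of "e / (B * D + 1)"] e p
      show "\<forall>\<^sub>F n in sequentially. dist (dist_of g (F n)) (dist_of g f) < e"
        by (auto simp: dist_norm elim!: eventually_mono)
    qed
  qed
qed

section \<open>Local cosine bases\<close>

definition brushlet_hat ::
  "(real \<Rightarrow> real) \<Rightarrow> real \<Rightarrow> real \<Rightarrow> real \<Rightarrow> real \<Rightarrow> nat \<Rightarrow> real \<Rightarrow> real" where
  "brushlet_hat \<rho> l r e e' n \<xi> =
     sqrt (2 / (r - l)) * bell \<rho> l r e e' \<xi> * cos (pi * (real n + 1 / 2) * ((\<xi> - l) / (r - l)))"

lemma brushlet_1d_eq: "brushlet_1d \<rho> l r e e' n = inverse_fourier (\<lambda>\<xi>. complex_of_real (brushlet_hat \<rho> l r e e' n \<xi>))"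
  by (simp add: brushlet_1d_def brushlet_hat_def)

lemma cutoff_functionD:
  assumes "cutoff_function \<rho>"
  shows "0 \<le> \<rho> t" "\<rho> t \<le> 1" "t \<le> -1 \<Longrightarrow> \<rho> t = 0" "1 \<le> t \<Longrightarrow> \<rho> t = 1"
    "(\<rho> t)\<^sup>2 + (\<rho> (- t))\<^sup>2 = 1" "continuous_on UNIV \<rho>"
proof -
  show 1: "0 \<le> \<rho> t" "t \<le> -1 \<Longrightarrow> \<rho> t = 0" "1 \<le> t \<Longrightarrow> \<rho> t = 1" "(\<rho> t)\<^sup>2 + (\<rho> (- t))\<^sup>2 = 1"
    using assms by (auto simp: cutoff_function_def)
  have "(\<rho> t)\<^sup>2 \<le> 1" using 1(4) zero_le_power2[of "\<rho> (- t)"] by linarith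
  then have "(\<rho> t)\<^sup>2 \<le> 1\<^sup>2" by simp
  then show "\<rho> t \<le> 1" by (rule power2_le_imp_le) simp
  show "continuous_on UNIV \<rho>"
    using assms smooth_imp_Ck[of \<rho> 0] by (simp add: cutoff_function_def)
qed

lemma cutoff_measurable: "cutoff_function \<rho> \<Longrightarrow> \<rho> \<in> borel_measurable borel"
  by (rule borel_measurable_continuous_onI) (rule cutoff_functionD)

lemma bell_support:
  assumes "cutoff_function \<rho>" "0 < e" "0 < e'" "\<xi> \<le> l - e \<or> r + e' \<le> \<xi>"
  shows "bell \<rho> l r e e' \<xi> = 0"
proof -
  have "(\<xi> - l) / e \<le> -1 \<or> (r - \<xi>) / e' \<le> -1" using assms(2-4) by (simp add: divide_simps) linarith
  then show ?thesis using cutoff_functionD(3)[OF assms(1)] by (auto simp: bell_def)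
qed

lemma bell_bounds:
  assumes "cutoff_function \<rho>" shows "0 \<le> bell \<rho> l r e e' \<xi>" "bell \<rho> l r e e' \<xi> \<le> 1"
  using cutoff_functionD(1,2)[OF assms] by (auto simp: bell_def intro: mult_le_one)

lemma brushlet_hat_measurable:
  assumes "cutoff_function \<rho>" shows "brushlet_hat \<rho> l r e e' n \<in> borel_measurable borel"
proof -
  note [measurable] = cutoff_measurable[OF assms]
  show ?thesis unfolding brushlet_hat_def[abs_def] bell_def[abs_def] by measurable
qed

lemma integrable_bounded_interval:
  fixes f :: "real \<Rightarrow> real"
  assumes "f \<in> borel_measurable borel" "\<And>x. \<bar>f x\<bar> \<le> B" "\<And>x. x < u \<or> v < x \<Longrightarrow> f x = 0"
  shows "integrable lborel f"
proof -
  have "integrable lborel (\<lambda>x. B * indicator {u..v} x)"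
    by (intro integrable_mult_right integrable_real_indicator) (auto simp: emeasure_lborel_Icc_eq)
  then show ?thesis
  proof (rule Bochner_Integration.integrable_bound)
    show "AE x in lborel. norm (f x) \<le> norm (B * indicator {u..v} x :: real)"
    proof (rule AE_I2)
      fix x show "norm (f x) \<le> norm (B * indicator {u..v} x :: real)"
        using assms(2)[of x] assms(3)[of x] by (cases "x \<in> {u..v}") auto
    qed
  qed (use assms in simp)
qed

lemma brushlet_hat_integrable:
  assumes \<rho>: "cutoff_function \<rho>" and e: "0 < e" "0 < e'"
  shows "integrable lborel (brushlet_hat \<rho> l r e e' n)"
proof (rule integrable_bounded_interval[OF brushlet_hat_measurable[OF \<rho>]])
  fix x
  have "\<bar>bell \<rho> l r e e' x\<bar> * \<bar>cos (pi * (real n + 1 / 2) * ((x - l) / (r - l)))\<bar> \<le> 1"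
    using bell_bounds[OF \<rho>] by (intro mult_le_one) auto
  then have "\<bar>sqrt (2 / (r - l))\<bar> * (\<bar>bell \<rho> l r e e' x\<bar> * \<bar>cos (pi * (real n + 1 / 2) * ((x - l) / (r - l)))\<bar>) \<le> \<bar>sqrt (2 / (r - l))\<bar> * 1"
    by (rule mult_left_mono) simp
  then show "\<bar>brushlet_hat \<rho> l r e e' n x\<bar> \<le> \<bar>sqrt (2 / (r - l))\<bar>"
    by (simp add: brushlet_hat_def abs_mult mult.assoc)
  assume "x < l - e \<or> r + e' < x"
  then show "brushlet_hat \<rho> l r e e' n x = 0"
    using bell_support[OF \<rho> e, of x l r] by (auto simp: brushlet_hat_def)
qed

lemma integral_antisymmetric:
  fixes f :: "real \<Rightarrow> real"
  assumes "\<And>x. f (2 * c - x) = - f x"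
  shows "(LINT x|lborel. f x) = 0"
proof -
  have "(LINT x|lborel. f x) = (LINT x|lborel. f (2 * c + (-1) * x))"
    using lborel_integral_real_affine[of "-1" f "2 * c"] by simp
  also have "\<dots> = - (LINT x|lborel. f x)" using assms by simp
  finally show ?thesis by simp
qed

lemma integral_cos_multiple:
  fixes k :: int assumes "l < r"
  shows "(LINT \<xi>|lborel. cos (pi * real_of_int k * ((\<xi> - l) / (r - l))) * indicator {l..r} \<xi>) = (if k = 0 then r - l else 0)"
proof -
  define F where "F \<xi> = (if k = 0 then \<xi> else sin (pi * real_of_int k * ((\<xi> - l) / (r - l))) * ((r - l) / (pi * real_of_int k)))" for \<xi>
  have "(LINT \<xi>|lborel. cos (pi * real_of_int k * ((\<xi> - l) / (r - l))) * indicator {l..r} \<xi>) = F r - F l"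
  proof (rule integral_FTC_Icc_real)
    show "l \<le> r" using assms by simp
    fix \<xi>
    show "(F has_real_derivative cos (pi * real_of_int k * ((\<xi> - l) / (r - l)))) (at \<xi>)"
    proof (cases "k = 0")
      case True then show ?thesis by (simp add: F_def[abs_def])
    next
      case False
      have "((\<lambda>\<xi>. sin (pi * real_of_int k * ((\<xi> - l) / (r - l))) * ((r - l) / (pi * real_of_int k))) has_real_derivative
        (cos (pi * real_of_int k * ((\<xi> - l) / (r - l))) * (pi * real_of_int k * (1 / (r - l)))) * ((r - l) / (pi * real_of_int k))) (at \<xi>)"
        using assms by (auto intro!: derivative_eq_intros)
      moreover have "(cos (pi * real_of_int k * ((\<xi> - l) / (r - l))) * (pi * real_of_int k * (1 / (r - l)))) * ((r - l) / (pi * real_of_int k)) = cos (pi * real_of_int k * ((\<xi> - l) / (r - l)))"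
        using assms False by simp
      ultimately show ?thesis using False by (simp add: F_def[abs_def])
    qed
    show "isCont (\<lambda>\<xi>. cos (pi * real_of_int k * ((\<xi> - l) / (r - l)))) \<xi>"
      using assms by (intro continuous_intros) auto
  qed
  moreover have "sin (pi * real_of_int k) = 0" using sin_zero_iff_int2[of "pi * real_of_int k"] by (auto simp: mult.commute)
  ultimately show ?thesis using assms by (simp add: F_def)
qed

text \<open>Half-integer frequencies make the cosines even about the left endpoint
  \<open>u = 0\<close> and odd about the right endpoint \<open>u = 1\<close>. The orthogonality
  relations rest on this alternation of parities.\<close>

lemma cos_half_odd: "cos (pi * (real n + 1 / 2) * (2 - u)) = - cos (pi * (real n + 1 / 2) * u)"
proof -
  have "pi * (real n + 1 / 2) * (2 - u) = pi * real (2 * n + 1) - pi * (real n + 1 / 2) * u"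
    by (simp add: field_simps)
  moreover have "sin (pi * real (2 * n + 1)) = 0" "cos (pi * real (2 * n + 1)) = -1"
    using sin_npi2[of "2 * n + 1"] cos_npi2[of "2 * n + 1"] by simp_all
  ultimately show ?thesis by (simp add: cos_diff)
qed

text \<open>By the relation between \<open>\<rho> t\<close> and \<open>\<rho> (- t)\<close>, the
  squared bell differs from the indicator of \<open>{l..r}\<close> by two corrections, each odd
  about one endpoint. A product of two of the cosines is even about both endpoints, so the
  corrections integrate to 0 and the orthogonality of cosines on the interval remains.\<close>

lemma brushlet_hat_orthonormal:
  assumes \<rho>: "cutoff_function \<rho>" and e: "0 < e" "0 < e'" "e + e' \<le> r - l"
  shows "(LINT \<xi>|lborel. brushlet_hat \<rho> l r e e' n \<xi> * brushlet_hat \<rho> l r e e' m \<xi>) = (if n = m then 1 else 0)"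
proof -
  note \<rho>D = cutoff_functionD[OF \<rho>]
  note [measurable] = cutoff_measurable[OF \<rho>]
  have lr: "l < r" using e by simp
  define c where "c n \<xi> = cos (pi * (real n + 1 / 2) * ((\<xi> - l) / (r - l)))" for n and \<xi> :: real
  define G where "G \<xi> = c n \<xi> * c m \<xi>" for \<xi>
  have Gb: "\<bar>G \<xi>\<bar> \<le> 1" for \<xi> unfolding G_def c_def abs_mult by (intro mult_le_one) auto
  have [measurable]: "G \<in> borel_measurable borel" unfolding G_def[abs_def] c_def by measurable
  have cl: "c n (2 * l - \<xi>) = c n \<xi>" for n \<xi>
  proof -
    have "pi * (real n + 1 / 2) * ((2 * l - \<xi> - l) / (r - l)) = - (pi * (real n + 1 / 2) * ((\<xi> - l) / (r - l)))"
      using lr by (simp add: field_simps)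
    then show ?thesis by (simp only: c_def cos_minus)
  qed
  have cr: "c n (2 * r - \<xi>) = - c n \<xi>" for n \<xi>
  proof -
    have "(2 * r - \<xi> - l) / (r - l) = 2 - (\<xi> - l) / (r - l)" using lr by (simp add: field_simps)
    then show ?thesis by (simp only: c_def cos_half_odd)
  qed
  \<comment> \<open>The value 1/2 at 0 makes the corrections \<open>A\<close> and \<open>B\<close>
    odd at every point, including the endpoint itself.\<close>
  define jump where "jump t = (if t < 0 then 0 else if t = 0 then 1 / 2 else 1 :: real)" for t :: real
  have [measurable]: "jump \<in> borel_measurable borel" unfolding jump_def[abs_def] by measurable
  define A where "A \<xi> = (\<rho> ((\<xi> - l) / e))\<^sup>2 - jump (\<xi> - l)" for \<xi>
  define B where "B \<xi> = (\<rho> ((r - \<xi>) / e'))\<^sup>2 - jump (r - \<xi>)" for \<xi>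
  have odd: "(\<rho> (- t / d))\<^sup>2 - jump (- t) = - ((\<rho> (t / d))\<^sup>2 - jump t)" for t d
    using \<rho>D(5)[of "t / d"] by (auto simp: jump_def)
  have small: "\<bar>(\<rho> (t / d))\<^sup>2 - jump t\<bar> \<le> 1" for t d
  proof -
    have "\<bar>q - jump t\<bar> \<le> 1" if "0 \<le> q" "q \<le> 1" for q using that by (auto simp: jump_def)
    then show ?thesis using \<rho>D(1,2) by (simp add: power_le_one)
  qed
  have zero: "(\<rho> (t / d))\<^sup>2 - jump t = 0" if "0 < d" "t < - d \<or> d < t" for t d
  proof -
    have "t / d \<le> -1 \<or> 1 \<le> t / d" using that by (auto simp: divide_simps)
    then show ?thesis using \<rho>D(3,4)[of "t / d"] that by (auto simp: jump_def)
  qed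
  have intA: "integrable lborel (\<lambda>\<xi>. A \<xi> * G \<xi>)"
  proof (rule integrable_bounded_interval[where u="l - e" and v="l + e" and B="1"])
    show "(\<lambda>\<xi>. A \<xi> * G \<xi>) \<in> borel_measurable borel" unfolding A_def by measurable
    show "\<bar>A \<xi> * G \<xi>\<bar> \<le> 1" for \<xi> unfolding abs_mult A_def using small Gb by (intro mult_le_one) auto
    show "A \<xi> * G \<xi> = 0" if "\<xi> < l - e \<or> l + e < \<xi>" for \<xi>
      using zero[OF e(1), of "\<xi> - l"] that by (auto simp: A_def)
  qed
  have intB: "integrable lborel (\<lambda>\<xi>. B \<xi> * G \<xi>)"
  proof (rule integrable_bounded_interval[where u="r - e'" and v="r + e'" and B="1"])
    show "(\<lambda>\<xi>. B \<xi> * G \<xi>) \<in> borel_measurable borel" unfolding B_def by measurable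
    show "\<bar>B \<xi> * G \<xi>\<bar> \<le> 1" for \<xi> unfolding abs_mult B_def using small Gb by (intro mult_le_one) auto
    show "B \<xi> * G \<xi> = 0" if "\<xi> < r - e' \<or> r + e' < \<xi>" for \<xi>
      using zero[OF e(2), of "r - \<xi>"] that by (auto simp: B_def)
  qed
  have A0: "(LINT \<xi>|lborel. A \<xi> * G \<xi>) = 0"
  proof (rule integral_antisymmetric[of _ l])
    fix \<xi>
    have "A (2 * l - \<xi>) = - A \<xi>" using odd[of "\<xi> - l" e] by (simp add: A_def)
    then show "A (2 * l - \<xi>) * G (2 * l - \<xi>) = - (A \<xi> * G \<xi>)" by (simp add: G_def cl)
  qed
  have B0: "(LINT \<xi>|lborel. B \<xi> * G \<xi>) = 0"
  proof (rule integral_antisymmetric[of _ r])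
    fix \<xi>
    have "B (2 * r - \<xi>) = - B \<xi>" using odd[of "r - \<xi>" e'] by (simp add: B_def)
    then show "B (2 * r - \<xi>) * G (2 * r - \<xi>) = - (B \<xi> * G \<xi>)" by (simp add: G_def cr)
  qed
  have intG: "integrable lborel (\<lambda>\<xi>. G \<xi> * indicator {l..r} \<xi>)"
  proof (rule integrable_bounded_interval[where u=l and v=r and B="1"])
    show "\<bar>G \<xi> * indicator {l..r} \<xi>\<bar> \<le> 1" for \<xi> using Gb[of \<xi>] by (simp add: indicator_def)
  qed (auto simp: indicator_def)
  have intG_val: "(LINT \<xi>|lborel. G \<xi> * indicator {l..r} \<xi>) = (if n = m then (r - l) / 2 else 0)"
  proof -
    let ?C = "\<lambda>k::int. \<lambda>\<xi>. cos (pi * real_of_int k * ((\<xi> - l) / (r - l))) * indicator {l..r} \<xi> :: real"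
    have intC: "integrable lborel (?C k)" for k
    proof (rule integrable_bounded_interval[where u=l and v=r and B="1"])
      show "\<bar>?C k \<xi>\<bar> \<le> 1" for \<xi> by (simp add: indicator_def)
    qed (auto simp: indicator_def)
    have "G \<xi> * indicator {l..r} \<xi> = (?C (int n - int m) \<xi> + ?C (int n + int m + 1) \<xi>) / 2" for \<xi>
    proof -
      let ?u = "(\<xi> - l) / (r - l)"
      have "pi * real_of_int (int n - int m) * u = pi * (real n + 1/2) * u - pi * (real m + 1/2) * u"
        "pi * real_of_int (int n + int m + 1) * u = pi * (real n + 1/2) * u + pi * (real m + 1/2) * u" for u
        by (simp_all add: algebra_simps)
      then have "c n \<xi> * c m \<xi> = (cos (pi * real_of_int (int n - int m) * ?u) + cos (pi * real_of_int (int n + int m + 1) * ?u)) / 2"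
        by (simp only: c_def cos_times_cos)
      then show ?thesis by (simp only: G_def times_divide_eq_left distrib_right)
    qed
    then have "(LINT \<xi>|lborel. G \<xi> * indicator {l..r} \<xi>) = ((LINT \<xi>|lborel. ?C (int n - int m) \<xi>) + (LINT \<xi>|lborel. ?C (int n + int m + 1) \<xi>)) / 2"
      by (simp only: integral_divide_zero Bochner_Integration.integral_add[OF intC intC])
    then show ?thesis unfolding integral_cos_multiple[OF lr] by auto
  qed
  \<comment> \<open>The two transition zones do not overlap, so at every point at least one factor
    of the bell is 1. The endpoints are exempted because of the value 1/2 of \<open>jump\<close>;
    they form a null set.\<close>
  have ptw: "(bell \<rho> l r e e' \<xi>)\<^sup>2 * G \<xi> = G \<xi> * indicator {l..r} \<xi> + A \<xi> * G \<xi> + B \<xi> * G \<xi>" if ne: "\<xi> \<noteq> l" "\<xi> \<noteq> r" for \<xi>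
  proof -
    let ?a = "(\<rho> ((\<xi> - l) / e))\<^sup>2" and ?b = "(\<rho> ((r - \<xi>) / e'))\<^sup>2"
    have bell2: "(bell \<rho> l r e e' \<xi>)\<^sup>2 = ?a * ?b" by (simp add: bell_def power_mult_distrib)
    have "?a * ?b = indicator {l..r} \<xi> + A \<xi> + B \<xi>"
    proof -
      have b1: "?b = 1" if "\<xi> \<le> r - e'" using \<rho>D(4)[of "(r - \<xi>) / e'"] e that by (simp add: divide_simps)
      have a1: "?a = 1" if "l + e \<le> \<xi>" using \<rho>D(4)[of "(\<xi> - l) / e"] e that by (simp add: divide_simps)
      consider "\<xi> < l" | "l < \<xi>" "\<xi> < r" "\<xi> \<le> r - e'" | "l < \<xi>" "\<xi> < r" "l + e \<le> \<xi>" | "r < \<xi>"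
        using ne e by linarith
      then show ?thesis
      proof cases
        case 1 then show ?thesis using b1 e by (simp add: A_def B_def jump_def)
      next
        case 2 then show ?thesis using b1 by (simp add: A_def B_def jump_def)
      next
        case 3 then show ?thesis using a1 by (simp add: A_def B_def jump_def)
      next
        case 4 then show ?thesis using a1 e by (simp add: A_def B_def jump_def)
      qed
    qed
    then show ?thesis by (simp add: bell2 algebra_simps)
  qed
  have "(LINT \<xi>|lborel. (bell \<rho> l r e e' \<xi>)\<^sup>2 * G \<xi>) = (LINT \<xi>|lborel. G \<xi> * indicator {l..r} \<xi> + A \<xi> * G \<xi> + B \<xi> * G \<xi>)"
  proof (rule integral_cong_AE)
    show "(\<lambda>\<xi>. (bell \<rho> l r e e' \<xi>)\<^sup>2 * G \<xi>) \<in> borel_measurable lborel" unfolding bell_def by measurable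
    show "(\<lambda>\<xi>. G \<xi> * indicator {l..r} \<xi> + A \<xi> * G \<xi> + B \<xi> * G \<xi>) \<in> borel_measurable lborel" unfolding A_def B_def by measurable
    have "AE \<xi> in lborel. \<xi> \<noteq> l \<and> \<xi> \<noteq> r" using AE_lborel_singleton[of l] AE_lborel_singleton[of r] by eventually_elim simp
    then show "AE \<xi> in lborel. (bell \<rho> l r e e' \<xi>)\<^sup>2 * G \<xi> = G \<xi> * indicator {l..r} \<xi> + A \<xi> * G \<xi> + B \<xi> * G \<xi>"
      by eventually_elim (rule ptw, auto)
  qed
  also have "\<dots> = (LINT \<xi>|lborel. G \<xi> * indicator {l..r} \<xi>) + (LINT \<xi>|lborel. A \<xi> * G \<xi>) + (LINT \<xi>|lborel. B \<xi> * G \<xi>)"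
    by (simp only: Bochner_Integration.integral_add Bochner_Integration.integrable_add intA intB intG)
  finally have I: "(LINT \<xi>|lborel. (bell \<rho> l r e e' \<xi>)\<^sup>2 * G \<xi>) = (if n = m then (r - l) / 2 else 0)"
    by (simp add: A0 B0 intG_val)
  have "sqrt (2 / (r - l)) * sqrt (2 / (r - l)) = 2 / (r - l)" using lr by simp
  then have "brushlet_hat \<rho> l r e e' n \<xi> * brushlet_hat \<rho> l r e e' m \<xi> = 2 / (r - l) * ((bell \<rho> l r e e' \<xi>)\<^sup>2 * G \<xi>)" for \<xi>
    by (simp only: brushlet_hat_def G_def c_def power2_eq_square mult_ac) (simp only: mult.assoc[symmetric])
  then have "(LINT \<xi>|lborel. brushlet_hat \<rho> l r e e' n \<xi> * brushlet_hat \<rho> l r e e' m \<xi>) = 2 / (r - l) * (if n = m then (r - l) / 2 else 0)"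
    by (simp only: integral_mult_right_zero I)
  then show ?thesis using lr by simp
qed

text \<open>The two bells meet only in their common transition zone, where their product is even
  about the shared endpoint \<open>r\<close>. The left cosine is odd about \<open>r\<close> and the
  right one even, so the integrand is odd.\<close>

lemma brushlet_hat_adjacent:
  assumes \<rho>: "cutoff_function \<rho>" and e: "0 < e" "0 < e1" "0 < e2" "e + e1 \<le> r - l" "e1 + e2 \<le> r' - r"
  shows "(LINT \<xi>|lborel. brushlet_hat \<rho> l r e e1 n \<xi> * brushlet_hat \<rho> r r' e1 e2 m \<xi>) = 0"
proof (rule integral_antisymmetric[of _ r])
  fix \<xi>
  note \<rho>D = cutoff_functionD[OF \<rho>]
  have bb: "bell \<rho> l r e e1 \<xi> * bell \<rho> r r' e1 e2 \<xi> = \<rho> ((r - \<xi>) / e1) * \<rho> ((\<xi> - r) / e1)" for \<xi>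
  proof -
    consider "\<xi> \<le> r - e1" | "r + e1 \<le> \<xi>" | "r - e1 \<le> \<xi>" "\<xi> \<le> r + e1" by linarith
    then show ?thesis
    proof cases
      case 1
      then have "(\<xi> - r) / e1 \<le> -1" using e by (simp add: divide_simps)
      then show ?thesis using \<rho>D(3) by (simp add: bell_def)
    next
      case 2
      then have "(r - \<xi>) / e1 \<le> -1" using e by (simp add: divide_simps)
      then show ?thesis using \<rho>D(3) by (simp add: bell_def)
    next
      case 3
      then have "1 \<le> (\<xi> - l) / e" "1 \<le> (r' - \<xi>) / e2" using e by (simp_all add: divide_simps)
      then show ?thesis using \<rho>D(4) by (simp add: bell_def)
    qed
  qed
  have "(2 * r - \<xi> - l) / (r - l) = 2 - (\<xi> - l) / (r - l)" using e by (simp add: field_simps)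
  then have c1: "cos (pi * (real n + 1 / 2) * ((2 * r - \<xi> - l) / (r - l))) = - cos (pi * (real n + 1 / 2) * ((\<xi> - l) / (r - l)))"
    by (simp only: cos_half_odd)
  have "pi * (real m + 1 / 2) * ((2 * r - \<xi> - r) / (r' - r)) = - (pi * (real m + 1 / 2) * ((\<xi> - r) / (r' - r)))"
    using e by (simp add: field_simps)
  then have c2: "cos (pi * (real m + 1 / 2) * ((2 * r - \<xi> - r) / (r' - r))) = cos (pi * (real m + 1 / 2) * ((\<xi> - r) / (r' - r)))"
    by (simp only: cos_minus)
  have prod: "brushlet_hat \<rho> l r e e1 n t * brushlet_hat \<rho> r r' e1 e2 m t
    = sqrt (2 / (r - l)) * sqrt (2 / (r' - r)) * (\<rho> ((r - t) / e1) * \<rho> ((t - r) / e1)) *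
      (cos (pi * (real n + 1 / 2) * ((t - l) / (r - l))) * cos (pi * (real m + 1 / 2) * ((t - r) / (r' - r))))" for t
    unfolding bb[symmetric] brushlet_hat_def by (simp only: mult_ac)
  have swap: "r - (2 * r - \<xi>) = \<xi> - r" "2 * r - \<xi> - r = r - \<xi>" by simp_all
  show "brushlet_hat \<rho> l r e e1 n (2 * r - \<xi>) * brushlet_hat \<rho> r r' e1 e2 m (2 * r - \<xi>)
    = - (brushlet_hat \<rho> l r e e1 n \<xi> * brushlet_hat \<rho> r r' e1 e2 m \<xi>)"
    unfolding prod c1 c2 by (simp only: swap) (simp add: mult_ac)
qed

lemma brushlet_hat_disjoint:
  assumes \<rho>: "cutoff_function \<rho>" and "0 < e" "0 < e'" "0 < d" "0 < d'" "r + e' \<le> l' - d"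
  shows "brushlet_hat \<rho> l r e e' n \<xi> * brushlet_hat \<rho> l' r' d d' m \<xi> = 0"
proof -
  have "r + e' \<le> \<xi> \<or> \<xi> \<le> l' - d" using assms by linarith
  then show ?thesis using bell_support[OF \<rho>] assms by (auto simp: brushlet_hat_def)
qed

section \<open>Brushlets of one level\<close>

definition level_hat :: "(real \<Rightarrow> real) \<Rightarrow> real \<Rightarrow> int \<Rightarrow> int \<Rightarrow> nat \<Rightarrow> real \<Rightarrow> real" where
  "level_hat \<rho> s j m = brushlet_hat \<rho> (left_end s j m) (right_end s j m)
     (cutoff_radius s j (left_end s j m)) (cutoff_radius s j (right_end s j m))"

text \<open>With \<open>X = 2 powr (j * s)\<close> and \<open>y = 2 powr (- s)\<close>, all
  endpoints and cutoff radii are \<open>X\<close> times a monomial in \<open>y\<close>, up to sign.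
  Comparing them then reduces to linear arithmetic with \<open>y \<le> 1 / 2\<close>.\<close>

lemma level_parameters:
  fixes s :: real and j :: int
  assumes s: "1 \<le> s"
  defines "X \<equiv> 2 powr (real_of_int j * s)" and "y \<equiv> 2 powr (- s)"
  shows "0 < X" "0 < y \<and> 0 < X" "y \<le> 1 / 2 \<and> 0 < X"
    "left_end s j 1 = 0" "right_end s j 1 = X * y" "cutoff_radius s j 0 = X * y ^ 3" "cutoff_radius s j (X * y) = X * y ^ 3"
    "left_end s j 2 = X * y" "right_end s j 2 = X" "cutoff_radius s j X = X * y ^ 2"
    "left_end s j (-1) = - (X * y)" "right_end s j (-1) = 0" "cutoff_radius s j (- (X * y)) = X * y ^ 3"
    "left_end s j (-2) = - X" "right_end s j (-2) = - (X * y)" "cutoff_radius s j (- X) = X * y ^ 2"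
proof -
  show X: "0 < X" by (simp add: X_def)
  have y0: "0 < y" by (simp add: y_def)
  have "2 powr (- s) \<le> 2 powr (-1 :: real)" using s by (intro powr_mono) auto
  then have y: "y \<le> 1 / 2" by (simp add: y_def powr_minus_divide)
  with X y0 show "0 < y \<and> 0 < X" "y \<le> 1 / 2 \<and> 0 < X" by simp_all
  have 1: "2 powr ((real_of_int j - 1) * s) = X * y"
    by (simp add: X_def y_def powr_add[symmetric] algebra_simps)
  have 2: "2 powr ((real_of_int j - 2) * s) = X * y ^ 2"
    by (simp add: X_def y_def powr_add[symmetric] powr_realpow[symmetric] powr_powr algebra_simps)
  have 3: "2 powr ((real_of_int j - 3) * s) = X * y ^ 3"
    by (simp add: X_def y_def powr_add[symmetric] powr_realpow[symmetric] powr_powr algebra_simps)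
  have ne: "X * y \<noteq> X" using X y by simp
  show "left_end s j 1 = 0" "right_end s j 1 = X * y" "left_end s j 2 = X * y" "right_end s j 2 = X"
    "left_end s j (-1) = - (X * y)" "right_end s j (-1) = 0" "left_end s j (-2) = - X" "right_end s j (-2) = - (X * y)"
    by (simp_all add: left_end_def right_end_def 1 X_def[symmetric])
  show "cutoff_radius s j 0 = X * y ^ 3" "cutoff_radius s j (X * y) = X * y ^ 3" "cutoff_radius s j X = X * y ^ 2"
    "cutoff_radius s j (- (X * y)) = X * y ^ 3" "cutoff_radius s j (- X) = X * y ^ 2"
    using X y0 ne by (simp_all add: cutoff_radius_def 2 3 X_def[symmetric] abs_mult)
qed

abbreviation labels :: "int set" where "labels \<equiv> {1, -1, 2, -2}"

lemma level_parameters_valid: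
  assumes s: "1 \<le> s" and m: "m \<in> labels"
  shows "left_end s j m < right_end s j m" "0 < cutoff_radius s j v"
    "cutoff_radius s j (left_end s j m) + cutoff_radius s j (right_end s j m) \<le> right_end s j m - left_end s j m"
proof -
  define X y where "X = 2 powr (real_of_int j * s)" and "y = 2 powr (- s)"
  note P = level_parameters[OF s, of j, folded X_def y_def]
  have y2: "y ^ 2 \<le> 1 / 4" using P(2,3)[THEN conjunct1] power_mono[of y "1/2" 2] by (simp add: power2_eq_square)
  have y3: "y ^ 3 \<le> y / 4" using mult_left_mono[OF y2, of y] P(2)[THEN conjunct1] by (simp add: power3_eq_cube power2_eq_square)
  have y2': "y ^ 2 \<le> y / 2" using mult_left_mono[OF P(3)[THEN conjunct1], of y] P(2)[THEN conjunct1] by (simp add: power2_eq_square)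
  have Xy: "X * y \<le> X / 2" using mult_left_mono[OF P(3)[THEN conjunct1], of X] P(1) by simp
  have Xy3: "X * y ^ 3 \<le> X * y / 4" using mult_left_mono[OF y3, of X] P(1) by simp
  have Xy2: "X * y ^ 2 \<le> X * y / 2" using mult_left_mono[OF y2', of X] P(1) by simp
  have pos: "0 < X * y" using P by simp
  show "0 < cutoff_radius s j v" by (simp add: cutoff_radius_def)
  show "left_end s j m < right_end s j m"
    using m P pos Xy by auto
  show "cutoff_radius s j (left_end s j m) + cutoff_radius s j (right_end s j m) \<le> right_end s j m - left_end s j m"
  proof -
    have "m = 1 \<or> m = -1 \<or> m = 2 \<or> m = -2" using m by auto
    then show ?thesis using Xy Xy3 Xy2 pos
      by (elim disjE; simp only: P(4-); linarith)
  qed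
qed

lemma level_hat_integrable:
  assumes "cutoff_function \<rho>" shows "integrable lborel (level_hat \<rho> s j m n)"
  unfolding level_hat_def by (intro brushlet_hat_integrable assms) (simp_all add: cutoff_radius_def)

text \<open>The four intervals of a level lie in the order -2, -1, 1, 2. Neighbours share an
  endpoint and its cutoff radius, so the parity argument applies to them; all other pairs have bells
  with disjoint supports.\<close>

lemma level_hat_orthonormal:
  assumes \<rho>: "cutoff_function \<rho>" and s: "1 \<le> s" and m: "m \<in> labels" "m' \<in> labels"
  shows "(LINT \<xi>|lborel. level_hat \<rho> s j m n \<xi> * level_hat \<rho> s j m' n' \<xi>) = (if m = m' \<and> n = n' then 1 else 0)"
proof -
  define X y where "X = 2 powr (real_of_int j * s)" and "y = 2 powr (- s)"
  note P = level_parameters[OF s, of j, folded X_def y_def]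
  note V = level_parameters_valid[OF s]
  have y2: "y ^ 2 \<le> 1 / 4" using P(2,3)[THEN conjunct1] power_mono[of y "1/2" 2] by (simp add: power2_eq_square)
  have y3: "y ^ 3 \<le> y / 4" using mult_left_mono[OF y2, of y] P(2)[THEN conjunct1] by (simp add: power3_eq_cube power2_eq_square)
  have Xy3: "X * y ^ 3 \<le> X * y / 4" using mult_left_mono[OF y3, of X] P(1) by simp
  have pos: "0 < X * y" using P by simp
  let ?I = "\<lambda>m n m' n'. LINT \<xi>|lborel. level_hat \<rho> s j m n \<xi> * level_hat \<rho> s j m' n' \<xi>"
  have diag: "?I m n m n' = (if n = n' then 1 else 0)" if "m \<in> labels" for m n n'
    unfolding level_hat_def using V[OF that] by (intro brushlet_hat_orthonormal \<rho>) auto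
  have adj: "?I m n m' n' = 0" if "m \<in> labels" "m' \<in> labels" "right_end s j m = left_end s j m'" for m m' n n'
    unfolding level_hat_def that(3)
    using V[OF that(1), where j=j] V[OF that(2), where j=j] unfolding that(3)
    by (intro brushlet_hat_adjacent \<rho>)
  have dis: "?I m n m' n' = 0" if "right_end s j m + cutoff_radius s j (right_end s j m) \<le> left_end s j m' - cutoff_radius s j (left_end s j m')" for m m' n n'
  proof -
    have "level_hat \<rho> s j m n \<xi> * level_hat \<rho> s j m' n' \<xi> = 0" for \<xi>
      unfolding level_hat_def using that V(2)[OF m(1)] by (intro brushlet_hat_disjoint \<rho>) auto
    then show ?thesis by (simp only: integral_zero)
  qed
  have comm: "?I m n m' n' = ?I m' n' m n" for m m' n n' by (simp only: mult.commute)
  have lt: "?I m n m' n' = 0" if mm: "(m, m') \<in> {(-2,-1), (-2,1), (-2,2), (-1,1), (-1,2), (1,2)}" for m m' n n'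
  proof -
    consider "(m, m') \<in> {(-2,-1), (-1,1), (1,2)}" | "(m, m') \<in> {(-2,1), (-2,2), (-1,2)}" using mm by blast
    then show ?thesis
    proof cases
      case 1 then show ?thesis by (intro adj) (auto simp: P(4-))
    next
      case 2 then show ?thesis using Xy3 pos by (intro dis) (auto simp: P(4-))
    qed
  qed
  show ?thesis
  proof (cases "m = m'")
    case True then show ?thesis using diag[OF m(1)] by simp
  next
    case False
    then have "(m, m') \<in> {(-2,-1), (-2,1), (-2,2), (-1,1), (-1,2), (1,2)} \<or> (m', m) \<in> {(-2,-1), (-2,1), (-2,2), (-1,1), (-1,2), (1,2)}"
      using m by auto
    then have "?I m n m' n' = 0" using lt[of m m' n n'] lt[of m' m n' n] comm[of m n m' n'] by argo
    then show ?thesis using False by simp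
  qed
qed

text \<open>An outer interval of the higher level begins at or beyond the place where the intervals
  of level \<open>j\<close> end, while the inner ones would overlap them. For
  \<open>j' = j + 1\<close> the two levels touch at \<open>X = X' * y\<close>, and the cutoff radii
  agree there because \<open>X' * y ^ 3 = X * y ^ 2\<close>; this explains the two different radii
  within one level. For larger gaps the supports are disjoint.\<close>

lemma level_hat_orthogonal_levels:
  assumes \<rho>: "cutoff_function \<rho>" and s: "1 \<le> s" and m: "m \<in> labels" "m' = 2 \<or> m' = -2" and j: "j < j'"
  shows "(LINT \<xi>|lborel. level_hat \<rho> s j m n \<xi> * level_hat \<rho> s j' m' n' \<xi>) = 0"
proof -
  define X y where "X = 2 powr (real_of_int j * s)" and "y = 2 powr (- s)"
  define X' where "X' = 2 powr (real_of_int j' * s)"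
  note P = level_parameters[OF s, of j, folded X_def y_def]
  note P' = level_parameters[OF s, of j', folded X'_def y_def]
  note V = level_parameters_valid[OF s]
  have y2: "y ^ 2 \<le> 1 / 4" using P(2,3)[THEN conjunct1] power_mono[of y "1/2" 2] by (simp add: power2_eq_square)
  have y3: "y ^ 3 \<le> y / 4" using mult_left_mono[OF y2, of y] P(2)[THEN conjunct1] by (simp add: power3_eq_cube power2_eq_square)
  have Xy: "X * y \<le> X / 2" using mult_left_mono[OF P(3)[THEN conjunct1], of X] P(1) by simp
  have Xy2: "X * y ^ 2 \<le> X / 4" using mult_left_mono[OF y2, of X] P(1) by simp
  have Xy3: "X * y ^ 3 \<le> X * y / 4" using mult_left_mono[OF y3, of X] P(1) by simp
  have X'y3: "X' * y ^ 3 \<le> X' * y / 4" using mult_left_mono[OF y3, of X'] P'(1) by simp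
  have pos: "0 < X * y" "0 < X" using P by simp_all
  have cases: "X' * y = X \<or> 2 * X \<le> X' * y"
  proof (cases "j' = j + 1")
    case True
    then have "X' * y = X" by (simp add: X_def X'_def y_def powr_add[symmetric] algebra_simps)
    then show ?thesis by simp
  next
    case False
    then have "j + 2 \<le> j'" using j by simp
    then have "real_of_int j + 2 \<le> real_of_int j'" by linarith
    then have "(real_of_int j + 2) * s \<le> real_of_int j' * s" using s by (intro mult_right_mono) auto
    then have "real_of_int j * s + 1 \<le> real_of_int j' * s - s" using s by (simp add: algebra_simps)
    then have "2 powr (real_of_int j * s + 1) \<le> 2 powr (real_of_int j' * s - s)" by (intro powr_mono) auto
    then show ?thesis by (simp add: X_def X'_def y_def powr_add powr_diff powr_minus divide_inverse mult.commute)
  qed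
  have dis1: ?thesis if "right_end s j m + cutoff_radius s j (right_end s j m) \<le> left_end s j' m' - cutoff_radius s j' (left_end s j' m')"
  proof -
    have "level_hat \<rho> s j m n \<xi> * level_hat \<rho> s j' m' n' \<xi> = 0" for \<xi>
      unfolding level_hat_def using that V(2)[OF m(1)] by (intro brushlet_hat_disjoint \<rho>) auto
    then show ?thesis by (simp only: integral_zero)
  qed
  have dis2: ?thesis if "right_end s j' m' + cutoff_radius s j' (right_end s j' m') \<le> left_end s j m - cutoff_radius s j (left_end s j m)"
  proof -
    have "level_hat \<rho> s j' m' n' \<xi> * level_hat \<rho> s j m n \<xi> = 0" for \<xi>
      unfolding level_hat_def using that V(2)[OF m(1)] by (intro brushlet_hat_disjoint \<rho>) auto
    then have "level_hat \<rho> s j m n \<xi> * level_hat \<rho> s j' m' n' \<xi> = 0" for \<xi> by (simp only: mult.commute)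
    then show ?thesis by (simp only: integral_zero)
  qed
  show ?thesis
  proof (cases "X' * y = X")
    case True
    have r: "X' * y ^ 3 = X * y ^ 2" using True by (simp add: power3_eq_cube power2_eq_square)
    have c: "cutoff_radius s j' X = X * y ^ 2" "cutoff_radius s j' (- X) = X * y ^ 2"
      using P'(7,13) True r by simp_all
    consider "m' = 2" "m = 2" | "m' = 2" "m \<noteq> 2" | "m' = -2" "m = -2" | "m' = -2" "m \<noteq> -2" using m by auto
    then show ?thesis
    proof cases
      case 1
      have c: "left_end s j' m' = right_end s j m" "cutoff_radius s j' (right_end s j m) = cutoff_radius s j (right_end s j m)"
        using 1 True r P'(7) by (simp_all add: P(4-) P'(4-))
      show ?thesis unfolding level_hat_def c
        using V[OF m(1), where j=j] V[where m=m' and j=j'] 1 c by (intro brushlet_hat_adjacent \<rho>) auto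
    next
      case 2
      have "m = 1 \<or> m = -1 \<or> m = -2" using m 2 by auto
      then have "right_end s j m + cutoff_radius s j (right_end s j m) \<le> left_end s j' m' - cutoff_radius s j' (left_end s j' m')"
        unfolding 2(1) using True r Xy Xy2 Xy3 pos by (elim disjE; simp only: P(4-) P'(4-) c; linarith)
      then show ?thesis by (rule dis1)
    next
      case 3
      have c: "right_end s j' m' = left_end s j m" "cutoff_radius s j' (left_end s j m) = cutoff_radius s j (left_end s j m)"
        using 3 True r P'(13) by (simp_all add: P(4-) P'(4-))
      have "(LINT \<xi>|lborel. level_hat \<rho> s j' m' n' \<xi> * level_hat \<rho> s j m n \<xi>) = 0"
        unfolding level_hat_def c
        using V[OF m(1), where j=j] V[where m=m' and j=j'] 3 c by (intro brushlet_hat_adjacent \<rho>) auto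
      then show ?thesis by (simp only: mult.commute)
    next
      case 4
      have "m = 1 \<or> m = -1 \<or> m = 2" using m 4 by auto
      then have "right_end s j' m' + cutoff_radius s j' (right_end s j' m') \<le> left_end s j m - cutoff_radius s j (left_end s j m)"
        unfolding 4(1) using True r Xy Xy2 Xy3 pos by (elim disjE; simp only: P(4-) P'(4-) c; linarith)
      then show ?thesis by (rule dis2)
    qed
  next
    case False
    then have big: "2 * X \<le> X' * y" using cases by simp
    show ?thesis
    proof (cases "m' = 2")
      case True
      have "m = 1 \<or> m = -1 \<or> m = 2 \<or> m = -2" using m by auto
      then have "right_end s j m + cutoff_radius s j (right_end s j m) \<le> left_end s j' m' - cutoff_radius s j' (left_end s j' m')"
        unfolding True using big X'y3 Xy Xy2 Xy3 pos by (elim disjE; simp only: P(4-) P'(4-); linarith)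
      then show ?thesis by (rule dis1)
    next
      case False
      then have m': "m' = -2" using m by simp
      have "m = 1 \<or> m = -1 \<or> m = 2 \<or> m = -2" using m by auto
      then have "right_end s j' m' + cutoff_radius s j' (right_end s j' m') \<le> left_end s j m - cutoff_radius s j (left_end s j m)"
        unfolding m' using big X'y3 Xy Xy2 Xy3 pos by (elim disjE; simp only: P(4-) P'(4-); linarith)
      then show ?thesis by (rule dis2)
    qed
  qed
qed

lemma level_parameters_scale:
  "left_end s j m = 2 powr (real_of_int j * s) * left_end s 0 m"
  "right_end s j m = 2 powr (real_of_int j * s) * right_end s 0 m"
  by (simp_all add: left_end_def right_end_def powr_add[symmetric] algebra_simps)

lemma cutoff_radius_scale:
  "cutoff_radius s j (2 powr (real_of_int j * s) * v) = 2 powr (real_of_int j * s) * cutoff_radius s 0 v"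
  by (simp add: cutoff_radius_def powr_add[symmetric] abs_mult algebra_simps)

text \<open>Endpoints and cutoff radii scale alike, so only the normalizing square root changes. All
  constants can thus be found at level 0.\<close>

lemma level_hat_scale:
  "level_hat \<rho> s j m n (2 powr (real_of_int j * s) * \<xi>) = 2 powr (- (real_of_int j * s) / 2) * level_hat \<rho> s 0 m n \<xi>"
proof -
  let ?X = "2 powr (real_of_int j * s)"
  have X: "?X > 0" by simp
  have "sqrt (2 / (?X * r - ?X * l)) = sqrt (1 / ?X) * sqrt (2 / (r - l))" for l r
    by (simp add: right_diff_distrib[symmetric] real_sqrt_mult[symmetric] real_sqrt_divide)
  moreover have "sqrt (1 / ?X) = 2 powr (- (real_of_int j * s) / 2)"
    by (simp add: powr_half_sqrt[symmetric] powr_powr powr_minus_divide[symmetric])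
  moreover have "(?X * \<xi> - ?X * l) / (?X * d) = (\<xi> - l) / d" "(?X * l - ?X * \<xi>) / (?X * d) = (l - \<xi>) / d" for l d
    by (simp_all add: right_diff_distrib[symmetric])
  moreover have "?X * r - ?X * l = ?X * (r - l)" for l r by (simp add: right_diff_distrib)
  ultimately show ?thesis
    unfolding level_hat_def level_parameters_scale[of s j] cutoff_radius_scale brushlet_hat_def bell_def
    by (simp only: mult.assoc)
qed

section \<open>Brushlets on the frequency side\<close>

definition hat_vec :: "(real \<Rightarrow> real) \<Rightarrow> 'd::finite rvec \<Rightarrow> 'd brushlet_index \<Rightarrow> 'd rvec \<Rightarrow> real" where
  "hat_vec \<rho> a = (\<lambda>(n, j, k) \<xi>. \<Prod>i\<in>UNIV. level_hat \<rho> (a $ i) j (k $ i) (n $ i) (\<xi> $ i))"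

abbreviation level :: "'d brushlet_index \<Rightarrow> int" where "level \<mu> \<equiv> fst (snd \<mu>)"

text \<open>The angular frequency of the \<open>i\<close>-th cosine after rescaling to level 0. On
  the space side it is the distance from the origin of the two centres of \<mu> in the rescaled
  coordinate \<open>i\<close>.\<close>

definition node :: "'d::finite rvec \<Rightarrow> 'd brushlet_index \<Rightarrow> 'd \<Rightarrow> real" where
  "node a \<mu> i = pi * (real (fst \<mu> $ i) + 1 / 2) / (right_end (a $ i) 0 (snd (snd \<mu>) $ i) - left_end (a $ i) 0 (snd (snd \<mu>) $ i))"

definition weight :: "'d::finite rvec \<Rightarrow> real \<Rightarrow> 'd brushlet_index \<Rightarrow> 'd rvec \<Rightarrow> real" where
  "weight a A \<mu> x = (\<Prod>i\<in>UNIV. (1 + \<bar>scl a (level \<mu>) i * \<bar>x $ i\<bar> - node a \<mu> i\<bar>) powr (- A))"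

text \<open>The weight called \<open>E\<^sub>\<mu>\<close> in the overview; it coincides with
  \<open>weight\<close> of order 2.\<close>

definition tw_weight :: "'d::finite rvec \<Rightarrow> 'd brushlet_index \<Rightarrow> 'd rvec \<Rightarrow> real" where
  "tw_weight a \<mu> x = (\<Prod>i\<in>UNIV. tw (scl a (level \<mu>) i * \<bar>x $ i\<bar> - node a \<mu> i))"

lemma weight_nonneg [simp]: "0 \<le> weight a A \<mu> x"
  unfolding weight_def by (intro prod_nonneg) auto

lemma tw_weight_nonneg [simp]: "0 \<le> tw_weight a \<mu> x"
  unfolding tw_weight_def by (intro prod_nonneg) auto

lemma weight_powr: "weight a A \<mu> x powr t = weight a (A * t) \<mu> x"
  unfolding weight_def by (simp add: prod_powr_distrib[symmetric] powr_powr)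

lemma weight_le_tw: "2 \<le> A \<Longrightarrow> weight a A \<mu> x \<le> tw_weight a \<mu> x"
  unfolding weight_def tw_weight_def by (intro prod_mono conjI powr_le_tw) auto

lemma measurable_weight [measurable]: "weight a A \<mu> \<in> borel_measurable borel"
  unfolding weight_def[abs_def] by measurable

lemma measurable_tw_weight [measurable]: "tw_weight a \<mu> \<in> borel_measurable borel"
  unfolding tw_weight_def[abs_def] by measurable

text \<open>A translation costs only a polynomial in the rescaled shift. Rapidly decreasing kernels
  absorb this factor when a weight is moved under an integral.\<close>

lemma weight_shift:
  assumes "0 \<le> A"
  shows "weight a A \<mu> (x - v) \<le> weight a A \<mu> x * (\<Prod>i\<in>UNIV. (1 + scl a (level \<mu>) i * \<bar>v $ i\<bar>) powr A)"
  unfolding weight_def prod.distrib[symmetric]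
proof (intro prod_mono conjI)
  fix i
  let ?s = "scl a (level \<mu>) i" and ?y = "node a \<mu> i"
  have s: "0 \<le> ?s" by simp
  have "\<bar>?s * \<bar>x $ i\<bar> - ?s * \<bar>x $ i - v $ i\<bar>\<bar> \<le> ?s * \<bar>v $ i\<bar>"
  proof -
    have "\<bar>\<bar>x $ i\<bar> - \<bar>x $ i - v $ i\<bar>\<bar> \<le> \<bar>v $ i\<bar>" by linarith
    then have "?s * \<bar>\<bar>x $ i\<bar> - \<bar>x $ i - v $ i\<bar>\<bar> \<le> ?s * \<bar>v $ i\<bar>" using s by (rule mult_left_mono)
    moreover have "\<bar>?s * \<bar>x $ i\<bar> - ?s * \<bar>x $ i - v $ i\<bar>\<bar> = ?s * \<bar>\<bar>x $ i\<bar> - \<bar>x $ i - v $ i\<bar>\<bar>"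
      unfolding right_diff_distrib[symmetric] by (simp add: abs_mult)
    ultimately show ?thesis by simp
  qed
  then have "1 + \<bar>?s * \<bar>x $ i\<bar> - ?y\<bar> \<le> 1 + (\<bar>?s * \<bar>x $ i - v $ i\<bar> - ?y\<bar> + ?s * \<bar>v $ i\<bar>)" by linarith
  also have "\<dots> \<le> (1 + \<bar>?s * \<bar>x $ i - v $ i\<bar> - ?y\<bar>) * (1 + ?s * \<bar>v $ i\<bar>)"
    using s by (simp add: algebra_simps)
  finally have le: "1 + \<bar>?s * \<bar>x $ i\<bar> - ?y\<bar> \<le> (1 + \<bar>?s * \<bar>x $ i - v $ i\<bar> - ?y\<bar>) * (1 + ?s * \<bar>v $ i\<bar>)" .
  let ?p = "1 + \<bar>?s * \<bar>x $ i\<bar> - ?y\<bar>" and ?q = "1 + \<bar>?s * \<bar>x $ i - v $ i\<bar> - ?y\<bar>" and ?u = "1 + ?s * \<bar>v $ i\<bar>"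
  have pos: "0 < ?p" "0 < ?q" "0 < ?u" using s by (auto intro: add_pos_nonneg)
  have "?p powr A \<le> ?q powr A * ?u powr A"
    using powr_mono2[OF assms _ le] pos by (simp add: powr_mult)
  then have "?q powr (- A) \<le> ?p powr (- A) * ?u powr A"
    using pos by (simp add: powr_minus divide_simps mult_ac)
  then show "(1 + \<bar>?s * \<bar>(x - v) $ i\<bar> - ?y\<bar>) powr (- A) \<le> (1 + \<bar>?s * \<bar>x $ i\<bar> - ?y\<bar>) powr (- A) * (1 + ?s * \<bar>v $ i\<bar>) powr A"
    by simp
qed simp

lemma nn_integral_tw_weight_1d:
  "(\<integral>\<^sup>+t. tw (scl a j i * \<bar>t\<bar> - y) \<partial>lborel) \<le> ennreal (2 * tw_mass / scl a j i)"
  by (rule nn_integral_tw_abs) simp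

lemma integrable_tw_abs:
  assumes "0 < c" shows "integrable lborel (\<lambda>u. tw (c * \<bar>u\<bar> - y))"
proof (rule integrableI_bounded)
  have "(\<integral>\<^sup>+u. ennreal (norm (tw (c * \<bar>u\<bar> - y))) \<partial>lborel) \<le> ennreal (2 * tw_mass / c)"
    using nn_integral_tw_abs[OF assms] by simp
  then show "(\<integral>\<^sup>+u. ennreal (norm (tw (c * \<bar>u\<bar> - y))) \<partial>lborel) < \<infinity>"
    using ennreal_less_top le_less_trans by (metis infinity_ennreal_def)
qed simp

lemma integrable_tw_weight: "integrable lborel (tw_weight a \<mu>)"
  unfolding tw_weight_def[abs_def] by (rule integrable_prod_vec) (rule integrable_tw_abs, simp)

lemma integrable_weight:
  assumes "2 \<le> A" shows "integrable lborel (weight a A \<mu>)"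
  by (rule Bochner_Integration.integrable_bound[OF integrable_tw_weight[of a \<mu>]])
     (use weight_le_tw[OF assms, of a \<mu>] in \<open>auto intro!: AE_I2\<close>)

lemma finite_labels: "finite {k :: (int, 'd::finite) vec. \<forall>i. k $ i \<in> labels}"
proof -
  have "{k :: (int, 'd) vec. \<forall>i. k $ i \<in> labels} \<subseteq> vec_lambda ` (Pi\<^sub>E UNIV (\<lambda>_. labels))"
  proof
    fix k :: "(int, 'd) vec" assume "k \<in> {k. \<forall>i. k $ i \<in> labels}"
    then have "vec_nth k \<in> Pi\<^sub>E UNIV (\<lambda>_. labels)" by auto
    then have "vec_lambda (vec_nth k) \<in> vec_lambda ` (Pi\<^sub>E UNIV (\<lambda>_. labels))" by (rule imageI)
    then show "k \<in> vec_lambda ` (Pi\<^sub>E UNIV (\<lambda>_. labels))" by simp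
  qed
  then show ?thesis by (rule finite_subset) (intro finite_imageI finite_PiE, auto)
qed

text \<open>The finitely many constants are added up. It is applied to the labels, the parameters on
  which the level 0 bells still depend.\<close>

lemma finite_uniform_bound:
  fixes f g :: "'b \<Rightarrow> 'c \<Rightarrow> real"
  assumes "finite S" "\<And>k. k \<in> S \<Longrightarrow> \<exists>C\<ge>0. \<forall>x. f k x \<le> C * g k x" "\<And>k x. 0 \<le> g k x"
  shows "\<exists>C\<ge>0. \<forall>k\<in>S. \<forall>x. f k x \<le> C * g k x"
proof -
  from assms(2) have "\<forall>k\<in>S. \<exists>C. 0 \<le> C \<and> (\<forall>x. f k x \<le> C * g k x)" by blast
  then obtain C where C: "\<forall>k\<in>S. 0 \<le> C k \<and> (\<forall>x. f k x \<le> C k * g k x)" by (rule bchoice[THEN exE])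
  have "f k x \<le> (\<Sum>k\<in>S. C k) * g k x" if "k \<in> S" for k x
  proof -
    have "C k \<le> (\<Sum>k\<in>S. C k)" using C assms(1) that by (intro member_le_sum) auto
    from mult_right_mono[OF this assms(3)[of k x]] show ?thesis using C that by (meson order_trans)
  qed
  moreover have "0 \<le> (\<Sum>k\<in>S. C k)" using C by (intro sum_nonneg) auto
  ultimately show ?thesis by blast
qed

locale brushlet_system =
  fixes a :: "'d::{finite,linorder} rvec" and \<phi> :: "'d rvec \<Rightarrow> complex" and \<rho> :: "real \<Rightarrow> real"
  assumes a: "\<forall>i. 1 \<le> a $ i" and adm: "admissible a \<phi>" and cut: "cutoff_function \<rho>"
begin

abbreviation "\<nu> \<equiv> aniso_dim a"
abbreviation "w \<equiv> brushlet \<rho> a"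
abbreviation "hat \<equiv> hat_vec \<rho> a"
abbreviation "D j \<equiv> diag_mult (scl a j)"

lemma phi_schwartz: "\<phi> \<in> schwartz" using adm by (simp add: admissible_def)
lemma phi_rapid: "rapid \<phi>" by (rule schwartz_rapid[OF phi_schwartz])
lemma phi_integrable: "integrable lborel \<phi>" by (rule rapid_integrable(2)[OF phi_rapid])

lemma D_D: "D i (D j x) = D (i + j) x"
  by (simp add: vec_eq_iff scl_add mult_ac)

lemma D_0 [simp]: "D 0 x = x" by (simp add: vec_eq_iff)

lemma hat_integrable: "integrable lborel (\<lambda>\<xi>. complex_of_real (hat \<mu> \<xi>))"
proof -
  have "integrable lborel (hat \<mu>)"
    unfolding hat_vec_def split_beta' by (rule integrable_prod_vec) (rule level_hat_integrable[OF cut])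
  then show ?thesis by (rule integrable_of_real)
qed

lemma brushlet_eq: "w \<mu> = inverse_fourier (\<lambda>\<xi>. complex_of_real (hat \<mu> \<xi>))"
proof
  fix x
  obtain n j k where \<mu>: "\<mu> = (n, j, k)" by (cases \<mu>)
  let ?f = "\<lambda>i t. complex_of_real (level_hat \<rho> (a $ i) j (k $ i) (n $ i) t) * exp (\<i> * complex_of_real (x $ i * t))"
  have int: "integrable lborel (?f i)" for i
  proof -
    have "integrable lborel (\<lambda>t. complex_of_real (level_hat \<rho> (a $ i) j (k $ i) (n $ i) t))"
      using level_hat_integrable[OF cut] by (rule integrable_of_real)
    from integrable_mult_exp(2)[OF this, of "x $ i"] show ?thesis by simp
  qed
  have lb: "level_brushlet \<rho> (a $ i) j (k $ i) (n $ i) (x $ i) = complex_of_real ((2 * pi) powr (- 1 / 2)) * (LINT t|lborel. ?f i t)" for i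
    by (simp add: level_brushlet_def brushlet_1d_eq level_hat_def inverse_fourier_def)
  have "w \<mu> x = (\<Prod>i\<in>(UNIV::'d set). complex_of_real ((2 * pi) powr (- 1 / 2))) * (\<Prod>i\<in>UNIV. (LINT t|lborel. ?f i t))"
    by (simp only: \<mu> brushlet_def split_conv lb prod.distrib)
  also have "(\<Prod>i\<in>UNIV. (LINT t|lborel. ?f i t)) = (LINT \<xi>|lborel. (\<Prod>i\<in>UNIV. ?f i (\<xi> $ i)))"
    by (rule integral_prod_vec[OF int, symmetric])
  also have "(\<lambda>\<xi>. \<Prod>i\<in>UNIV. ?f i (\<xi> $ i)) = (\<lambda>\<xi>. complex_of_real (hat \<mu> \<xi>) * exp (\<i> * complex_of_real (x \<bullet> \<xi>)))"
    by (simp add: hat_vec_def \<mu> prod.distrib inner_vec_def exp_sum sum_distrib_left)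
  also have "(\<Prod>i\<in>(UNIV::'d set). complex_of_real ((2 * pi) powr (- 1 / 2))) = fourier_const TYPE('d)"
  proof -
    have "((2 * pi) powr (- 1 / 2)) ^ CARD('d) = (2 * pi) powr (- real CARD('d) / 2)"
      by (simp add: powr_realpow[symmetric] powr_powr)
    then show ?thesis by (simp only: prod_constant of_real_power[symmetric])
  qed
  finally show "w \<mu> x = inverse_fourier (\<lambda>\<xi>. complex_of_real (hat \<mu> \<xi>)) x"
    by (simp add: inverse_fourier_def)
qed

lemma indices_labels: "\<mu> \<in> brushlet_indices \<Longrightarrow> snd (snd \<mu>) $ i \<in> labels"
  by (auto simp: brushlet_indices_def)

lemma indices_outer:
  assumes "\<mu> \<in> brushlet_indices"
  obtains i where "snd (snd \<mu>) $ i = 2 \<or> snd (snd \<mu>) $ i = -2"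
proof -
  have "snd (snd \<mu>) \<in> {k. \<forall>i. k $ i \<in> {1, -1, 2, -2}} - {k. \<forall>i. k $ i \<in> {1, -1}}"
    using assms by (simp only: brushlet_indices_def mem_Times_iff)
  then obtain i where "snd (snd \<mu>) $ i \<notin> {1, -1}" "snd (snd \<mu>) $ i \<in> {1, -1, 2, -2}" by blast
  then show ?thesis using that[of i] by blast
qed

text \<open>A single vanishing factor suffices in the product over the coordinates. For different
  levels it comes from a coordinate in which the rectangle of the higher level has an outer label;
  every index has such a coordinate.\<close>

lemma hat_orthonormal:
  assumes \<mu>: "\<mu> \<in> brushlet_indices" and \<mu>': "\<mu>' \<in> brushlet_indices"
  shows "(LINT \<xi>|lborel. hat \<mu> \<xi> * hat \<mu>' \<xi>) = (if \<mu> = \<mu>' then 1 else 0)"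
    and hat_mult_integrable: "integrable lborel (\<lambda>\<xi>. hat \<mu> \<xi> * hat \<mu>' \<xi>)"
proof -
  obtain n j k where 1: "\<mu> = (n, j, k)" by (cases \<mu>)
  obtain n' j' k' where 2: "\<mu>' = (n', j', k')" by (cases \<mu>')
  have k: "k $ i \<in> labels" "k' $ i \<in> labels" for i
    using indices_labels[OF \<mu>, of i] indices_labels[OF \<mu>', of i] by (auto simp: 1 2)
  have a1: "1 \<le> a $ i" for i using a by simp
  let ?f = "\<lambda>i t. level_hat \<rho> (a $ i) j (k $ i) (n $ i) t * level_hat \<rho> (a $ i) j' (k' $ i) (n' $ i) t"
  have int: "integrable lborel (?f i)" for i
  proof (rule Bochner_Integration.integrable_bound)
    let ?B = "sqrt (2 / (right_end (a $ i) j (k $ i) - left_end (a $ i) j (k $ i)))"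
    show "integrable lborel (\<lambda>t. ?B * level_hat \<rho> (a $ i) j' (k' $ i) (n' $ i) t)"
      by (intro integrable_mult_right level_hat_integrable cut)
    show "?f i \<in> borel_measurable lborel"
      using level_hat_integrable[OF cut] by (intro borel_measurable_times) auto
    have "\<bar>level_hat \<rho> (a $ i) j (k $ i) (n $ i) t\<bar> \<le> \<bar>?B\<bar>" for t
    proof -
      have "\<bar>bell \<rho> l r e e' t\<bar> * \<bar>cos z\<bar> \<le> 1" for l r e e' z
        using bell_bounds[OF cut] by (intro mult_le_one) auto
      from mult_left_mono[OF this abs_ge_zero[of ?B]] show ?thesis
        by (simp only: level_hat_def brushlet_hat_def abs_mult mult.assoc mult_1_right)
    qed
    then show "AE t in lborel. norm (?f i t) \<le> norm (?B * level_hat \<rho> (a $ i) j' (k' $ i) (n' $ i) t)"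
      by (intro AE_I2) (simp only: real_norm_def abs_mult mult_right_mono abs_ge_zero)
  qed
  have eq: "hat \<mu> \<xi> * hat \<mu>' \<xi> = (\<Prod>i\<in>UNIV. ?f i (\<xi> $ i))" for \<xi>
    by (simp add: hat_vec_def 1 2 prod.distrib)
  show "integrable lborel (\<lambda>\<xi>. hat \<mu> \<xi> * hat \<mu>' \<xi>)"
    unfolding eq by (rule integrable_prod_vec[OF int])
  have I: "(LINT \<xi>|lborel. hat \<mu> \<xi> * hat \<mu>' \<xi>) = (\<Prod>i\<in>UNIV. (LINT t|lborel. ?f i t))"
    unfolding eq by (rule integral_prod_vec[OF int])
  consider "j = j'" | "j < j'" | "j' < j" by linarith
  then show "(LINT \<xi>|lborel. hat \<mu> \<xi> * hat \<mu>' \<xi>) = (if \<mu> = \<mu>' then 1 else 0)"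
  proof cases
    case 1
    have "(LINT t|lborel. ?f i t) = (if k $ i = k' $ i \<and> n $ i = n' $ i then 1 else 0)" for i
      unfolding \<open>j = j'\<close> by (rule level_hat_orthonormal[OF cut a1 k])
    then have "(LINT \<xi>|lborel. hat \<mu> \<xi> * hat \<mu>' \<xi>) = (\<Prod>i\<in>UNIV. if k $ i = k' $ i \<and> n $ i = n' $ i then 1 else 0)"
      by (simp only: I)
    also have "\<dots> = (if \<mu> = \<mu>' then 1 else 0)"
    proof (cases "\<mu> = \<mu>'")
      case True then show ?thesis by (simp add: \<open>\<mu> = (n, j, k)\<close> \<open>\<mu>' = (n', j', k')\<close>)
    next
      case False
      then obtain i where "\<not> (k $ i = k' $ i \<and> n $ i = n' $ i)"
        using \<open>j = j'\<close> by (auto simp: \<open>\<mu> = (n, j, k)\<close> \<open>\<mu>' = (n', j', k')\<close> vec_eq_iff)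
      then have "(\<Prod>i\<in>UNIV. if k $ i = k' $ i \<and> n $ i = n' $ i then 1 else 0 :: real) = 0"
        by (intro prod_zero) auto
      then show ?thesis using False by simp
    qed
    finally show ?thesis .
  next
    case 2
    obtain i where "k' $ i = 2 \<or> k' $ i = -2" using indices_outer[OF \<mu>'] by (auto simp: \<open>\<mu>' = (n', j', k')\<close>)
    then have "(LINT t|lborel. ?f i t) = 0" by (rule level_hat_orthogonal_levels[OF cut a1 k(1) _ 2])
    then have "(\<Prod>i\<in>UNIV. (LINT t|lborel. ?f i t)) = 0" by (intro prod_zero) auto
    then have "(LINT \<xi>|lborel. hat \<mu> \<xi> * hat \<mu>' \<xi>) = 0" by (simp only: I)
    moreover have "\<mu> \<noteq> \<mu>'" using 2 by (auto simp: \<open>\<mu> = (n, j, k)\<close> \<open>\<mu>' = (n', j', k')\<close>)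
    ultimately show ?thesis by simp
  next
    case 3
    obtain i where "k $ i = 2 \<or> k $ i = -2" using indices_outer[OF \<mu>] by (auto simp: \<open>\<mu> = (n, j, k)\<close>)
    then have "(LINT t|lborel. level_hat \<rho> (a $ i) j' (k' $ i) (n' $ i) t * level_hat \<rho> (a $ i) j (k $ i) (n $ i) t) = 0"
      by (rule level_hat_orthogonal_levels[OF cut a1 k(2) _ 3])
    then have "(LINT t|lborel. ?f i t) = 0" by (simp only: mult.commute)
    then have "(\<Prod>i\<in>UNIV. (LINT t|lborel. ?f i t)) = 0" by (intro prod_zero) auto
    then have "(LINT \<xi>|lborel. hat \<mu> \<xi> * hat \<mu>' \<xi>) = 0" by (simp only: I)
    moreover have "\<mu> \<noteq> \<mu>'" using 3 by (auto simp: \<open>\<mu> = (n, j, k)\<close> \<open>\<mu>' = (n', j', k')\<close>)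
    ultimately show ?thesis by simp
  qed
qed

section \<open>Rescaling to level 0 and the supports there\<close>

lemma hat_scale: "hat (n, j, k) (D j \<xi>) = 2 powr (- (real_of_int j * \<nu>) / 2) * hat (n, 0, k) \<xi>"
proof -
  have "hat (n, j, k) (D j \<xi>) = (\<Prod>i\<in>UNIV. 2 powr (- (real_of_int j * a $ i) / 2) * level_hat \<rho> (a $ i) 0 (k $ i) (n $ i) (\<xi> $ i))"
    by (simp only: hat_vec_def split_conv vec_lambda_beta scl_def level_hat_scale)
  also have "\<dots> = (\<Prod>i\<in>UNIV. 2 powr (- (real_of_int j * a $ i) / 2)) * hat (n, 0, k) \<xi>"
    by (simp add: hat_vec_def prod.distrib)
  also have "(\<Prod>i\<in>UNIV. 2 powr (- (real_of_int j * a $ i) / 2)) = 2 powr (\<Sum>i\<in>UNIV. - (real_of_int j * a $ i) / 2)"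
    by (simp add: powr_sum)
  also have "(\<Sum>i\<in>UNIV. - (real_of_int j * a $ i) / 2) = - (real_of_int j * \<nu>) / 2"
    by (simp add: aniso_dim_def sum_distrib_left sum_negf sum_divide_distrib)
  finally show ?thesis .
qed

lemma hat_scale': "hat (n, j, k) \<xi> = 2 powr (- (real_of_int j * \<nu>) / 2) * hat (n, 0, k) (D (- j) \<xi>)"
  using hat_scale[of n j k "D (- j) \<xi>"] unfolding D_D by simp

text \<open>The spectrum at level 0 stripped of its cosines. It depends on the label only, so its
  constants are independent of the frequency index \<open>n\<close>.\<close>

definition base :: "(int, 'd) vec \<Rightarrow> 'd rvec \<Rightarrow> complex" where
  "base k \<xi> = complex_of_real (\<Prod>i\<in>UNIV. sqrt (2 / (right_end (a $ i) 0 (k $ i) - left_end (a $ i) 0 (k $ i))) *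
     bell \<rho> (left_end (a $ i) 0 (k $ i)) (right_end (a $ i) 0 (k $ i))
       (cutoff_radius (a $ i) 0 (left_end (a $ i) 0 (k $ i))) (cutoff_radius (a $ i) 0 (right_end (a $ i) 0 (k $ i))) (\<xi> $ i))"

lemma hat_level_0:
  "complex_of_real (hat (n, 0, k) \<xi>) = base k \<xi> * complex_of_real (\<Prod>i\<in>UNIV. cos (node a (n, j, k) i * (\<xi> $ i - left_end (a $ i) 0 (k $ i))))"
proof -
  have "pi * (real (n $ i) + 1 / 2) * ((\<xi> $ i - left_end (a $ i) 0 (k $ i)) / (right_end (a $ i) 0 (k $ i) - left_end (a $ i) 0 (k $ i)))
    = node a (n, j, k) i * (\<xi> $ i - left_end (a $ i) 0 (k $ i))" for i
    by (simp add: node_def)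
  then show ?thesis
    unfolding of_real_mult[symmetric] base_def
    by (simp only: hat_vec_def split_conv level_hat_def brushlet_hat_def prod.distrib of_real_mult)
qed

definition box_of :: "(int, 'd) vec \<Rightarrow> 'd rvec set" where
  "box_of k = {\<xi>. \<forall>i. left_end (a $ i) 0 (k $ i) - cutoff_radius (a $ i) 0 (left_end (a $ i) 0 (k $ i)) \<le> \<xi> $ i \<and>
     \<xi> $ i \<le> right_end (a $ i) 0 (k $ i) + cutoff_radius (a $ i) 0 (right_end (a $ i) 0 (k $ i))}"

lemma closed_box_of: "closed (box_of k)"
proof -
  have "box_of k = cbox (\<chi> i. left_end (a $ i) 0 (k $ i) - cutoff_radius (a $ i) 0 (left_end (a $ i) 0 (k $ i)))
    (\<chi> i. right_end (a $ i) 0 (k $ i) + cutoff_radius (a $ i) 0 (right_end (a $ i) 0 (k $ i)))"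
    by (auto simp: box_of_def mem_box_cart)
  then show ?thesis by (simp add: closed_cbox)
qed

lemma base_support: assumes "\<xi> \<notin> box_of k" shows "base k \<xi> = 0"
proof -
  obtain i where i: "\<xi> $ i \<le> left_end (a $ i) 0 (k $ i) - cutoff_radius (a $ i) 0 (left_end (a $ i) 0 (k $ i)) \<or>
     right_end (a $ i) 0 (k $ i) + cutoff_radius (a $ i) 0 (right_end (a $ i) 0 (k $ i)) \<le> \<xi> $ i"
    using assms by (auto simp: box_of_def not_le intro: less_imp_le)
  have "0 < cutoff_radius s 0 v" for s v by (simp add: cutoff_radius_def)
  from bell_support[OF cut this this i] show ?thesis
    unfolding base_def of_real_eq_0_iff by (intro prod_zero) auto
qed

text \<open>With \<open>y = 2 powr (- (a $ i))\<close>, an outer side keeps the distance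
  \<open>y - y ^ 3 \<ge> 3 / 4 * y\<close> from 0. Replacing \<open>a $ i\<close> by the larger
  \<open>\<nu>\<close> makes the bound the same for all directions.\<close>

lemma box_of_bounds:
  assumes k: "\<And>i. k $ i \<in> labels" and \<xi>: "\<xi> \<in> box_of k"
  shows "\<bar>\<xi> $ i\<bar> \<le> 2" "k $ i = 2 \<or> k $ i = -2 \<Longrightarrow> 3 / 4 * 2 powr (- \<nu>) \<le> \<bar>\<xi> $ i\<bar>"
proof -
  define y where "y = 2 powr (- (a $ i))"
  have a1: "1 \<le> a $ i" using a by simp
  note P = level_parameters[OF a1, of 0, simplified, folded y_def]
  have y: "0 < y" "y \<le> 1 / 2" using level_parameters(2,3)[OF a1, of 0] by (simp_all add: y_def)
  have y2: "y ^ 2 \<le> 1 / 4" using y power_mono[of y "1/2" 2] by (simp add: power2_eq_square)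
  have y3: "y ^ 3 \<le> y / 4" using mult_left_mono[OF y2, of y] y by (simp add: power3_eq_cube power2_eq_square)
  have b: "left_end (a $ i) 0 (k $ i) - cutoff_radius (a $ i) 0 (left_end (a $ i) 0 (k $ i)) \<le> \<xi> $ i"
    "\<xi> $ i \<le> right_end (a $ i) 0 (k $ i) + cutoff_radius (a $ i) 0 (right_end (a $ i) 0 (k $ i))"
    using \<xi> by (auto simp: box_of_def)
  have "a $ i \<le> \<nu>" unfolding aniso_dim_def
  proof (rule member_le_sum)
    show "0 \<le> a $ j" for j using a order_trans[OF zero_le_one] by blast
  qed auto
  then have yn: "2 powr (- \<nu>) \<le> y" unfolding y_def by (intro powr_mono) auto
  have c: "k $ i = 1 \<or> k $ i = -1 \<or> k $ i = 2 \<or> k $ i = -2" using k[of i] by auto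
  show "\<bar>\<xi> $ i\<bar> \<le> 2" using c b y y2 y3 by (elim disjE; simp only: P; linarith)
  show "3 / 4 * 2 powr (- \<nu>) \<le> \<bar>\<xi> $ i\<bar>" if "k $ i = 2 \<or> k $ i = -2"
    using that b y y2 y3 yn by (elim disjE; simp only: P; linarith)
qed

lemma base_compact_support:
  assumes k: "\<And>i. k $ i \<in> labels" and "2 * real CARD('d) < norm \<xi>"
  shows "base k \<xi> = 0"
proof (rule base_support, rule notI)
  assume "\<xi> \<in> box_of k"
  then have "norm \<xi> \<le> (\<Sum>i\<in>(UNIV::'d set). 2)"
    using norm_le_l1_cart[of \<xi>] box_of_bounds(1)[OF k] by (meson order_trans sum_mono)
  then show False using assms(2) by simp
qed

lemma bell_Ck: "Ck n UNIV (\<lambda>\<xi>::'d rvec. complex_of_real (bell \<rho> l r e e' (\<xi> $ i)))"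
proof -
  have \<rho>: "Ck n UNIV (\<lambda>t. complex_of_real (\<rho> t))"
    using cut by (intro Ck_bounded_linear[OF open_UNIV bounded_linear_of_real] smooth_imp_Ck) (simp add: cutoff_function_def)
  have "Ck n UNIV (\<lambda>\<xi>::'d rvec. complex_of_real (\<rho> (axis i (1 / e) \<bullet> \<xi> + (- l / e))) * complex_of_real (\<rho> (axis i (- 1 / e') \<bullet> \<xi> + r / e')))"
    by (intro Ck_mult open_UNIV Ck_compose_affine[OF \<rho>])
  moreover have "axis i (1 / e) \<bullet> \<xi> + (- l / e) = (\<xi> $ i - l) / e" "axis i (- 1 / e') \<bullet> \<xi> + r / e' = (r - \<xi> $ i) / e'" for \<xi> :: "'d rvec"
    by (simp_all add: inner_axis' diff_divide_distrib)
  ultimately show ?thesis by (simp add: bell_def)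
qed

lemma base_Ck: "Ck n UNIV (base k)"
  unfolding base_def[abs_def] of_real_prod of_real_mult
  by (intro Ck_prod Ck_mult open_UNIV Ck_const bell_Ck)

section \<open>Spectral overlap of brushlets and Littlewood--Paley pieces\<close>

abbreviation "phi_hat i \<xi> \<equiv> fourier \<phi> (D (- i) \<xi>)"

text \<open>One outer side keeps the box away from the origin. In the upper bound
  \<open>?t = 2 * real CARD('d) + 1\<close> is chosen so that \<open>CARD('d)\<close> terms
  \<open>2 / ?t\<close> add up to less than 1.\<close>

lemma box_of_aniso:
  assumes k: "\<And>i. k $ i \<in> labels" "k $ i = 2 \<or> k $ i = -2" and \<xi>: "\<xi> \<in> box_of k"
  shows "3 / 4 * 2 powr (- \<nu>) \<le> aniso_norm a \<xi>" "aniso_norm a \<xi> \<le> 2 * real CARD('d) + 1"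
proof -
  let ?t = "2 * real CARD('d) + 1" and ?\<delta> = "3 / 4 * 2 powr (- \<nu>)"
  have "\<nu> \<ge> 0" unfolding aniso_dim_def using a by (intro sum_nonneg) (meson order_trans zero_le_one)
  then have \<delta>1: "?\<delta> \<le> 1" using powr_mono[of "- \<nu>" 0 2] by simp
  have "aniso_norm a \<xi> < ?t"
  proof (rule aniso_norm_le[OF a box_of_bounds(1)[OF k(1) \<xi>]])
    have "(\<Sum>i\<in>UNIV. ?t powr (- a $ i) * 2) \<le> (\<Sum>i\<in>(UNIV::'d set). 1 / ?t * 2)"
    proof (intro sum_mono mult_right_mono)
      fix i
      have "?t powr (- a $ i) \<le> ?t powr (- 1)" using a by (intro powr_mono) auto
      then show "?t powr (- a $ i) \<le> 1 / ?t" by (simp add: powr_minus_divide)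
    qed auto
    also have "\<dots> < 1" by (simp add: divide_simps)
    finally show "(\<Sum>i\<in>UNIV. ?t powr (- a $ i) * 2) < 1" .
  qed simp
  then show "aniso_norm a \<xi> \<le> ?t" by simp
  have \<xi>i: "?\<delta> \<le> \<bar>\<xi> $ i\<bar>" by (rule box_of_bounds(2)[OF k(1) \<xi> k(2)])
  then have "\<xi> \<noteq> 0" using mult_pos_pos[of "3/4" "2 powr (- \<nu>)"] by auto
  note p = aniso_norm_props(1)[OF a this]
  show "?\<delta> \<le> aniso_norm a \<xi>"
  proof (rule ccontr)
    assume "\<not> ?\<delta> \<le> aniso_norm a \<xi>"
    then have lt: "aniso_norm a \<xi> < ?\<delta>" by simp
    then have "aniso_norm a \<xi> powr (a $ i) \<le> aniso_norm a \<xi> powr 1"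
      using p \<delta>1 a by (intro powr_mono') auto
    then show False using abs_component_le_aniso[OF a, of \<xi> i] \<xi>i p lt by simp
  qed
qed

lemma aniso_phi_hat:
  "aniso_norm a (D (- i) \<xi>) = 2 powr (- real_of_int i) * aniso_norm a \<xi>"
  using aniso_norm_scl[OF a, of "- i" \<xi>] by simp

lemma overlap_bound: "\<exists>K::nat. \<forall>k \<xi> i. (\<forall>i. k $ i \<in> labels) \<longrightarrow> (\<exists>l. k $ l = 2 \<or> k $ l = -2) \<longrightarrow> \<xi> \<in> box_of k \<longrightarrow>
    phi_hat i \<xi> \<noteq> 0 \<longrightarrow> \<bar>i\<bar> \<le> int K"
proof -
  define d t where "d = 3 / 4 * 2 powr (- \<nu>)" and "t = 2 * real CARD('d) + 1"
  define M where "M = \<bar>log 2 (d / 2)\<bar> + \<bar>log 2 (2 * t)\<bar>"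
  have "\<bar>i\<bar> \<le> int (nat \<lceil>M\<rceil>)" if k: "\<forall>i. k $ i \<in> labels" "k $ l = 2 \<or> k $ l = -2" and \<xi>: "\<xi> \<in> box_of k" and nz: "phi_hat i \<xi> \<noteq> 0" for k \<xi> i l
  proof -
    let ?z = "aniso_norm a \<xi>"
    have z: "d \<le> ?z" "?z \<le> t" using box_of_aniso[of k l \<xi>] k \<xi> by (auto simp: d_def t_def)
    have d: "0 < d" "0 < t" by (simp_all add: d_def t_def add_pos_nonneg)
    have "1 / 2 \<le> 2 powr (- real_of_int i) * ?z" "2 powr (- real_of_int i) * ?z \<le> 2"
      using admissible_support[OF adm nz] by (simp_all add: aniso_phi_hat)
    then have "2 powr (real_of_int i) \<le> 2 * ?z" "?z / 2 \<le> 2 powr (real_of_int i)"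
      by (simp_all add: powr_minus field_simps)
    then have "2 powr (real_of_int i) \<le> 2 * t" "d / 2 \<le> 2 powr (real_of_int i)" using z by linarith+
    then have "real_of_int i \<le> log 2 (2 * t)" "log 2 (d / 2) \<le> real_of_int i"
      using d by (simp_all add: le_log_iff log_le_iff)
    then have "\<bar>real_of_int i\<bar> \<le> M" unfolding M_def by linarith
    then show ?thesis by linarith
  qed
  then show ?thesis by blast
qed

text \<open>A fixed bound for the distance between the levels of a brushlet and of a
  Littlewood--Paley piece whose spectra meet. Fixing one witness lets \<open>active\<close>,
  \<open>energy\<close> and the constants refer to it.\<close>

definition overlap :: nat where
  "overlap = (SOME K. \<forall>k \<xi> i. (\<forall>i. k $ i \<in> labels) \<longrightarrow> (\<exists>l. k $ l = 2 \<or> k $ l = -2) \<longrightarrow> \<xi> \<in> box_of k \<longrightarrow>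
    phi_hat i \<xi> \<noteq> 0 \<longrightarrow> \<bar>i\<bar> \<le> int K)"

lemma overlap:
  assumes "\<And>i. k $ i \<in> labels" "k $ l = 2 \<or> k $ l = -2" "\<xi> \<in> box_of k" "phi_hat i \<xi> \<noteq> 0"
  shows "\<bar>i\<bar> \<le> int overlap"
  using someI_ex[OF overlap_bound] assms unfolding overlap_def[symmetric] by blast

text \<open>Rescaling by the level of \<mu> leaves only the difference of the two levels, to which
  \<open>overlap\<close> applies.\<close>

lemma hat_phi_hat_zero:
  assumes \<mu>: "\<mu> \<in> brushlet_indices" and i: "int overlap < \<bar>i - level \<mu>\<bar>"
  shows "complex_of_real (hat \<mu> \<xi>) * phi_hat i \<xi> = 0"
proof (rule ccontr)
  assume nz: "complex_of_real (hat \<mu> \<xi>) * phi_hat i \<xi> \<noteq> 0"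
  obtain n j k where \<mu>eq: "\<mu> = (n, j, k)" by (cases \<mu>)
  obtain l where l: "k $ l = 2 \<or> k $ l = -2" using indices_outer[OF \<mu>] by (auto simp: \<mu>eq)
  have k: "k $ i \<in> labels" for i using indices_labels[OF \<mu>, of i] by (simp add: \<mu>eq)
  have "hat \<mu> \<xi> = 2 powr (- (real_of_int j * \<nu>) / 2) * hat (n, 0, k) (D (- j) \<xi>)"
    unfolding \<mu>eq by (rule hat_scale')
  then have "complex_of_real (hat (n, 0, k) (D (- j) \<xi>)) \<noteq> 0" using nz by auto
  then have "base k (D (- j) \<xi>) \<noteq> 0" unfolding hat_level_0[of n k _ j] by simp
  then have "D (- j) \<xi> \<in> box_of k" using base_support by blast
  moreover have "phi_hat (i - j) (D (- j) \<xi>) \<noteq> 0" using nz unfolding D_D by simp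
  ultimately have "\<bar>i - j\<bar> \<le> int overlap" by (rule overlap[OF k l])
  then show False using i by (simp add: \<mu>eq)
qed

section \<open>Pointwise bounds for brushlets\<close>

lemma inverse_fourier_D:
  "inverse_fourier u x = complex_of_real (2 powr (real_of_int j * \<nu>)) * inverse_fourier (\<lambda>\<xi>. u (D j \<xi>)) (D j x)"
proof -
  have "(LINT \<xi>|lborel. u \<xi> * exp (\<i> * complex_of_real (x \<bullet> \<xi>)))
    = (\<Prod>i\<in>UNIV. \<bar>scl a j i\<bar>) *\<^sub>R (LINT \<xi>|lborel. u (0 + D j \<xi>) * exp (\<i> * complex_of_real (x \<bullet> (0 + D j \<xi>))))"
    by (rule integral_affine_vec) simp
  also have "(\<Prod>i\<in>UNIV. \<bar>scl a j i\<bar>) = 2 powr (real_of_int j * \<nu>)"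
    using prod_scl[of a j] by simp
  finally show ?thesis by (simp add: inverse_fourier_def inner_diag_mult scaleR_conv_of_real mult.left_commute)
qed

lemma node_nonneg: "\<mu> \<in> brushlet_indices \<Longrightarrow> 0 \<le> node a \<mu> i"
proof -
  assume "\<mu> \<in> brushlet_indices"
  then have "left_end (a $ i) 0 (snd (snd \<mu>) $ i) < right_end (a $ i) 0 (snd (snd \<mu>) $ i)"
    using a by (intro level_parameters_valid(1) indices_labels) auto
  then show ?thesis by (simp add: node_def)
qed

text \<open>The constant is uniform in the frequency index: the cosines merely translate the kernel
  of \<open>u\<close> to the centres, and the offsets \<open>\<alpha>\<close> merely change
  phases.\<close>

lemma modulated_decay:
  assumes u: "\<And>n. Ck n UNIV u" "\<And>x. R < norm x \<Longrightarrow> u x = 0" and A: "0 \<le> A"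
  shows "\<exists>C\<ge>0. \<forall>n j k x. (n, j, k) \<in> brushlet_indices \<longrightarrow>
    norm (inverse_fourier (\<lambda>\<xi>. u \<xi> * complex_of_real (\<Prod>i\<in>UNIV. cos (node a (n, j, k) i * (\<xi> $ i - \<alpha> i)))) x) \<le> C * weight a A (n, 0, k) x"
proof -
  obtain C where C: "0 \<le> C" "\<And>x. norm (inverse_fourier u x) \<le> C * decay A x"
    using inverse_fourier_decay[OF u A] by blast
  have int: "integrable lborel u" by (rule compact_support_integrable[OF Ck_continuous_on[OF u(1)] u(2)])
  have "norm (inverse_fourier (\<lambda>\<xi>. u \<xi> * complex_of_real (\<Prod>i\<in>UNIV. cos (node a (n, j, k) i * (\<xi> $ i - \<alpha> i)))) x) \<le> C * weight a A (n, 0, k) x"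
    if "(n, j, k) \<in> brushlet_indices" for n j k x
  proof -
    have "norm (inverse_fourier (\<lambda>\<xi>. u \<xi> * complex_of_real (\<Prod>i\<in>UNIV. cos (node a (n, j, k) i * (\<xi> $ i - \<alpha> i)))) x)
      \<le> C * (\<Prod>i\<in>UNIV. (1 + \<bar>if i \<in> UNIV then \<bar>x $ i\<bar> - node a (n, j, k) i else x $ i\<bar>) powr (- A))"
      by (rule inverse_fourier_cos_decay[OF int C A node_nonneg[OF that]])
    then show ?thesis by (simp add: weight_def node_def)
  qed
  then show ?thesis using C(1) by blast
qed

lemma brushlet_bound:
  assumes A: "0 \<le> A"
  shows "\<exists>C\<ge>0. \<forall>\<mu>\<in>brushlet_indices. \<forall>x. norm (w \<mu> x) \<le> C * 2 powr (real_of_int (level \<mu>) * \<nu> / 2) * weight a A \<mu> x"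
proof -
  \<comment> \<open>Frequency index and point are bundled into one argument so that
    \<open>finite_uniform_bound\<close> yields a constant for all labels. Triples that are not
    brushlet indices receive the value 0.\<close>
  have ex: "\<exists>C\<ge>0. \<forall>y. (case y of (n, x) \<Rightarrow> if (n, 0, k) \<in> brushlet_indices then norm (w (n, 0, k) x) else 0) \<le> C * (case y of (n, x) \<Rightarrow> weight a A (n, 0, k) x)"
    if "k \<in> {k. \<forall>i. k $ i \<in> labels}" for k :: "(int, 'd) vec"
  proof -
    have k: "k $ i \<in> labels" for i using that by simp
    obtain C where C: "0 \<le> C" "\<forall>n j k' x. (n, j, k') \<in> brushlet_indices \<longrightarrow>
      norm (inverse_fourier (\<lambda>\<xi>. base k \<xi> * complex_of_real (\<Prod>i\<in>UNIV. cos (node a (n, j, k') i * (\<xi> $ i - left_end (a $ i) 0 (k $ i))))) x) \<le> C * weight a A (n, 0, k') x"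
      using modulated_decay[OF base_Ck base_compact_support[OF k] A, where \<alpha>="\<lambda>i. left_end (a $ i) 0 (k $ i)"] by blast
    have "norm (w (n, 0, k) x) \<le> C * weight a A (n, 0, k) x" if "(n, 0, k) \<in> brushlet_indices" for n x
      using C(2) that unfolding brushlet_eq hat_level_0[of n k _ 0] by blast
    note b = this
    show ?thesis
    proof (intro exI conjI allI)
      fix y :: "(nat, 'd) vec \<times> 'd rvec"
      obtain n x where y: "y = (n, x)" by (cases y)
      show "(case y of (n, x) \<Rightarrow> if (n, 0, k) \<in> brushlet_indices then norm (w (n, 0, k) x) else 0) \<le> C * (case y of (n, x) \<Rightarrow> weight a A (n, 0, k) x)"
        using b[of n x] mult_nonneg_nonneg[OF C(1) weight_nonneg[of a A "(n, 0, k)" x]]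
        by (cases "(n, 0, k) \<in> brushlet_indices") (simp_all add: y)
    qed (rule C(1))
  qed
  have nn: "0 \<le> (case y of (n, x) \<Rightarrow> weight a A (n, 0, k) x)" for k :: "(int, 'd) vec" and y
    by (cases y) simp
  have "\<exists>C\<ge>0. \<forall>k\<in>{k. \<forall>i. k $ i \<in> labels}. \<forall>y. (case y of (n, x) \<Rightarrow> if (n, 0, k) \<in> brushlet_indices then norm (w (n, 0, k) x) else 0) \<le> C * (case y of (n, x) \<Rightarrow> weight a A (n, 0, k) x)"
    by (rule finite_uniform_bound[OF finite_labels ex nn])
  then obtain C where C: "0 \<le> C" "\<forall>k\<in>{k. \<forall>i. k $ i \<in> labels}. \<forall>y. (case y of (n, x) \<Rightarrow> if (n, 0, k) \<in> brushlet_indices then norm (w (n, 0, k) x) else 0) \<le> C * (case y of (n, x) \<Rightarrow> weight a A (n, 0, k) x)"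
    by blast
  have "norm (w (n, j, k) x) \<le> C * 2 powr (real_of_int j * \<nu> / 2) * weight a A (n, j, k) x" if \<mu>: "(n, j, k) \<in> brushlet_indices" for n j k x
  proof -
    have \<mu>0: "(n, 0, k) \<in> brushlet_indices" using \<mu> by (auto simp: brushlet_indices_def)
    have k: "k \<in> {k. \<forall>i. k $ i \<in> labels}" using indices_labels[OF \<mu>] by simp
    have b: "norm (w (n, 0, k) y) \<le> C * weight a A (n, 0, k) y" for y
      using bspec[OF C(2) k, THEN spec, of "(n, y)"] \<mu>0 by simp
    have "w (n, j, k) x = complex_of_real (2 powr (real_of_int j * \<nu>)) * (complex_of_real (2 powr (- (real_of_int j * \<nu>) / 2)) * w (n, 0, k) (D j x))"
    proof -
      have "inverse_fourier (\<lambda>\<xi>. complex_of_real (hat (n, j, k) (D j \<xi>))) y = complex_of_real (2 powr (- (real_of_int j * \<nu>) / 2)) * inverse_fourier (\<lambda>\<xi>. complex_of_real (hat (n, 0, k) \<xi>)) y" for y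
        unfolding hat_scale inverse_fourier_def of_real_mult mult.assoc integral_mult_right_zero by (simp only: mult.left_commute)
      then show ?thesis unfolding brushlet_eq by (subst inverse_fourier_D[of _ x j]) simp
    qed
    also have "\<dots> = complex_of_real (2 powr (real_of_int j * \<nu> / 2)) * w (n, 0, k) (D j x)"
      unfolding mult.assoc[symmetric] of_real_mult[symmetric] powr_add[symmetric] by (simp add: field_simps)
    finally have "norm (w (n, j, k) x) = 2 powr (real_of_int j * \<nu> / 2) * norm (w (n, 0, k) (D j x))"
      by (simp add: norm_mult)
    also have "\<dots> \<le> 2 powr (real_of_int j * \<nu> / 2) * (C * weight a A (n, 0, k) (D j x))"
      by (intro mult_left_mono b) simp
    also have "weight a A (n, 0, k) (D j x) = weight a A (n, j, k) x"
      by (simp add: weight_def node_def abs_mult)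
    finally show ?thesis by (simp add: mult_ac)
  qed
  then show ?thesis using C(1) by (intro exI[of _ C]) auto
qed

end

section \<open>Littlewood--Paley pieces of brushlet sums\<close>

lemma measurable_inverse_fourier:
  fixes u :: "'d::finite rvec \<Rightarrow> complex"
  assumes [measurable]: "u \<in> borel_measurable borel"
  shows "inverse_fourier u \<in> borel_measurable borel"
  unfolding inverse_fourier_def[abs_def] by measurable

lemma rapid_decay:
  fixes u :: "'d::finite rvec \<Rightarrow> complex"
  assumes "rapid u" "0 \<le> A"
  shows "\<exists>C\<ge>0. \<forall>x. norm (u x) \<le> C * decay A x"
proof -
  define n where "n = nat \<lceil>A * real CARD('d)\<rceil>"
  have n: "A * real CARD('d) \<le> real n" unfolding n_def by linarith
  obtain C where C: "\<And>x. (1 + norm x) ^ n * norm (u x) \<le> C" using assms(1) unfolding rapid_def by blast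
  have "0 \<le> (1 + norm (0::'d rvec)) ^ n * norm (u 0)" by simp
  then have C0: "0 \<le> C" using C[of 0] by linarith
  have "norm (u x) \<le> C * decay A x" for x
  proof -
    have "(\<Prod>k\<in>UNIV. (1 + \<bar>x $ k\<bar>) powr A) \<le> (\<Prod>k\<in>(UNIV::'d set). (1 + norm x) powr A)"
      using component_le_norm_cart[of x] assms(2) by (intro prod_mono conjI powr_mono2) auto
    also have "\<dots> = (1 + norm x) powr (A * real CARD('d))"
      using add_pos_nonneg[OF zero_less_one norm_ge_zero[of x]] by (simp add: powr_realpow[symmetric] powr_powr)
    also have "\<dots> \<le> (1 + norm x) powr real n" using n by (intro powr_mono) auto
    also have "\<dots> = (1 + norm x) ^ n" by (intro powr_realpow) (simp add: add_pos_nonneg)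
    finally have "(\<Prod>k\<in>UNIV. (1 + \<bar>x $ k\<bar>) powr A) * norm (u x) \<le> (1 + norm x) ^ n * norm (u x)"
      by (rule mult_right_mono) simp
    also have "\<dots> \<le> C" by (rule C)
    finally have "norm (u x) * (\<Prod>k\<in>UNIV. (1 + \<bar>x $ k\<bar>) powr A) \<le> C" by (simp only: mult.commute)
    moreover have "0 < (\<Prod>k\<in>UNIV. (1 + \<bar>x $ k\<bar>) powr A)" by (intro prod_pos) (simp add: add_pos_nonneg)
    ultimately have "norm (u x) \<le> C / (\<Prod>k\<in>UNIV. (1 + \<bar>x $ k\<bar>) powr A)" by (simp add: pos_le_divide_eq)
    also have "\<dots> = C * decay A x" by (simp add: powr_minus divide_inverse prod_inversef[symmetric] comp_def)
    finally show ?thesis .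
  qed
  then show ?thesis using C0 by blast
qed

lemma inverse_fourier_sum:
  fixes u :: "'b \<Rightarrow> 'd::finite rvec \<Rightarrow> complex"
  assumes "\<And>\<mu>. \<mu> \<in> \<Gamma> \<Longrightarrow> integrable lborel (u \<mu>)"
  shows "inverse_fourier (\<lambda>\<xi>. \<Sum>\<mu>\<in>\<Gamma>. c \<mu> * u \<mu> \<xi>) x = (\<Sum>\<mu>\<in>\<Gamma>. c \<mu> * inverse_fourier (u \<mu>) x)"
proof -
  have "(LINT \<xi>|lborel. (\<Sum>\<mu>\<in>\<Gamma>. c \<mu> * u \<mu> \<xi>) * exp (\<i> * complex_of_real (x \<bullet> \<xi>)))
    = (LINT \<xi>|lborel. (\<Sum>\<mu>\<in>\<Gamma>. c \<mu> * (u \<mu> \<xi> * exp (\<i> * complex_of_real (x \<bullet> \<xi>)))))"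
    by (simp only: sum_distrib_right mult.assoc)
  also have "\<dots> = (\<Sum>\<mu>\<in>\<Gamma>. (LINT \<xi>|lborel. c \<mu> * (u \<mu> \<xi> * exp (\<i> * complex_of_real (x \<bullet> \<xi>)))))"
    by (rule Bochner_Integration.integral_sum) (intro integrable_mult_right integrable_mult_exp assms)
  also have "\<dots> = (\<Sum>\<mu>\<in>\<Gamma>. c \<mu> * (LINT \<xi>|lborel. u \<mu> \<xi> * exp (\<i> * complex_of_real (x \<bullet> \<xi>))))"
    by (simp only: integral_mult_right_zero)
  finally show ?thesis by (simp only: inverse_fourier_def sum_distrib_left mult.left_commute)
qed

lemma fourier_bounded:
  fixes u :: "'d::finite rvec \<Rightarrow> complex"
  assumes "integrable lborel u"
  shows "norm (fourier u \<xi>) \<le> norm (fourier_const TYPE('d)) * (LINT x|lborel. norm (u x))"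
proof -
  have "norm (LINT x|lborel. u x * exp (- (\<i> * complex_of_real (x \<bullet> \<xi>)))) \<le> (LINT x|lborel. norm (u x))"
    using assms by (intro norm_integral_le integrable_mult_exp) (auto simp: norm_mult)
  then have "norm (fourier_const TYPE('d)) * norm (LINT x|lborel. u x * exp (- (\<i> * complex_of_real (x \<bullet> \<xi>))))
    \<le> norm (fourier_const TYPE('d)) * (LINT x|lborel. norm (u x))"
    by (rule mult_left_mono) simp
  then show ?thesis by (simp only: fourier_def norm_mult DIM_cart DIM_real mult_1_right)
qed

context brushlet_system
begin

definition piece :: "int \<Rightarrow> ('d rvec \<Rightarrow> complex) \<Rightarrow> 'd rvec \<Rightarrow> complex" where
  "piece i g x = convolve (level_fun a \<phi> i) (dist_of g) x"

lemma piece_eq: "piece i g x = (LINT z|lborel. \<phi> z * g (x - D (- i) z))"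
  unfolding piece_def by (rule convolve_level_fun)

lemma phi_hat_continuous: "continuous_on UNIV (phi_hat i)"
proof -
  have c: "continuous_on UNIV (fourier \<phi>)" using fourier_Ck[OF phi_rapid, of 0] by simp
  have d: "continuous_on UNIV (D (- i))" by (intro continuous_intros)
  show ?thesis using continuous_on_compose2[OF c d] by simp
qed

lemma integrable_phi_hat:
  assumes "integrable lborel H" shows "integrable lborel (\<lambda>\<xi>. H \<xi> * phi_hat i \<xi>)"
proof (rule Bochner_Integration.integrable_bound)
  let ?B = "norm (fourier_const TYPE('d)) * (LINT x|lborel. norm (\<phi> x))"
  have B: "norm (phi_hat i \<xi>) \<le> ?B" for \<xi> by (rule fourier_bounded[OF phi_integrable])
  show "integrable lborel (\<lambda>\<xi>. complex_of_real ?B * H \<xi>)" using assms by (intro integrable_mult_right)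
  have [measurable]: "H \<in> borel_measurable borel" using assms by auto
  have [measurable]: "phi_hat i \<in> borel_measurable borel" by (rule borel_measurable_continuous_onI[OF phi_hat_continuous])
  show "(\<lambda>\<xi>. H \<xi> * phi_hat i \<xi>) \<in> borel_measurable lborel" by measurable
  show "AE \<xi> in lborel. norm (H \<xi> * phi_hat i \<xi>) \<le> norm (complex_of_real ?B * H \<xi>)"
  proof (rule AE_I2)
    fix \<xi>
    have "norm (H \<xi> * phi_hat i \<xi>) \<le> norm (H \<xi>) * ?B" unfolding norm_mult by (rule mult_left_mono[OF B]) simp
    also have "\<dots> \<le> norm (complex_of_real ?B * H \<xi>)"
      unfolding norm_mult norm_of_real by (simp only: mult.commute[of "norm (H \<xi>)"]) (rule mult_right_mono, simp_all)
    finally show "norm (H \<xi> * phi_hat i \<xi>) \<le> norm (complex_of_real ?B * H \<xi>)" .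
  qed
qed

lemma piece_fourier:
  assumes "integrable lborel H"
  shows "inverse_fourier (\<lambda>\<xi>. H \<xi> * phi_hat i \<xi>) x = fourier_const TYPE('d) * piece i (inverse_fourier H) x"
  unfolding piece_eq by (rule inverse_fourier_mult_fourier[OF assms phi_integrable])

definition comb :: "('d brushlet_index \<Rightarrow> complex) \<Rightarrow> 'd brushlet_index set \<Rightarrow> 'd rvec \<Rightarrow> complex" where
  "comb c \<Gamma> x = (\<Sum>\<mu>\<in>\<Gamma>. c \<mu> * w \<mu> x)"

definition comb_hat :: "('d brushlet_index \<Rightarrow> complex) \<Rightarrow> 'd brushlet_index set \<Rightarrow> 'd rvec \<Rightarrow> complex" where
  "comb_hat c \<Gamma> \<xi> = (\<Sum>\<mu>\<in>\<Gamma>. c \<mu> * complex_of_real (hat \<mu> \<xi>))"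

lemma comb_eq: "comb c \<Gamma> = inverse_fourier (comb_hat c \<Gamma>)"
proof
  fix x
  show "comb c \<Gamma> x = inverse_fourier (comb_hat c \<Gamma>) x"
    unfolding comb_def comb_hat_def[abs_def] brushlet_eq by (rule inverse_fourier_sum[OF hat_integrable, symmetric])
qed

lemma comb_hat_integrable: "integrable lborel (comb_hat c \<Gamma>)"
  unfolding comb_hat_def[abs_def] by (intro Bochner_Integration.integrable_sum integrable_mult_right hat_integrable)

text \<open>Linearity is read off on the frequency side, where each term is known to be integrable;
  the nonzero Fourier constant is then cancelled.\<close>

lemma piece_comb: "piece i (comb c \<Gamma>) x = (\<Sum>\<mu>\<in>\<Gamma>. c \<mu> * piece i (w \<mu>) x)"
proof -
  have "fourier_const TYPE('d) * piece i (comb c \<Gamma>) x = inverse_fourier (\<lambda>\<xi>. comb_hat c \<Gamma> \<xi> * phi_hat i \<xi>) x"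
    unfolding comb_eq by (rule piece_fourier[OF comb_hat_integrable, symmetric])
  also have "\<dots> = inverse_fourier (\<lambda>\<xi>. \<Sum>\<mu>\<in>\<Gamma>. c \<mu> * (complex_of_real (hat \<mu> \<xi>) * phi_hat i \<xi>)) x"
    by (simp only: comb_hat_def sum_distrib_right mult.assoc)
  also have "\<dots> = (\<Sum>\<mu>\<in>\<Gamma>. c \<mu> * inverse_fourier (\<lambda>\<xi>. complex_of_real (hat \<mu> \<xi>) * phi_hat i \<xi>) x)"
    by (rule inverse_fourier_sum[OF integrable_phi_hat[OF hat_integrable]])
  also have "\<dots> = (\<Sum>\<mu>\<in>\<Gamma>. c \<mu> * (fourier_const TYPE('d) * piece i (w \<mu>) x))"
    unfolding brushlet_eq piece_fourier[OF hat_integrable] ..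
  also have "\<dots> = fourier_const TYPE('d) * (\<Sum>\<mu>\<in>\<Gamma>. c \<mu> * piece i (w \<mu>) x)"
    by (simp only: sum_distrib_left mult.left_commute)
  finally show ?thesis by simp
qed

lemma piece_zero:
  assumes "\<mu> \<in> brushlet_indices" "int overlap < \<bar>i - level \<mu>\<bar>"
  shows "piece i (w \<mu>) x = 0"
proof -
  have "fourier_const TYPE('d) * piece i (w \<mu>) x = inverse_fourier (\<lambda>\<xi>. complex_of_real (hat \<mu> \<xi>) * phi_hat i \<xi>) x"
    unfolding brushlet_eq by (rule piece_fourier[OF hat_integrable, symmetric])
  also have "\<dots> = 0" unfolding hat_phi_hat_zero[OF assms] by (simp add: inverse_fourier_def)
  finally show ?thesis by simp
qed

text \<open>The price of exchanging two levels at distance at most \<open>overlap\<close> in a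
  polynomial of order \<open>A\<close>: each of the coordinates contributes at most the factor
  \<open>2 powr (overlap * \<nu>)\<close>, raised to the power \<open>A\<close>.\<close>

definition spread :: "real \<Rightarrow> real" where
  "spread A = (2 powr (real overlap * \<nu>)) powr (A * real CARD('d))"

lemma spread_nonneg: "0 \<le> spread A" by (simp add: spread_def)

lemma spread_bound:
  assumes A: "0 \<le> A" and ij: "\<bar>i - j\<bar> \<le> int overlap"
  shows "(\<Prod>l\<in>UNIV. (1 + scl a j l * \<bar>D (- i) z $ l\<bar>) powr A) \<le> spread A * (\<Prod>l\<in>UNIV. (1 + \<bar>z $ l\<bar>) powr A)"
proof -
  let ?M = "2 powr (real overlap * \<nu>)"
  have a0: "0 \<le> a $ l" for l using a order_trans[OF zero_le_one] by blast
  have \<nu>: "a $ l \<le> \<nu>" for l unfolding aniso_dim_def using a0 by (intro member_le_sum) auto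
  have \<nu>0: "0 \<le> \<nu>" unfolding aniso_dim_def by (intro sum_nonneg a0)
  have "0 \<le> real overlap * \<nu>" using \<nu>0 by simp
  then have M1: "1 \<le> ?M" using powr_mono[of 0 "real overlap * \<nu>" 2] by simp
  have each: "(1 + scl a j l * \<bar>D (- i) z $ l\<bar>) powr A \<le> ?M powr A * (1 + \<bar>z $ l\<bar>) powr A" for l
  proof -
    have "real_of_int (j - i) \<le> real overlap" using ij by linarith
    then have "real_of_int (j - i) * a $ l \<le> real overlap * a $ l" using a0 by (rule mult_right_mono)
    also have "\<dots> \<le> real overlap * \<nu>" using \<nu> by (intro mult_left_mono) auto
    finally have s: "scl a (j - i) l \<le> ?M" unfolding scl_def by (intro powr_mono) auto
    have "scl a j l * \<bar>D (- i) z $ l\<bar> = scl a (j - i) l * \<bar>z $ l\<bar>"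
      using scl_add[of a j "- i" l] by (simp add: abs_mult)
    also have "1 + \<dots> \<le> ?M * (1 + \<bar>z $ l\<bar>)"
      using mult_right_mono[OF s abs_ge_zero[of "z $ l"]] M1 by (simp add: distrib_left)
    finally have "(1 + scl a j l * \<bar>D (- i) z $ l\<bar>) powr A \<le> (?M * (1 + \<bar>z $ l\<bar>)) powr A"
      using A by (intro powr_mono2) (auto intro: add_nonneg_nonneg mult_nonneg_nonneg)
    then show ?thesis by (simp add: powr_mult)
  qed
  have "(\<Prod>l\<in>UNIV. (1 + scl a j l * \<bar>D (- i) z $ l\<bar>) powr A) \<le> (\<Prod>l\<in>UNIV. ?M powr A * (1 + \<bar>z $ l\<bar>) powr A)"
    using each by (intro prod_mono conjI) auto
  also have "\<dots> = spread A * (\<Prod>l\<in>UNIV. (1 + \<bar>z $ l\<bar>) powr A)"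
    by (simp add: spread_def prod.distrib powr_powr powr_realpow[symmetric] mult_ac)
  finally show ?thesis .
qed

lemma decay_mult: "decay (A + B) z * (\<Prod>l\<in>UNIV. (1 + \<bar>z $ l\<bar>) powr A) = decay B (z :: 'd rvec)"
  unfolding prod.distrib[symmetric] by (intro prod.cong refl) (simp add: powr_add[symmetric])

lemma piece_bound:
  assumes A: "0 \<le> A"
  shows "\<exists>C\<ge>0. \<forall>\<mu>\<in>brushlet_indices. \<forall>i x. norm (piece i (w \<mu>) x)
    \<le> (if \<bar>i - level \<mu>\<bar> \<le> int overlap then C * 2 powr (real_of_int (level \<mu>) * \<nu> / 2) * weight a A \<mu> x else 0)"
proof -
  \<comment> \<open>Of the decay order \<open>A + 2\<close>, the part \<open>A\<close> pays for
    translating the weight and the part 2 leaves an integrable kernel.\<close>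
  obtain Cp where Cp: "0 \<le> Cp" "\<And>z. norm (\<phi> z) \<le> Cp * decay (A + 2) z"
    using rapid_decay[OF phi_rapid, of "A + 2"] A by auto
  obtain Cw where Cw: "0 \<le> Cw" "\<And>\<mu> x. \<mu> \<in> brushlet_indices \<Longrightarrow> norm (w \<mu> x) \<le> Cw * 2 powr (real_of_int (level \<mu>) * \<nu> / 2) * weight a A \<mu> x"
    using brushlet_bound[OF A] by blast
  let ?I = "LINT z|lborel. decay 2 (z :: 'd rvec)"
  define C where "C = Cp * Cw * spread A * ?I"
  have I0: "0 \<le> ?I" by (intro integral_nonneg_AE AE_I2 prod_nonneg) auto
  then have C0: "0 \<le> C" using Cp Cw spread_nonneg by (simp add: C_def)
  have "norm (piece i (w \<mu>) x) \<le> C * 2 powr (real_of_int (level \<mu>) * \<nu> / 2) * weight a A \<mu> x"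
    if \<mu>: "\<mu> \<in> brushlet_indices" and ij: "\<bar>i - level \<mu>\<bar> \<le> int overlap" for \<mu> i x
  proof -
    let ?T = "2 powr (real_of_int (level \<mu>) * \<nu> / 2)"
    let ?c = "Cp * Cw * spread A * ?T * weight a A \<mu> x"
    have c0: "0 \<le> ?c" using Cp Cw spread_nonneg by simp
    have b: "norm (\<phi> z * w \<mu> (x - D (- i) z)) \<le> ?c * decay 2 z" for z
    proof -
      have "norm (w \<mu> (x - D (- i) z)) \<le> Cw * ?T * weight a A \<mu> (x - D (- i) z)" by (rule Cw(2)[OF \<mu>])
      also have "\<dots> \<le> Cw * ?T * (weight a A \<mu> x * (spread A * (\<Prod>l\<in>UNIV. (1 + \<bar>z $ l\<bar>) powr A)))"
      proof (rule mult_left_mono)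
        show "weight a A \<mu> (x - D (- i) z) \<le> weight a A \<mu> x * (spread A * (\<Prod>l\<in>UNIV. (1 + \<bar>z $ l\<bar>) powr A))"
          using weight_shift[OF A, of a \<mu> x "D (- i) z"] mult_left_mono[OF spread_bound[OF A ij, of z] weight_nonneg[of a A \<mu> x]]
          by linarith
      qed (use Cw in simp)
      finally have "norm (\<phi> z) * norm (w \<mu> (x - D (- i) z)) \<le> (Cp * decay (A + 2) z) * (Cw * ?T * (weight a A \<mu> x * (spread A * (\<Prod>l\<in>UNIV. (1 + \<bar>z $ l\<bar>) powr A))))"
        using Cp by (intro mult_mono) (auto intro!: mult_nonneg_nonneg prod_nonneg)
      also have "\<dots> = ?c * (decay (A + 2) z * (\<Prod>l\<in>UNIV. (1 + \<bar>z $ l\<bar>) powr A))"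
        by (simp only: mult_ac)
      also have "decay (A + 2) z * (\<Prod>l\<in>UNIV. (1 + \<bar>z $ l\<bar>) powr A) = decay 2 z" by (rule decay_mult)
      finally show ?thesis by (simp only: norm_mult)
    qed
    have [measurable]: "w \<mu> \<in> borel_measurable borel"
      unfolding brushlet_eq using hat_integrable[of \<mu>] by (intro measurable_inverse_fourier) auto
    have [measurable]: "\<phi> \<in> borel_measurable borel" by (rule rapid_measurable[OF phi_rapid])
    have int2: "integrable lborel (\<lambda>z::'d rvec. ?c * decay 2 z)"
      by (rule integrable_mult_right[OF integrable_decay]) simp
    have "norm (piece i (w \<mu>) x) \<le> (LINT z|lborel. ?c * decay 2 (z :: 'd rvec))"
      unfolding piece_eq
    proof (rule norm_integral_le[OF _ int2 b])
      show "integrable lborel (\<lambda>z. \<phi> z * w \<mu> (x - D (- i) z))"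
      proof (rule Bochner_Integration.integrable_bound[OF int2])
        have "(\<lambda>z. x - D (- i) z) \<in> borel_measurable borel"
          by (intro borel_measurable_continuous_onI continuous_intros)
        then have "(\<lambda>z. w \<mu> (x - D (- i) z)) \<in> borel_measurable borel"
          by (rule measurable_compose) measurable
        then show "(\<lambda>z. \<phi> z * w \<mu> (x - D (- i) z)) \<in> borel_measurable lborel" by measurable
        show "AE z in lborel. norm (\<phi> z * w \<mu> (x - D (- i) z)) \<le> norm (?c * decay 2 z)"
        proof (rule AE_I2)
          fix z
          show "norm (\<phi> z * w \<mu> (x - D (- i) z)) \<le> norm (?c * decay 2 z)"
            unfolding real_norm_def by (rule order_trans[OF b abs_ge_self])
        qed
      qed
    qed
    also have "\<dots> = ?c * ?I" by (rule integral_mult_right_zero)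
    finally show ?thesis by (simp only: C_def mult_ac)
  qed
  then show ?thesis using piece_zero C0 by (intro exI[of _ C]) auto
qed

section \<open>The square function of a brushlet sum\<close>

definition sqfun :: "real \<Rightarrow> real \<Rightarrow> ('d rvec \<Rightarrow> complex) \<Rightarrow> 'd rvec \<Rightarrow> ennreal" where
  "sqfun q \<beta> g x = ennpow (\<Sum>\<^sub>\<infinity>i\<in>(UNIV :: int set).
     ennpow (ennreal (2 powr (\<beta> * real_of_int i) * norm (piece i g x))) q) (1 / q)"

lemma TL_norm_rep_sqfun: "TL_norm_rep a p q \<beta> \<phi> (dist_of g) = mixed_norm p (sqfun q \<beta> g)"
  by (simp add: TL_norm_rep_def sqfun_def[abs_def] piece_def)

text \<open>Outside these finitely many levels all pieces vanish, which turns the sum over the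
  integers in \<open>sqfun\<close> into a finite one.\<close>

definition active :: "'d brushlet_index set \<Rightarrow> int set" where
  "active \<Gamma> = (\<Union>\<mu>\<in>\<Gamma>. {level \<mu> - int overlap..level \<mu> + int overlap})"

lemma finite_active: "finite \<Gamma> \<Longrightarrow> finite (active \<Gamma>)" by (simp add: active_def)

lemma piece_inactive:
  assumes "\<Gamma> \<subseteq> brushlet_indices" "i \<notin> active \<Gamma>"
  shows "piece i (comb c \<Gamma>) x = 0"
  unfolding piece_comb
proof (rule sum.neutral, rule ballI)
  fix \<mu> assume \<mu>: "\<mu> \<in> \<Gamma>"
  then have "int overlap < \<bar>i - level \<mu>\<bar>" using assms(2) by (auto simp: active_def)
  then show "c \<mu> * piece i (w \<mu>) x = 0" using piece_zero[of \<mu> i x] \<mu> assms(1) by auto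
qed

lemma sqfun_comb:
  assumes "\<Gamma> \<subseteq> brushlet_indices" "finite \<Gamma>" "0 < q"
  shows "sqfun q \<beta> (comb c \<Gamma>) x = ennreal ((\<Sum>i\<in>active \<Gamma>. (2 powr (\<beta> * real_of_int i) * norm (piece i (comb c \<Gamma>) x)) powr q) powr (1 / q))"
proof -
  let ?u = "\<lambda>i. 2 powr (\<beta> * real_of_int i) * norm (piece i (comb c \<Gamma>) x)"
  have "(\<Sum>\<^sub>\<infinity>i\<in>(UNIV :: int set). ennpow (ennreal (?u i)) q) = (\<Sum>\<^sub>\<infinity>i\<in>active \<Gamma>. ennpow (ennreal (?u i)) q)"
  proof (rule infsum_cong_neutral)
    fix i assume "i \<in> UNIV - active \<Gamma>"
    then have "piece i (comb c \<Gamma>) x = 0" using piece_inactive[OF assms(1)] by simp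
    then show "ennpow (ennreal (?u i)) q = 0" by simp
  qed auto
  also have "\<dots> = (\<Sum>i\<in>active \<Gamma>. ennpow (ennreal (?u i)) q)" by (rule infsum_finite[OF finite_active[OF assms(2)]])
  also have "\<dots> = (\<Sum>i\<in>active \<Gamma>. ennreal (?u i powr q))" by (intro sum.cong refl ennpow_ennreal assms(3)) simp
  also have "\<dots> = ennreal (\<Sum>i\<in>active \<Gamma>. ?u i powr q)" by (rule sum_ennreal) simp
  finally show ?thesis unfolding sqfun_def using assms(3) by (simp add: ennpow_ennreal sum_nonneg)
qed

lemma piece_le_sqfun:
  assumes "\<Gamma> \<subseteq> brushlet_indices" "finite \<Gamma>" "0 < q"
  shows "ennreal (2 powr (\<beta> * real_of_int i) * norm (piece i (comb c \<Gamma>) x)) \<le> sqfun q \<beta> (comb c \<Gamma>) x"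
proof (cases "i \<in> active \<Gamma>")
  case True
  let ?u = "\<lambda>i. 2 powr (\<beta> * real_of_int i) * norm (piece i (comb c \<Gamma>) x)"
  have "?u i powr q \<le> (\<Sum>i\<in>active \<Gamma>. ?u i powr q)"
    using True finite_active[OF assms(2)] by (intro member_le_sum) auto
  then have "(?u i powr q) powr (1 / q) \<le> (\<Sum>i\<in>active \<Gamma>. ?u i powr q) powr (1 / q)"
    using assms(3) by (intro powr_mono2) auto
  then have "?u i \<le> (\<Sum>i\<in>active \<Gamma>. ?u i powr q) powr (1 / q)"
    using assms(3) by (simp only: powr_powr) simp
  then show ?thesis unfolding sqfun_comb[OF assms] by (rule ennreal_leI)
next
  case False
  then show ?thesis using piece_inactive[OF assms(1)] by simp
qed

lemma measurable_comb: "comb c \<Gamma> \<in> borel_measurable borel"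
  unfolding comb_eq using comb_hat_integrable[of c \<Gamma>] by (intro measurable_inverse_fourier) auto

lemma measurable_piece: "piece i (comb c \<Gamma>) \<in> borel_measurable borel"
proof -
  have "piece i (comb c \<Gamma>) x = inverse (fourier_const TYPE('d)) * inverse_fourier (\<lambda>\<xi>. comb_hat c \<Gamma> \<xi> * phi_hat i \<xi>) x" for x
    unfolding comb_eq piece_fourier[OF comb_hat_integrable] by simp
  then have eq: "piece i (comb c \<Gamma>) = (\<lambda>x. inverse (fourier_const TYPE('d)) * inverse_fourier (\<lambda>\<xi>. comb_hat c \<Gamma> \<xi> * phi_hat i \<xi>) x)"
    by (rule ext)
  have [measurable]: "inverse_fourier (\<lambda>\<xi>. comb_hat c \<Gamma> \<xi> * phi_hat i \<xi>) \<in> borel_measurable borel"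
    using integrable_phi_hat[OF comb_hat_integrable, of c \<Gamma> i] by (intro measurable_inverse_fourier) auto
  show ?thesis unfolding eq by (rule borel_measurable_times[OF borel_measurable_const]) measurable
qed

lemma measurable_sqfun:
  assumes "\<Gamma> \<subseteq> brushlet_indices" "finite \<Gamma>" "0 < q"
  shows "sqfun q \<beta> (comb c \<Gamma>) \<in> borel_measurable borel"
proof -
  note [measurable] = measurable_piece
  have "sqfun q \<beta> (comb c \<Gamma>) = (\<lambda>x. ennreal ((\<Sum>i\<in>active \<Gamma>. (2 powr (\<beta> * real_of_int i) * norm (piece i (comb c \<Gamma>) x)) powr q) powr (1 / q)))"
    by (rule ext) (rule sqfun_comb[OF assms])
  moreover have "(\<lambda>x. ennreal ((\<Sum>i\<in>active \<Gamma>. (2 powr (\<beta> * real_of_int i) * norm (piece i (comb c \<Gamma>) x)) powr q) powr (1 / q))) \<in> borel_measurable borel"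
    by measurable
  ultimately show ?thesis by simp
qed

lemma tempered_comb: "tempered (dist_of (comb c \<Gamma>))"
  by (rule tempered_dist_of_bounded[OF measurable_comb])
     (simp only: comb_eq, rule norm_inverse_fourier_le[OF comb_hat_integrable])

text \<open>The power \<open>t\<close> passes through the sum over the levels because
  \<open>t \<le> q\<close>, and through the sum over the brushlets because \<open>t \<le> 1\<close>.
  Each brushlet meets at most \<open>2 * overlap + 1\<close> levels, and decay of order
  \<open>2 / t\<close> becomes order 2.\<close>

lemma sqfun_upper:
  assumes q: "0 < q" and t: "0 < t" "t \<le> 1" "t \<le> q"
  shows "\<exists>C\<ge>0. \<forall>c \<Gamma> x. \<Gamma> \<subseteq> brushlet_indices \<longrightarrow> finite \<Gamma> \<longrightarrow>
    ennpow (sqfun q \<beta> (comb c \<Gamma>) x) t \<le> ennreal (C * (\<Sum>\<mu>\<in>\<Gamma>. norm (c \<mu>) powr t *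
      2 powr (real_of_int (level \<mu>) * (t * (\<beta> + \<nu> / 2))) * tw_weight a \<mu> x))"
proof -
  let ?A = "2 / t"
  obtain B where B: "0 \<le> B" "\<And>\<mu> i x. \<mu> \<in> brushlet_indices \<Longrightarrow> norm (piece i (w \<mu>) x)
    \<le> (if \<bar>i - level \<mu>\<bar> \<le> int overlap then B * 2 powr (real_of_int (level \<mu>) * \<nu> / 2) * weight a ?A \<mu> x else 0)"
    using piece_bound[of ?A] t by auto
  \<comment> \<open>The loss incurred by replacing the level of the piece by the level of the
    brushlet in the factor with \<beta>.\<close>
  let ?L = "2 powr (\<bar>\<beta>\<bar> * real overlap)"
  define C where "C = (2 * real overlap + 1) * (?L * B) powr t"
  have C0: "0 \<le> C" by (simp add: C_def)
  have "ennpow (sqfun q \<beta> (comb c \<Gamma>) x) t \<le> ennreal (C * (\<Sum>\<mu>\<in>\<Gamma>. norm (c \<mu>) powr t *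
      2 powr (real_of_int (level \<mu>) * (t * (\<beta> + \<nu> / 2))) * tw_weight a \<mu> x))"
    if \<Gamma>: "\<Gamma> \<subseteq> brushlet_indices" "finite \<Gamma>" for c \<Gamma> x
  proof -
    let ?u = "\<lambda>i. 2 powr (\<beta> * real_of_int i) * norm (piece i (comb c \<Gamma>) x)"
    let ?X = "\<lambda>\<mu>. 2 powr (real_of_int (level \<mu>) * (\<beta> + \<nu> / 2)) * weight a ?A \<mu> x"
    let ?b = "\<lambda>i \<mu>. if \<bar>i - level \<mu>\<bar> \<le> int overlap then norm (c \<mu>) * (?L * B * ?X \<mu>) else 0"
    have u: "?u i \<le> (\<Sum>\<mu>\<in>\<Gamma>. ?b i \<mu>)" for i
    proof -
      have "?u i \<le> 2 powr (\<beta> * real_of_int i) * (\<Sum>\<mu>\<in>\<Gamma>. norm (c \<mu> * piece i (w \<mu>) x))"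
        unfolding piece_comb by (intro mult_left_mono norm_sum) simp
      also have "\<dots> = (\<Sum>\<mu>\<in>\<Gamma>. 2 powr (\<beta> * real_of_int i) * (norm (c \<mu>) * norm (piece i (w \<mu>) x)))"
        by (simp only: sum_distrib_left norm_mult)
      also have "\<dots> \<le> (\<Sum>\<mu>\<in>\<Gamma>. ?b i \<mu>)"
      proof (rule sum_mono)
        fix \<mu> assume "\<mu> \<in> \<Gamma>"
        then have \<mu>: "\<mu> \<in> brushlet_indices" using \<Gamma> by blast
        show "2 powr (\<beta> * real_of_int i) * (norm (c \<mu>) * norm (piece i (w \<mu>) x)) \<le> ?b i \<mu>"
        proof (cases "\<bar>i - level \<mu>\<bar> \<le> int overlap")
          case True
          have "\<beta> * real_of_int i \<le> \<bar>\<beta>\<bar> * real overlap + \<beta> * real_of_int (level \<mu>)"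
          proof -
            have "\<beta> * real_of_int (i - level \<mu>) \<le> \<bar>\<beta>\<bar> * \<bar>real_of_int (i - level \<mu>)\<bar>"
              unfolding abs_mult[symmetric] by (rule abs_ge_self)
            also have "\<dots> \<le> \<bar>\<beta>\<bar> * real overlap" using True by (intro mult_left_mono) linarith+
            finally show ?thesis by (simp add: algebra_simps)
          qed
          then have "2 powr (\<beta> * real_of_int i) \<le> 2 powr (\<bar>\<beta>\<bar> * real overlap + \<beta> * real_of_int (level \<mu>))" by (intro powr_mono) auto
          then have l: "2 powr (\<beta> * real_of_int i) \<le> ?L * 2 powr (\<beta> * real_of_int (level \<mu>))" by (simp only: powr_add)
          have "2 powr (\<beta> * real_of_int i) * norm (piece i (w \<mu>) x) \<le> (?L * 2 powr (\<beta> * real_of_int (level \<mu>))) * (B * 2 powr (real_of_int (level \<mu>) * \<nu> / 2) * weight a ?A \<mu> x)"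
            using B(2)[OF \<mu>, of i x] True by (intro mult_mono l) auto
          also have "\<dots> = ?L * B * ((2 powr (\<beta> * real_of_int (level \<mu>)) * 2 powr (real_of_int (level \<mu>) * \<nu> / 2)) * weight a ?A \<mu> x)"
            by (simp only: mult_ac)
          also have "2 powr (\<beta> * real_of_int (level \<mu>)) * 2 powr (real_of_int (level \<mu>) * \<nu> / 2) = 2 powr (real_of_int (level \<mu>) * (\<beta> + \<nu> / 2))"
            unfolding powr_add[symmetric] by (simp add: algebra_simps)
          finally have "norm (c \<mu>) * (2 powr (\<beta> * real_of_int i) * norm (piece i (w \<mu>) x)) \<le> norm (c \<mu>) * (?L * B * ?X \<mu>)"
            by (rule mult_left_mono) simp
          then show ?thesis using True by (simp add: mult.left_commute)
        next
          case False
          then show ?thesis using piece_zero[OF \<mu>, of i x] by simp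
        qed
      qed
      finally show ?thesis .
    qed
    have b0: "0 \<le> ?b i \<mu>" for i \<mu> using B(1) by simp
    have "ennpow (sqfun q \<beta> (comb c \<Gamma>) x) t = ennreal ((\<Sum>i\<in>active \<Gamma>. ?u i powr q) powr (t / q))"
      unfolding sqfun_comb[OF \<Gamma> q] using t q by (simp add: ennpow_ennreal powr_powr)
    also have "\<dots> \<le> ennreal (\<Sum>i\<in>active \<Gamma>. (?u i powr q) powr (t / q))"
      using t q by (intro ennreal_leI powr_sum_le) auto
    also have "(\<Sum>i\<in>active \<Gamma>. (?u i powr q) powr (t / q)) = (\<Sum>i\<in>active \<Gamma>. ?u i powr t)"
      using q by (simp add: powr_powr)
    also have "\<dots> \<le> (\<Sum>i\<in>active \<Gamma>. \<Sum>\<mu>\<in>\<Gamma>. ?b i \<mu> powr t)"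
    proof (rule sum_mono)
      fix i
      have "?u i powr t \<le> (\<Sum>\<mu>\<in>\<Gamma>. ?b i \<mu>) powr t" using u[of i] t by (intro powr_mono2) auto
      also have "\<dots> \<le> (\<Sum>\<mu>\<in>\<Gamma>. ?b i \<mu> powr t)" using t b0 by (intro powr_sum_le) auto
      finally show "?u i powr t \<le> (\<Sum>\<mu>\<in>\<Gamma>. ?b i \<mu> powr t)" .
    qed
    also have "\<dots> = (\<Sum>\<mu>\<in>\<Gamma>. \<Sum>i\<in>active \<Gamma>. ?b i \<mu> powr t)" by (rule sum.swap)
    also have "\<dots> \<le> (\<Sum>\<mu>\<in>\<Gamma>. (2 * real overlap + 1) * (norm (c \<mu>) * (?L * B * ?X \<mu>)) powr t)"
    proof (rule sum_mono)
      fix \<mu> assume \<mu>: "\<mu> \<in> \<Gamma>"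
      let ?J = "{level \<mu> - int overlap..level \<mu> + int overlap}"
      have "?J \<subseteq> active \<Gamma>" using \<mu> by (auto simp: active_def)
      then have "(\<Sum>i\<in>active \<Gamma>. ?b i \<mu> powr t) = (\<Sum>i\<in>?J. ?b i \<mu> powr t)"
        using finite_active[OF \<Gamma>(2)] by (intro sum.mono_neutral_right) auto
      also have "\<dots> \<le> (\<Sum>i\<in>?J. (norm (c \<mu>) * (?L * B * ?X \<mu>)) powr t)"
        by (intro sum_mono) auto
      also have "\<dots> = (2 * real overlap + 1) * (norm (c \<mu>) * (?L * B * ?X \<mu>)) powr t" by simp
      finally show "(\<Sum>i\<in>active \<Gamma>. ?b i \<mu> powr t) \<le> (2 * real overlap + 1) * (norm (c \<mu>) * (?L * B * ?X \<mu>)) powr t" .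
    qed
    also have "\<dots> \<le> C * (\<Sum>\<mu>\<in>\<Gamma>. norm (c \<mu>) powr t * 2 powr (real_of_int (level \<mu>) * (t * (\<beta> + \<nu> / 2))) * tw_weight a \<mu> x)"
      unfolding sum_distrib_left
    proof (rule sum_mono)
      fix \<mu> assume \<mu>: "\<mu> \<in> \<Gamma>"
      have "(norm (c \<mu>) * (?L * B * ?X \<mu>)) powr t = norm (c \<mu>) powr t * ((?L * B) powr t * ((2 powr (real_of_int (level \<mu>) * (\<beta> + \<nu> / 2))) powr t * weight a ?A \<mu> x powr t))"
        using B(1) by (simp add: powr_mult mult.assoc)
      also have "(2 powr (real_of_int (level \<mu>) * (\<beta> + \<nu> / 2))) powr t = 2 powr (real_of_int (level \<mu>) * (t * (\<beta> + \<nu> / 2)))"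
        by (simp add: powr_powr mult_ac)
      also have "weight a ?A \<mu> x powr t = weight a 2 \<mu> x" using t by (simp add: weight_powr)
      finally have e: "(norm (c \<mu>) * (?L * B * ?X \<mu>)) powr t = norm (c \<mu>) powr t * ((?L * B) powr t * (2 powr (real_of_int (level \<mu>) * (t * (\<beta> + \<nu> / 2))) * weight a 2 \<mu> x))" .
      have "(2 * real overlap + 1) * (norm (c \<mu>) * (?L * B * ?X \<mu>)) powr t
        = C * (norm (c \<mu>) powr t * 2 powr (real_of_int (level \<mu>) * (t * (\<beta> + \<nu> / 2)))) * weight a 2 \<mu> x"
        unfolding e C_def by (simp only: mult_ac)
      also have "\<dots> \<le> C * (norm (c \<mu>) powr t * 2 powr (real_of_int (level \<mu>) * (t * (\<beta> + \<nu> / 2)))) * tw_weight a \<mu> x"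
        using C0 by (intro mult_left_mono weight_le_tw) auto
      finally show "(2 * real overlap + 1) * (norm (c \<mu>) * (?L * B * ?X \<mu>)) powr t
        \<le> C * (norm (c \<mu>) powr t * 2 powr (real_of_int (level \<mu>) * (t * (\<beta> + \<nu> / 2))) * tw_weight a \<mu> x)"
        by (simp only: mult.assoc)
    qed
    finally show ?thesis by (simp add: ennreal_leI)
  qed
  then show ?thesis using C0 by blast
qed

end

section \<open>Recovering a brushlet coefficient from the Littlewood--Paley pieces\<close>

text \<open>For a function that is not integrable the left side is the norm of the default value
  0.\<close>

lemma norm_integral_le_nn_integral:
  fixes f :: "'a \<Rightarrow> 'b::{banach,second_countable_topology}"
  shows "ennreal (norm (integral\<^sup>L M f)) \<le> (\<integral>\<^sup>+x. ennreal (norm (f x)) \<partial>M)"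
  by (cases "integrable M f") (simp_all add: integral_norm_bound_ennreal not_integrable_integral_eq)

lemma ennpow_add_le:
  assumes "0 < r" "r \<le> 1" shows "ennpow (x + y) r \<le> ennpow x r + ennpow y r"
proof (cases "x = top \<or> y = top")
  case False
  then obtain u v where "0 \<le> u" "x = ennreal u" "0 \<le> v" "y = ennreal v"
    by (metis ennreal_cases)
  then show ?thesis using powr_add_le[OF assms, of u v] assms(1)
    by (simp add: ennreal_plus[symmetric] ennpow_ennreal ennreal_leI del: ennreal_plus)
qed auto

lemma ennpow_sum_le:
  assumes "0 < r" "r \<le> 1" shows "ennpow (\<Sum>i\<in>S. f i) r \<le> (\<Sum>i\<in>S. ennpow (f i) r)"
proof (induction S rule: infinite_finite_induct)
  case (insert i S)
  then have "ennpow (\<Sum>i\<in>insert i S. f i) r \<le> ennpow (f i) r + ennpow (\<Sum>i\<in>S. f i) r"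
    using ennpow_add_le[OF assms, of "f i" "\<Sum>i\<in>S. f i"] by simp
  also have "\<dots> \<le> ennpow (f i) r + (\<Sum>i\<in>S. ennpow (f i) r)" using insert by (intro add_left_mono)
  finally show ?case using insert by simp
qed simp_all

lemma cos_Ck: "Ck n UNIV (\<lambda>t. complex_of_real (cos t))"
proof -
  have "Ck n UNIV (\<lambda>t. complex_of_real (cos t)) \<and> Ck n UNIV (\<lambda>t. complex_of_real (sin t))"
  proof (induction n)
    case 0
    show ?case by (auto intro!: continuous_intros)
  next
    case (Suc n)
    have d: "((\<lambda>t. complex_of_real (cos t)) has_derivative (\<lambda>h. (- complex_of_real (sin x)) * complex_of_real h)) (at x)"
      "((\<lambda>t. complex_of_real (sin t)) has_derivative (\<lambda>h. complex_of_real (cos x) * complex_of_real h)) (at x)" for x :: real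
      by (auto intro!: derivative_eq_intros simp: mult_ac)
    have "Ck n UNIV (\<lambda>t. - complex_of_real (sin t))"
      using Ck_mult[OF open_UNIV Ck_const[of n UNIV "-1 :: complex"] conjunct2[OF Suc.IH]] by simp
    then have 1: "Ck n UNIV (\<lambda>t. (- complex_of_real (sin t)) * complex_of_real b)" for b
      by (intro Ck_mult open_UNIV Ck_const)
    have 2: "Ck n UNIV (\<lambda>t. complex_of_real (cos t) * complex_of_real b)" for b
      using Suc.IH by (intro Ck_mult open_UNIV Ck_const) simp
    show ?case by (intro conjI Ck_SucI[OF open_UNIV d(1) 1] Ck_SucI[OF open_UNIV d(2) 2])
  qed
  then show ?thesis ..
qed

context brushlet_system
begin

section \<open>A finite Calderon decomposition of brushlet spectra\<close>

lemma phi_hat_Ck: "Ck n UNIV (phi_hat i)"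
proof -
  let ?\<psi> = "\<lambda>x. complex_of_real (2 powr (real_of_int i * \<nu>)) * \<phi> (0 + D i x)"
  have eq: "fourier ?\<psi> \<xi> = phi_hat i \<xi>" for \<xi>
  proof -
    have inn: "D i x \<bullet> D (- i) \<xi> = x \<bullet> \<xi>" for x
      unfolding inner_diag_mult D_D by simp
    have "(LINT x|lborel. \<phi> x * exp (- (\<i> * complex_of_real (x \<bullet> D (- i) \<xi>))))
      = (\<Prod>l\<in>UNIV. \<bar>scl a i l\<bar>) *\<^sub>R (LINT x|lborel. \<phi> (0 + D i x) * exp (- (\<i> * complex_of_real ((0 + D i x) \<bullet> D (- i) \<xi>))))"
      by (rule integral_affine_vec) simp
    also have "(\<Prod>l\<in>UNIV. \<bar>scl a i l\<bar>) = 2 powr (real_of_int i * \<nu>)" using prod_scl[of a i] by simp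
    finally show ?thesis by (simp add: fourier_def inn scaleR_conv_of_real mult.assoc)
  qed
  have "?\<psi> \<in> schwartz" by (rule schwartz_affine[OF phi_schwartz]) simp
  then have "Ck n UNIV (fourier ?\<psi>)" by (rule fourier_Ck[OF schwartz_rapid])
  then show ?thesis by (simp only: eq[abs_def])
qed

text \<open>A finite section of the Calderon sum, taken over the levels that can meet a level 0
  brushlet. Writing the squared modulus with \<open>cnj\<close> exhibits it as a product of smooth
  functions.\<close>

definition energy :: "'d rvec \<Rightarrow> complex" where
  "energy \<xi> = (\<Sum>i\<in>{- int overlap..int overlap}. phi_hat i \<xi> * cnj (phi_hat i \<xi>))"

lemma energy_Ck: "Ck n UNIV energy"
  unfolding energy_def[abs_def]
  by (intro Ck_sum Ck_mult open_UNIV phi_hat_Ck Ck_bounded_linear[OF open_UNIV bounded_linear_cnj])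

text \<open>Rounding \<open>log 2\<close> of the quasi-norm to an integer \<open>i\<close> rescales
  \<xi> into the shell on which admissibility bounds \<open>fourier \<phi>\<close> from below. This
  \<open>i\<close> belongs to the finite section by \<open>overlap\<close>.\<close>

lemma energy_nonzero:
  assumes k: "\<And>i. k $ i \<in> labels" "k $ l = 2 \<or> k $ l = -2" and \<xi>: "\<xi> \<in> box_of k"
  shows "energy \<xi> \<noteq> 0"
proof -
  let ?t = "aniso_norm a \<xi>"
  define s where "s = log 2 ?t"
  define i where "i = \<lfloor>s + 1 / 2\<rfloor>"
  have "0 < 3 / 4 * 2 powr (- \<nu>)" by simp
  then have t: "0 < ?t" using box_of_aniso(1)[OF k \<xi>] by linarith
  have i: "- (3 / 4) \<le> s - real_of_int i" "s - real_of_int i \<le> 3 / 4" unfolding i_def by linarith+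
  have "?t = 2 powr s" using t by (simp add: s_def)
  then have "aniso_norm a (D (- i) \<xi>) = 2 powr (s - real_of_int i)"
    unfolding aniso_phi_hat by (simp only: powr_add[symmetric]) simp
  then have b: "2 powr (- 3 / 4) \<le> aniso_norm a (D (- i) \<xi>)" "aniso_norm a (D (- i) \<xi>) \<le> 2 powr (3 / 4)"
    using powr_mono[OF i(1), of 2] powr_mono[OF i(2), of 2] by simp_all
  obtain c where c: "0 < c" "\<forall>\<xi>. 2 powr (- 3 / 4) \<le> aniso_norm a \<xi> \<and> aniso_norm a \<xi> \<le> 2 powr (3 / 4) \<longrightarrow> c \<le> norm (fourier \<phi> \<xi>)"
    using adm unfolding admissible_def by blast
  then have "c \<le> norm (phi_hat i \<xi>)" using b by blast
  then have pos: "0 < norm (phi_hat i \<xi>)" using c(1) by linarith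
  then have nz: "0 < (norm (phi_hat i \<xi>))\<^sup>2" by (rule zero_less_power)
  have "\<bar>i\<bar> \<le> int overlap" using pos by (intro overlap[OF k \<xi>, of i]) auto
  then have "(norm (phi_hat i \<xi>))\<^sup>2 \<le> (\<Sum>i\<in>{- int overlap..int overlap}. (norm (phi_hat i \<xi>))\<^sup>2)"
    by (intro member_le_sum) auto
  then have "0 < (\<Sum>i\<in>{- int overlap..int overlap}. (norm (phi_hat i \<xi>))\<^sup>2)" using nz by linarith
  moreover have "energy \<xi> = complex_of_real (\<Sum>i\<in>{- int overlap..int overlap}. (norm (phi_hat i \<xi>))\<^sup>2)"
    unfolding energy_def of_real_sum by (intro sum.cong refl) (rule complex_norm_square[symmetric])
  ultimately show ?thesis by (simp only: of_real_eq_0_iff; linarith)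
qed

text \<open>Dual symbols for the pieces, localized to the spectrum of the label \<open>k\<close>;
  summed against \<open>phi_hat i\<close> they restore \<open>base k\<close>.\<close>

definition dual :: "(int, 'd) vec \<Rightarrow> int \<Rightarrow> 'd rvec \<Rightarrow> complex" where
  "dual k i \<xi> = cnj (phi_hat i \<xi>) * base k \<xi> * inverse (energy \<xi>)"

text \<open>The quotient is smooth where \<open>energy\<close> does not vanish and identically 0 off
  the closed box. The two open sets cover the space, since \<open>energy\<close> has no zero in the
  box.\<close>

lemma dual_Ck:
  assumes k: "\<And>i. k $ i \<in> labels" "k $ l = 2 \<or> k $ l = -2"
  shows "Ck n UNIV (dual k i)"
proof -
  let ?S = "{\<xi>. energy \<xi> \<noteq> 0}" and ?T = "- box_of k"
  have "continuous_on UNIV energy" by (rule Ck_continuous_on[OF energy_Ck])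
  then have S: "open ?S" by (intro open_Collect_neq continuous_on_const)
  have T: "open ?T" using closed_box_of by (simp add: open_Compl)
  have "Ck n ?S (dual k i)"
    unfolding dual_def[abs_def]
  proof (intro Ck_mult S Ck_inverse)
    show "Ck n ?S (\<lambda>x. cnj (phi_hat i x))"
      by (rule Ck_subset[OF Ck_bounded_linear[OF open_UNIV bounded_linear_cnj phi_hat_Ck]]) simp
    show "Ck n ?S (base k)" by (rule Ck_subset[OF base_Ck]) simp
    show "Ck n ?S energy" by (rule Ck_subset[OF energy_Ck]) simp
  qed simp
  moreover have "Ck n ?T (dual k i)"
    by (rule Ck_cong[OF T _ Ck_const[of n ?T 0]]) (simp add: dual_def base_support)
  ultimately have "Ck n (?S \<union> ?T) (dual k i)" by (rule Ck_Un[OF S T])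
  moreover have "?S \<union> ?T = UNIV" using energy_nonzero[OF k] by blast
  ultimately show ?thesis by simp
qed

lemma dual_support:
  assumes "\<And>i. k $ i \<in> labels" "2 * real CARD('d) < norm \<xi>"
  shows "dual k i \<xi> = 0"
  unfolding dual_def base_compact_support[OF assms] by simp

lemma base_eq_dual:
  assumes k: "\<And>i. k $ i \<in> labels" "k $ l = 2 \<or> k $ l = -2"
  shows "base k \<xi> = (\<Sum>i\<in>{- int overlap..int overlap}. phi_hat i \<xi> * dual k i \<xi>)"
proof (cases "\<xi> \<in> box_of k")
  case True
  have "(\<Sum>i\<in>{- int overlap..int overlap}. phi_hat i \<xi> * dual k i \<xi>) = energy \<xi> * (base k \<xi> * inverse (energy \<xi>))"
    unfolding energy_def[of \<xi>] sum_distrib_right dual_def by (simp only: mult.assoc energy_def)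
  then show ?thesis using energy_nonzero[OF k True] by simp
next
  case False
  then show ?thesis by (simp add: dual_def base_support)
qed

lemma dual_decay:
  assumes A: "0 \<le> A"
  shows "\<exists>C\<ge>0. \<forall>n j k x. \<forall>i\<in>{- int overlap..int overlap}. (n, j, k) \<in> brushlet_indices \<longrightarrow>
    norm (inverse_fourier (\<lambda>\<xi>. dual k i \<xi> * complex_of_real (\<Prod>l\<in>UNIV. cos (node a (n, j, k) l * (\<xi> $ l - left_end (a $ l) 0 (k $ l))))) x) \<le> C * weight a A (n, 0, k) x"
proof -
  \<comment> \<open>Only labels of actual indices are collected: they have an outer side, on which
    the smoothness of \<open>dual\<close> depends.\<close>
  let ?S = "{k. \<exists>n j. (n :: (nat, 'd) vec, j :: int, k :: (int, 'd) vec) \<in> brushlet_indices} \<times> {- int overlap..int overlap}"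
  let ?f = "\<lambda>ki nx. norm (inverse_fourier (\<lambda>\<xi>. dual (fst ki) (snd ki) \<xi> * complex_of_real (\<Prod>l\<in>UNIV. cos (node a (fst nx, 0, fst ki) l * (\<xi> $ l - left_end (a $ l) 0 (fst ki $ l))))) (snd nx))"
  let ?g = "\<lambda>ki nx. weight a A (fst nx, 0, fst ki) (snd nx)"
  have fin: "finite ?S"
    by (intro finite_cartesian_product finite_subset[OF _ finite_labels]) (auto simp: brushlet_indices_def)
  have ex: "\<exists>C\<ge>0. \<forall>nx. ?f ki nx \<le> C * ?g ki nx" if S: "ki \<in> ?S" for ki
  proof -
    obtain n0 j0 where idx: "(n0 :: (nat, 'd) vec, j0 :: int, fst ki) \<in> brushlet_indices" using S by auto
    then have idx': "(n, 0, fst ki) \<in> brushlet_indices" for n by (auto simp: brushlet_indices_def)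
    have k1: "fst ki $ i \<in> labels" for i using indices_labels[OF idx, of i] by simp
    obtain l where k2: "fst ki $ l = 2 \<or> fst ki $ l = -2" using indices_outer[OF idx] by auto
    have "\<exists>C\<ge>0. \<forall>n j k x. (n, j, k) \<in> brushlet_indices \<longrightarrow>
      norm (inverse_fourier (\<lambda>\<xi>. dual (fst ki) (snd ki) \<xi> * complex_of_real (\<Prod>l\<in>UNIV. cos (node a (n, j, k) l * (\<xi> $ l - left_end (a $ l) 0 (fst ki $ l))))) x) \<le> C * weight a A (n, 0, k) x"
      by (rule modulated_decay[OF dual_Ck[OF k1 k2] dual_support[OF k1] A])
    then obtain C where C: "0 \<le> C" "\<And>n j k x. (n, j, k) \<in> brushlet_indices \<Longrightarrow>
      norm (inverse_fourier (\<lambda>\<xi>. dual (fst ki) (snd ki) \<xi> * complex_of_real (\<Prod>l\<in>UNIV. cos (node a (n, j, k) l * (\<xi> $ l - left_end (a $ l) 0 (fst ki $ l))))) x) \<le> C * weight a A (n, 0, k) x"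
      by blast
    show ?thesis by (intro exI[of _ C] conjI allI C idx')
  qed
  have "\<exists>C\<ge>0. \<forall>ki\<in>?S. \<forall>nx. ?f ki nx \<le> C * ?g ki nx"
    by (rule finite_uniform_bound[OF fin ex weight_nonneg])
  then obtain C where C: "0 \<le> C" "\<forall>ki\<in>?S. \<forall>nx. ?f ki nx \<le> C * ?g ki nx"
    by (elim exE conjE)
  have "norm (inverse_fourier (\<lambda>\<xi>. dual k i \<xi> * complex_of_real (\<Prod>l\<in>UNIV. cos (node a (n, j, k) l * (\<xi> $ l - left_end (a $ l) 0 (k $ l))))) x) \<le> C * weight a A (n, 0, k) x"
    if i: "i \<in> {- int overlap..int overlap}" and idx: "(n, j, k) \<in> brushlet_indices" for n j k x i
  proof -
    have "(k, i) \<in> ?S" using i idx by auto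
    from bspec[OF C(2) this, THEN spec, of "(n, x)"] show ?thesis by (simp add: node_def)
  qed
  then show ?thesis using C(1) by blast
qed

lemma coefficient_eq:
  assumes \<Gamma>: "\<Gamma> \<subseteq> brushlet_indices" "finite \<Gamma>" and \<mu>: "\<mu> \<in> \<Gamma>"
  shows "c \<mu> = (LINT \<xi>|lborel. comb_hat c \<Gamma> \<xi> * complex_of_real (hat \<mu> \<xi>))"
proof -
  have idx: "\<mu>' \<in> brushlet_indices" if "\<mu>' \<in> \<Gamma>" for \<mu>' using \<Gamma>(1) that by blast
  have "(LINT \<xi>|lborel. comb_hat c \<Gamma> \<xi> * complex_of_real (hat \<mu> \<xi>))
    = (LINT \<xi>|lborel. (\<Sum>\<mu>'\<in>\<Gamma>. c \<mu>' * complex_of_real (hat \<mu>' \<xi> * hat \<mu> \<xi>)))"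
    by (simp only: comb_hat_def sum_distrib_right of_real_mult mult.assoc)
  also have "\<dots> = (\<Sum>\<mu>'\<in>\<Gamma>. (LINT \<xi>|lborel. c \<mu>' * complex_of_real (hat \<mu>' \<xi> * hat \<mu> \<xi>)))"
    by (rule Bochner_Integration.integral_sum) (intro integrable_mult_right integrable_of_real hat_mult_integrable idx \<mu>)
  also have "\<dots> = (\<Sum>\<mu>'\<in>\<Gamma>. c \<mu>' * complex_of_real (if \<mu>' = \<mu> then 1 else 0))"
    by (intro sum.cong refl) (simp only: integral_mult_right_zero integral_of_real hat_orthonormal[OF idx idx[OF \<mu>]])
  also have "\<dots> = c \<mu>" using \<Gamma>(2) \<mu> by (simp add: if_distrib[of "\<lambda>t. complex_of_real t"] if_distrib[of "\<lambda>t. _ * t"] cong: if_cong)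
  finally show ?thesis ..
qed

lemma nn_integral_reflect:
  assumes [measurable]: "f \<in> borel_measurable borel"
  shows "(\<integral>\<^sup>+x. f x \<partial>lborel) = ennreal (2 powr (real_of_int j * \<nu>)) * (\<integral>\<^sup>+x. f (z - D j x) \<partial>lborel)"
proof -
  have "(\<integral>\<^sup>+x. f x \<partial>lborel) = ennreal (\<Prod>l\<in>UNIV. \<bar>- scl a j l\<bar>) * (\<integral>\<^sup>+x. f (z + (\<chi> l. - scl a j l * x $ l)) \<partial>lborel)"
    by (rule nn_integral_affine_vec) simp_all
  also have "(\<Prod>l\<in>UNIV. \<bar>- scl a j l\<bar>) = 2 powr (real_of_int j * \<nu>)" using prod_scl[of a j] by simp
  also have "(\<lambda>x. f (z + (\<chi> l. - scl a j l * x $ l))) = (\<lambda>x. f (z - D j x))"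
    by (rule ext) (rule arg_cong[of _ _ f], simp add: vec_eq_iff)
  finally show ?thesis .
qed

definition pairing :: "real \<Rightarrow> 'd brushlet_index \<Rightarrow> int \<Rightarrow> ('d rvec \<Rightarrow> complex) \<Rightarrow> ennreal" where
  "pairing A \<mu> i g = (\<integral>\<^sup>+x. ennreal (norm (piece i g x) * weight a A \<mu> x) \<partial>lborel)"

text \<open>By orthonormality the coefficient is the integral of \<open>comb_hat c \<Gamma>\<close>
  against \<open>hat \<mu>\<close>. Splitting \<open>hat \<mu>\<close> by means of
  \<open>base_eq_dual\<close> turns it into finitely many pairings of pieces with functions that are
  concentrated like the brushlet \<mu>.\<close>

lemma coefficient_le_pairing:
  assumes A: "2 \<le> A"
  shows "\<exists>C\<ge>0. \<forall>c \<Gamma>. \<forall>\<mu>\<in>\<Gamma>. \<Gamma> \<subseteq> brushlet_indices \<longrightarrow> finite \<Gamma> \<longrightarrow>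
    ennreal (norm (c \<mu>)) \<le> ennreal (C * 2 powr (real_of_int (level \<mu>) * \<nu> / 2)) *
      (\<Sum>i\<in>{- int overlap..int overlap}. pairing A \<mu> (i + level \<mu>) (comb c \<Gamma>))"
proof -
  have A0: "0 \<le> A" using A by simp
  obtain C where C: "0 \<le> C" "\<And>n j k x i. i \<in> {- int overlap..int overlap} \<Longrightarrow> (n, j, k) \<in> brushlet_indices \<Longrightarrow>
    norm (inverse_fourier (\<lambda>\<xi>. dual k i \<xi> * complex_of_real (\<Prod>l\<in>UNIV. cos (node a (n, j, k) l * (\<xi> $ l - left_end (a $ l) 0 (k $ l))))) x) \<le> C * weight a A (n, 0, k) x"
    using dual_decay[OF A0] by blast
  let ?K = "norm (fourier_const TYPE('d))"
  let ?I = "{- int overlap..int overlap}"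
  have "ennreal (norm (c \<mu>)) \<le> ennreal (C * 2 powr (real_of_int (level \<mu>) * \<nu> / 2) * ?K) *
      (\<Sum>i\<in>?I. pairing A \<mu> (i + level \<mu>) (comb c \<Gamma>))"
    if \<Gamma>: "\<Gamma> \<subseteq> brushlet_indices" "finite \<Gamma>" and \<mu>\<Gamma>: "\<mu> \<in> \<Gamma>" for c \<Gamma> \<mu>
  proof -
    have idx: "\<mu> \<in> brushlet_indices" using \<Gamma> \<mu>\<Gamma> by blast
    obtain n j k where \<mu>: "\<mu> = (n, j, k)" by (cases \<mu>)
    have k1: "k $ i \<in> labels" for i using indices_labels[OF idx, of i] by (simp add: \<mu>)
    obtain l where k2: "k $ l = 2 \<or> k $ l = -2" using indices_outer[OF idx] by (auto simp: \<mu>)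
    define co where "co \<xi> = complex_of_real (\<Prod>l\<in>UNIV. cos (node a (n, j, k) l * (\<xi> $ l - left_end (a $ l) 0 (k $ l))))" for \<xi> :: "'d rvec"
    have co_Ck: "Ck N UNIV co" for N
    proof -
      have e: "node a (n, j, k) l * (\<xi> $ l - left_end (a $ l) 0 (k $ l))
        = axis l (node a (n, j, k) l) \<bullet> \<xi> + (- node a (n, j, k) l * left_end (a $ l) 0 (k $ l))" for l \<xi>
        by (simp add: inner_axis' algebra_simps)
      show ?thesis unfolding co_def[abs_def] of_real_prod e
        by (intro Ck_prod open_UNIV Ck_compose_affine[where f="\<lambda>t. complex_of_real (cos t)"]) (rule cos_Ck)
    qed
    \<comment> \<open>The cosines remain part of the symbol, so that its inverse transform
      \<open>U i\<close> sits at the centres of \<mu>.\<close>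
    define V where "V i \<xi> = dual k i \<xi> * co \<xi>" for i \<xi>
    have V1: "Ck N UNIV (V i)" for N i
      unfolding V_def[abs_def] by (intro Ck_mult open_UNIV dual_Ck[OF k1 k2] co_Ck)
    have V2: "V i \<xi> = 0" if "2 * real CARD('d) < norm \<xi>" for i \<xi>
      by (simp add: V_def dual_support[OF k1 that])
    define U where "U i = inverse_fourier (V i)" for i
    have U: "integrable lborel (U i)" "fourier (U i) = V i" for i
      unfolding U_def by (rule test_function_inversion[OF V1 V2], assumption)+
    have Ub: "norm (U i x) \<le> C * weight a A (n, 0, k) x" if "i \<in> ?I" for i x
      using C(2)[OF that, of n j k x] idx by (simp add: U_def V_def[abs_def] co_def[abs_def] \<mu>)
    let ?F = "comb_hat c \<Gamma>"
    let ?H = "\<lambda>i \<xi>. ?F \<xi> * phi_hat (i + j) \<xi>"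
    let ?s = "2 powr (- (real_of_int j * \<nu>) / 2)"
    have Hint: "integrable lborel (?H i)" for i by (rule integrable_phi_hat[OF comb_hat_integrable])
    have VD: "(\<lambda>\<xi>. V i (D (- j) \<xi>)) \<in> borel_measurable borel" for i
    proof -
      have "continuous_on UNIV (V i)" by (rule Ck_continuous_on[OF V1])
      then have "continuous_on UNIV (\<lambda>\<xi>. V i (D (- j) \<xi>))"
        by (rule continuous_on_compose2) (auto intro!: continuous_intros)
      then show ?thesis by (rule borel_measurable_continuous_onI)
    qed
    have HV: "integrable lborel (\<lambda>\<xi>. ?H i \<xi> * V i (D (- j) \<xi>))" for i
    proof -
      have "\<exists>B. 0 \<le> B \<and> (\<forall>x. norm (V i x) \<le> B)"
        by (rule compact_support_bound[OF Ck_continuous_on[OF V1[of 0 i]] V2]) (assumption, blast)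
      then obtain B where B: "0 \<le> B" "\<And>x. norm (V i x) \<le> B" by blast
      show ?thesis
      proof (rule Bochner_Integration.integrable_bound)
        show "integrable lborel (\<lambda>\<xi>. complex_of_real B * ?H i \<xi>)" by (rule integrable_mult_right[OF Hint])
        show "(\<lambda>\<xi>. ?H i \<xi> * V i (D (- j) \<xi>)) \<in> borel_measurable lborel"
          by (rule borel_measurable_times[OF borel_measurable_integrable[OF Hint]]) (use VD[of i] in simp)
        show "AE \<xi> in lborel. norm (?H i \<xi> * V i (D (- j) \<xi>)) \<le> norm (complex_of_real B * ?H i \<xi>)"
        proof (rule AE_I2)
          fix \<xi>
          have "norm (?H i \<xi>) * norm (V i (D (- j) \<xi>)) \<le> norm (?H i \<xi>) * B" by (intro mult_left_mono B(2) norm_ge_zero)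
          then show "norm (?H i \<xi> * V i (D (- j) \<xi>)) \<le> norm (complex_of_real B * ?H i \<xi>)"
            using B(1) by (simp add: norm_mult mult.commute mult.left_commute)
        qed
      qed
    qed
    \<comment> \<open>The multiplication formula at \<open>z = 0\<close> transfers the pairing to
      the space side. The reflected argument is harmless because the weights are even in every
      coordinate.\<close>
    have LI: "(LINT \<xi>|lborel. ?H i \<xi> * V i (D (- j) \<xi>))
      = fourier_const TYPE('d) * (LINT x|lborel. U i x * piece (i + j) (comb c \<Gamma>) (0 - D (- j) x))" for i
    proof -
      have "fourier_const TYPE('d) * (LINT \<xi>|lborel. ?H i \<xi> * V i (D (- j) \<xi>)) = inverse_fourier (\<lambda>\<xi>. ?H i \<xi> * fourier (U i) (D (- j) \<xi>)) 0"
        by (simp add: inverse_fourier_def U(2))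
      also have "\<dots> = fourier_const TYPE('d) * (LINT x|lborel. U i x * inverse_fourier (?H i) (0 - D (- j) x))"
        by (rule inverse_fourier_mult_fourier[OF Hint U(1)])
      also have "\<dots> = fourier_const TYPE('d) * (LINT x|lborel. fourier_const TYPE('d) * (U i x * piece (i + j) (comb c \<Gamma>) (0 - D (- j) x)))"
        unfolding piece_fourier[OF comb_hat_integrable] comb_eq[symmetric] by (simp only: mult.left_commute)
      also have "\<dots> = fourier_const TYPE('d) * (fourier_const TYPE('d) * (LINT x|lborel. U i x * piece (i + j) (comb c \<Gamma>) (0 - D (- j) x)))"
        by (simp only: integral_mult_right_zero)
      finally show ?thesis by simp
    qed
    have "complex_of_real (hat \<mu> \<xi>) = complex_of_real ?s * (\<Sum>i\<in>?I. phi_hat (i + j) \<xi> * V i (D (- j) \<xi>))" for \<xi>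
    proof -
      have "complex_of_real (hat \<mu> \<xi>) = complex_of_real ?s * (base k (D (- j) \<xi>) * co (D (- j) \<xi>))"
        unfolding \<mu> by (subst hat_scale') (simp only: of_real_mult hat_level_0[of n k _ j] co_def)
      also have "base k (D (- j) \<xi>) = (\<Sum>i\<in>?I. phi_hat (i + j) \<xi> * dual k i (D (- j) \<xi>))"
        unfolding base_eq_dual[OF k1 k2] D_D by simp
      finally show ?thesis by (simp only: V_def sum_distrib_right mult.assoc)
    qed
    then have "c \<mu> = (LINT \<xi>|lborel. ?F \<xi> * (complex_of_real ?s * (\<Sum>i\<in>?I. phi_hat (i + j) \<xi> * V i (D (- j) \<xi>))))"
      using coefficient_eq[OF \<Gamma> \<mu>\<Gamma>, of c] by simp
    also have "\<dots> = (LINT \<xi>|lborel. complex_of_real ?s * (\<Sum>i\<in>?I. ?H i \<xi> * V i (D (- j) \<xi>)))"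
      by (simp only: sum_distrib_left mult.assoc mult.left_commute)
    also have "\<dots> = complex_of_real ?s * (\<Sum>i\<in>?I. (LINT \<xi>|lborel. ?H i \<xi> * V i (D (- j) \<xi>)))"
      unfolding integral_mult_right_zero by (subst Bochner_Integration.integral_sum[OF HV]) simp
    also have "\<dots> = complex_of_real ?s * (\<Sum>i\<in>?I. fourier_const TYPE('d) * (LINT x|lborel. U i x * piece (i + j) (comb c \<Gamma>) (0 - D (- j) x)))"
      by (simp only: LI)
    finally have ceq: "c \<mu> = complex_of_real ?s * (\<Sum>i\<in>?I. fourier_const TYPE('d) * (LINT x|lborel. U i x * piece (i + j) (comb c \<Gamma>) (0 - D (- j) x)))" .
    have each: "ennreal (norm (LINT x|lborel. U i x * piece (i + j) (comb c \<Gamma>) (0 - D (- j) x)))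
      \<le> ennreal (C * 2 powr (real_of_int j * \<nu>)) * pairing A \<mu> (i + j) (comb c \<Gamma>)" if "i \<in> ?I" for i
    proof -
      let ?h = "piece (i + j) (comb c \<Gamma>)"
      note [measurable] = measurable_piece[of "i + j" c \<Gamma>]
      have m: "(\<lambda>x. ennreal (norm (?h x) * weight a A \<mu> x)) \<in> borel_measurable borel" by measurable
      have "ennreal (norm (LINT x|lborel. U i x * ?h (0 - D (- j) x))) \<le> (\<integral>\<^sup>+x. ennreal (norm (U i x * ?h (0 - D (- j) x))) \<partial>lborel)"
        by (rule norm_integral_le_nn_integral)
      also have "\<dots> \<le> (\<integral>\<^sup>+x. ennreal C * ennreal (norm (?h (0 - D (- j) x)) * weight a A \<mu> (0 - D (- j) x)) \<partial>lborel)"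
      proof (rule nn_integral_mono)
        fix x
        have "weight a A \<mu> (0 - D (- j) x) = weight a A (n, 0, k) x"
          by (simp add: weight_def node_def \<mu> abs_mult mult.assoc[symmetric])
        then have "norm (U i x * ?h (0 - D (- j) x)) \<le> C * (norm (?h (0 - D (- j) x)) * weight a A \<mu> (0 - D (- j) x))"
          using mult_right_mono[OF Ub[OF that, of x] norm_ge_zero[of "?h (0 - D (- j) x)"]] by (simp only: norm_mult mult_ac)
        then show "ennreal (norm (U i x * ?h (0 - D (- j) x))) \<le> ennreal C * ennreal (norm (?h (0 - D (- j) x)) * weight a A \<mu> (0 - D (- j) x))"
          using C(1) by (simp only: ennreal_mult'[symmetric] ennreal_leI)
      qed
      also have "\<dots> = ennreal C * (\<integral>\<^sup>+x. ennreal (norm (?h (0 - D (- j) x)) * weight a A \<mu> (0 - D (- j) x)) \<partial>lborel)"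
      proof (rule nn_integral_cmult)
        have "(\<lambda>x. 0 - D (- j) x) \<in> borel_measurable borel"
          by (intro borel_measurable_continuous_onI continuous_intros)
        from measurable_compose[OF this m] show "(\<lambda>x. ennreal (norm (?h (0 - D (- j) x)) * weight a A \<mu> (0 - D (- j) x))) \<in> borel_measurable lborel"
          by simp
      qed
      also have "(\<integral>\<^sup>+x. ennreal (norm (?h (0 - D (- j) x)) * weight a A \<mu> (0 - D (- j) x)) \<partial>lborel) = ennreal (2 powr (real_of_int j * \<nu>)) * pairing A \<mu> (i + j) (comb c \<Gamma>)"
      proof -
        have "ennreal (2 powr (real_of_int j * \<nu>)) * pairing A \<mu> (i + j) (comb c \<Gamma>) = ennreal (2 powr (real_of_int j * \<nu>)) * (ennreal (2 powr (real_of_int (- j) * \<nu>)) * (\<integral>\<^sup>+x. ennreal (norm (?h (0 - D (- j) x)) * weight a A \<mu> (0 - D (- j) x)) \<partial>lborel))"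
          unfolding pairing_def by (subst nn_integral_reflect[OF m, of "- j" 0]) simp
        also have "\<dots> = ennreal (2 powr (real_of_int j * \<nu>) * 2 powr (real_of_int (- j) * \<nu>)) * (\<integral>\<^sup>+x. ennreal (norm (?h (0 - D (- j) x)) * weight a A \<mu> (0 - D (- j) x)) \<partial>lborel)"
          by (simp only: ennreal_mult'[OF powr_ge_zero] mult.assoc)
        also have "2 powr (real_of_int j * \<nu>) * 2 powr (real_of_int (- j) * \<nu>) = 1"
          unfolding powr_add[symmetric] by simp
        finally show ?thesis by simp
      qed
      also have "ennreal C * (ennreal (2 powr (real_of_int j * \<nu>)) * pairing A \<mu> (i + j) (comb c \<Gamma>)) = ennreal (C * 2 powr (real_of_int j * \<nu>)) * pairing A \<mu> (i + j) (comb c \<Gamma>)"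
        using C(1) by (simp only: ennreal_mult' mult.assoc)
      finally show ?thesis .
    qed
    have "norm (c \<mu>) = ?s * norm (\<Sum>i\<in>?I. fourier_const TYPE('d) * (LINT x|lborel. U i x * piece (i + j) (comb c \<Gamma>) (0 - D (- j) x)))"
      by (subst ceq) (simp only: norm_mult norm_of_real abs_of_nonneg[OF powr_ge_zero])
    also have "\<dots> \<le> ?s * (\<Sum>i\<in>?I. ?K * norm (LINT x|lborel. U i x * piece (i + j) (comb c \<Gamma>) (0 - D (- j) x)))"
      unfolding norm_mult[symmetric] by (intro mult_left_mono norm_sum) simp
    finally have "ennreal (norm (c \<mu>)) \<le> ennreal (?s * (\<Sum>i\<in>?I. ?K * norm (LINT x|lborel. U i x * piece (i + j) (comb c \<Gamma>) (0 - D (- j) x))))"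
      by (rule ennreal_leI)
    also have "\<dots> = ennreal (?s * ?K) * (\<Sum>i\<in>?I. ennreal (norm (LINT x|lborel. U i x * piece (i + j) (comb c \<Gamma>) (0 - D (- j) x))))"
      unfolding sum_distrib_left[symmetric] by (subst sum_ennreal) (simp_all add: ennreal_mult'[symmetric] mult.assoc sum_nonneg)
    also have "\<dots> \<le> ennreal (?s * ?K) * (\<Sum>i\<in>?I. ennreal (C * 2 powr (real_of_int j * \<nu>)) * pairing A \<mu> (i + j) (comb c \<Gamma>))"
      by (intro mult_left_mono sum_mono each) auto
    also have "\<dots> = ennreal (?s * ?K * (C * 2 powr (real_of_int j * \<nu>))) * (\<Sum>i\<in>?I. pairing A \<mu> (i + j) (comb c \<Gamma>))"
      unfolding sum_distrib_left[symmetric] using C(1) by (simp add: ennreal_mult' mult.assoc)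
    also have "?s * ?K * (C * 2 powr (real_of_int j * \<nu>)) = C * (?s * 2 powr (real_of_int j * \<nu>)) * ?K" by (simp only: mult_ac)
    also have "?s * 2 powr (real_of_int j * \<nu>) = 2 powr (real_of_int (level \<mu>) * \<nu> / 2)"
      unfolding powr_add[symmetric] by (simp add: \<mu> field_simps)
    finally show ?thesis by (simp add: \<mu>)
  qed
  then show ?thesis using C(1) by (intro exI[of _ "C * ?K"]) (auto simp: mult_ac)
qed

section \<open>Reproducing formula and sub-mean-value property\<close>

text \<open>A smooth \<theta> that equals 1 on the spectrum of \<open>\<phi>\<close> reproduces,
  after rescaling to level \<open>i\<close>, every piece of that level.\<close>

lemma reproducing_kernel:
  "\<exists>\<Theta> :: 'd rvec \<Rightarrow> complex. integrable lborel \<Theta> \<and> (\<forall>A\<ge>0. \<exists>C\<ge>0. \<forall>x. norm (\<Theta> x) \<le> C * decay A x) \<and>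
    (\<forall>i c \<Gamma> z. piece i (comb c \<Gamma>) z = fourier_const TYPE('d) * (LINT x|lborel. \<Theta> x * piece i (comb c \<Gamma>) (z - D (- i) x)))"
proof -
  \<comment> \<open>On the spectrum of \<open>\<phi>\<close> every coordinate is bounded by
    \<open>2 powr (a $ l) \<le> 2 powr \<nu>\<close>; the additional 1 keeps the transition zones of
    the bell clear of it.\<close>
  define T where "T = 1 + 2 powr \<nu>"
  define \<theta> where "\<theta> \<xi> = (\<Prod>l\<in>UNIV. complex_of_real (bell \<rho> (- T) T 1 1 (\<xi> $ l)))" for \<xi> :: "'d rvec"
  have \<theta>1: "Ck n UNIV \<theta>" for n unfolding \<theta>_def[abs_def] by (intro Ck_prod open_UNIV bell_Ck)
  have \<theta>2: "\<theta> \<xi> = 0" if "(T + 1) * real CARD('d) < norm \<xi>" for \<xi>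
  proof -
    obtain l where l: "T + 1 < \<bar>\<xi> $ l\<bar>"
    proof (rule ccontr)
      assume "\<not> thesis"
      then have "\<bar>\<xi> $ l\<bar> \<le> T + 1" for l using that not_le by blast
      then have "norm \<xi> \<le> (\<Sum>l\<in>(UNIV::'d set). T + 1)" using norm_le_l1_cart[of \<xi>] by (meson order_trans sum_mono)
      then show False using \<open>(T + 1) * real CARD('d) < norm \<xi>\<close> by (simp add: mult.commute)
    qed
    then have "\<xi> $ l \<le> - T - 1 \<or> T + 1 \<le> \<xi> $ l" by linarith
    then have "bell \<rho> (- T) T 1 1 (\<xi> $ l) = 0" by (intro bell_support[OF cut]) auto
    then show ?thesis unfolding \<theta>_def by (intro prod_zero) auto
  qed
  let ?\<Theta> = "inverse_fourier \<theta>"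
  have \<Theta>: "integrable lborel ?\<Theta>" "fourier ?\<Theta> = \<theta>" by (rule test_function_inversion[OF \<theta>1 \<theta>2], assumption)+
  have one: "phi_hat i \<xi> * \<theta> (D (- i) \<xi>) = phi_hat i \<xi>" for i \<xi>
  proof (cases "phi_hat i \<xi> = 0")
    case False
    have "bell \<rho> (- T) T 1 1 (D (- i) \<xi> $ l) = 1" for l
    proof -
      let ?y = "D (- i) \<xi>"
      have z: "1 / 2 \<le> aniso_norm a ?y" "aniso_norm a ?y \<le> 2" using admissible_support[OF adm False] by auto
      have a0: "0 \<le> a $ l" for l using a order_trans[OF zero_le_one] by blast
      have "a $ l \<le> \<nu>" unfolding aniso_dim_def using a0 by (intro member_le_sum) auto
      have "\<bar>?y $ l\<bar> \<le> aniso_norm a ?y powr (a $ l)" by (rule abs_component_le_aniso[OF a])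
      also have "\<dots> \<le> 2 powr (a $ l)" using z a0 by (intro powr_mono2) auto
      also have "\<dots> \<le> 2 powr \<nu>" using \<open>a $ l \<le> \<nu>\<close> by (intro powr_mono) auto
      finally have y: "\<bar>?y $ l\<bar> \<le> 2 powr \<nu>" .
      have "bell \<rho> (- T) T 1 1 t = 1" if "\<bar>t\<bar> \<le> 2 powr \<nu>" for t
      proof -
        have "1 \<le> t - (- T)" "1 \<le> T - t" using that unfolding T_def by linarith+
        then show ?thesis unfolding bell_def using cutoff_functionD(4)[OF cut] by simp
      qed
      from this[OF y] show ?thesis .
    qed
    then show ?thesis by (simp add: \<theta>_def del: vec_lambda_beta)
  qed simp
  show ?thesis
  proof (intro exI[of _ ?\<Theta>] conjI allI impI)
    show "integrable lborel ?\<Theta>" by (rule \<Theta>)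
    show "\<exists>C\<ge>0. \<forall>x. norm (?\<Theta> x) \<le> C * decay A x" if "0 \<le> A" for A
      by (rule inverse_fourier_decay[OF \<theta>1 \<theta>2 that])
    show "piece i (comb c \<Gamma>) z = fourier_const TYPE('d) * (LINT x|lborel. ?\<Theta> x * piece i (comb c \<Gamma>) (z - D (- i) x))" for i c \<Gamma> z
    proof -
      let ?H = "\<lambda>\<xi>. comb_hat c \<Gamma> \<xi> * phi_hat i \<xi>"
      have "fourier_const TYPE('d) * piece i (comb c \<Gamma>) z = inverse_fourier ?H z"
        unfolding comb_eq by (rule piece_fourier[OF comb_hat_integrable, symmetric])
      also have "\<dots> = inverse_fourier (\<lambda>\<xi>. ?H \<xi> * fourier ?\<Theta> (D (- i) \<xi>)) z"
        unfolding \<Theta>(2) mult.assoc one ..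
      also have "\<dots> = fourier_const TYPE('d) * (LINT x|lborel. ?\<Theta> x * inverse_fourier ?H (z - D (- i) x))"
        by (rule inverse_fourier_mult_fourier[OF integrable_phi_hat[OF comb_hat_integrable] \<Theta>(1)])
      also have "\<dots> = fourier_const TYPE('d) * (LINT x|lborel. fourier_const TYPE('d) * (?\<Theta> x * piece i (comb c \<Gamma>) (z - D (- i) x)))"
        unfolding piece_fourier[OF comb_hat_integrable] comb_eq[symmetric] by (simp only: mult.left_commute)
      also have "\<dots> = fourier_const TYPE('d) * (fourier_const TYPE('d) * (LINT x|lborel. ?\<Theta> x * piece i (comb c \<Gamma>) (z - D (- i) x)))"
        by (simp only: integral_mult_right_zero)
      finally show ?thesis by simp
    qed
  qed
qed

text \<open>The reproducing formula is inserted and \<open>weight_shift\<close> moves the weight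
  from \<open>z\<close> to the argument of the piece under the integral. The decay of order
  \<open>A\<close> of the kernel cancels the polynomial that this costs. Thus a weighted integral
  controls the weighted supremum.\<close>

lemma pointwise_le_pairing:
  assumes A: "0 \<le> A"
  shows "\<exists>C\<ge>0. \<forall>c \<Gamma> i \<mu> z. \<bar>i - level \<mu>\<bar> \<le> int overlap \<longrightarrow>
    ennreal (norm (piece i (comb c \<Gamma>) z) * weight a A \<mu> z) \<le> ennreal (C * 2 powr (real_of_int (level \<mu>) * \<nu>)) * pairing A \<mu> i (comb c \<Gamma>)"
proof -
  obtain \<Theta> :: "'d rvec \<Rightarrow> complex" where \<Theta>: "integrable lborel \<Theta>" "\<forall>A\<ge>0. \<exists>C\<ge>0. \<forall>x. norm (\<Theta> x) \<le> C * decay A x"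
    "\<forall>i c \<Gamma> z. piece i (comb c \<Gamma>) z = fourier_const TYPE('d) * (LINT x|lborel. \<Theta> x * piece i (comb c \<Gamma>) (z - D (- i) x))"
    using reproducing_kernel by (elim exE conjE)
  obtain B where B: "0 \<le> B" "\<And>x. norm (\<Theta> x) \<le> B * decay A x" using \<Theta>(2) A by blast
  let ?K = "norm (fourier_const TYPE('d))" and ?L = "2 powr (real overlap * \<nu>)"
  have \<nu>0: "0 \<le> \<nu>" unfolding aniso_dim_def using a by (intro sum_nonneg) (meson order_trans zero_le_one)
  have "ennreal (norm (piece i (comb c \<Gamma>) z) * weight a A \<mu> z) \<le> ennreal (?K * (B * spread A) * ?L * 2 powr (real_of_int (level \<mu>) * \<nu>)) * pairing A \<mu> i (comb c \<Gamma>)"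
    if ij: "\<bar>i - level \<mu>\<bar> \<le> int overlap" for c \<Gamma> i \<mu> z
  proof -
    let ?h = "piece i (comb c \<Gamma>)" and ?W = "weight a A \<mu>"
    note [measurable] = measurable_piece[of i c \<Gamma>]
    have m: "(\<lambda>x. ennreal (norm (?h x) * ?W x)) \<in> borel_measurable borel" by measurable
    have b: "norm (\<Theta> x) * ?W z \<le> B * spread A * ?W (z - D (- i) x)" for x
    proof -
      let ?P = "\<Prod>l\<in>UNIV. (1 + \<bar>x $ l\<bar>) powr A"
      have P: "0 < ?P" by (intro prod_pos) (simp add: add_pos_nonneg)
      have "?W z = ?W ((z - D (- i) x) - (- D (- i) x))" by simp
      also have "\<dots> \<le> ?W (z - D (- i) x) * (\<Prod>l\<in>UNIV. (1 + scl a (level \<mu>) l * \<bar>(- D (- i) x) $ l\<bar>) powr A)"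
        by (rule weight_shift[OF A])
      also have "\<dots> = ?W (z - D (- i) x) * (\<Prod>l\<in>UNIV. (1 + scl a (level \<mu>) l * \<bar>D (- i) x $ l\<bar>) powr A)"
        by simp
      also have "\<dots> \<le> ?W (z - D (- i) x) * (spread A * ?P)"
        by (intro mult_left_mono spread_bound[OF A ij] weight_nonneg)
      finally have "norm (\<Theta> x) * ?W z \<le> (B * decay A x) * (?W (z - D (- i) x) * (spread A * ?P))"
        using B by (intro mult_mono) (auto intro!: mult_nonneg_nonneg prod_nonneg)
      also have "\<dots> = B * spread A * ?W (z - D (- i) x) * (decay A x * ?P)" by (simp only: mult_ac)
      also have "decay A x * ?P = 1" unfolding prod.distrib[symmetric]
        by (intro prod.neutral ballI) (simp add: powr_minus add_pos_nonneg add_nonneg_eq_0_iff)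
      finally show ?thesis by simp
    qed
    have "ennreal (norm (?h z) * ?W z) = ennreal (?K * ?W z) * ennreal (norm (LINT x|lborel. \<Theta> x * ?h (z - D (- i) x)))"
      by (subst \<Theta>(3)[rule_format]) (simp add: norm_mult ennreal_mult'[symmetric] mult_ac)
    also have "\<dots> \<le> ennreal (?K * ?W z) * (\<integral>\<^sup>+x. ennreal (norm (\<Theta> x * ?h (z - D (- i) x))) \<partial>lborel)"
      by (intro mult_left_mono norm_integral_le_nn_integral) simp
    also have "\<dots> = (\<integral>\<^sup>+x. ennreal (?K * ?W z) * ennreal (norm (\<Theta> x * ?h (z - D (- i) x))) \<partial>lborel)"
    proof (rule nn_integral_cmult[symmetric])
      have [measurable]: "\<Theta> \<in> borel_measurable borel" using \<Theta>(1) by auto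
      have "(\<lambda>x. z - D (- i) x) \<in> borel_measurable borel"
        by (intro borel_measurable_continuous_onI continuous_intros)
      then have [measurable]: "(\<lambda>x. ?h (z - D (- i) x)) \<in> borel_measurable borel"
        by (rule measurable_compose) measurable
      show "(\<lambda>x. ennreal (norm (\<Theta> x * ?h (z - D (- i) x)))) \<in> borel_measurable lborel" by measurable
    qed
    also have "\<dots> \<le> (\<integral>\<^sup>+x. ennreal (?K * (B * spread A)) * ennreal (norm (?h (z - D (- i) x)) * ?W (z - D (- i) x)) \<partial>lborel)"
    proof (rule nn_integral_mono)
      fix x
      let ?y = "z - D (- i) x"
      have "(?K * ?W z) * norm (\<Theta> x * ?h ?y) = ?K * norm (?h ?y) * (norm (\<Theta> x) * ?W z)" by (simp only: norm_mult mult_ac)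
      also have "\<dots> \<le> ?K * norm (?h ?y) * (B * spread A * ?W ?y)" by (intro mult_left_mono b) simp
      finally have "(?K * ?W z) * norm (\<Theta> x * ?h ?y) \<le> ?K * (B * spread A) * (norm (?h ?y) * ?W ?y)" by (simp only: mult_ac)
      then show "ennreal (?K * ?W z) * ennreal (norm (\<Theta> x * ?h ?y)) \<le> ennreal (?K * (B * spread A)) * ennreal (norm (?h ?y) * ?W ?y)"
        using B(1) spread_nonneg by (simp only: ennreal_mult'[symmetric] mult_nonneg_nonneg weight_nonneg norm_ge_zero ennreal_leI)
    qed
    also have "\<dots> = ennreal (?K * (B * spread A)) * (\<integral>\<^sup>+x. ennreal (norm (?h (z - D (- i) x)) * ?W (z - D (- i) x)) \<partial>lborel)"
    proof (rule nn_integral_cmult)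
      have "(\<lambda>x. z - D (- i) x) \<in> borel_measurable borel"
        by (intro borel_measurable_continuous_onI continuous_intros)
      from measurable_compose[OF this m] show "(\<lambda>x. ennreal (norm (?h (z - D (- i) x)) * ?W (z - D (- i) x))) \<in> borel_measurable lborel"
        by simp
    qed
    also have "(\<integral>\<^sup>+x. ennreal (norm (?h (z - D (- i) x)) * ?W (z - D (- i) x)) \<partial>lborel) = ennreal (2 powr (real_of_int i * \<nu>)) * pairing A \<mu> i (comb c \<Gamma>)"
    proof -
      have "ennreal (2 powr (real_of_int i * \<nu>)) * pairing A \<mu> i (comb c \<Gamma>) = ennreal (2 powr (real_of_int i * \<nu>)) * (ennreal (2 powr (real_of_int (- i) * \<nu>)) * (\<integral>\<^sup>+x. ennreal (norm (?h (z - D (- i) x)) * ?W (z - D (- i) x)) \<partial>lborel))"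
        unfolding pairing_def by (subst nn_integral_reflect[OF m, of "- i" z]) simp
      also have "\<dots> = ennreal (2 powr (real_of_int i * \<nu>) * 2 powr (real_of_int (- i) * \<nu>)) * (\<integral>\<^sup>+x. ennreal (norm (?h (z - D (- i) x)) * ?W (z - D (- i) x)) \<partial>lborel)"
        by (simp only: ennreal_mult'[OF powr_ge_zero] mult.assoc)
      also have "2 powr (real_of_int i * \<nu>) * 2 powr (real_of_int (- i) * \<nu>) = 1"
        unfolding powr_add[symmetric] by simp
      finally show ?thesis by simp
    qed
    also have "\<dots> \<le> ennreal (?L * 2 powr (real_of_int (level \<mu>) * \<nu>)) * pairing A \<mu> i (comb c \<Gamma>)"
    proof (intro mult_right_mono ennreal_leI)
      have "real_of_int i \<le> real overlap + real_of_int (level \<mu>)" using ij by linarith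
      then have "real_of_int i * \<nu> \<le> (real overlap + real_of_int (level \<mu>)) * \<nu>" using \<nu>0 by (rule mult_right_mono)
      then have "2 powr (real_of_int i * \<nu>) \<le> 2 powr (real overlap * \<nu> + real_of_int (level \<mu>) * \<nu>)"
        by (intro powr_mono) (simp_all add: distrib_right)
      then show "2 powr (real_of_int i * \<nu>) \<le> ?L * 2 powr (real_of_int (level \<mu>) * \<nu>)" by (simp only: powr_add)
    qed simp
    finally have "ennreal (norm (?h z) * ?W z) \<le> ennreal (?K * (B * spread A)) * (ennreal (?L * 2 powr (real_of_int (level \<mu>) * \<nu>)) * pairing A \<mu> i (comb c \<Gamma>))"
      by (simp add: mult_left_mono)
    also have "\<dots> = ennreal (?K * (B * spread A) * ?L * 2 powr (real_of_int (level \<mu>) * \<nu>)) * pairing A \<mu> i (comb c \<Gamma>)"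
      using B(1) spread_nonneg[of A] by (simp add: ennreal_mult' ennreal_mult mult.assoc)
    finally show ?thesis .
  qed
  then show ?thesis using B(1) spread_nonneg[of A] by (intro exI[of _ "?K * (B * spread A) * ?L"]) auto
qed

text \<open>In the pairing \<open>J\<close> the integrand is split into its powers
  \<open>1 - r\<close> and \<open>r\<close>. The first is at most the weighted supremum to the power
  \<open>1 - r\<close>, hence a constant times \<open>J\<close> to that power, and is then divided
  out. An integral of first powers is thereby controlled by one of \<open>r\<close>-th
  powers.\<close>

lemma pairing_power_le:
  assumes A: "2 \<le> A" and r: "0 < r" "r < 1"
  shows "\<exists>C\<ge>0. \<forall>c \<Gamma> i \<mu>. \<bar>i - level \<mu>\<bar> \<le> int overlap \<longrightarrow>
    ennpow (pairing A \<mu> i (comb c \<Gamma>)) r \<le> ennreal (C * 2 powr (real_of_int (level \<mu>) * \<nu> * (1 - r))) *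
      (\<integral>\<^sup>+x. ennreal (norm (piece i (comb c \<Gamma>) x) powr r * weight a (A * r) \<mu> x) \<partial>lborel)"
proof -
  obtain C where C: "0 \<le> C" "\<And>c \<Gamma> i \<mu> z. \<bar>i - level \<mu>\<bar> \<le> int overlap \<Longrightarrow>
    ennreal (norm (piece i (comb c \<Gamma>) z) * weight a A \<mu> z) \<le> ennreal (C * 2 powr (real_of_int (level \<mu>) * \<nu>)) * pairing A \<mu> i (comb c \<Gamma>)"
    using pointwise_le_pairing[of A] A by auto
  have "ennpow (pairing A \<mu> i (comb c \<Gamma>)) r \<le> ennreal (C powr (1 - r) * 2 powr (real_of_int (level \<mu>) * \<nu> * (1 - r))) *
      (\<integral>\<^sup>+x. ennreal (norm (piece i (comb c \<Gamma>) x) powr r * weight a (A * r) \<mu> x) \<partial>lborel)"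
    if ij: "\<bar>i - level \<mu>\<bar> \<le> int overlap" for c \<Gamma> i \<mu>
  proof -
    let ?h = "piece i (comb c \<Gamma>)" and ?W = "weight a A \<mu>" and ?J = "pairing A \<mu> i (comb c \<Gamma>)"
    let ?B = "C * 2 powr (real_of_int (level \<mu>) * \<nu>)"
    let ?Q = "\<integral>\<^sup>+x. ennreal (norm (?h x) powr r * weight a (A * r) \<mu> x) \<partial>lborel"
    note [measurable] = measurable_piece[of i c \<Gamma>]
    have B0: "0 \<le> ?B" using C(1) by simp
    obtain M where M: "\<And>x. norm (?h x) \<le> M"
    proof -
      let ?H = "\<lambda>\<xi>. comb_hat c \<Gamma> \<xi> * phi_hat i \<xi>"
      have "norm (?h x) \<le> inverse (norm (fourier_const TYPE('d))) * (norm (fourier_const TYPE('d)) * (LINT \<xi>|lborel. norm (?H \<xi>)))" for x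
      proof -
        have "?h x = inverse (fourier_const TYPE('d)) * inverse_fourier ?H x"
          unfolding comb_eq piece_fourier[OF comb_hat_integrable] by simp
        then have "norm (?h x) = inverse (norm (fourier_const TYPE('d))) * norm (inverse_fourier ?H x)"
          by (simp only: norm_mult norm_inverse)
        also have "\<dots> \<le> inverse (norm (fourier_const TYPE('d))) * (norm (fourier_const TYPE('d)) * (LINT \<xi>|lborel. norm (?H \<xi>)))"
          by (intro mult_left_mono norm_inverse_fourier_le[OF integrable_phi_hat[OF comb_hat_integrable]]) simp
        finally show ?thesis .
      qed
      then show ?thesis using that by blast
    qed
    \<comment> \<open>Finiteness permits the division by a power of the pairing; it holds because a
      piece is bounded and the weight integrable.\<close>
    have fin: "?J < \<infinity>"
    proof -
      have "?J \<le> (\<integral>\<^sup>+x. ennreal (M * ?W x) \<partial>lborel)" unfolding pairing_def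
        by (intro nn_integral_mono ennreal_leI mult_right_mono M weight_nonneg)
      also have "\<dots> < \<infinity>"
      proof -
        have "integrable lborel (\<lambda>x. M * ?W x)" by (intro integrable_mult_right integrable_weight A)
        moreover have "0 \<le> M" using M[of 0] norm_ge_zero[of "?h 0"] by linarith
        ultimately show ?thesis using nn_integral_eq_integral[of lborel "\<lambda>x. M * ?W x"] by simp
      qed
      finally show ?thesis .
    qed
    then obtain I where I: "0 \<le> I" "?J = ennreal I" by (metis ennreal_cases infinity_ennreal_def less_irrefl)
    show ?thesis
    proof (cases "I = 0")
      case True
      then show ?thesis using I by simp
    next
      case False
      then have I0: "0 < I" using I by simp
      have le: "norm (?h x) * ?W x \<le> ?B * I" for x
      proof -
        have "ennreal (norm (?h x) * ?W x) \<le> ennreal (?B * I)" using C(2)[OF ij, of c \<Gamma> x] B0 I by (simp add: ennreal_mult)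
        then show ?thesis by (rule ennreal_le_iff[THEN iffD1, rotated]) (use B0 I in simp)
      qed
      have pt: "norm (?h x) * ?W x \<le> (?B * I) powr (1 - r) * (norm (?h x) powr r * weight a (A * r) \<mu> x)" for x
      proof -
        let ?y = "norm (?h x) * ?W x"
        have y0: "0 \<le> ?y" by simp
        have "?y = ?y powr (1 - r) * ?y powr r" unfolding powr_add[symmetric] using y0 by simp
        also have "\<dots> \<le> (?B * I) powr (1 - r) * ?y powr r" using r le[of x] y0 by (intro mult_right_mono powr_mono2) auto
        also have "?y powr r = norm (?h x) powr r * weight a (A * r) \<mu> x" by (simp add: powr_mult weight_powr)
        finally show ?thesis .
      qed
      have "?J \<le> (\<integral>\<^sup>+x. ennreal ((?B * I) powr (1 - r)) * ennreal (norm (?h x) powr r * weight a (A * r) \<mu> x) \<partial>lborel)"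
        unfolding pairing_def using pt by (intro nn_integral_mono) (simp only: ennreal_mult'[OF powr_ge_zero, symmetric] ennreal_leI)
      also have "\<dots> = ennreal ((?B * I) powr (1 - r)) * ?Q" by (rule nn_integral_cmult) measurable
      finally have J: "ennreal I \<le> ennreal ((?B * I) powr (1 - r)) * ?Q" by (simp only: I)
      have "ennpow ?J r = ennreal (I powr r)" using I r by (simp add: ennpow_ennreal)
      also have "I powr r = I powr (r - 1) * I" using I0 by (simp add: powr_diff)
      also have "ennreal (I powr (r - 1) * I) = ennreal (I powr (r - 1)) * ennreal I" by (simp add: ennreal_mult')
      also have "\<dots> \<le> ennreal (I powr (r - 1)) * (ennreal ((?B * I) powr (1 - r)) * ?Q)" by (intro mult_left_mono J) simp
      also have "\<dots> = ennreal (I powr (r - 1) * (?B * I) powr (1 - r)) * ?Q" by (simp add: ennreal_mult' mult.assoc)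
      also have "I powr (r - 1) * (?B * I) powr (1 - r) = ?B powr (1 - r) * (I powr (r - 1) * I powr (1 - r))"
        using B0 I by (simp only: powr_mult mult_ac)
      also have "I powr (r - 1) * I powr (1 - r) = 1" unfolding powr_add[symmetric] using I0 by simp
      also have "?B powr (1 - r) * 1 = C powr (1 - r) * 2 powr (real_of_int (level \<mu>) * \<nu> * (1 - r))"
        using C(1) by (simp add: powr_mult powr_powr)
      finally show ?thesis .
    qed
  qed
  then show ?thesis by (intro exI[of _ "C powr (1 - r)"]) auto
qed

text \<open>The two preceding estimates are used with the order \<open>2 / r\<close>, which the
  \<open>r\<close>-th power reduces to 2. Since \<open>r < 1\<close>, this power passes through the
  sum over the overlapping levels, and each piece is dominated by the square function.\<close>

lemma coefficient_le_sqfun: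
  assumes r: "0 < r" "r < 1" and q: "0 < q"
  shows "\<exists>C\<ge>0. \<forall>c \<Gamma>. \<forall>\<mu>\<in>\<Gamma>. \<Gamma> \<subseteq> brushlet_indices \<longrightarrow> finite \<Gamma> \<longrightarrow>
    ennreal (norm (c \<mu>) powr r) \<le> ennreal (C * 2 powr (real_of_int (level \<mu>) * (\<nu> * (1 - r / 2) - \<beta> * r))) *
      (\<integral>\<^sup>+x. ennpow (sqfun q \<beta> (comb c \<Gamma>) x) r * ennreal (tw_weight a \<mu> x) \<partial>lborel)"
proof -
  let ?A = "2 / r"
  have A: "2 \<le> ?A" using r by (simp add: divide_simps)
  let ?I = "{- int overlap..int overlap}"
  obtain C1 where C1: "0 \<le> C1" "\<And>c \<Gamma> \<mu>. \<mu> \<in> \<Gamma> \<Longrightarrow> \<Gamma> \<subseteq> brushlet_indices \<Longrightarrow> finite \<Gamma> \<Longrightarrow>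
    ennreal (norm (c \<mu>)) \<le> ennreal (C1 * 2 powr (real_of_int (level \<mu>) * \<nu> / 2)) * (\<Sum>i\<in>?I. pairing ?A \<mu> (i + level \<mu>) (comb c \<Gamma>))"
    using coefficient_le_pairing[OF A] by blast
  obtain C2 where C2: "0 \<le> C2" "\<And>c \<Gamma> i \<mu>. \<bar>i - level \<mu>\<bar> \<le> int overlap \<Longrightarrow>
    ennpow (pairing ?A \<mu> i (comb c \<Gamma>)) r \<le> ennreal (C2 * 2 powr (real_of_int (level \<mu>) * \<nu> * (1 - r))) *
      (\<integral>\<^sup>+x. ennreal (norm (piece i (comb c \<Gamma>) x) powr r * weight a (?A * r) \<mu> x) \<partial>lborel)"
    using pairing_power_le[OF A r] by blast
  let ?L = "2 powr (\<bar>\<beta>\<bar> * real overlap * r)"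
  define C where "C = C1 powr r * (2 * real overlap + 1) * C2 * ?L"
  have C0: "0 \<le> C" using C2 by (simp add: C_def)
  have "ennreal (norm (c \<mu>) powr r) \<le> ennreal (C * 2 powr (real_of_int (level \<mu>) * (\<nu> * (1 - r / 2) - \<beta> * r))) *
      (\<integral>\<^sup>+x. ennpow (sqfun q \<beta> (comb c \<Gamma>) x) r * ennreal (tw_weight a \<mu> x) \<partial>lborel)"
    if \<mu>: "\<mu> \<in> \<Gamma>" and \<Gamma>: "\<Gamma> \<subseteq> brushlet_indices" "finite \<Gamma>" for c \<Gamma> \<mu>
  proof -
    let ?j = "real_of_int (level \<mu>)" and ?G = "sqfun q \<beta> (comb c \<Gamma>)"
    let ?Q = "\<integral>\<^sup>+x. ennpow (?G x) r * ennreal (tw_weight a \<mu> x) \<partial>lborel"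
    note [measurable] = measurable_sqfun[OF \<Gamma> q]
    have P: "ennpow (pairing ?A \<mu> (i + level \<mu>) (comb c \<Gamma>)) r \<le> ennreal (C2 * 2 powr (?j * \<nu> * (1 - r)) * (?L * 2 powr (- (\<beta> * ?j * r)))) * ?Q"
      if i: "i \<in> ?I" for i
    proof -
      let ?i = "i + level \<mu>"
      let ?h = "piece ?i (comb c \<Gamma>)"
      have pt: "ennreal (norm (?h x) powr r * weight a (?A * r) \<mu> x) \<le> ennreal (?L * 2 powr (- (\<beta> * ?j * r))) * (ennpow (?G x) r * ennreal (tw_weight a \<mu> x))" for x
      proof -
        let ?b = "2 powr (\<beta> * real_of_int ?i)"
        have "ennreal (norm (?h x) powr r) = ennreal (?b powr (- r)) * ennreal ((?b * norm (?h x)) powr r)"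
          by (simp add: ennreal_mult'[symmetric] powr_mult mult.assoc[symmetric] powr_minus)
        also have "ennreal ((?b * norm (?h x)) powr r) = ennpow (ennreal (?b * norm (?h x))) r" using r by (simp add: ennpow_ennreal)
        also have "ennreal (?b powr (- r)) * \<dots> \<le> ennreal (?L * 2 powr (- (\<beta> * ?j * r))) * ennpow (?G x) r"
        proof (intro mult_mono ennreal_leI ennpow_mono r piece_le_sqfun[OF \<Gamma> q])
          have "- (\<beta> * real_of_int i) \<le> \<bar>\<beta>\<bar> * \<bar>real_of_int i\<bar>" unfolding abs_mult[symmetric] by linarith
          also have "\<dots> \<le> \<bar>\<beta>\<bar> * real overlap" using i by (intro mult_left_mono) auto
          finally have "- (\<beta> * real_of_int i) * r \<le> \<bar>\<beta>\<bar> * real overlap * r" using r by (intro mult_right_mono) auto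
          then have "\<beta> * real_of_int ?i * - r \<le> \<bar>\<beta>\<bar> * real overlap * r + - (\<beta> * ?j * r)" by (simp add: algebra_simps)
          then have "2 powr (\<beta> * real_of_int ?i * - r) \<le> 2 powr (\<bar>\<beta>\<bar> * real overlap * r + - (\<beta> * ?j * r))" by (intro powr_mono) auto
          then show "?b powr (- r) \<le> ?L * 2 powr (- (\<beta> * ?j * r))" by (simp only: powr_powr powr_add)
        qed auto
        finally have "ennreal (norm (?h x) powr r) \<le> ennreal (?L * 2 powr (- (\<beta> * ?j * r))) * ennpow (?G x) r" .
        moreover have "ennreal (weight a (?A * r) \<mu> x) \<le> ennreal (tw_weight a \<mu> x)"
          using r by (intro ennreal_leI weight_le_tw) simp
        ultimately have "ennreal (norm (?h x) powr r) * ennreal (weight a (?A * r) \<mu> x) \<le> ennreal (?L * 2 powr (- (\<beta> * ?j * r))) * ennpow (?G x) r * ennreal (tw_weight a \<mu> x)"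
          by (intro mult_mono) auto
        then show ?thesis by (simp only: ennreal_mult'[OF powr_ge_zero] mult.assoc)
      qed
      have "\<bar>?i - level \<mu>\<bar> \<le> int overlap" using i by auto
      then have "ennpow (pairing ?A \<mu> ?i (comb c \<Gamma>)) r \<le> ennreal (C2 * 2 powr (?j * \<nu> * (1 - r))) * (\<integral>\<^sup>+x. ennreal (norm (?h x) powr r * weight a (?A * r) \<mu> x) \<partial>lborel)"
        by (rule C2(2))
      also have "\<dots> \<le> ennreal (C2 * 2 powr (?j * \<nu> * (1 - r))) * (\<integral>\<^sup>+x. ennreal (?L * 2 powr (- (\<beta> * ?j * r))) * (ennpow (?G x) r * ennreal (tw_weight a \<mu> x)) \<partial>lborel)"
        by (intro mult_left_mono nn_integral_mono pt) simp
      also have "(\<integral>\<^sup>+x. ennreal (?L * 2 powr (- (\<beta> * ?j * r))) * (ennpow (?G x) r * ennreal (tw_weight a \<mu> x)) \<partial>lborel) = ennreal (?L * 2 powr (- (\<beta> * ?j * r))) * ?Q"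
        by (rule nn_integral_cmult) measurable
      finally show ?thesis using C2(1) by (simp add: ennreal_mult' ennreal_mult mult.assoc)
    qed
    have "ennreal (norm (c \<mu>) powr r) = ennpow (ennreal (norm (c \<mu>))) r" using r by (simp add: ennpow_ennreal)
    also have "\<dots> \<le> ennpow (ennreal (C1 * 2 powr (?j * \<nu> / 2)) * (\<Sum>i\<in>?I. pairing ?A \<mu> (i + level \<mu>) (comb c \<Gamma>))) r"
      by (intro ennpow_mono r C1(2)[OF \<mu> \<Gamma>])
    also have "\<dots> = ennreal ((C1 * 2 powr (?j * \<nu> / 2)) powr r) * ennpow (\<Sum>i\<in>?I. pairing ?A \<mu> (i + level \<mu>) (comb c \<Gamma>)) r"
      using r C1(1) by (simp add: ennpow_mult ennpow_ennreal)
    also have "\<dots> \<le> ennreal ((C1 * 2 powr (?j * \<nu> / 2)) powr r) * (\<Sum>i\<in>?I. ennpow (pairing ?A \<mu> (i + level \<mu>) (comb c \<Gamma>)) r)"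
      using r by (intro mult_left_mono ennpow_sum_le) auto
    also have "\<dots> \<le> ennreal ((C1 * 2 powr (?j * \<nu> / 2)) powr r) * (\<Sum>i\<in>?I. ennreal (C2 * 2 powr (?j * \<nu> * (1 - r)) * (?L * 2 powr (- (\<beta> * ?j * r)))) * ?Q)"
      by (intro mult_left_mono sum_mono P) auto
    also have "\<dots> = ennreal ((C1 * 2 powr (?j * \<nu> / 2)) powr r * ((2 * real overlap + 1) * (C2 * 2 powr (?j * \<nu> * (1 - r)) * (?L * 2 powr (- (\<beta> * ?j * r)))))) * ?Q"
    proof -
      have "of_nat (card ?I) = ennreal (2 * real overlap + 1)"
        by (simp add: ennreal_of_nat_eq_real_of_nat)
      then show ?thesis using C2(1) by (simp add: ennreal_mult' ennreal_mult mult.assoc)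
    qed
    also have "(C1 * 2 powr (?j * \<nu> / 2)) powr r * ((2 * real overlap + 1) * (C2 * 2 powr (?j * \<nu> * (1 - r)) * (?L * 2 powr (- (\<beta> * ?j * r)))))
      = C * (2 powr (?j * \<nu> / 2 * r) * 2 powr (?j * \<nu> * (1 - r)) * 2 powr (- (\<beta> * ?j * r)))"
      using C1(1) by (simp only: C_def powr_mult powr_powr powr_ge_zero mult_ac)
    \<comment> \<open>The three exponents stem from the normalization of the brushlet, from the
      passage to \<open>r\<close>-th powers, and from the smoothness factor in the square
      function.\<close>
    also have "2 powr (?j * \<nu> / 2 * r) * 2 powr (?j * \<nu> * (1 - r)) * 2 powr (- (\<beta> * ?j * r)) = 2 powr (?j * (\<nu> * (1 - r / 2) - \<beta> * r))"
      unfolding powr_add[symmetric] by (simp add: algebra_simps)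
    finally show ?thesis .
  qed
  then show ?thesis using C0 by blast
qed

end

section \<open>Mixed norms of sums of weights\<close>

text \<open>The exponents are distinct integers, so the sum is at most a full geometric series
  descending from its largest term, and that term is at most \<tau>.\<close>

lemma sum_powr_int_le:
  fixes b \<tau> :: real
  assumes b: "1 < b" and J: "finite J" and \<tau>: "0 \<le> \<tau>" "\<And>j. j \<in> J \<Longrightarrow> b powr real_of_int j \<le> \<tau>"
  shows "(\<Sum>j\<in>J. b powr real_of_int j) \<le> b / (b - 1) * \<tau>"
proof (cases "J = {}")
  case True
  then show ?thesis using b \<tau>(1) by (auto intro!: mult_nonneg_nonneg divide_nonneg_nonneg)
next
  case False
  define M where "M = Max J"
  have M: "M \<in> J" "\<And>j. j \<in> J \<Longrightarrow> j \<le> M" using J False by (auto simp: M_def)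
  let ?f = "\<lambda>j. nat (M - j)"
  have inj: "inj_on ?f J"
  proof (rule inj_onI)
    fix x y assume "x \<in> J" "y \<in> J" "nat (M - x) = nat (M - y)"
    then show "x = y" using M(2)[of x] M(2)[of y] by linarith
  qed
  have "(\<Sum>j\<in>J. b powr real_of_int j) = (\<Sum>j\<in>J. b powr real_of_int M * (1 / b) ^ ?f j)"
  proof (rule sum.cong[OF refl])
    fix j assume "j \<in> J"
    then have "real (?f j) = real_of_int M - real_of_int j" using M(2)[of j] by simp
    then have "b powr real_of_int j = b powr real_of_int M * b powr (- real (?f j))"
      unfolding powr_add[symmetric] by simp
    also have "b powr (- real (?f j)) = (1 / b) ^ ?f j"
      using b by (simp add: powr_minus powr_realpow power_inverse divide_inverse)
    finally show "b powr real_of_int j = b powr real_of_int M * (1 / b) ^ ?f j" .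
  qed
  also have "\<dots> = b powr real_of_int M * (\<Sum>i\<in>?f ` J. (1 / b) ^ i)"
    by (simp only: sum_distrib_left sum.reindex[OF inj] comp_def)
  also have "\<dots> \<le> b powr real_of_int M * (1 / (1 - 1 / b))"
  proof (rule mult_left_mono)
    have c: "norm (1 / b) < 1" using b by simp
    have "(\<Sum>i\<in>?f ` J. (1 / b) ^ i) \<le> (\<Sum>i. (1 / b) ^ i)"
      using b J by (intro sum_le_suminf summable_geometric c) auto
    then show "(\<Sum>i\<in>?f ` J. (1 / b) ^ i) \<le> 1 / (1 - 1 / b)" by (simp only: suminf_geometric[OF c])
  qed simp
  also have "1 / (1 - 1 / b) = b / (b - 1)" using b by (simp add: field_simps)
  also have "b powr real_of_int M * (b / (b - 1)) \<le> \<tau> * (b / (b - 1))"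
    using b by (intro mult_right_mono \<tau>(2) M) auto
  finally show ?thesis by (simp only: mult.commute)
qed

text \<open>For bounded \<open>\<theta>\<close> the terms with large \<open>j\<close> carry at least half of the sum.\<close>

lemma geometric_power_sum:
  fixes b s B :: real
  assumes b: "1 < b" and s: "1 \<le> s" and B: "0 < B"
  shows "\<exists>C\<ge>0. \<forall>J \<theta>. finite J \<longrightarrow> (\<forall>j\<in>J. 0 \<le> \<theta> j \<and> \<theta> j \<le> B) \<longrightarrow>
    (\<Sum>j\<in>J. b powr real_of_int j * \<theta> j) powr s \<le> C * (\<Sum>j\<in>J. b powr (real_of_int j * s) * \<theta> j)"
proof -
  \<comment> \<open>Chosen so that the terms with \<open>b powr j \<le> S * k\<close> add up to at
    most \<open>B * (b / (b - 1)) * (S * k) = S / 2\<close>.\<close>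
  define k where "k = (b - 1) / (2 * b * B)"
  have k: "0 < k" using b B by (simp add: k_def)
  have "(\<Sum>j\<in>J. b powr real_of_int j * \<theta> j) powr s \<le> 2 / k powr (s - 1) * (\<Sum>j\<in>J. b powr (real_of_int j * s) * \<theta> j)"
    if J: "finite J" and \<theta>: "\<And>j. j \<in> J \<Longrightarrow> 0 \<le> \<theta> j" "\<And>j. j \<in> J \<Longrightarrow> \<theta> j \<le> B" for J \<theta>
  proof -
    define S where "S = (\<Sum>j\<in>J. b powr real_of_int j * \<theta> j)"
    have S0: "0 \<le> S" unfolding S_def using \<theta> by (intro sum_nonneg) auto
    have R0: "0 \<le> (\<Sum>j\<in>J. b powr (real_of_int j * s) * \<theta> j)" using \<theta> by (intro sum_nonneg) auto
    show ?thesis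
    proof (cases "S = 0")
      case True
      then show ?thesis using R0 k by (simp add: S_def[symmetric])
    next
      case False
      then have S: "0 < S" using S0 by simp
      define \<tau> where "\<tau> = S * k"
      have \<tau>: "0 < \<tau>" using S k by (simp add: \<tau>_def)
      let ?L = "{j \<in> J. b powr real_of_int j \<le> \<tau>}" and ?H = "{j \<in> J. \<not> b powr real_of_int j \<le> \<tau>}"
      have "(\<Sum>j\<in>?L. b powr real_of_int j * \<theta> j) \<le> (\<Sum>j\<in>?L. b powr real_of_int j * B)"
        using \<theta> by (intro sum_mono mult_left_mono) auto
      also have "\<dots> = B * (\<Sum>j\<in>?L. b powr real_of_int j)" by (simp only: sum_distrib_left mult.commute)
      also have "\<dots> \<le> B * (b / (b - 1) * \<tau>)"
        using b B \<tau> J by (intro mult_left_mono sum_powr_int_le) auto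
      also have "\<dots> = S / 2" using b B by (simp add: \<tau>_def k_def field_simps)
      finally have low: "(\<Sum>j\<in>?L. b powr real_of_int j * \<theta> j) \<le> S / 2" .
      have "S = (\<Sum>j\<in>?L. b powr real_of_int j * \<theta> j) + (\<Sum>j\<in>?H. b powr real_of_int j * \<theta> j)"
        unfolding S_def using J by (subst sum.union_disjoint[symmetric]) (auto intro!: sum.cong)
      then have high: "S / 2 \<le> (\<Sum>j\<in>?H. b powr real_of_int j * \<theta> j)" using low by linarith
      have "\<tau> powr (s - 1) * (S / 2) \<le> \<tau> powr (s - 1) * (\<Sum>j\<in>?H. b powr real_of_int j * \<theta> j)"
        by (rule mult_left_mono[OF high]) simp
      also have "\<dots> = (\<Sum>j\<in>?H. \<tau> powr (s - 1) * (b powr real_of_int j * \<theta> j))" by (rule sum_distrib_left)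
      also have "\<dots> \<le> (\<Sum>j\<in>?H. b powr (real_of_int j * s) * \<theta> j)"
      proof (rule sum_mono)
        fix j assume j: "j \<in> ?H"
        have "\<tau> powr (s - 1) \<le> (b powr real_of_int j) powr (s - 1)" using j \<tau> s by (intro powr_mono2) auto
        then have "\<tau> powr (s - 1) * (b powr real_of_int j * \<theta> j) \<le> (b powr real_of_int j) powr (s - 1) * (b powr real_of_int j * \<theta> j)"
          using \<theta> j by (intro mult_right_mono) auto
        also have "\<dots> = b powr (real_of_int j * s) * \<theta> j"
          by (simp only: powr_powr mult.assoc[symmetric] powr_add[symmetric]) (simp add: algebra_simps)
        finally show "\<tau> powr (s - 1) * (b powr real_of_int j * \<theta> j) \<le> b powr (real_of_int j * s) * \<theta> j" .
      qed
      also have "\<dots> \<le> (\<Sum>j\<in>J. b powr (real_of_int j * s) * \<theta> j)"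
        using J \<theta> by (intro sum_mono2) auto
      finally have "2 / k powr (s - 1) * (\<tau> powr (s - 1) * (S / 2)) \<le> 2 / k powr (s - 1) * (\<Sum>j\<in>J. b powr (real_of_int j * s) * \<theta> j)"
        by (rule mult_left_mono) simp
      moreover have "2 / k powr (s - 1) * (\<tau> powr (s - 1) * (S / 2)) = S powr s"
      proof -
        have "\<tau> powr (s - 1) = S powr (s - 1) * k powr (s - 1)" using S k by (simp add: \<tau>_def powr_mult)
        moreover have "S powr (s - 1) * S = S powr s" using S by (simp add: powr_diff)
        ultimately show ?thesis using k by simp
      qed
      ultimately show ?thesis by (simp only: S_def[symmetric])
    qed
  qed
  then show ?thesis using k by (intro exI[of _ "2 / k powr (s - 1)"]) auto
qed

context brushlet_system
begin

lemma dim_ge_1: "1 \<le> \<nu>"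
proof -
  obtain i :: 'd where True by simp
  have "0 \<le> a $ l" for l using a order_trans[OF zero_le_one] by blast
  then have "a $ i \<le> \<nu>" unfolding aniso_dim_def by (intro member_le_sum) auto
  then show ?thesis using a order_trans by blast
qed

definition gap :: "(int, 'd) vec \<Rightarrow> 'd \<Rightarrow> real" where
  "gap k i = pi / (right_end (a $ i) 0 (k $ i) - left_end (a $ i) 0 (k $ i))"

lemma node_gap: "node a (n, j, k) i = gap k i * (real (n $ i) + 1 / 2)"
  by (simp add: node_def gap_def)

lemma gap_pos: "k $ i \<in> labels \<Longrightarrow> 0 < gap k i"
proof -
  assume "k $ i \<in> labels"
  then have "left_end (a $ i) 0 (k $ i) < right_end (a $ i) 0 (k $ i)"
    using a by (intro level_parameters_valid(1)) auto
  then show ?thesis by (simp add: gap_def)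
qed

text \<open>The factor normalizes each weight: a single \<open>tw_weight\<close> of level
  \<open>j\<close> has a mixed norm of at most the order
  \<open>2 powr (- j * (\<Sum>i\<in>UNIV. a $ i / s $ i))\<close>, so singletons have bounded
  mass.\<close>

definition mass :: "'d rvec \<Rightarrow> 'd brushlet_index set \<Rightarrow> ennreal" where
  "mass s \<Gamma> = mixed_norm s (\<lambda>x. ennreal (\<Sum>\<mu>\<in>\<Gamma>. 2 powr (real_of_int (level \<mu>) * (\<Sum>i\<in>UNIV. a $ i / s $ i)) * tw_weight a \<mu> x))"

lemma tw_powr_le: "1 \<le> s \<Longrightarrow> tw u powr s \<le> tw u"
  using powr_mono'[of 1 s "tw u"] tw_pos[of u] tw_le_1[of u] by simp

lemma mass_singleton:
  assumes s: "\<And>i. 1 \<le> s $ i"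
  shows "\<exists>C\<ge>0. \<forall>\<mu>. mass s {\<mu>} \<le> ennreal C"
proof (intro exI conjI allI)
  show "0 \<le> (\<Prod>i\<in>(UNIV::'d set). (2 * tw_mass) powr (1 / s $ i))" by (intro prod_nonneg) simp
  fix \<mu> :: "'d brushlet_index"
  let ?S = "scl a (level \<mu>)"
  let ?f = "\<lambda>i t. ennreal (?S i powr (1 / s $ i) * tw (?S i * \<bar>t\<bar> - node a \<mu> i))"
  have s0: "0 < s $ i" for i using s[of i] by linarith
  have "2 powr (real_of_int (level \<mu>) * (\<Sum>i\<in>UNIV. a $ i / s $ i)) = (\<Prod>i\<in>UNIV. ?S i powr (1 / s $ i))"
    by (simp add: scl_def powr_powr powr_sum sum_distrib_left)
  then have eq: "ennreal (\<Sum>\<mu>\<in>{\<mu>}. 2 powr (real_of_int (level \<mu>) * (\<Sum>i\<in>UNIV. a $ i / s $ i)) * tw_weight a \<mu> x) = (\<Prod>i\<in>UNIV. ?f i (x $ i))" for x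
    by (subst prod_ennreal) (simp_all add: tw_weight_def prod.distrib)
  have "mass s {\<mu>} = (\<Prod>i\<in>UNIV. ennpow (\<integral>\<^sup>+t. ennpow (?f i t) (s $ i) \<partial>lborel) (1 / s $ i))"
    unfolding mass_def eq by (rule mixed_norm_prod[OF s0]) measurable
  also have "\<dots> \<le> (\<Prod>i\<in>UNIV. ennreal ((2 * tw_mass) powr (1 / s $ i)))"
  proof (intro prod_mono_ennreal)
    fix i
    have "(\<integral>\<^sup>+t. ennpow (?f i t) (s $ i) \<partial>lborel) \<le> (\<integral>\<^sup>+t. ennreal (?S i) * ennreal (tw (?S i * \<bar>t\<bar> - node a \<mu> i)) \<partial>lborel)"
    proof (rule nn_integral_mono)
      fix t
      have "(?S i powr (1 / s $ i) * tw (?S i * \<bar>t\<bar> - node a \<mu> i)) powr (s $ i) = ?S i * tw (?S i * \<bar>t\<bar> - node a \<mu> i) powr (s $ i)"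
        using s0[of i] by (simp add: powr_mult powr_powr)
      also have "\<dots> \<le> ?S i * tw (?S i * \<bar>t\<bar> - node a \<mu> i)" by (intro mult_left_mono tw_powr_le s) simp
      finally show "ennpow (?f i t) (s $ i) \<le> ennreal (?S i) * ennreal (tw (?S i * \<bar>t\<bar> - node a \<mu> i))"
        using s0[of i] by (simp add: ennpow_ennreal ennreal_mult'[symmetric] ennreal_leI)
    qed
    also have "\<dots> = ennreal (?S i) * (\<integral>\<^sup>+t. ennreal (tw (?S i * \<bar>t\<bar> - node a \<mu> i)) \<partial>lborel)"
      by (rule nn_integral_cmult) measurable
    also have "\<dots> \<le> ennreal (?S i) * ennreal (2 * tw_mass / ?S i)"
      by (intro mult_left_mono nn_integral_tw_weight_1d) simp
    also have "\<dots> = ennreal (2 * tw_mass)"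
      using tw_mass_nonneg by (simp add: ennreal_mult'[symmetric])
    finally have "ennpow (\<integral>\<^sup>+t. ennpow (?f i t) (s $ i) \<partial>lborel) (1 / s $ i) \<le> ennpow (ennreal (2 * tw_mass)) (1 / s $ i)"
      using s0[of i] by (intro ennpow_mono) auto
    also have "\<dots> = ennreal ((2 * tw_mass) powr (1 / s $ i))" using s0[of i] tw_mass_nonneg by (simp add: ennpow_ennreal)
    finally show "ennpow (\<integral>\<^sup>+t. ennpow (?f i t) (s $ i) \<partial>lborel) (1 / s $ i) \<le> ennreal ((2 * tw_mass) powr (1 / s $ i))" .
  qed
  also have "\<dots> = ennreal (\<Prod>i\<in>(UNIV::'d set). (2 * tw_mass) powr (1 / s $ i))" by (rule prod_ennreal) simp
  finally show "mass s {\<mu>} \<le> ennreal (\<Prod>i\<in>(UNIV::'d set). (2 * tw_mass) powr (1 / s $ i))" .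
qed

text \<open>The label with all entries 2 is an outer one, so these triples are brushlet indices, and
  level 0 removes all scaling factors.\<close>

definition ray :: "'d \<Rightarrow> nat \<Rightarrow> 'd brushlet_index" where
  "ray i m = (\<chi> l. if l = i then m else 0, 0, \<chi> l. 2)"

definition line :: "'d \<Rightarrow> nat \<Rightarrow> 'd brushlet_index set" where
  "line i N = ray i ` {..<N}"

lemma inj_ray: "inj_on (ray i) S"
  by (rule inj_onI) (auto simp: ray_def vec_eq_iff split: if_splits)

lemma line_props: "line i N \<subseteq> brushlet_indices" "finite (line i N)" "card (line i N) = N"
  unfolding line_def card_image[OF inj_ray] by (auto simp: ray_def brushlet_indices_def)

text \<open>The sum over a line factors into one-dimensional sums, of which only the one in
  direction \<open>i\<close> has \<open>N\<close> terms. It is bounded, so its power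
  \<open>s $ i\<close> is at most a constant times the sum itself, whose integral is at most of
  order \<open>N\<close>. The root gives \<open>N powr (1 / s $ i)\<close>, and the other directions
  contribute constants.\<close>

lemma mass_line:
  assumes s: "\<And>l. 1 \<le> s $ l"
  shows "\<exists>C\<ge>0. \<forall>N. mass s (line i N) \<le> ennreal (C * real (card (line i N)) powr (1 / s $ i))"
proof -
  define \<delta> where "\<delta> = gap (\<chi> l. 2)"
  have \<delta>: "0 < \<delta> l" for l unfolding \<delta>_def by (rule gap_pos) simp
  define H where "H l = (1 + \<delta> l)\<^sup>2 * tw_mass / \<delta> l" for l
  have H0: "0 \<le> H l" for l using \<delta>[of l] tw_mass_nonneg by (simp add: H_def)
  define C where "C = (\<Prod>l\<in>UNIV. (H l powr (s $ l - 1) * (2 * tw_mass)) powr (1 / s $ l))"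
  have C0: "0 \<le> C" unfolding C_def by (intro prod_nonneg) simp
  have s0: "0 < s $ l" for l using s[of l] by linarith
  have "mass s (line i N) \<le> ennreal (C * real (card (line i N)) powr (1 / s $ i))" for N
  proof -
    \<comment> \<open>The one-element sets in the other directions give all factors the same
      shape.\<close>
    define B where "B l = (if l = i then {..<N} else {0})" for l
    have Bf: "finite (B l)" for l by (simp add: B_def)
    define f where "f l t = (\<Sum>m\<in>B l. tw (\<bar>t\<bar> - \<delta> l * (real m + 1 / 2)))" for l t
    have f0: "0 \<le> f l t" for l t unfolding f_def by (intro sum_nonneg) simp
    have fH: "f l t \<le> H l" for l t unfolding f_def H_def by (rule sum_tw_bounded[OF \<delta> Bf])
    have [measurable]: "f l \<in> borel_measurable borel" for l unfolding f_def[abs_def] by measurable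
    have eq: "ennreal (\<Sum>\<mu>\<in>line i N. 2 powr (real_of_int (level \<mu>) * (\<Sum>i\<in>UNIV. a $ i / s $ i)) * tw_weight a \<mu> x) = (\<Prod>l\<in>UNIV. ennreal (f l (x $ l)))" for x
    proof -
      have tr: "tw_weight a (ray i m) x = tw (\<bar>x $ i\<bar> - \<delta> i * (real m + 1 / 2)) * (\<Prod>l\<in>UNIV - {i}. f l (x $ l))" for m
        unfolding tw_weight_def ray_def node_gap \<delta>_def[symmetric]
        by (subst prod.remove[of UNIV i]) (auto simp: f_def B_def intro!: prod.cong)
      have "(\<Sum>\<mu>\<in>line i N. 2 powr (real_of_int (level \<mu>) * (\<Sum>i\<in>UNIV. a $ i / s $ i)) * tw_weight a \<mu> x) = (\<Sum>m<N. tw_weight a (ray i m) x)"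
        unfolding line_def by (subst sum.reindex[OF inj_ray]) (simp add: ray_def)
      also have "\<dots> = f i (x $ i) * (\<Prod>l\<in>UNIV - {i}. f l (x $ l))"
        unfolding tr sum_distrib_right[symmetric] by (simp add: f_def B_def)
      also have "\<dots> = (\<Prod>l\<in>UNIV. f l (x $ l))" by (rule prod.remove[symmetric]) auto
      finally show ?thesis by (simp add: prod_ennreal f0)
    qed
    have "mass s (line i N) = (\<Prod>l\<in>UNIV. ennpow (\<integral>\<^sup>+t. ennpow (ennreal (f l t)) (s $ l) \<partial>lborel) (1 / s $ l))"
      unfolding mass_def eq by (rule mixed_norm_prod[OF s0]) measurable
    also have "\<dots> \<le> (\<Prod>l\<in>UNIV. ennreal ((H l powr (s $ l - 1) * (2 * tw_mass)) powr (1 / s $ l) * real (card (B l)) powr (1 / s $ l)))"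
    proof (intro prod_mono_ennreal)
      fix l
      have "(\<integral>\<^sup>+t. ennpow (ennreal (f l t)) (s $ l) \<partial>lborel) \<le> (\<integral>\<^sup>+t. ennreal (H l powr (s $ l - 1)) * ennreal (f l t) \<partial>lborel)"
      proof (rule nn_integral_mono)
        fix t
        have "f l t powr (s $ l) = f l t powr (s $ l - 1) * f l t"
          using f0[of l t] by (cases "f l t = 0") (simp_all add: powr_diff)
        also have "\<dots> \<le> H l powr (s $ l - 1) * f l t" using s[of l] f0 fH by (intro mult_right_mono powr_mono2) auto
        finally show "ennpow (ennreal (f l t)) (s $ l) \<le> ennreal (H l powr (s $ l - 1)) * ennreal (f l t)"
          using s0[of l] f0 by (simp add: ennpow_ennreal ennreal_mult'[symmetric] ennreal_leI)
      qed
      also have "\<dots> = ennreal (H l powr (s $ l - 1)) * (\<integral>\<^sup>+t. ennreal (f l t) \<partial>lborel)"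
        by (rule nn_integral_cmult) measurable
      also have "(\<integral>\<^sup>+t. ennreal (f l t) \<partial>lborel) = (\<Sum>m\<in>B l. (\<integral>\<^sup>+t. ennreal (tw (\<bar>t\<bar> - \<delta> l * (real m + 1 / 2))) \<partial>lborel))"
        unfolding f_def by (subst nn_integral_sum[symmetric]) (simp_all add: sum_ennreal)
      also have "ennreal (H l powr (s $ l - 1)) * \<dots> \<le> ennreal (H l powr (s $ l - 1)) * (\<Sum>m\<in>B l. ennreal (2 * tw_mass))"
        using nn_integral_tw_abs[of 1] by (intro mult_left_mono sum_mono) auto
      also have "\<dots> = ennreal (H l powr (s $ l - 1) * (2 * tw_mass) * real (card (B l)))"
        using tw_mass_nonneg by (simp add: ennreal_mult ennreal_of_nat_eq_real_of_nat mult_ac)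
      finally have "ennpow (\<integral>\<^sup>+t. ennpow (ennreal (f l t)) (s $ l) \<partial>lborel) (1 / s $ l) \<le> ennpow (ennreal (H l powr (s $ l - 1) * (2 * tw_mass) * real (card (B l)))) (1 / s $ l)"
        using s0[of l] by (intro ennpow_mono) auto
      also have "\<dots> = ennreal ((H l powr (s $ l - 1) * (2 * tw_mass)) powr (1 / s $ l) * real (card (B l)) powr (1 / s $ l))"
        using s0[of l] tw_mass_nonneg by (subst ennpow_ennreal) (simp_all add: powr_mult)
      finally show "ennpow (\<integral>\<^sup>+t. ennpow (ennreal (f l t)) (s $ l) \<partial>lborel) (1 / s $ l) \<le> ennreal ((H l powr (s $ l - 1) * (2 * tw_mass)) powr (1 / s $ l) * real (card (B l)) powr (1 / s $ l))" .
    qed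
    also have "\<dots> = ennreal (C * (\<Prod>l\<in>UNIV. real (card (B l)) powr (1 / s $ l)))"
      by (subst prod_ennreal) (simp_all add: C_def prod.distrib)
    also have "(\<Prod>l\<in>UNIV. real (card (B l)) powr (1 / s $ l)) = real N powr (1 / s $ i)"
      by (subst prod.remove[of UNIV i]) (auto simp: B_def intro!: prod.neutral)
    finally show ?thesis by (simp only: line_props)
  qed
  then show ?thesis using C0 by blast
qed

text \<open>\<Gamma> is enlarged to all labels times a cube of frequency indices. The enlarged sum
  factors into one-dimensional sums, each of which \<open>sum_tw_bounded\<close> controls
  independently of the size of the cube.\<close>

lemma sum_tw_weight_bounded:
  "\<exists>B>0. \<forall>\<Gamma> j x. \<Gamma> \<subseteq> brushlet_indices \<longrightarrow> finite \<Gamma> \<longrightarrow> (\<forall>\<mu>\<in>\<Gamma>. level \<mu> = j) \<longrightarrow> (\<Sum>\<mu>\<in>\<Gamma>. tw_weight a \<mu> x) \<le> B"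
proof -
  let ?L = "{k :: (int, 'd) vec. \<forall>i. k $ i \<in> labels}"
  define H where "H k = (\<Prod>i\<in>UNIV. (1 + gap k i)\<^sup>2 * tw_mass / gap k i)" for k
  have H0: "0 \<le> H k" if "k \<in> ?L" for k
    unfolding H_def
  proof (intro prod_nonneg ballI divide_nonneg_nonneg mult_nonneg_nonneg zero_le_power2 tw_mass_nonneg)
    fix i
    show "0 \<le> gap k i" using that by (intro less_imp_le gap_pos) simp
  qed
  \<comment> \<open>The summand 1 makes the bound strictly positive, as
    \<open>geometric_power_sum\<close> demands.\<close>
  have main: "(\<Sum>\<mu>\<in>\<Gamma>. tw_weight a \<mu> x) \<le> (\<Sum>k\<in>?L. H k) + 1"
    if \<Gamma>: "\<Gamma> \<subseteq> brushlet_indices" "finite \<Gamma>" "\<And>\<mu>. \<mu> \<in> \<Gamma> \<Longrightarrow> level \<mu> = j" for \<Gamma> j x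
  proof -
    have "finite ((\<lambda>(\<mu>, i). fst \<mu> $ i) ` (\<Gamma> \<times> (UNIV :: 'd set)))" using \<Gamma>(2) by simp
    then obtain M where M0: "\<forall>m\<in>(\<lambda>(\<mu>, i). fst \<mu> $ i) ` (\<Gamma> \<times> (UNIV :: 'd set)). m < M"
      unfolding finite_nat_set_iff_bounded by (elim exE)
    have M: "fst \<mu> $ i < M" if "\<mu> \<in> \<Gamma>" for \<mu> i
      using bspec[OF M0 imageI[of "(\<mu>, i)"]] that by simp
    let ?P = "Pi\<^sub>E (UNIV :: 'd set) (\<lambda>_. {..<M})"
    let ?h = "\<lambda>(k, g). (vec_lambda g, j, k)"
    have inj: "inj_on ?h (?L \<times> ?P)" by (rule inj_onI) (auto simp: vec_lambda_inject)
    have finP: "finite ?P" by (intro finite_PiE) auto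
    have sub: "\<Gamma> \<subseteq> ?h ` (?L \<times> ?P)"
    proof
      fix \<mu> assume \<mu>: "\<mu> \<in> \<Gamma>"
      obtain n j' k where \<mu>': "\<mu> = (n, j', k)" by (cases \<mu>)
      have "\<mu> = ?h (k, vec_nth n)" using \<Gamma>(3)[OF \<mu>] by (simp add: \<mu>')
      moreover have "k \<in> ?L" using indices_labels[OF subsetD[OF \<Gamma>(1) \<mu>]] by (simp add: \<mu>')
      moreover have "vec_nth n \<in> ?P" using M[OF \<mu>] by (simp add: \<mu>' PiE_iff)
      ultimately show "\<mu> \<in> ?h ` (?L \<times> ?P)" by (intro image_eqI[where x="(k, vec_nth n)"] SigmaI)
    qed
    have "(\<Sum>\<mu>\<in>\<Gamma>. tw_weight a \<mu> x) \<le> (\<Sum>\<mu>\<in>?h ` (?L \<times> ?P). tw_weight a \<mu> x)"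
      by (intro sum_mono2 sub finite_imageI finite_cartesian_product finite_labels finP) simp
    also have "\<dots> = (\<Sum>(k, g)\<in>?L \<times> ?P. tw_weight a (vec_lambda g, j, k) x)"
      by (subst sum.reindex[OF inj]) (simp add: comp_def split_beta)
    also have "\<dots> = (\<Sum>k\<in>?L. \<Sum>g\<in>?P. tw_weight a (vec_lambda g, j, k) x)"
      by (rule sum.cartesian_product[symmetric])
    also have "\<dots> = (\<Sum>k\<in>?L. \<Prod>i\<in>UNIV. \<Sum>m<M. tw (scl a j i * \<bar>x $ i\<bar> - gap k i * (real m + 1 / 2)))"
      by (subst prod_sum_PiE) (simp_all add: tw_weight_def node_gap)
    also have "\<dots> \<le> (\<Sum>k\<in>?L. H k)"
      unfolding H_def
    proof (intro sum_mono prod_mono conjI sum_nonneg)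
      fix k i assume "k \<in> ?L"
      then have "0 < gap k i" by (intro gap_pos) simp
      then show "(\<Sum>m<M. tw (scl a j i * \<bar>x $ i\<bar> - gap k i * (real m + 1 / 2))) \<le> (1 + gap k i)\<^sup>2 * tw_mass / gap k i"
        by (rule sum_tw_bounded) simp
    qed simp
    finally show ?thesis by simp
  qed
  have pos: "0 < (\<Sum>k\<in>?L. H k) + 1" using sum_nonneg[of ?L H] H0 by (simp add: add_nonneg_pos)
  show ?thesis
    by (intro exI[of _ "(\<Sum>k\<in>?L. H k) + 1"] conjI allI impI pos) (rule main, assumption+, erule (1) bspec)
qed

lemma nn_integral_tw_weight:
  "(\<integral>\<^sup>+x. ennreal (tw_weight a \<mu> x) \<partial>lborel) \<le> ennreal ((2 * tw_mass) ^ CARD('d) * 2 powr (- (real_of_int (level \<mu>) * \<nu>)))"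
proof -
  let ?S = "scl a (level \<mu>)"
  have "(\<integral>\<^sup>+x. ennreal (tw_weight a \<mu> x) \<partial>lborel) = (\<integral>\<^sup>+x. (\<Prod>i\<in>UNIV. ennreal (tw (?S i * \<bar>x $ i\<bar> - node a \<mu> i))) \<partial>lborel)"
    unfolding tw_weight_def by (simp add: prod_ennreal)
  also have "\<dots> = (\<Prod>i\<in>UNIV. \<integral>\<^sup>+t. ennreal (tw (?S i * \<bar>t\<bar> - node a \<mu> i)) \<partial>lborel)"
    by (rule nn_integral_prod_vec) measurable
  also have "\<dots> \<le> (\<Prod>i\<in>UNIV. ennreal (2 * tw_mass / ?S i))"
    by (intro prod_mono_ennreal nn_integral_tw_weight_1d)
  also have "\<dots> = ennreal (\<Prod>i\<in>UNIV. 2 * tw_mass / ?S i)"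
    using tw_mass_nonneg by (intro prod_ennreal) simp
  also have "(\<Prod>i\<in>UNIV. 2 * tw_mass / ?S i) = (\<Prod>i\<in>(UNIV::'d set). 2 * tw_mass) / (\<Prod>i\<in>UNIV. ?S i)"
    by (rule prod_dividef)
  also have "\<dots> = (2 * tw_mass) ^ CARD('d) * 2 powr (- (real_of_int (level \<mu>) * \<nu>))"
    by (simp only: prod_constant prod_scl powr_minus divide_inverse)
  finally show ?thesis .
qed

text \<open>For equal exponents the mixed norm is an ordinary Lebesgue norm. Grouped by levels, the
  integrand is a geometric sum with bounded coefficients, so its power \<sigma> is bounded by the
  sum of the powers of the scales. That sum is linear in the weights and each normalized weight has
  bounded integral, so only the number of indices matters.\<close>

lemma mass_const:
  assumes s: "\<And>i. s $ i = \<sigma>" "1 \<le> \<sigma>"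
  shows "\<exists>C\<ge>0. \<forall>\<Gamma>. \<Gamma> \<subseteq> brushlet_indices \<longrightarrow> finite \<Gamma> \<longrightarrow> mass s \<Gamma> \<le> ennreal (C * real (card \<Gamma>) powr (1 / \<sigma>))"
proof -
  define b where "b = 2 powr (\<nu> / \<sigma>)"
  have b: "1 < b" unfolding b_def using dim_ge_1 s(2) by simp
  obtain B where B: "0 < B" "\<And>\<Gamma> j x. \<Gamma> \<subseteq> brushlet_indices \<Longrightarrow> finite \<Gamma> \<Longrightarrow> (\<forall>\<mu>\<in>\<Gamma>. level \<mu> = j) \<Longrightarrow> (\<Sum>\<mu>\<in>\<Gamma>. tw_weight a \<mu> x) \<le> B"
    using sum_tw_weight_bounded by blast
  obtain C where C: "0 \<le> C" "\<And>J \<theta>. finite J \<Longrightarrow> (\<forall>j\<in>J. 0 \<le> \<theta> j \<and> \<theta> j \<le> B) \<Longrightarrow>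
    (\<Sum>j\<in>J. b powr real_of_int j * \<theta> j) powr \<sigma> \<le> C * (\<Sum>j\<in>J. b powr (real_of_int j * \<sigma>) * \<theta> j)"
    using geometric_power_sum[OF b s(2) B(1)] by blast
  let ?m = "(2 * tw_mass) ^ CARD('d)"
  have m0: "0 \<le> ?m" using tw_mass_nonneg by simp
  have "mass s \<Gamma> \<le> ennreal ((C * ?m) powr (1 / \<sigma>) * real (card \<Gamma>) powr (1 / \<sigma>))"
    if \<Gamma>: "\<Gamma> \<subseteq> brushlet_indices" "finite \<Gamma>" for \<Gamma>
  proof -
    have bp: "2 powr (real_of_int j * (\<Sum>i\<in>UNIV. a $ i / s $ i)) = b powr real_of_int j" for j
      unfolding b_def powr_powr by (simp add: s(1) aniso_dim_def sum_divide_distrib[symmetric] mult.commute)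
    have bs: "b powr (real_of_int j * \<sigma>) = 2 powr (real_of_int j * \<nu>)" for j
      unfolding b_def powr_powr using s(2) by (simp add: mult.commute)
    let ?F = "\<lambda>x. \<Sum>\<mu>\<in>\<Gamma>. b powr real_of_int (level \<mu>) * tw_weight a \<mu> x"
    have F0: "0 \<le> ?F x" for x by (intro sum_nonneg) simp
    have pt: "?F x powr \<sigma> \<le> C * (\<Sum>\<mu>\<in>\<Gamma>. 2 powr (real_of_int (level \<mu>) * \<nu>) * tw_weight a \<mu> x)" for x
    proof -
      define G where "G j = {\<mu>. \<mu> \<in> \<Gamma> \<and> level \<mu> = j}" for j
      define \<theta> where "\<theta> j = (\<Sum>\<mu>\<in>G j. tw_weight a \<mu> x)" for j
      \<comment> \<open>The factor \<open>u\<close> is arbitrary because both sides of the estimate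
        are regrouped, with different exponents.\<close>
      have group: "(\<Sum>\<mu>\<in>\<Gamma>. u (level \<mu>) * tw_weight a \<mu> x) = (\<Sum>j\<in>level ` \<Gamma>. u j * \<theta> j)" for u
      proof -
        have "(\<Sum>\<mu>\<in>\<Gamma>. u (level \<mu>) * tw_weight a \<mu> x) = (\<Sum>j\<in>level ` \<Gamma>. \<Sum>\<mu>\<in>G j. u (level \<mu>) * tw_weight a \<mu> x)"
          unfolding G_def by (rule sum.image_gen[OF \<Gamma>(2)])
        also have "\<dots> = (\<Sum>j\<in>level ` \<Gamma>. u j * \<theta> j)"
          unfolding \<theta>_def sum_distrib_left by (intro sum.cong refl) (simp add: G_def)
        finally show ?thesis .
      qed
      have "0 \<le> \<theta> j \<and> \<theta> j \<le> B" for j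
      proof
        show "0 \<le> \<theta> j" unfolding \<theta>_def by (intro sum_nonneg) simp
        show "\<theta> j \<le> B" unfolding \<theta>_def
          by (rule B(2)[of "G j" j x]) (use \<Gamma> in \<open>auto simp: G_def\<close>)
      qed
      then have "(\<Sum>j\<in>level ` \<Gamma>. b powr real_of_int j * \<theta> j) powr \<sigma> \<le> C * (\<Sum>j\<in>level ` \<Gamma>. b powr (real_of_int j * \<sigma>) * \<theta> j)"
        using \<Gamma>(2) by (intro C(2)) auto
      then show ?thesis unfolding bs group[symmetric] .
    qed
    have "mass s \<Gamma> = ennpow (\<integral>\<^sup>+x. ennpow (ennreal (?F x)) \<sigma> \<partial>lborel) (1 / \<sigma>)"
      unfolding mass_def bp using s by (intro mixed_norm_const) (auto simp: measurable_tw_weight)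
    also have "\<dots> \<le> ennpow (ennreal (C * ?m * real (card \<Gamma>))) (1 / \<sigma>)"
    proof (rule ennpow_mono)
      have "(\<integral>\<^sup>+x. ennpow (ennreal (?F x)) \<sigma> \<partial>lborel) \<le> (\<integral>\<^sup>+x. (\<Sum>\<mu>\<in>\<Gamma>. ennreal (C * 2 powr (real_of_int (level \<mu>) * \<nu>)) * ennreal (tw_weight a \<mu> x)) \<partial>lborel)"
      proof (rule nn_integral_mono)
        fix x
        have "ennpow (ennreal (?F x)) \<sigma> \<le> ennreal (C * (\<Sum>\<mu>\<in>\<Gamma>. 2 powr (real_of_int (level \<mu>) * \<nu>) * tw_weight a \<mu> x))"
          using pt[of x] s(2) F0[of x] by (simp add: ennpow_ennreal ennreal_leI)
        also have "\<dots> = (\<Sum>\<mu>\<in>\<Gamma>. ennreal (C * 2 powr (real_of_int (level \<mu>) * \<nu>)) * ennreal (tw_weight a \<mu> x))"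
          unfolding sum_distrib_left using C(1)
          by (subst sum_ennreal[symmetric]) (simp_all add: ennreal_mult'[symmetric] mult.assoc)
        finally show "ennpow (ennreal (?F x)) \<sigma> \<le> (\<Sum>\<mu>\<in>\<Gamma>. ennreal (C * 2 powr (real_of_int (level \<mu>) * \<nu>)) * ennreal (tw_weight a \<mu> x))" .
      qed
      also have "\<dots> = (\<Sum>\<mu>\<in>\<Gamma>. (\<integral>\<^sup>+x. ennreal (C * 2 powr (real_of_int (level \<mu>) * \<nu>)) * ennreal (tw_weight a \<mu> x) \<partial>lborel))"
        by (rule nn_integral_sum) (simp add: measurable_tw_weight)
      also have "\<dots> = (\<Sum>\<mu>\<in>\<Gamma>. ennreal (C * 2 powr (real_of_int (level \<mu>) * \<nu>)) * (\<integral>\<^sup>+x. ennreal (tw_weight a \<mu> x) \<partial>lborel))"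
        by (intro sum.cong refl nn_integral_cmult) (simp add: measurable_tw_weight)
      also have "\<dots> \<le> (\<Sum>\<mu>\<in>\<Gamma>. ennreal (C * ?m))"
      proof (rule sum_mono)
        fix \<mu>
        have "ennreal (C * 2 powr (real_of_int (level \<mu>) * \<nu>)) * (\<integral>\<^sup>+x. ennreal (tw_weight a \<mu> x) \<partial>lborel)
          \<le> ennreal (C * 2 powr (real_of_int (level \<mu>) * \<nu>)) * ennreal (?m * 2 powr (- (real_of_int (level \<mu>) * \<nu>)))"
          by (intro mult_left_mono nn_integral_tw_weight) simp
        also have "\<dots> = ennreal (C * ?m * (2 powr (real_of_int (level \<mu>) * \<nu>) * 2 powr (- (real_of_int (level \<mu>) * \<nu>))))"
          using C(1) m0 by (subst ennreal_mult'[symmetric]) (simp_all add: mult_ac)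
        also have "2 powr (real_of_int (level \<mu>) * \<nu>) * 2 powr (- (real_of_int (level \<mu>) * \<nu>)) = 1"
          unfolding powr_add[symmetric] by simp
        finally show "ennreal (C * 2 powr (real_of_int (level \<mu>) * \<nu>)) * (\<integral>\<^sup>+x. ennreal (tw_weight a \<mu> x) \<partial>lborel) \<le> ennreal (C * ?m)" by simp
      qed
      also have "\<dots> = ennreal (C * ?m * real (card \<Gamma>))"
        using C(1) m0 by (simp add: ennreal_mult ennreal_of_nat_eq_real_of_nat mult_ac)
      finally show "(\<integral>\<^sup>+x. ennpow (ennreal (?F x)) \<sigma> \<partial>lborel) \<le> ennreal (C * ?m * real (card \<Gamma>))" .
    qed (use s in simp)
    also have "\<dots> = ennreal ((C * ?m) powr (1 / \<sigma>) * real (card \<Gamma>) powr (1 / \<sigma>))"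
      using s(2) C(1) m0 by (simp add: ennpow_ennreal powr_mult)
    finally show ?thesis .
  qed
  then show ?thesis by (intro exI[of _ "(C * ?m) powr (1 / \<sigma>)"]) auto
qed

section \<open>Two-sided norm estimates\<close>

text \<open>Up to constants, the normalizing factor of a brushlet of level \<open>j\<close> is \<open>2 powr (- j * gain p \<beta>)\<close>.\<close>

definition gain :: "'d rvec \<Rightarrow> real \<Rightarrow> real" where
  "gain p \<beta> = \<beta> + \<nu> / 2 - (\<Sum>i\<in>UNIV. a $ i / p $ i)"

text \<open>The pointwise bound for the square function is put under the mixed norm. In it the
  exponent \<open>t * (\<beta> + \<nu> / 2)\<close> splits into \<open>t * gain p \<beta>\<close>,
  which meets the bound on the coefficients, and the normalizing exponent of
  \<open>mass\<close>.\<close>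

lemma norm_upper:
  assumes p: "\<And>i. 0 < p $ i" and q: "0 < q" and t: "0 < t" "t \<le> 1" "t \<le> q"
  shows "\<exists>C\<ge>0. \<forall>c \<Gamma> M. \<Gamma> \<subseteq> brushlet_indices \<longrightarrow> finite \<Gamma> \<longrightarrow>
    (\<forall>\<mu>\<in>\<Gamma>. norm (c \<mu>) * 2 powr (real_of_int (level \<mu>) * gain p \<beta>) \<le> M) \<longrightarrow>
    ennpow (mixed_norm p (sqfun q \<beta> (comb c \<Gamma>))) t \<le> ennreal (C * M powr t) * mass ((1 / t) *\<^sub>R p) \<Gamma>"
proof -
  obtain C where C: "0 \<le> C" "\<And>c \<Gamma> x. \<Gamma> \<subseteq> brushlet_indices \<Longrightarrow> finite \<Gamma> \<Longrightarrow>
    ennpow (sqfun q \<beta> (comb c \<Gamma>) x) t \<le> ennreal (C * (\<Sum>\<mu>\<in>\<Gamma>. norm (c \<mu>) powr t *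
      2 powr (real_of_int (level \<mu>) * (t * (\<beta> + \<nu> / 2))) * tw_weight a \<mu> x))"
    using sqfun_upper[OF q t, of \<beta>] by blast
  let ?s = "(1 / t) *\<^sub>R p"
  let ?e = "\<Sum>i\<in>UNIV. a $ i / ?s $ i"
  have s0: "0 < ?s $ i" for i using p t by simp
  have e: "?e = t * (\<Sum>i\<in>UNIV. a $ i / p $ i)" using t by (simp add: sum_distrib_left mult_ac)
  have main: "ennpow (mixed_norm p (sqfun q \<beta> (comb c \<Gamma>))) t \<le> ennreal (C * M powr t) * mass ?s \<Gamma>"
    if \<Gamma>: "\<Gamma> \<subseteq> brushlet_indices" "finite \<Gamma>" and M: "\<And>\<mu>. \<mu> \<in> \<Gamma> \<Longrightarrow> norm (c \<mu>) * 2 powr (real_of_int (level \<mu>) * gain p \<beta>) \<le> M" for c \<Gamma> M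
  proof -
    let ?F = "\<lambda>x. \<Sum>\<mu>\<in>\<Gamma>. 2 powr (real_of_int (level \<mu>) * ?e) * tw_weight a \<mu> x"
    have "ennpow (mixed_norm p (sqfun q \<beta> (comb c \<Gamma>))) t = mixed_norm ?s (\<lambda>x. ennpow (sqfun q \<beta> (comb c \<Gamma>) x) t)"
      by (rule mixed_norm_power[OF p t(1), symmetric])
    also have "\<dots> \<le> mixed_norm ?s (\<lambda>x. ennreal (C * M powr t) * ennreal (?F x))"
    proof (rule mixed_norm_mono[OF s0])
      fix x
      have "(\<Sum>\<mu>\<in>\<Gamma>. norm (c \<mu>) powr t * 2 powr (real_of_int (level \<mu>) * (t * (\<beta> + \<nu> / 2))) * tw_weight a \<mu> x)
        \<le> (\<Sum>\<mu>\<in>\<Gamma>. M powr t * (2 powr (real_of_int (level \<mu>) * ?e) * tw_weight a \<mu> x))"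
      proof (rule sum_mono)
        fix \<mu> assume \<mu>: "\<mu> \<in> \<Gamma>"
        let ?j = "real_of_int (level \<mu>)"
        have "?j * (t * (\<beta> + \<nu> / 2)) = ?j * gain p \<beta> * t + ?j * ?e"
          unfolding e gain_def by (simp add: algebra_simps)
        then have "norm (c \<mu>) powr t * 2 powr (?j * (t * (\<beta> + \<nu> / 2))) = (norm (c \<mu>) * 2 powr (?j * gain p \<beta>)) powr t * 2 powr (?j * ?e)"
          by (simp only: powr_add powr_mult powr_powr mult.assoc norm_ge_zero powr_ge_zero)
        also have "\<dots> \<le> M powr t * 2 powr (?j * ?e)"
          using t M[OF \<mu>] by (intro mult_right_mono powr_mono2) auto
        finally have "norm (c \<mu>) powr t * 2 powr (?j * (t * (\<beta> + \<nu> / 2))) * tw_weight a \<mu> x \<le> M powr t * 2 powr (?j * ?e) * tw_weight a \<mu> x"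
          by (rule mult_right_mono) simp
        then show "norm (c \<mu>) powr t * 2 powr (?j * (t * (\<beta> + \<nu> / 2))) * tw_weight a \<mu> x \<le> M powr t * (2 powr (?j * ?e) * tw_weight a \<mu> x)"
          by (simp only: mult.assoc)
      qed
      also have "\<dots> = M powr t * ?F x" by (rule sum_distrib_left[symmetric])
      finally have "C * (\<Sum>\<mu>\<in>\<Gamma>. norm (c \<mu>) powr t * 2 powr (real_of_int (level \<mu>) * (t * (\<beta> + \<nu> / 2))) * tw_weight a \<mu> x) \<le> C * (M powr t * ?F x)"
        using C(1) by (rule mult_left_mono)
      then have "ennpow (sqfun q \<beta> (comb c \<Gamma>) x) t \<le> ennreal (C * (M powr t * ?F x))"
        by (intro order_trans[OF C(2)[OF \<Gamma>] ennreal_leI])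
      also have "\<dots> = ennreal (C * M powr t) * ennreal (?F x)"
        using C(1) by (simp only: mult.assoc[symmetric] ennreal_mult' mult_nonneg_nonneg powr_ge_zero)
      finally show "ennpow (sqfun q \<beta> (comb c \<Gamma>) x) t \<le> ennreal (C * M powr t) * ennreal (?F x)" .
    qed
    also have "\<dots> = ennreal (C * M powr t) * mass ?s \<Gamma>"
      unfolding mass_def by (rule mixed_norm_cmult[OF s0]) (simp add: measurable_tw_weight)
    finally show ?thesis .
  qed
  show ?thesis
    by (intro exI[of _ C] conjI allI impI C(1)) (rule main, assumption+, erule (1) bspec)
qed

text \<open>Summation over \<Gamma> collects the integrals against single weights into one integral
  against their sum, to which Hoelder's inequality applies. The factors match because the conjugate
  exponents satisfy \<open>?e = \<nu> - r * (\<Sum>i\<in>UNIV. a $ i / p $ i)\<close>.\<close>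

lemma norm_lower:
  assumes p: "\<And>i. 0 < p $ i" and q: "0 < q" and r: "0 < r" "r < 1" "\<And>i. r < p $ i"
  shows "\<exists>C\<ge>0. \<forall>c \<Gamma> m. \<Gamma> \<subseteq> brushlet_indices \<longrightarrow> finite \<Gamma> \<longrightarrow> 0 \<le> m \<longrightarrow>
    (\<forall>\<mu>\<in>\<Gamma>. m \<le> norm (c \<mu>) * 2 powr (real_of_int (level \<mu>) * gain p \<beta>)) \<longrightarrow>
    ennreal (real (card \<Gamma>) * m powr r) \<le> ennreal C * ennpow (mixed_norm p (sqfun q \<beta> (comb c \<Gamma>))) r * mass (\<chi> i. 1 / (1 - r / p $ i)) \<Gamma>"
proof -
  obtain C where C: "0 \<le> C" "\<And>c \<Gamma> \<mu>. \<mu> \<in> \<Gamma> \<Longrightarrow> \<Gamma> \<subseteq> brushlet_indices \<Longrightarrow> finite \<Gamma> \<Longrightarrow>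
    ennreal (norm (c \<mu>) powr r) \<le> ennreal (C * 2 powr (real_of_int (level \<mu>) * (\<nu> * (1 - r / 2) - \<beta> * r))) *
      (\<integral>\<^sup>+x. ennpow (sqfun q \<beta> (comb c \<Gamma>) x) r * ennreal (tw_weight a \<mu> x) \<partial>lborel)"
    using coefficient_le_sqfun[OF r(1,2) q, of \<beta>] by blast
  let ?P = "(1 / r) *\<^sub>R p" and ?P' = "\<chi> i. 1 / (1 - r / p $ i)"
  let ?e = "\<Sum>i\<in>UNIV. a $ i / ?P' $ i"
  have rp: "r / p $ i < 1" for i using r(3)[of i] p[of i] by (simp add: divide_simps)
  have P: "1 < ?P $ i" "1 / ?P $ i + 1 / ?P' $ i = 1" for i
    using r p[of i] rp[of i] by (simp_all add: divide_simps)
  have e: "?e = \<nu> - r * (\<Sum>i\<in>UNIV. a $ i / p $ i)"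
    by (simp add: aniso_dim_def sum_subtractf[symmetric] sum_distrib_left right_diff_distrib mult_ac)
  have main: "ennreal (real (card \<Gamma>) * m powr r) \<le> ennreal C * ennpow (mixed_norm p (sqfun q \<beta> (comb c \<Gamma>))) r * mass ?P' \<Gamma>"
    if \<Gamma>: "\<Gamma> \<subseteq> brushlet_indices" "finite \<Gamma>" and m: "0 \<le> m" "\<And>\<mu>. \<mu> \<in> \<Gamma> \<Longrightarrow> m \<le> norm (c \<mu>) * 2 powr (real_of_int (level \<mu>) * gain p \<beta>)" for c \<Gamma> m
  proof -
    let ?G = "\<lambda>x. ennpow (sqfun q \<beta> (comb c \<Gamma>) x) r"
    let ?F = "\<lambda>x. \<Sum>\<mu>\<in>\<Gamma>. 2 powr (real_of_int (level \<mu>) * ?e) * tw_weight a \<mu> x"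
    note [measurable] = measurable_sqfun[OF \<Gamma> q] measurable_tw_weight
    have each: "ennreal (m powr r) \<le> ennreal C * (\<integral>\<^sup>+x. ?G x * ennreal (2 powr (real_of_int (level \<mu>) * ?e) * tw_weight a \<mu> x) \<partial>lborel)"
      if \<mu>: "\<mu> \<in> \<Gamma>" for \<mu>
    proof -
      let ?j = "real_of_int (level \<mu>)"
      have "m powr r \<le> (norm (c \<mu>) * 2 powr (?j * gain p \<beta>)) powr r" using r m(1) m(2)[OF \<mu>] by (intro powr_mono2) auto
      also have "\<dots> = 2 powr (?j * gain p \<beta> * r) * norm (c \<mu>) powr r"
        by (simp only: powr_mult powr_powr norm_ge_zero powr_ge_zero mult.commute)
      finally have "ennreal (m powr r) \<le> ennreal (2 powr (?j * gain p \<beta> * r)) * ennreal (norm (c \<mu>) powr r)"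
        by (simp only: ennreal_mult'[OF powr_ge_zero, symmetric] ennreal_leI)
      also have "\<dots> \<le> ennreal (2 powr (?j * gain p \<beta> * r)) * (ennreal (C * 2 powr (?j * (\<nu> * (1 - r / 2) - \<beta> * r))) * (\<integral>\<^sup>+x. ?G x * ennreal (tw_weight a \<mu> x) \<partial>lborel))"
        by (intro mult_left_mono C(2)[OF \<mu> \<Gamma>]) simp
      also have "\<dots> = ennreal (2 powr (?j * gain p \<beta> * r) * (C * 2 powr (?j * (\<nu> * (1 - r / 2) - \<beta> * r)))) * (\<integral>\<^sup>+x. ?G x * ennreal (tw_weight a \<mu> x) \<partial>lborel)"
        by (simp only: ennreal_mult'[OF powr_ge_zero] mult.assoc)
      also have "2 powr (?j * gain p \<beta> * r) * (C * 2 powr (?j * (\<nu> * (1 - r / 2) - \<beta> * r))) = C * (2 powr (?j * gain p \<beta> * r) * 2 powr (?j * (\<nu> * (1 - r / 2) - \<beta> * r)))"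
        by (simp only: mult_ac)
      also have "2 powr (?j * gain p \<beta> * r) * 2 powr (?j * (\<nu> * (1 - r / 2) - \<beta> * r)) = 2 powr (?j * ?e)"
        unfolding powr_add[symmetric] e gain_def by (simp add: algebra_simps)
      also have "ennreal (C * 2 powr (?j * ?e)) * (\<integral>\<^sup>+x. ?G x * ennreal (tw_weight a \<mu> x) \<partial>lborel)
        = ennreal C * (ennreal (2 powr (?j * ?e)) * (\<integral>\<^sup>+x. ?G x * ennreal (tw_weight a \<mu> x) \<partial>lborel))"
        using C(1) by (simp only: ennreal_mult' mult.assoc)
      also have "ennreal (2 powr (?j * ?e)) * (\<integral>\<^sup>+x. ?G x * ennreal (tw_weight a \<mu> x) \<partial>lborel)
        = (\<integral>\<^sup>+x. ennreal (2 powr (?j * ?e)) * (?G x * ennreal (tw_weight a \<mu> x)) \<partial>lborel)"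
        by (rule nn_integral_cmult[symmetric]) measurable
      also have "\<dots> = (\<integral>\<^sup>+x. ?G x * ennreal (2 powr (?j * ?e) * tw_weight a \<mu> x) \<partial>lborel)"
        by (simp only: ennreal_mult'[OF powr_ge_zero] mult.left_commute)
      finally show ?thesis .
    qed
    have "ennreal (real (card \<Gamma>) * m powr r) = (\<Sum>\<mu>\<in>\<Gamma>. ennreal (m powr r))"
      by (simp add: ennreal_mult' ennreal_of_nat_eq_real_of_nat)
    also have "\<dots> \<le> (\<Sum>\<mu>\<in>\<Gamma>. ennreal C * (\<integral>\<^sup>+x. ?G x * ennreal (2 powr (real_of_int (level \<mu>) * ?e) * tw_weight a \<mu> x) \<partial>lborel))"
      by (intro sum_mono each)
    also have "\<dots> = ennreal C * (\<integral>\<^sup>+x. (\<Sum>\<mu>\<in>\<Gamma>. ?G x * ennreal (2 powr (real_of_int (level \<mu>) * ?e) * tw_weight a \<mu> x)) \<partial>lborel)"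
      by (subst nn_integral_sum) (measurable, simp only: sum_distrib_left)
    also have "\<dots> = ennreal C * (\<integral>\<^sup>+x. ?G x * ennreal (?F x) \<partial>lborel)"
      by (simp only: sum_distrib_left[symmetric] sum_ennreal mult_nonneg_nonneg powr_ge_zero tw_weight_nonneg)
    also have "\<dots> \<le> ennreal C * (mixed_norm ?P ?G * mixed_norm ?P' (\<lambda>x. ennreal (?F x)))"
      by (intro mult_left_mono Holder_mixed_norm P) measurable
    also have "mixed_norm ?P ?G = ennpow (mixed_norm p (sqfun q \<beta> (comb c \<Gamma>))) r" by (rule mixed_norm_power[OF p r(1)])
    finally show ?thesis by (simp only: mass_def mult.assoc)
  qed
  show ?thesis
    by (intro exI[of _ C] conjI allI impI C(1)) (rule main, assumption+, erule (1) bspec)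
qed

end

section \<open>Consequences of the quasi-normalization\<close>

context brushlet_system
begin

abbreviation Fnorm :: "'d rvec \<Rightarrow> real \<Rightarrow> real \<Rightarrow> ('d brushlet_index \<Rightarrow> complex) \<Rightarrow> 'd brushlet_index set \<Rightarrow> ennreal" where
  "Fnorm p q \<beta> c \<Gamma> \<equiv> mixed_norm p (sqfun q \<beta> (comb c \<Gamma>))"

text \<open>Both norm estimates are applied to singletons and solved for the coefficient: the upper
  estimate bounds it from below, the lower estimate from above.\<close>

lemma coefficient_bounds:
  assumes p: "\<And>i. 0 < p $ i" and q: "0 < q" and t: "0 < t" "t \<le> 1" "t \<le> q" "\<And>i. t \<le> p $ i"
    and r: "0 < r" "r < 1" "\<And>i. r < p $ i" and K: "1 \<le> K"
    and c: "\<forall>\<mu>\<in>brushlet_indices. ennreal (inverse K) \<le> Fnorm p q \<beta> c {\<mu>} \<and> Fnorm p q \<beta> c {\<mu>} \<le> ennreal K"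
  shows "\<exists>m>0. \<exists>M. \<forall>\<mu>\<in>brushlet_indices. m \<le> norm (c \<mu>) * 2 powr (real_of_int (level \<mu>) * gain p \<beta>) \<and>
    norm (c \<mu>) * 2 powr (real_of_int (level \<mu>) * gain p \<beta>) \<le> M"
proof -
  let ?e = "\<lambda>\<mu>. norm (c \<mu>) * 2 powr (real_of_int (level \<mu>) * gain p \<beta>)"
  let ?s = "(1 / t) *\<^sub>R p" and ?s' = "\<chi> i. 1 / (1 - r / p $ i)"
  have s1: "1 \<le> ?s $ i" for i using t(1) t(4)[of i] by (simp add: divide_simps)
  have s'1: "1 \<le> ?s' $ i" for i
    using r(1) r(3)[of i] p[of i] by (simp add: divide_simps)
  obtain D1 where D1: "0 \<le> D1" "\<And>\<mu>. mass ?s {\<mu>} \<le> ennreal D1" using mass_singleton[of ?s, OF s1] by (elim exE conjE) blast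
  obtain D2 where D2: "0 \<le> D2" "\<And>\<mu>. mass ?s' {\<mu>} \<le> ennreal D2" using mass_singleton[of ?s', OF s'1] by (elim exE conjE) blast
  obtain C1 where C1: "0 \<le> C1" "\<And>\<Gamma> M. \<Gamma> \<subseteq> brushlet_indices \<Longrightarrow> finite \<Gamma> \<Longrightarrow> (\<forall>\<mu>\<in>\<Gamma>. ?e \<mu> \<le> M) \<Longrightarrow>
    ennpow (Fnorm p q \<beta> c \<Gamma>) t \<le> ennreal (C1 * M powr t) * mass ?s \<Gamma>"
    using norm_upper[OF p q t(1-3), of \<beta>] by (elim exE conjE) blast
  obtain C2 where C2: "0 \<le> C2" "\<And>\<Gamma> m. \<Gamma> \<subseteq> brushlet_indices \<Longrightarrow> finite \<Gamma> \<Longrightarrow> 0 \<le> m \<Longrightarrow> (\<forall>\<mu>\<in>\<Gamma>. m \<le> ?e \<mu>) \<Longrightarrow>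
    ennreal (real (card \<Gamma>) * m powr r) \<le> ennreal C2 * ennpow (Fnorm p q \<beta> c \<Gamma>) r * mass ?s' \<Gamma>"
    using norm_lower[OF p q r, of \<beta>] by (elim exE conjE) blast
  \<comment> \<open>The added 1 keeps the denominator positive even if \<open>C1 * D1\<close> is
    0.\<close>
  define m where "m = (inverse K powr t / (C1 * D1 + 1)) powr (1 / t)"
  define M where "M = (C2 * K powr r * D2) powr (1 / r)"
  have CD: "0 < C1 * D1 + 1" using C1(1) D1(1) by (simp add: add_nonneg_pos)
  have e0: "0 \<le> ?e \<mu>" for \<mu> by simp
  have "0 < m" using K CD by (simp add: m_def)
  moreover have "m \<le> ?e \<mu>" if \<mu>: "\<mu> \<in> brushlet_indices" for \<mu>
  proof -
    have "ennreal (inverse K powr t) = ennpow (ennreal (inverse K)) t" using K t by (simp add: ennpow_ennreal)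
    also have "\<dots> \<le> ennpow (Fnorm p q \<beta> c {\<mu>}) t" using bspec[OF c \<mu>] t by (intro ennpow_mono) auto
    also have "\<dots> \<le> ennreal (C1 * ?e \<mu> powr t) * mass ?s {\<mu>}" using \<mu> by (intro C1(2)) auto
    also have "\<dots> \<le> ennreal (C1 * ?e \<mu> powr t) * ennreal D1" by (intro mult_left_mono D1) simp
    also have "\<dots> = ennreal (C1 * ?e \<mu> powr t * D1)" using C1(1) by (intro ennreal_mult'[symmetric]) simp
    finally have "inverse K powr t \<le> C1 * ?e \<mu> powr t * D1"
      by (rule ennreal_le_iff[THEN iffD1, rotated]) (use C1(1) D1(1) in simp)
    also have "\<dots> \<le> (C1 * D1 + 1) * ?e \<mu> powr t" by (simp add: distrib_right mult_ac)
    finally have "inverse K powr t / (C1 * D1 + 1) \<le> ?e \<mu> powr t" using CD by (simp add: pos_divide_le_eq mult.commute)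
    then have "m \<le> (?e \<mu> powr t) powr (1 / t)" unfolding m_def using CD t by (intro powr_mono2) (auto intro!: divide_nonneg_nonneg)
    then show ?thesis using t e0[of \<mu>] by (simp only: powr_powr) simp
  qed
  moreover have "?e \<mu> \<le> M" if \<mu>: "\<mu> \<in> brushlet_indices" for \<mu>
  proof -
    have "ennreal (?e \<mu> powr r) = ennreal (real (card {\<mu>}) * ?e \<mu> powr r)" by simp
    also have "\<dots> \<le> ennreal C2 * ennpow (Fnorm p q \<beta> c {\<mu>}) r * mass ?s' {\<mu>}"
      using \<mu> by (intro C2(2)) auto
    also have "\<dots> \<le> ennreal C2 * ennpow (ennreal K) r * ennreal D2"
      using bspec[OF c \<mu>] r by (intro mult_mono mult_left_mono ennpow_mono D2) auto
    also have "\<dots> = ennreal (C2 * K powr r * D2)"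
      using K C2(1) D2(1) r by (simp add: ennpow_ennreal ennreal_mult)
    finally have "?e \<mu> powr r \<le> C2 * K powr r * D2"
      by (rule ennreal_le_iff[THEN iffD1, rotated]) (use C2(1) D2(1) in simp)
    then have "(?e \<mu> powr r) powr (1 / r) \<le> M" unfolding M_def using r by (intro powr_mono2) auto
    then show ?thesis using r e0[of \<mu>] by (simp only: powr_powr) simp
  qed
  ultimately show ?thesis by (intro exI[of _ m] exI[of _ M] conjI ballI) auto
qed

text \<open>A common frame for lines and for constant exponents: as soon as both masses grow at most
  like the powers belonging to one coordinate \<open>i\<close>, the upper and the lower estimate
  combine to the same exponent \<open>1 / p $ i\<close>. The auxiliary exponents stay existential,
  with just the properties used in the two applications.\<close>

lemma norm_two_sided:
  assumes p: "\<And>i. 0 < p $ i" and q: "0 < q" and K: "1 \<le> K"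
    and c: "\<forall>\<mu>\<in>brushlet_indices. ennreal (inverse K) \<le> Fnorm p q \<beta> c {\<mu>} \<and> Fnorm p q \<beta> c {\<mu>} \<le> ennreal K"
  shows "\<exists>s s'. (\<forall>i. 1 \<le> s $ i) \<and> (\<forall>i. 1 \<le> s' $ i) \<and>
    (\<forall>i k. p $ i = p $ k \<longrightarrow> s $ i = s $ k \<and> s' $ i = s' $ k) \<and>
    (\<forall>i E F. 0 \<le> E \<longrightarrow> 0 \<le> F \<longrightarrow> (\<exists>C\<ge>1. \<forall>\<Gamma>. \<Gamma> \<subseteq> brushlet_indices \<longrightarrow> finite \<Gamma> \<longrightarrow> \<Gamma> \<noteq> {} \<longrightarrow>
      mass s \<Gamma> \<le> ennreal (E * real (card \<Gamma>) powr (1 / s $ i)) \<longrightarrow>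
      mass s' \<Gamma> \<le> ennreal (F * real (card \<Gamma>) powr (1 / s' $ i)) \<longrightarrow>
      Fnorm p q \<beta> c \<Gamma> \<le> ennreal (C * real (card \<Gamma>) powr (1 / p $ i)) \<and>
      ennreal (real (card \<Gamma>) powr (1 / p $ i)) \<le> ennreal C * Fnorm p q \<beta> c \<Gamma>))"
proof -
  \<comment> \<open>The largest power allowed in the upper estimate. Half of it serves as
    \<open>r\<close>, which must lie strictly below 1 and below every \<open>p $ i\<close>.\<close>
  define b where "b = Min (insert 1 (insert q (range (($) p))))"
  have b: "0 < b" "b \<le> 1" "b \<le> q" "b \<le> p $ i" for i
  proof -
    show "0 < b" using p q unfolding b_def by (subst Min_gr_iff) auto
    show "b \<le> 1" "b \<le> q" "b \<le> p $ i" unfolding b_def by (rule Min_le, simp, simp)+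
  qed
  define r where "r = b / 2"
  have r: "0 < r" "r < 1" "r < p $ i" for i using b(1,2) b(4)[of i] by (auto simp: r_def)
  let ?e = "\<lambda>\<mu>. norm (c \<mu>) * 2 powr (real_of_int (level \<mu>) * gain p \<beta>)"
  define s where "s = (1 / b) *\<^sub>R p"
  define s' where "s' = (\<chi> i. 1 / (1 - r / p $ i))"
  obtain m M where mM: "0 < m" "\<And>\<mu>. \<mu> \<in> brushlet_indices \<Longrightarrow> m \<le> ?e \<mu> \<and> ?e \<mu> \<le> M"
    using coefficient_bounds[OF p q b r K c] by (elim exE conjE) blast
  obtain C1 where C1: "0 \<le> C1" "\<And>\<Gamma> M. \<Gamma> \<subseteq> brushlet_indices \<Longrightarrow> finite \<Gamma> \<Longrightarrow> (\<forall>\<mu>\<in>\<Gamma>. ?e \<mu> \<le> M) \<Longrightarrow>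
    ennpow (Fnorm p q \<beta> c \<Gamma>) b \<le> ennreal (C1 * M powr b) * mass s \<Gamma>"
    using norm_upper[OF p q b(1-3), of \<beta>] unfolding s_def by (elim exE conjE) blast
  obtain C2 where C2: "0 \<le> C2" "\<And>\<Gamma> m. \<Gamma> \<subseteq> brushlet_indices \<Longrightarrow> finite \<Gamma> \<Longrightarrow> 0 \<le> m \<Longrightarrow> (\<forall>\<mu>\<in>\<Gamma>. m \<le> ?e \<mu>) \<Longrightarrow>
    ennreal (real (card \<Gamma>) * m powr r) \<le> ennreal C2 * ennpow (Fnorm p q \<beta> c \<Gamma>) r * mass s' \<Gamma>"
    using norm_lower[OF p q r, of \<beta>] unfolding s'_def by (elim exE conjE) blast
  show ?thesis
  proof (rule exI[of _ s], rule exI[of _ s'], rule conjI[OF _ conjI[OF _ conjI]]; intro allI impI)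
    show "1 \<le> s $ i" for i using b(1) b(4)[of i] by (simp add: s_def divide_simps)
    show "1 \<le> s' $ i" for i using r(1) r(3)[of i] p[of i] by (simp add: s'_def divide_simps)
    show "s $ i = s $ k \<and> s' $ i = s' $ k" if "p $ i = p $ k" for i k using that by (simp add: s_def s'_def)
    fix i and E F :: real assume E: "0 \<le> E" and F: "0 \<le> F"
    define U where "U = (C1 * M powr b * E) powr (1 / b)"
    define L where "L = (C2 * F / m powr r) powr (1 / r)"
    have main: "Fnorm p q \<beta> c \<Gamma> \<le> ennreal (U * real (card \<Gamma>) powr (1 / p $ i)) \<and>
      ennreal (real (card \<Gamma>) powr (1 / p $ i)) \<le> ennreal L * Fnorm p q \<beta> c \<Gamma>"
      if \<Gamma>: "\<Gamma> \<subseteq> brushlet_indices" "finite \<Gamma>" "\<Gamma> \<noteq> {}"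
        and mass: "mass s \<Gamma> \<le> ennreal (E * real (card \<Gamma>) powr (1 / s $ i))" "mass s' \<Gamma> \<le> ennreal (F * real (card \<Gamma>) powr (1 / s' $ i))" for \<Gamma>
    proof
      let ?n = "real (card \<Gamma>)" and ?X = "Fnorm p q \<beta> c \<Gamma>"
      have n: "0 < ?n" using \<Gamma> by (simp add: card_gt_0_iff)
      have "ennpow ?X b \<le> ennreal (C1 * M powr b) * mass s \<Gamma>"
        using \<Gamma> mM(2) by (intro C1(2)) auto
      also have "\<dots> \<le> ennreal (C1 * M powr b) * ennreal (E * ?n powr (1 / s $ i))" by (intro mult_left_mono mass) simp
      also have "\<dots> = ennreal (C1 * M powr b * E * ?n powr (1 / s $ i))" using C1(1) E by (simp add: ennreal_mult' mult.assoc)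
      finally have "ennpow (ennpow ?X b) (1 / b) \<le> ennpow (ennreal (C1 * M powr b * E * ?n powr (1 / s $ i))) (1 / b)"
        using b by (intro ennpow_mono) auto
      then have "?X \<le> ennpow (ennreal (C1 * M powr b * E * ?n powr (1 / s $ i))) (1 / b)"
        by (simp only: ennpow_inverse(1)[OF b(1)])
      also have "\<dots> = ennreal (U * ?n powr (1 / p $ i))"
      proof -
        have "(?n powr (1 / s $ i)) powr (1 / b) = ?n powr (1 / p $ i)"
          unfolding powr_powr using b(1) by (simp add: s_def)
        then show ?thesis using b(1) C1(1) E by (subst ennpow_ennreal) (simp_all add: U_def powr_mult)
      qed
      finally show "?X \<le> ennreal (U * ?n powr (1 / p $ i))" .
      have "ennreal (?n * m powr r) \<le> ennreal C2 * ennpow ?X r * mass s' \<Gamma>"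
        using \<Gamma> mM by (intro C2(2)) auto
      also have "\<dots> \<le> ennreal C2 * ennpow ?X r * ennreal (F * ?n powr (1 / s' $ i))" by (intro mult_left_mono mass) simp
      finally have low: "ennreal (?n * m powr r) \<le> ennreal C2 * ennpow ?X r * ennreal (F * ?n powr (1 / s' $ i))" .
      have e: "1 / s' $ i = 1 - r / p $ i" by (simp add: s'_def)
      \<comment> \<open>Multiplication by this factor cancels the growth of the mass on the right
        and reduces the count \<open>?n\<close> on the left to
        \<open>?n powr (r / p $ i)\<close>.\<close>
      let ?k = "?n powr (r / p $ i - 1) / m powr r"
      have "ennreal (?n powr (r / p $ i)) = ennreal ?k * ennreal (?n * m powr r)"
        using n mM(1) by (simp add: ennreal_mult'[symmetric] powr_diff)
      also have "\<dots> \<le> ennreal ?k * (ennreal C2 * ennpow ?X r * ennreal (F * ?n powr (1 / s' $ i)))"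
        by (intro mult_left_mono low) simp
      also have "\<dots> = (ennreal ?k * ennreal C2 * ennreal (F * ?n powr (1 / s' $ i))) * ennpow ?X r"
        by (simp only: mult_ac)
      also have "ennreal ?k * ennreal C2 * ennreal (F * ?n powr (1 / s' $ i)) = ennreal (?k * C2 * (F * ?n powr (1 / s' $ i)))"
      proof -
        have "0 \<le> ?k" by simp
        then show ?thesis using C2(1) F by (simp only: ennreal_mult' mult_nonneg_nonneg powr_ge_zero)
      qed
      also have "?k * C2 * (F * ?n powr (1 / s' $ i)) = C2 * F / m powr r * (?n powr (r / p $ i - 1) * ?n powr (1 - r / p $ i))"
        unfolding e by (simp only: divide_inverse mult_ac)
      also have "?n powr (r / p $ i - 1) * ?n powr (1 - r / p $ i) = 1" unfolding powr_add[symmetric] using n by simp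
      finally have "ennpow (ennreal (?n powr (r / p $ i))) (1 / r) \<le> ennpow (ennreal (C2 * F / m powr r) * ennpow ?X r) (1 / r)"
        using r(1) by (intro ennpow_mono) auto
      also have "ennpow (ennreal (?n powr (r / p $ i))) (1 / r) = ennreal (?n powr (1 / p $ i))"
        using r(1) by (subst ennpow_ennreal) (simp_all add: powr_powr)
      also have "ennpow (ennreal (C2 * F / m powr r) * ennpow ?X r) (1 / r) = ennreal L * ?X"
        using r(1) C2(1) F by (simp only: ennpow_mult ennpow_inverse zero_less_divide_1_iff) (subst ennpow_ennreal, simp_all add: L_def)
      finally show "ennreal (?n powr (1 / p $ i)) \<le> ennreal L * ?X" .
    qed
    have U0: "0 \<le> U" and L0: "0 \<le> L" by (simp_all add: U_def L_def)
    have "Fnorm p q \<beta> c \<Gamma> \<le> ennreal ((1 + U + L) * real (card \<Gamma>) powr (1 / p $ i)) \<and>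
      ennreal (real (card \<Gamma>) powr (1 / p $ i)) \<le> ennreal (1 + U + L) * Fnorm p q \<beta> c \<Gamma>"
      if "\<Gamma> \<subseteq> brushlet_indices" "finite \<Gamma>" "\<Gamma> \<noteq> {}"
        "mass s \<Gamma> \<le> ennreal (E * real (card \<Gamma>) powr (1 / s $ i))" "mass s' \<Gamma> \<le> ennreal (F * real (card \<Gamma>) powr (1 / s' $ i))" for \<Gamma>
    proof -
      note m = main[OF that]
      have 1: "ennreal (U * real (card \<Gamma>) powr (1 / p $ i)) \<le> ennreal ((1 + U + L) * real (card \<Gamma>) powr (1 / p $ i))"
        using U0 L0 by (intro ennreal_leI mult_right_mono) auto
      have 2: "ennreal L * Fnorm p q \<beta> c \<Gamma> \<le> ennreal (1 + U + L) * Fnorm p q \<beta> c \<Gamma>"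
        using U0 L0 by (intro mult_right_mono ennreal_leI) auto
      show ?thesis using order_trans[OF conjunct1[OF m] 1] order_trans[OF conjunct2[OF m] 2] ..
    qed
    then show "\<exists>C\<ge>1. \<forall>\<Gamma>. \<Gamma> \<subseteq> brushlet_indices \<longrightarrow> finite \<Gamma> \<longrightarrow> \<Gamma> \<noteq> {} \<longrightarrow>
      mass s \<Gamma> \<le> ennreal (E * real (card \<Gamma>) powr (1 / s $ i)) \<longrightarrow>
      mass s' \<Gamma> \<le> ennreal (F * real (card \<Gamma>) powr (1 / s' $ i)) \<longrightarrow>
      Fnorm p q \<beta> c \<Gamma> \<le> ennreal (C * real (card \<Gamma>) powr (1 / p $ i)) \<and>
      ennreal (real (card \<Gamma>) powr (1 / p $ i)) \<le> ennreal C * Fnorm p q \<beta> c \<Gamma>"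
      using U0 L0 by (intro exI[of _ "1 + U + L"] conjI[of "1 \<le> 1 + U + L"] allI impI) simp_all
  qed
qed

text \<open>Both parts feed the frame of \<open>norm_two_sided\<close>: the first with
  \<open>mass_line\<close>, where \<open>p\<close> is arbitrary but the set is special, the second
  with \<open>mass_const\<close>, where the roles are reversed. Equal entries of \<open>p\<close>
  give equal auxiliary exponents, as \<open>mass_const\<close> presupposes.\<close>

lemma norm_equivalence:
  assumes p: "\<And>i. 0 < p $ i" and q: "0 < q" and K: "1 \<le> K"
    and c: "\<forall>\<mu>\<in>brushlet_indices. ennreal (inverse K) \<le> Fnorm p q \<beta> c {\<mu>} \<and> Fnorm p q \<beta> c {\<mu>} \<le> ennreal K"
  shows norm_line: "\<exists>C\<ge>1. \<forall>N\<ge>1. Fnorm p q \<beta> c (line i N) \<le> ennreal (C * real N powr (1 / p $ i)) \<and>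
      ennreal (real N powr (1 / p $ i)) \<le> ennreal C * Fnorm p q \<beta> c (line i N)"
    and norm_const: "(\<And>k. p $ k = p $ i) \<Longrightarrow> \<exists>C\<ge>1. \<forall>\<Gamma>. \<Gamma> \<subseteq> brushlet_indices \<longrightarrow> finite \<Gamma> \<longrightarrow> \<Gamma> \<noteq> {} \<longrightarrow>
      Fnorm p q \<beta> c \<Gamma> \<le> ennreal (C * real (card \<Gamma>) powr (1 / p $ i)) \<and>
      ennreal (real (card \<Gamma>) powr (1 / p $ i)) \<le> ennreal C * Fnorm p q \<beta> c \<Gamma>"
proof -
  obtain s s' where s: "\<forall>i. 1 \<le> s $ i" "\<forall>i. 1 \<le> s' $ i"
    "\<forall>i k. p $ i = p $ k \<longrightarrow> s $ i = s $ k \<and> s' $ i = s' $ k"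
    and est: "\<forall>i E F. 0 \<le> E \<longrightarrow> 0 \<le> F \<longrightarrow> (\<exists>C\<ge>1. \<forall>\<Gamma>. \<Gamma> \<subseteq> brushlet_indices \<longrightarrow> finite \<Gamma> \<longrightarrow> \<Gamma> \<noteq> {} \<longrightarrow>
      mass s \<Gamma> \<le> ennreal (E * real (card \<Gamma>) powr (1 / s $ i)) \<longrightarrow>
      mass s' \<Gamma> \<le> ennreal (F * real (card \<Gamma>) powr (1 / s' $ i)) \<longrightarrow>
      Fnorm p q \<beta> c \<Gamma> \<le> ennreal (C * real (card \<Gamma>) powr (1 / p $ i)) \<and>
      ennreal (real (card \<Gamma>) powr (1 / p $ i)) \<le> ennreal C * Fnorm p q \<beta> c \<Gamma>)"
    using norm_two_sided[OF p q K c] by (elim exE conjE)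
  obtain X Y where X: "0 \<le> X" "\<forall>N. mass s (line i N) \<le> ennreal (X * real (card (line i N)) powr (1 / s $ i))"
    and Y: "0 \<le> Y" "\<forall>N. mass s' (line i N) \<le> ennreal (Y * real (card (line i N)) powr (1 / s' $ i))"
    using mass_line[of s i, OF s(1)[rule_format]] mass_line[of s' i, OF s(2)[rule_format]] by (elim exE conjE)
  obtain C where C: "1 \<le> C" "\<forall>\<Gamma>. \<Gamma> \<subseteq> brushlet_indices \<longrightarrow> finite \<Gamma> \<longrightarrow> \<Gamma> \<noteq> {} \<longrightarrow>
      mass s \<Gamma> \<le> ennreal (X * real (card \<Gamma>) powr (1 / s $ i)) \<longrightarrow>
      mass s' \<Gamma> \<le> ennreal (Y * real (card \<Gamma>) powr (1 / s' $ i)) \<longrightarrow>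
      Fnorm p q \<beta> c \<Gamma> \<le> ennreal (C * real (card \<Gamma>) powr (1 / p $ i)) \<and>
      ennreal (real (card \<Gamma>) powr (1 / p $ i)) \<le> ennreal C * Fnorm p q \<beta> c \<Gamma>"
    using est[rule_format, OF X(1) Y(1), of i] by (elim exE conjE)
  have "Fnorm p q \<beta> c (line i N) \<le> ennreal (C * real N powr (1 / p $ i)) \<and>
      ennreal (real N powr (1 / p $ i)) \<le> ennreal C * Fnorm p q \<beta> c (line i N)" if "1 \<le> N" for N
  proof -
    have "line i N \<noteq> {}" using line_props(3)[of i N] that by auto
    from C(2)[rule_format, OF line_props(1,2) this X(2)[rule_format] Y(2)[rule_format]] show ?thesis by (simp only: line_props(3))
  qed
  then show "\<exists>C\<ge>1. \<forall>N\<ge>1. Fnorm p q \<beta> c (line i N) \<le> ennreal (C * real N powr (1 / p $ i)) \<and>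
      ennreal (real N powr (1 / p $ i)) \<le> ennreal C * Fnorm p q \<beta> c (line i N)"
    using C(1) by (intro exI[of _ C] conjI[of "1 \<le> C"] allI impI)
  show "\<exists>C\<ge>1. \<forall>\<Gamma>. \<Gamma> \<subseteq> brushlet_indices \<longrightarrow> finite \<Gamma> \<longrightarrow> \<Gamma> \<noteq> {} \<longrightarrow>
      Fnorm p q \<beta> c \<Gamma> \<le> ennreal (C * real (card \<Gamma>) powr (1 / p $ i)) \<and>
      ennreal (real (card \<Gamma>) powr (1 / p $ i)) \<le> ennreal C * Fnorm p q \<beta> c \<Gamma>"
    if const: "\<And>k. p $ k = p $ i"
  proof -
    obtain E E' where E: "0 \<le> E" "\<forall>\<Gamma>. \<Gamma> \<subseteq> brushlet_indices \<longrightarrow> finite \<Gamma> \<longrightarrow> mass s \<Gamma> \<le> ennreal (E * real (card \<Gamma>) powr (1 / s $ i))"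
      and E': "0 \<le> E'" "\<forall>\<Gamma>. \<Gamma> \<subseteq> brushlet_indices \<longrightarrow> finite \<Gamma> \<longrightarrow> mass s' \<Gamma> \<le> ennreal (E' * real (card \<Gamma>) powr (1 / s' $ i))"
      using mass_const[of s "s $ i", OF conjunct1[OF s(3)[rule_format, OF const]] s(1)[rule_format]]
        mass_const[of s' "s' $ i", OF conjunct2[OF s(3)[rule_format, OF const]] s(2)[rule_format]]
      by (elim exE conjE)
    obtain C' where C': "1 \<le> C'" "\<forall>\<Gamma>. \<Gamma> \<subseteq> brushlet_indices \<longrightarrow> finite \<Gamma> \<longrightarrow> \<Gamma> \<noteq> {} \<longrightarrow>
        mass s \<Gamma> \<le> ennreal (E * real (card \<Gamma>) powr (1 / s $ i)) \<longrightarrow>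
        mass s' \<Gamma> \<le> ennreal (E' * real (card \<Gamma>) powr (1 / s' $ i)) \<longrightarrow>
        Fnorm p q \<beta> c \<Gamma> \<le> ennreal (C' * real (card \<Gamma>) powr (1 / p $ i)) \<and>
        ennreal (real (card \<Gamma>) powr (1 / p $ i)) \<le> ennreal C' * Fnorm p q \<beta> c \<Gamma>"
      using est[rule_format, OF E(1) E'(1), of i] by (elim exE conjE)
    have "Fnorm p q \<beta> c \<Gamma> \<le> ennreal (C' * real (card \<Gamma>) powr (1 / p $ i)) \<and>
        ennreal (real (card \<Gamma>) powr (1 / p $ i)) \<le> ennreal C' * Fnorm p q \<beta> c \<Gamma>"
      if "\<Gamma> \<subseteq> brushlet_indices" "finite \<Gamma>" "\<Gamma> \<noteq> {}" for \<Gamma>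
      by (rule C'(2)[rule_format, OF that]) (use E(2) E'(2) that in simp_all)
    then show ?thesis using C'(1) by (intro exI[of _ C'] conjI[of "1 \<le> C'"] allI impI)
  qed
qed

end

section \<open>Growth rates and the final comparison\<close>

lemma powr_growth:
  fixes u v B :: real
  assumes "\<And>N::nat. 1 \<le> N \<Longrightarrow> real N powr u \<le> B * real N powr v"
  shows "u \<le> v"
proof (rule ccontr)
  assume "\<not> u \<le> v"
  then have \<delta>: "0 < u - v" by simp
  have B: "0 \<le> B" using assms[of 1] by simp
  \<comment> \<open>Large enough that \<open>real N powr (u - v)\<close> is at least
    \<open>B + 1\<close>, which contradicts the assumed bound.\<close>
  define N where "N = Suc (nat \<lceil>(B + 1) powr (1 / (u - v))\<rceil>)"
  have N: "1 \<le> N" "(B + 1) powr (1 / (u - v)) \<le> real N" unfolding N_def by linarith+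
  have "B + 1 = ((B + 1) powr (1 / (u - v))) powr (u - v)" using B \<delta> by (simp only: powr_powr) simp
  also have "\<dots> \<le> real N powr (u - v)" using N(2) \<delta> by (intro powr_mono2) auto
  also have "\<dots> = real N powr u / real N powr v" by (rule powr_diff)
  also have "\<dots> \<le> B" using assms[OF N(1)] N(1) by (simp add: pos_divide_le_eq)
  finally show False by simp
qed

theorem proposition6p4:
  fixes a p :: "'d::{finite,linorder} rvec"
    and q \<beta> :: real
    and \<phi> :: "'d rvec \<Rightarrow> complex"
    and \<rho> :: "real \<Rightarrow> real"
    and g :: "'d brushlet_index \<Rightarrow> 'd rvec \<Rightarrow> complex"
  assumes "CARD('d) \<ge> 2"
    and "\<forall>i. 1 \<le> a $ i"
    and "\<forall>i. 0 < p $ i"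
    and "0 < q"
    and "admissible a \<phi>"
    and "cutoff_function \<rho>"
    and "quasi_normalized_brushlets \<rho> a p q \<beta> \<phi> g"
  shows "democratic a p q \<beta> \<phi> brushlet_indices g \<longleftrightarrow> (\<forall>i k. p $ i = p $ k)"
proof -
  interpret brushlet_system a \<phi> \<rho> by unfold_locales (fact assms)+
  have p: "0 < p $ i" for i using assms(3) by blast
  obtain c where c: "\<And>\<mu>. \<mu> \<in> brushlet_indices \<Longrightarrow> g \<mu> = (\<lambda>x. c \<mu> * brushlet \<rho> a \<mu> x)"
    using assms(7) unfolding quasi_normalized_brushlets_def by (elim exE conjE) blast
  obtain K where K: "1 \<le> K" "\<And>\<mu>. \<mu> \<in> brushlet_indices \<Longrightarrow>
      ennreal (inverse K) \<le> TL_norm a p q \<beta> \<phi> (class_of (g \<mu>)) \<and> TL_norm a p q \<beta> \<phi> (class_of (g \<mu>)) \<le> ennreal K"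
    using assms(7) unfolding quasi_normalized_brushlets_def by (elim exE conjE) blast
  let ?N = "Fnorm p q \<beta> c"
  \<comment> \<open>From here on the quasi-norms of classes are mixed norms of square functions, to
    which the two-sided estimates apply.\<close>
  have TL: "TL_norm a p q \<beta> \<phi> (class_of (\<lambda>x. \<Sum>\<mu>\<in>\<Gamma>. g \<mu> x)) = ?N \<Gamma>" if "\<Gamma> \<subseteq> brushlet_indices" for \<Gamma>
  proof -
    have "(\<lambda>x. \<Sum>\<mu>\<in>\<Gamma>. g \<mu> x) = comb c \<Gamma>"
    proof
      fix x show "(\<Sum>\<mu>\<in>\<Gamma>. g \<mu> x) = comb c \<Gamma> x"
        unfolding comb_def using that by (intro sum.cong refl) (auto simp: c)
    qed
    then show ?thesis by (simp only: TL_norm_class_of[OF a adm tempered_comb] TL_norm_rep_sqfun)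
  qed
  have norm: "\<forall>\<mu>\<in>brushlet_indices. ennreal (inverse K) \<le> ?N {\<mu>} \<and> ?N {\<mu>} \<le> ennreal K"
  proof
    fix \<mu> :: "'d brushlet_index" assume "\<mu> \<in> brushlet_indices"
    then show "ennreal (inverse K) \<le> ?N {\<mu>} \<and> ?N {\<mu>} \<le> ennreal K" using K(2)[of \<mu>] TL[of "{\<mu>}"] by simp
  qed
  note line = norm_line[OF p assms(4) K(1) norm] and const = norm_const[OF p assms(4) K(1) norm]
  show ?thesis
  proof
    assume "democratic a p q \<beta> \<phi> brushlet_indices g"
    then obtain D where D: "1 \<le> D" "\<forall>\<Gamma> \<Gamma>'. \<Gamma> \<subseteq> brushlet_indices \<longrightarrow> \<Gamma>' \<subseteq> brushlet_indices \<longrightarrow> finite \<Gamma> \<longrightarrow> finite \<Gamma>' \<longrightarrow> card \<Gamma> = card \<Gamma>' \<longrightarrow>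
        ennreal (inverse D) * TL_norm a p q \<beta> \<phi> (class_of (\<lambda>x. \<Sum>\<mu>\<in>\<Gamma>. g \<mu> x)) \<le> TL_norm a p q \<beta> \<phi> (class_of (\<lambda>x. \<Sum>\<mu>\<in>\<Gamma>'. g \<mu> x)) \<and>
        TL_norm a p q \<beta> \<phi> (class_of (\<lambda>x. \<Sum>\<mu>\<in>\<Gamma>'. g \<mu> x)) \<le> ennreal D * TL_norm a p q \<beta> \<phi> (class_of (\<lambda>x. \<Sum>\<mu>\<in>\<Gamma>. g \<mu> x))"
      unfolding democratic_def by (elim exE conjE)
    \<comment> \<open>Lines of equal length in the directions \<open>i\<close> and \<open>k\<close>
      are compared. As the two directions are arbitrary, the reverse inequality comes from
      exchanging them.\<close>
    have "1 / p $ i \<le> 1 / p $ k" for i k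
    proof -
      obtain Ci where Ci: "1 \<le> Ci" "\<forall>N\<ge>1. ?N (line i N) \<le> ennreal (Ci * real N powr (1 / p $ i)) \<and> ennreal (real N powr (1 / p $ i)) \<le> ennreal Ci * ?N (line i N)"
        using line[of i] by (elim exE conjE)
      obtain Ck where Ck: "1 \<le> Ck" "\<forall>N\<ge>1. ?N (line k N) \<le> ennreal (Ck * real N powr (1 / p $ k)) \<and> ennreal (real N powr (1 / p $ k)) \<le> ennreal Ck * ?N (line k N)"
        using line[of k] by (elim exE conjE)
      have "real N powr (1 / p $ i) \<le> Ci * D * Ck * real N powr (1 / p $ k)" if N: "1 \<le> N" for N
      proof -
        have "card (line k N) = card (line i N)" by (simp only: line_props)
        from D(2)[rule_format, OF line_props(1) line_props(1) line_props(2) line_props(2) this]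
        have dem: "?N (line i N) \<le> ennreal D * ?N (line k N)" by (simp only: TL[OF line_props(1)])
        have "ennreal (real N powr (1 / p $ i)) \<le> ennreal Ci * ?N (line i N)" using Ci(2) N by blast
        also have "\<dots> \<le> ennreal Ci * (ennreal D * ?N (line k N))" by (intro mult_left_mono dem) simp
        also have "\<dots> \<le> ennreal Ci * (ennreal D * ennreal (Ck * real N powr (1 / p $ k)))"
          using Ck(2) N by (intro mult_left_mono) auto
        also have "\<dots> = ennreal (Ci * D * Ck * real N powr (1 / p $ k))"
          using Ci(1) Ck(1) D(1) by (simp add: ennreal_mult mult.assoc)
        finally show ?thesis
          by (rule ennreal_le_iff[THEN iffD1, rotated]) (use Ci(1) Ck(1) D(1) in simp)
      qed
      then show ?thesis by (rule powr_growth)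
    qed
    then have "1 / p $ i = 1 / p $ k" for i k by (intro antisym)
    then show "\<forall>i k. p $ i = p $ k" by simp
  next
    assume eq: "\<forall>i k. p $ i = p $ k"
    obtain i :: 'd where True by simp
    have pi: "p $ k = p $ i" for k using eq by blast
    obtain C where C: "1 \<le> C" "\<forall>\<Gamma>. \<Gamma> \<subseteq> brushlet_indices \<longrightarrow> finite \<Gamma> \<longrightarrow> \<Gamma> \<noteq> {} \<longrightarrow>
      ?N \<Gamma> \<le> ennreal (C * real (card \<Gamma>) powr (1 / p $ i)) \<and> ennreal (real (card \<Gamma>) powr (1 / p $ i)) \<le> ennreal C * ?N \<Gamma>"
      using const[of i, OF pi] by (elim exE conjE)
    have CC: "1 \<le> C * C" using C(1) mult_mono[of 1 C 1 C] by simp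
    have cmp: "?N \<Gamma>' \<le> ennreal (C * C) * ?N \<Gamma>"
      if \<Gamma>: "\<Gamma> \<subseteq> brushlet_indices" "\<Gamma>' \<subseteq> brushlet_indices" "finite \<Gamma>" "finite \<Gamma>'" "card \<Gamma> = card \<Gamma>'" for \<Gamma> \<Gamma>'
    proof (cases "\<Gamma> = {}")
      \<comment> \<open>The two-sided estimate concerns nonempty sets. Equal cardinality makes both
        sets empty here, so the two quasi-norms coincide.\<close>
      case True
      then have "\<Gamma>' = \<Gamma>" using \<Gamma> by simp
      moreover have "1 * ?N \<Gamma> \<le> ennreal (C * C) * ?N \<Gamma>" using CC by (intro mult_right_mono) (auto simp: ennreal_ge_1)
      ultimately show ?thesis by simp
    next
      case False
      then have "\<Gamma>' \<noteq> {}" using \<Gamma> by auto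
      have "?N \<Gamma>' \<le> ennreal (C * real (card \<Gamma>') powr (1 / p $ i))"
        using C(2)[rule_format, OF \<Gamma>(2,4) \<open>\<Gamma>' \<noteq> {}\<close>] by (rule conjunct1)
      also have "\<dots> = ennreal C * ennreal (real (card \<Gamma>) powr (1 / p $ i))"
        using C(1) by (simp add: ennreal_mult \<Gamma>(5))
      also have "\<dots> \<le> ennreal C * (ennreal C * ?N \<Gamma>)"
        using C(2)[rule_format, OF \<Gamma>(1,3) False] by (intro mult_left_mono) simp_all
      also have "\<dots> = ennreal (C * C) * ?N \<Gamma>" using C(1) by (simp add: ennreal_mult mult.assoc)
      finally show ?thesis .
    qed
    show "democratic a p q \<beta> \<phi> brushlet_indices g"
      unfolding democratic_def
    proof (intro exI[of _ "C * C"] conjI[of "1 \<le> C * C"] CC allI impI)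
      fix \<Gamma> \<Gamma>' :: "'d brushlet_index set"
      assume \<Gamma>: "\<Gamma> \<subseteq> brushlet_indices" "\<Gamma>' \<subseteq> brushlet_indices" "finite \<Gamma>" "finite \<Gamma>'" "card \<Gamma> = card \<Gamma>'"
      have "ennreal (inverse (C * C)) * ?N \<Gamma> \<le> ennreal (inverse (C * C)) * (ennreal (C * C) * ?N \<Gamma>')"
        by (intro mult_left_mono cmp[OF \<Gamma>(2,1,4,3) \<Gamma>(5)[symmetric]]) simp
      also have "\<dots> = ennreal (inverse (C * C) * (C * C)) * ?N \<Gamma>'"
        using CC by (subst ennreal_mult') (simp_all add: mult.assoc)
      also have "inverse (C * C) * (C * C) = 1" using CC by (intro left_inverse) linarith
      finally have "ennreal (inverse (C * C)) * ?N \<Gamma> \<le> ?N \<Gamma>'" by simp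
      then show "ennreal (inverse (C * C)) * TL_norm a p q \<beta> \<phi> (class_of (\<lambda>x. \<Sum>\<mu>\<in>\<Gamma>. g \<mu> x)) \<le> TL_norm a p q \<beta> \<phi> (class_of (\<lambda>x. \<Sum>\<mu>\<in>\<Gamma>'. g \<mu> x)) \<and>
        TL_norm a p q \<beta> \<phi> (class_of (\<lambda>x. \<Sum>\<mu>\<in>\<Gamma>'. g \<mu> x)) \<le> ennreal (C * C) * TL_norm a p q \<beta> \<phi> (class_of (\<lambda>x. \<Sum>\<mu>\<in>\<Gamma>. g \<mu> x))"
        using cmp[OF \<Gamma>] by (simp only: TL[OF \<Gamma>(1)] TL[OF \<Gamma>(2)])
    qed
  qed
qed

end
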